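(* Let $\kappa$ be an initial ordinal and let $\tau$ be an infinite order type which is a finite sum of ordinals and reverse ordinals, each of these ordinals being $<\kappa$. Then \[\langle {}^\kappa 2,<_{\mathrm{lex}}\rangle \rightarrow(\tau)^\tau \iff \kappa\rightarrow(\beta(\tau))^{\beta(\tau)},\] where $\beta(\tau)$ is the ordinal defined below.
   Context: Work in ZF (without the Axiom of Choice). For an ordinal $\alpha$, ${}^\alpha 2$ is the set of functions $\alpha\to\{0,1\}$ with the lexicographic order $<_{\mathrm{lex}}$ ($x<_{\mathrm{lex}}y$ iff $x(\delta)<y(\delta)$ for $\delta$ least with $x(\delta)\ne y(\delta)$). Order types are isomorphism classes of linear orders, $\gamma^*$ is the reverse of $\gamma$, $+$ is concatenation. For a linear order $L$ (in particular an ordinal) and order type $\sigma$, $[L]^\sigma$ is the set of subsets of $L$ of induced order type $\sigma$; $L\rightarrow(\sigma)^\tau$ means: for every $F:[L]^\tau\to\{0,1\}$ there is $H\in[L]^\sigma$ with $F$ constant on $[H]^\tau$. Definition of $\beta(\tau)$: write $\tau$ as an alternating sum $\beta_0^{( * )}+\beta_1^{( * )}+\dots+\beta_{n-1}^{( * )}$ of infinite ordinals and reverse ordinals (i.e. either $\tau=\beta_0+\beta_1^*+\beta_2+\cdots$ or $\tau=\beta_0^*+\beta_1+\beta_2^*+\cdots$ with each $\beta_i$ an infinite ordinal). For each $i<n$ let $\beta_i=\omega^{\varepsilon^{(i)}_0}k^{(i)}_0+\dots+\omega^{\varepsilon^{(i)}_{m_i}}k^{(i)}_{m_i}$ be its Cantor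 Normal Form. Then $\beta(\tau)$ is the sum of all the terms $\omega^{\varepsilon^{(i)}_j}k^{(i)}_j$ (over all $i$ and $j$) arranged in weakly decreasing order; equivalently, the largest ordinal expressible as a sum of these terms in some order. *)

theory Defs
  imports Main
begin

text \<open>
  HOL proves the axiom of choice, and choice refutes every partition relation with an infinite
  exponent, so a statement about such relations in ZF cannot be made about HOL's own sets.
  It is made here about an arbitrary first-order model of ZF: a type \<open>'a\<close> with a binary relation
  \<open>mem\<close>. Everything in the locale \<open>membership\<close> below is the interpretation in that
  structure of a notion of set theory. Quantifiers and descriptions range over \<open>'a\<close> only, so
  functions, bijections, colourings and finite sequences are elements of the model, and
  ``finite'' refers to the model's own \<open>\<omega>\<close>.
\<close>

datatype fm = Mem nat nat | Equal nat nat | Neg fm | Conj fm fm | Exists nat fm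

primrec sat :: "('a \<Rightarrow> 'a \<Rightarrow> bool) \<Rightarrow> (nat \<Rightarrow> 'a) \<Rightarrow> fm \<Rightarrow> bool" where
  "sat mem v (Mem i j) \<longleftrightarrow> mem (v i) (v j)"
| "sat mem v (Equal i j) \<longleftrightarrow> v i = v j"
| "sat mem v (Neg p) \<longleftrightarrow> \<not> sat mem v p"
| "sat mem v (Conj p q) \<longleftrightarrow> sat mem v p \<and> sat mem v q"
| "sat mem v (Exists i p) \<longleftrightarrow> (\<exists>x. sat mem (v(i := x)) p)"

locale membership =
  fixes mem :: "'a \<Rightarrow> 'a \<Rightarrow> bool"  (infix "\<^bold>\<in>" 50)
begin

definition subset :: "'a \<Rightarrow> 'a \<Rightarrow> bool"  (infix "\<^bold>\<subseteq>" 50) where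
  "x \<^bold>\<subseteq> y \<longleftrightarrow> (\<forall>z. z \<^bold>\<in> x \<longrightarrow> z \<^bold>\<in> y)"

text \<open>
  The element of the model whose members are exactly the \<open>z\<close> with \<open>P z\<close>. It is used only for
  classes that are sets by the axioms of ZF.
\<close>

definition setof :: "('a \<Rightarrow> bool) \<Rightarrow> 'a" where
  "setof P = (THE x. \<forall>z. z \<^bold>\<in> x \<longleftrightarrow> P z)"

definition zero :: 'a where
  "zero = setof (\<lambda>z. False)"

definition succ :: "'a \<Rightarrow> 'a" where
  "succ x = setof (\<lambda>z. z \<^bold>\<in> x \<or> z = x)"

definition one :: 'a where
  "one = succ zero"

definition two :: 'a where
  "two = succ one"

definition omega :: 'a where
  "omega = setof (\<lambda>n. \<forall>I. zero \<^bold>\<in> I \<and> (\<forall>m. m \<^bold>\<in> I \<longrightarrow> succ m \<^bold>\<in> I) \<longrightarrow> n \<^bold>\<in> I)"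

definition upair :: "'a \<Rightarrow> 'a \<Rightarrow> 'a" where
  "upair x y = setof (\<lambda>z. z = x \<or> z = y)"

definition opair :: "'a \<Rightarrow> 'a \<Rightarrow> 'a" where
  "opair x y = upair (upair x x) (upair x y)"

definition fun_on :: "'a \<Rightarrow> 'a \<Rightarrow> bool" where
  "fun_on f A \<longleftrightarrow> (\<forall>p. p \<^bold>\<in> f \<longrightarrow> (\<exists>x y. x \<^bold>\<in> A \<and> p = opair x y)) \<and>
                 (\<forall>x. x \<^bold>\<in> A \<longrightarrow> (\<exists>!y. opair x y \<^bold>\<in> f))"

definition app :: "'a \<Rightarrow> 'a \<Rightarrow> 'a" where
  "app f x = (THE y. opair x y \<^bold>\<in> f)"

definition maps :: "'a \<Rightarrow> 'a \<Rightarrow> 'a \<Rightarrow> bool" where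
  "maps f A B \<longleftrightarrow> fun_on f A \<and> (\<forall>x. x \<^bold>\<in> A \<longrightarrow> app f x \<^bold>\<in> B)"

definition bijection :: "'a \<Rightarrow> 'a \<Rightarrow> 'a \<Rightarrow> bool" where
  "bijection f A B \<longleftrightarrow> maps f A B \<and> (\<forall>y. y \<^bold>\<in> B \<longrightarrow> (\<exists>!x. x \<^bold>\<in> A \<and> app f x = y))"

definition equipotent :: "'a \<Rightarrow> 'a \<Rightarrow> bool" where
  "equipotent A B \<longleftrightarrow> (\<exists>f. bijection f A B)"

definition infinite_set :: "'a \<Rightarrow> bool" where
  "infinite_set A \<longleftrightarrow> \<not> (\<exists>n. n \<^bold>\<in> omega \<and> equipotent A n)"

text \<open>
  A linear order is given by its carrier \<open>A\<close> and its strict order relation \<open>R\<close>, a set of pairs.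
  Order types are represented by linear orders belonging to them.
\<close>

definition linear_order :: "'a \<Rightarrow> 'a \<Rightarrow> bool" where
  "linear_order A R \<longleftrightarrow>
     (\<forall>p. p \<^bold>\<in> R \<longrightarrow> (\<exists>x y. x \<^bold>\<in> A \<and> y \<^bold>\<in> A \<and> p = opair x y)) \<and>
     (\<forall>x. x \<^bold>\<in> A \<longrightarrow> \<not> opair x x \<^bold>\<in> R) \<and>
     (\<forall>x y z. opair x y \<^bold>\<in> R \<and> opair y z \<^bold>\<in> R \<longrightarrow> opair x z \<^bold>\<in> R) \<and>
     (\<forall>x y. x \<^bold>\<in> A \<and> y \<^bold>\<in> A \<and> x \<noteq> y \<longrightarrow> opair x y \<^bold>\<in> R \<or> opair y x \<^bold>\<in> R)"

text \<open>
  Only pairs with both components in the carrier matter for isomorphism, so \<open>isomorphic H R B S\<close>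
  for a subset \<open>H\<close> of the carrier of \<open>R\<close> refers to the order induced on \<open>H\<close>.
\<close>

definition isomorphic :: "'a \<Rightarrow> 'a \<Rightarrow> 'a \<Rightarrow> 'a \<Rightarrow> bool" where
  "isomorphic A R B S \<longleftrightarrow>
     (\<exists>f. bijection f A B \<and>
          (\<forall>x y. x \<^bold>\<in> A \<and> y \<^bold>\<in> A \<longrightarrow>
             (opair x y \<^bold>\<in> R \<longleftrightarrow> opair (app f x) (app f y) \<^bold>\<in> S)))"

definition subsets_of_type :: "'a \<Rightarrow> 'a \<Rightarrow> 'a \<Rightarrow> 'a \<Rightarrow> 'a" where
  "subsets_of_type A R T S = setof (\<lambda>H. H \<^bold>\<subseteq> A \<and> isomorphic H R T S)"

text \<open>
  \<open>arrow A R P Q T S\<close> is the partition relation \<open>\<langle>A,R\<rangle> \<rightarrow> (\<sigma>)\<^sup>\<tau>\<close> with two colours, where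
  \<open>\<sigma>\<close> and \<open>\<tau>\<close> are the types of \<open>\<langle>P,Q\<rangle>\<close> and \<open>\<langle>T,S\<rangle>\<close>.
\<close>

definition arrow :: "'a \<Rightarrow> 'a \<Rightarrow> 'a \<Rightarrow> 'a \<Rightarrow> 'a \<Rightarrow> 'a \<Rightarrow> bool" where
  "arrow A R P Q T S \<longleftrightarrow>
     (\<forall>F. maps F (subsets_of_type A R T S) two \<longrightarrow>
       (\<exists>H. H \<^bold>\<in> subsets_of_type A R P Q \<and>
         (\<forall>X Y. X \<^bold>\<in> subsets_of_type H R T S \<and> Y \<^bold>\<in> subsets_of_type H R T S \<longrightarrow>
            app F X = app F Y)))"

definition transitive_set :: "'a \<Rightarrow> bool" where
  "transitive_set x \<longleftrightarrow> (\<forall>y. y \<^bold>\<in> x \<longrightarrow> y \<^bold>\<subseteq> x)"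

definition ordinal :: "'a \<Rightarrow> bool" where
  "ordinal a \<longleftrightarrow> transitive_set a \<and> (\<forall>x. x \<^bold>\<in> a \<longrightarrow> transitive_set x)"

definition initial_ordinal :: "'a \<Rightarrow> bool" where
  "initial_ordinal k \<longleftrightarrow> ordinal k \<and> (\<forall>a. a \<^bold>\<in> k \<longrightarrow> \<not> equipotent a k)"

definition memrel :: "'a \<Rightarrow> 'a" where
  "memrel a = setof (\<lambda>p. \<exists>x y. x \<^bold>\<in> a \<and> y \<^bold>\<in> a \<and> x \<^bold>\<in> y \<and> p = opair x y)"

definition otype :: "'a \<Rightarrow> 'a \<Rightarrow> 'a" where
  "otype A R = (THE a. ordinal a \<and> isomorphic A R a (memrel a))"

definition binary_seqs :: "'a \<Rightarrow> 'a" where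
  "binary_seqs a = setof (\<lambda>x. maps x a two)"

definition lex :: "'a \<Rightarrow> 'a" where
  "lex a = setof (\<lambda>p. \<exists>x y. x \<^bold>\<in> binary_seqs a \<and> y \<^bold>\<in> binary_seqs a \<and> p = opair x y \<and>
     (\<exists>d. d \<^bold>\<in> a \<and> app x d \<^bold>\<in> app y d \<and> (\<forall>e. e \<^bold>\<in> d \<longrightarrow> app x e = app y e)))"

text \<open>
  The sum over \<open>i\<close> in the ordinal \<open>I\<close> of the ordinals \<open>b(i)\<close>, with summand \<open>i\<close> reversed iff
  \<open>d(i) = 1\<close>; its points are the pairs \<open>\<langle>i,x\<rangle>\<close> with \<open>x\<close> in \<open>b(i)\<close>.
\<close>

definition sum_set :: "'a \<Rightarrow> 'a \<Rightarrow> 'a" where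
  "sum_set I b = setof (\<lambda>p. \<exists>i x. i \<^bold>\<in> I \<and> x \<^bold>\<in> app b i \<and> p = opair i x)"

definition sum_rel :: "'a \<Rightarrow> 'a \<Rightarrow> 'a \<Rightarrow> 'a" where
  "sum_rel I b d = setof (\<lambda>p. \<exists>i x j y.
     i \<^bold>\<in> I \<and> x \<^bold>\<in> app b i \<and> j \<^bold>\<in> I \<and> y \<^bold>\<in> app b j \<and> p = opair (opair i x) (opair j y) \<and>
     (i \<^bold>\<in> j \<or> i = j \<and> (app d i = zero \<and> x \<^bold>\<in> y \<or> app d i = one \<and> y \<^bold>\<in> x)))"

definition finite_sum_below :: "'a \<Rightarrow> 'a \<Rightarrow> 'a \<Rightarrow> bool" where
  "finite_sum_below k T S \<longleftrightarrow>
     (\<exists>n b d. n \<^bold>\<in> omega \<and> maps b n k \<and> maps d n two \<and>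
        isomorphic T S (sum_set n b) (sum_rel n b d))"

definition const :: "'a \<Rightarrow> 'a \<Rightarrow> 'a" where
  "const I c = setof (\<lambda>p. \<exists>i. i \<^bold>\<in> I \<and> p = opair i c)"

definition osum :: "'a \<Rightarrow> 'a \<Rightarrow> 'a" where
  "osum I b = otype (sum_set I b) (sum_rel I b (const I zero))"

definition omult :: "'a \<Rightarrow> 'a \<Rightarrow> 'a" where
  "omult a c = osum c (const c a)"

text \<open>Ordinal exponentiation with base \<open>\<omega>\<close>, by transfinite recursion.\<close>

definition omega_power :: "'a \<Rightarrow> 'a" where
  "omega_power e = (THE p. \<exists>f. fun_on f (succ e) \<and> p = app f e \<and>
     app f zero = one \<and>
     (\<forall>x. x \<^bold>\<in> e \<longrightarrow> app f (succ x) = omult (app f x) omega) \<and>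
     (\<forall>x. x \<^bold>\<in> succ e \<and> x \<noteq> zero \<and> \<not> (\<exists>y. x = succ y) \<longrightarrow>
        app f x = setof (\<lambda>z. \<exists>y. y \<^bold>\<in> x \<and> z \<^bold>\<in> app f y)))"

text \<open>
  \<open>t\<close> is the sequence, of length \<open>m\<close>, of the terms \<open>\<omega>\<^bsup>e(j)\<^esup> c(j)\<close> of the Cantor normal form
  of \<open>x\<close>.
\<close>

definition is_cnf :: "'a \<Rightarrow> 'a \<Rightarrow> 'a \<Rightarrow> bool" where
  "is_cnf x m t \<longleftrightarrow> m \<^bold>\<in> omega \<and> fun_on t m \<and>
     (\<exists>e c. fun_on e m \<and> maps c m omega \<and>
        (\<forall>j. j \<^bold>\<in> m \<longrightarrow> ordinal (app e j) \<and> app c j \<noteq> zero \<and>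
           app t j = omult (omega_power (app e j)) (app c j)) \<and>
        (\<forall>i j. i \<^bold>\<in> j \<and> j \<^bold>\<in> m \<longrightarrow> app e j \<^bold>\<in> app e i)) \<and>
     x = osum m t"

definition alternating_sum :: "'a \<Rightarrow> 'a \<Rightarrow> 'a \<Rightarrow> 'a \<Rightarrow> bool" where
  "alternating_sum T S n b \<longleftrightarrow> n \<^bold>\<in> omega \<and> fun_on b n \<and>
     (\<forall>i. i \<^bold>\<in> n \<longrightarrow> ordinal (app b i) \<and> infinite_set (app b i)) \<and>
     (\<exists>d. maps d n two \<and> (\<forall>i. succ i \<^bold>\<in> n \<longrightarrow> app d (succ i) \<noteq> app d i) \<and>
        isomorphic T S (sum_set n b) (sum_rel n b d))"

text \<open>
  Summand \<open>b(i)\<close> has the Cantor normal form terms \<open>t(i)(j)\<close> for \<open>j < m(i)\<close>. The terms are indexed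
  by the pairs \<open>\<langle>i,j\<rangle>\<close>, which make up \<open>sum_set n m\<close>; \<open>g\<close> lists these pairs, each once, so that
  the corresponding sequence \<open>s\<close> of terms is weakly decreasing.
\<close>

definition is_beta :: "'a \<Rightarrow> 'a \<Rightarrow> 'a \<Rightarrow> bool" where
  "is_beta T S c \<longleftrightarrow>
     (\<exists>n b m t N g s. alternating_sum T S n b \<and> fun_on m n \<and> fun_on t n \<and>
        (\<forall>i. i \<^bold>\<in> n \<longrightarrow> is_cnf (app b i) (app m i) (app t i)) \<and>
        N \<^bold>\<in> omega \<and> bijection g N (sum_set n m) \<and> fun_on s N \<and>
        (\<forall>l i j. l \<^bold>\<in> N \<and> app g l = opair i j \<longrightarrow> app s l = app (app t i) j) \<and>
        (\<forall>l l'. l \<^bold>\<in> l' \<and> l' \<^bold>\<in> N \<longrightarrow> app s l' \<^bold>\<in> app s l \<or> app s l' = app s l) \<and>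
        c = osum N s)"

definition beta :: "'a \<Rightarrow> 'a \<Rightarrow> 'a" where
  "beta T S = (THE c. is_beta T S c)"

end

text \<open>
  In the two schemes \<open>p\<close> is an arbitrary formula whose variables 0 and 1 are the displayed ones;
  the valuation \<open>v\<close> supplies the parameters.
\<close>

locale zf_model = membership mem
  for mem :: "'a \<Rightarrow> 'a \<Rightarrow> bool"  (infix "\<^bold>\<in>" 50) +
  assumes extensionality: "\<forall>x y. (\<forall>z. z \<^bold>\<in> x \<longleftrightarrow> z \<^bold>\<in> y) \<longrightarrow> x = y"
    and foundation: "\<forall>x. (\<exists>y. y \<^bold>\<in> x) \<longrightarrow> (\<exists>y. y \<^bold>\<in> x \<and> \<not> (\<exists>z. z \<^bold>\<in> x \<and> z \<^bold>\<in> y))"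
    and pairing: "\<forall>x y. \<exists>u. \<forall>z. z \<^bold>\<in> u \<longleftrightarrow> z = x \<or> z = y"
    and union: "\<forall>x. \<exists>u. \<forall>z. z \<^bold>\<in> u \<longleftrightarrow> (\<exists>y. y \<^bold>\<in> x \<and> z \<^bold>\<in> y)"
    and power_set: "\<forall>x. \<exists>u. \<forall>z. z \<^bold>\<in> u \<longleftrightarrow> z \<^bold>\<subseteq> x"
    and infinity: "\<exists>u. (\<exists>e. e \<^bold>\<in> u \<and> \<not> (\<exists>z. z \<^bold>\<in> e)) \<and>
      (\<forall>x. x \<^bold>\<in> u \<longrightarrow> (\<exists>y. y \<^bold>\<in> u \<and> (\<forall>z. z \<^bold>\<in> y \<longleftrightarrow> z \<^bold>\<in> x \<or> z = x)))"
    and separation: "\<forall>p v a. \<exists>u. \<forall>x. x \<^bold>\<in> u \<longleftrightarrow> x \<^bold>\<in> a \<and> sat (\<^bold>\<in>) (v(0 := x)) p"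
    and replacement: "\<forall>p v a. (\<forall>x. x \<^bold>\<in> a \<longrightarrow> (\<exists>!y. sat (\<^bold>\<in>) (v(0 := x, 1 := y)) p)) \<longrightarrow>
      (\<exists>u. \<forall>y. y \<^bold>\<in> u \<longleftrightarrow> (\<exists>x. x \<^bold>\<in> a \<and> sat (\<^bold>\<in>) (v(0 := x, 1 := y)) p))"

end

theory Submission
  imports Defs
begin

text \<open>
  Cut \<open>\<tau>\<close> into finitely many convex pieces of indecomposable type \<open>\<omega>\<^bsup>e\<^esup>\<close>, or the reverse of such a
  type, according to the Cantor normal forms of its summands. Arranging the pieces by decreasing
  size and turning the reversed ones around gives a second order \<open>W\<close> on the same set \<open>T\<close>, of type
  \<open>\<beta>(\<tau>)\<close>. An embedding of \<open>T\<close> into itself sends a tail of each piece into a single piece; comparing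
  sizes shows that the subsets of \<open>T\<close> of type \<open>\<tau>\<close> in the given order and those of type \<open>\<beta>(\<tau>)\<close> in \<open>W\<close>
  are the same, namely the sets that meet every piece in a set of full type. This also makes
  \<open>\<beta>(\<tau>)\<close> independent of the decomposition.

  If \<open>\<kappa> \<rightarrow> (\<beta>)\<^sup>\<beta>\<close>, code the ordinal \<open>x\<close> at a point of the \<open>q\<close>-th piece by the sequence that names
  \<open>q\<close> and continues with the characteristic function of \<open>x\<close>, or its complement if the piece is
  reversed: a copy of \<open>W\<close> in \<open>\<kappa>\<close> becomes a copy of \<open>\<tau>\<close> among the sequences.
  Conversely, let \<open>f\<close> embed \<open>T\<close> into the sequences. The least position where \<open>f t\<close> splits from a later
  element of its piece is weakly increasing along the piece. If these positions (moved below \<open>\<kappa>\<close> by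
  a cofinal map where they are unbounded) are injective on the pieces, they yield a copy of \<open>W\<close> in
  \<open>\<kappa>\<close>, whose colour is used; otherwise the colour tells whether some piece starts with a repeated
  value, and no copy of \<open>\<tau>\<close> is homogeneous for that.
\<close>

subsection \<open>Definability\<close>

inductive first_order :: "('a \<Rightarrow> 'a \<Rightarrow> bool) \<Rightarrow> ((nat \<Rightarrow> 'a) \<Rightarrow> bool) \<Rightarrow> bool" for mem where
  fo_Mem: "first_order mem (\<lambda>v. mem (v i) (v j))"
| fo_Equal: "first_order mem (\<lambda>v. v i = v j)"
| fo_Neg: "first_order mem P \<Longrightarrow> first_order mem (\<lambda>v. \<not> P v)"
| fo_Conj: "first_order mem P \<Longrightarrow> first_order mem Q \<Longrightarrow> first_order mem (\<lambda>v. P v \<and> Q v)"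
| fo_Exists: "first_order mem P \<Longrightarrow> first_order mem (\<lambda>v. \<exists>x. P (case_nat x v))"

lemma first_order_reindex: "first_order mem P \<Longrightarrow> first_order mem (\<lambda>v. P (\<lambda>i. v (r i)))"
proof (induction arbitrary: r rule: first_order.induct)
  case (fo_Exists P)
  have eq: "(\<lambda>i. case_nat x v (case_nat 0 (\<lambda>n. Suc (r n)) i)) = case_nat x (\<lambda>i. v (r i))" for x v
    by (auto split: nat.splits)
  show ?case
    using first_order.fo_Exists[OF fo_Exists.IH[of "case_nat 0 (\<lambda>n. Suc (r n))"]] by (simp add: eq)
qed (auto intro: first_order.intros)

lemma first_order_formula:
  "first_order mem P \<Longrightarrow> infinite (- range r) \<Longrightarrow> \<exists>p. \<forall>v. sat mem v p \<longleftrightarrow> P (\<lambda>i. v (r i))"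
proof (induction arbitrary: r rule: first_order.induct)
  case (fo_Mem i j)
  show ?case by (rule exI[of _ "Mem (r i) (r j)"]) simp
next
  case (fo_Equal i j)
  show ?case by (rule exI[of _ "Equal (r i) (r j)"]) simp
next
  case (fo_Neg P)
  then obtain p where "\<forall>v. sat mem v p \<longleftrightarrow> P (\<lambda>i. v (r i))" by blast
  thus ?case by (intro exI[of _ "Neg p"]) simp
next
  case (fo_Conj P Q)
  then obtain p q where "\<forall>v. sat mem v p \<longleftrightarrow> P (\<lambda>i. v (r i))" "\<forall>v. sat mem v q \<longleftrightarrow> Q (\<lambda>i. v (r i))"
    by blast
  thus ?case by (intro exI[of _ "Conj p q"]) simp
next
  case (fo_Exists P)
  obtain k where k: "k \<notin> range r"
    using fo_Exists.prems infinite_imp_nonempty by blast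
  have "range (case_nat k r) = insert k (range r)"
  proof safe
    fix i assume "case_nat k r i \<notin> range r" thus "case_nat k r i = k" by (cases i) auto
  next
    show "k \<in> range (case_nat k r)" by (rule range_eqI[of _ _ 0]) simp
  next
    fix i show "r i \<in> range (case_nat k r)" by (rule range_eqI[of _ _ "Suc i"]) simp
  qed
  hence "infinite (- range (case_nat k r))"
    using fo_Exists.prems by (simp add: Compl_insert)
  then obtain p where p: "\<forall>v. sat mem v p \<longleftrightarrow> P (\<lambda>i. v (case_nat k r i))"
    using fo_Exists.IH by blast
  have eq: "(\<lambda>i. (v(k := x)) (case_nat k r i)) = case_nat x (\<lambda>i. v (r i))" for v x
    using k by (auto simp: fun_eq_iff split: nat.splits)
  show ?case by (rule exI[of _ "Exists k p"]) (simp only: sat.simps p[rule_format] eq simp_thms)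
qed

text \<open>From here on the symbols \<open>\<in>\<close> and \<open>\<subseteq>\<close> denote membership and inclusion in the model.\<close>

no_notation Set.member (\<open>'(\<in>')\<close>) and Set.member (\<open>(\<open>notation=\<open>infix \<in>\<close>\<close>_/ \<in> _)\<close> [51, 51] 50)
  and subset_eq (\<open>'(\<subseteq>')\<close>) and subset_eq (\<open>(\<open>notation=\<open>infix \<subseteq>\<close>\<close>_/ \<subseteq> _)\<close> [51, 51] 50)

context membership
begin

notation mem (infix "\<in>" 50) and subset (infix "\<subseteq>" 50)

abbreviation lt :: "'a \<Rightarrow> 'a \<Rightarrow> 'a \<Rightarrow> bool" where
  "lt R x y \<equiv> opair x y \<in> R"

definition interleave :: "(nat \<Rightarrow> 'a) \<Rightarrow> (nat \<Rightarrow> 'a) \<Rightarrow> nat \<Rightarrow> 'a" where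
  "interleave v w i = (if even i then v (i div 2) else w (i div 2))"

text \<open>
  First-order definability with parameters. Environments are de Bruijn style: a quantifier
  pushes its value in front of the environment, so definability goals are closed by blind
  application of the rules \<open>definable\<close>.
\<close>

definition definable :: "((nat \<Rightarrow> 'a) \<Rightarrow> bool) \<Rightarrow> bool" where
  "definable P \<longleftrightarrow> (\<exists>Q w. first_order (\<in>) Q \<and> (\<forall>v. P v \<longleftrightarrow> Q (interleave v w)))"

definition definable_fn :: "((nat \<Rightarrow> 'a) \<Rightarrow> 'a) \<Rightarrow> bool" where
  "definable_fn f \<longleftrightarrow> definable (\<lambda>v. v 0 = f (\<lambda>i. v (Suc i)))"

abbreviation definable_map :: "('a \<Rightarrow> 'a) \<Rightarrow> bool" where
  "definable_map F \<equiv> definable_fn (\<lambda>v. F (v 0))"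

named_theorems definable

lemma definableI: "first_order (\<in>) Q \<Longrightarrow> (\<And>v. P v \<longleftrightarrow> Q (interleave v w)) \<Longrightarrow> definable P"
  unfolding definable_def by blast

lemma definable_neg [definable]: "definable P \<Longrightarrow> definable (\<lambda>v. \<not> P v)"
  unfolding definable_def by (blast intro: first_order.fo_Neg)

lemma definable_conj [definable]:
  assumes "definable P" "definable P'"
  shows "definable (\<lambda>v. P v \<and> P' v)"
proof -
  obtain Q w Q' w' where Q: "first_order (\<in>) Q" "\<And>v. P v \<longleftrightarrow> Q (interleave v w)"
    and Q': "first_order (\<in>) Q'" "\<And>v. P' v \<longleftrightarrow> Q' (interleave v w')"
    using assms unfolding definable_def by blast
  let ?r = "\<lambda>i. if even i then i else 2 * (2 * (i div 2)) + 1"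
  let ?r' = "\<lambda>i. if even i then i else 2 * (2 * (i div 2) + 1) + 1"
  have eq: "(\<lambda>i. interleave v (interleave w w') (?r i)) = interleave v w"
    "(\<lambda>i. interleave v (interleave w w') (?r' i)) = interleave v w'" for v
    by (auto simp: interleave_def fun_eq_iff elim!: oddE)
  have "first_order (\<in>) (\<lambda>v. Q (\<lambda>i. v (?r i)) \<and> Q' (\<lambda>i. v (?r' i)))"
    by (rule first_order.fo_Conj[OF first_order_reindex[OF Q(1), of ?r] first_order_reindex[OF Q'(1), of ?r']])
  thus ?thesis
    by (rule definableI[where w = "interleave w w'"]) (simp only: eq Q(2) Q'(2))
qed

lemma definable_ex [definable]:
  assumes "definable (\<lambda>v. P (v 0) (\<lambda>i. v (Suc i)))"
  shows "definable (\<lambda>v. \<exists>x. P x v)"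
proof -
  obtain Q w where Q: "first_order (\<in>) Q"
      "\<And>v. P (v 0) (\<lambda>i. v (Suc i)) \<longleftrightarrow> Q (interleave v w)"
    using assms unfolding definable_def by blast
  let ?r = "\<lambda>i. case i of 0 \<Rightarrow> 0 | Suc j \<Rightarrow> if even i then j else Suc i"
  have eq: "(\<lambda>i. case_nat x (interleave v w) (?r i)) = interleave (case_nat x v) w" for x v
  proof
    fix i show "case_nat x (interleave v w) (?r i) = interleave (case_nat x v) w i"
    proof (cases "even i")
      case True
      then obtain k where "i = 2 * k" by (auto elim: evenE)
      thus ?thesis by (cases k) (auto simp: interleave_def)
    next
      case False
      then obtain k where "i = 2 * k + 1" by (auto elim: oddE)
      thus ?thesis by (auto simp: interleave_def)
    qed
  qed
  have "first_order (\<in>) (\<lambda>v. \<exists>x. Q (\<lambda>i. case_nat x v (?r i)))"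
    by (rule first_order.fo_Exists[OF first_order_reindex[OF Q(1), of ?r]])
  moreover have "P x v \<longleftrightarrow> Q (interleave (case_nat x v) w)" for x v
    using Q(2)[of "case_nat x v"] by simp
  ultimately show ?thesis
    by (intro definableI[where w = w]) (assumption, simp only: eq)
qed

lemma definable_iff_cong: "definable P \<Longrightarrow> (\<And>v. P v \<longleftrightarrow> Q v) \<Longrightarrow> definable Q"
  by (subgoal_tac "P = Q") auto

lemma definable_const [definable]: "definable (\<lambda>v. b)"
proof -
  have T: "definable (\<lambda>v. True)"
    unfolding definable_def using first_order.fo_Equal[of "(\<in>)" 0 0] by auto
  show ?thesis using T definable_neg[OF T] by (cases b) auto
qed

lemma definable_disj [definable]: "definable P \<Longrightarrow> definable Q \<Longrightarrow> definable (\<lambda>v. P v \<or> Q v)"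
  by (rule definable_iff_cong[OF definable_neg[OF definable_conj[OF definable_neg definable_neg]]]) auto

lemma definable_imp [definable]: "definable P \<Longrightarrow> definable Q \<Longrightarrow> definable (\<lambda>v. P v \<longrightarrow> Q v)"
  by (rule definable_iff_cong[OF definable_neg[OF definable_conj[OF _ definable_neg]]]) auto

lemma definable_iff [definable]: "definable P \<Longrightarrow> definable Q \<Longrightarrow> definable (\<lambda>v. P v \<longleftrightarrow> Q v)"
  by (rule definable_iff_cong[OF definable_conj[OF definable_imp[of P Q] definable_imp[of Q P]]]) auto

lemma definable_all [definable]:
  assumes "definable (\<lambda>v. P (v 0) (\<lambda>i. v (Suc i)))"
  shows "definable (\<lambda>v. \<forall>x. P x v)"
  by (rule definable_iff_cong[OF definable_neg[OF definable_ex[OF definable_neg[OF assms]]]]) auto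

lemma definable_var_eq: "definable (\<lambda>v. v i = v j)"
  unfolding definable_def
  by (rule exI[of _ "\<lambda>v. v (2*i) = v (2*j)"])
     (auto intro: first_order.fo_Equal simp: interleave_def)

lemma definable_var_mem: "definable (\<lambda>v. v i \<in> v j)"
  unfolding definable_def
  by (rule exI[of _ "\<lambda>v. v (2*i) \<in> v (2*j)"])
     (auto intro: first_order.fo_Mem simp: interleave_def)

lemma definable_fn_var [definable]: "definable_fn (\<lambda>v. v i)"
  unfolding definable_fn_def by (rule definable_var_eq)

lemma definable_fn_const [definable]: "definable_fn (\<lambda>v. c)"
  unfolding definable_fn_def definable_def
  by (intro exI[of _ "\<lambda>v. v 0 = v 1"] exI[of _ "\<lambda>i. c"])
     (use first_order.fo_Equal[of "(\<in>)" 0 1] in \<open>auto simp: interleave_def\<close>)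

lemma definable_reindex:
  assumes "definable P" shows "definable (\<lambda>v. P (\<lambda>i. v (r i)))"
proof -
  obtain Q w where Q: "first_order (\<in>) Q" "\<And>v. P v \<longleftrightarrow> Q (interleave v w)"
    using assms unfolding definable_def by blast
  let ?r = "\<lambda>i. if even i then 2 * r (i div 2) else i"
  have eq: "(\<lambda>i. interleave v w (?r i)) = interleave (\<lambda>i. v (r i)) w" for v
    by (auto simp: interleave_def fun_eq_iff)
  have "first_order (\<in>) (\<lambda>v. Q (\<lambda>i. v (?r i)))" by (rule first_order_reindex[OF Q(1)])
  thus ?thesis by (rule definableI[where w = w]) (simp only: eq Q(2))
qed

lemma definable_fn_reindex: "definable_fn f \<Longrightarrow> definable_fn (\<lambda>v. f (\<lambda>i. v (r i)))"
  unfolding definable_fn_def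
  by (drule definable_reindex[of _ "case_nat 0 (\<lambda>i. Suc (r i))"]) simp

lemma definable_reindex_tail:
  "definable (\<lambda>v. P (v 0) (\<lambda>i. v (Suc i))) \<Longrightarrow> definable (\<lambda>v. P (v 0) (\<lambda>i. v (r i)))"
  using definable_reindex[of "\<lambda>v. P (v 0) (\<lambda>i. v (Suc i))" "case_nat 0 r"] by simp

lemma definable_fn_reindex_tail:
  "definable_fn (\<lambda>v. F (v 0) (\<lambda>i. v (Suc i))) \<Longrightarrow> definable_fn (\<lambda>v. F (v 0) (\<lambda>i. v (r i)))"
  using definable_fn_reindex[of "\<lambda>v. F (v 0) (\<lambda>i. v (Suc i))" "case_nat 0 r"] by simp

lemma definable_app5:
  assumes P: "definable (\<lambda>v. P (v 0) (v 1) (v 2) (v 3) (v 4))"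
    and f: "definable_fn f0" "definable_fn f1" "definable_fn f2" "definable_fn f3" "definable_fn f4"
  shows "definable (\<lambda>v. P (f0 v) (f1 v) (f2 v) (f3 v) (f4 v))"
proof -
  have arg: "definable (\<lambda>v. v i = f (\<lambda>j. v (j + 5)))" if "definable_fn f" for f i
    using definable_reindex[OF that[unfolded definable_fn_def], of "case_nat i (\<lambda>j. j + 5)"] by simp
  have "definable (\<lambda>v. P (v 4) (v 3) (v 2) (v 1) (v 0))"
    using definable_reindex[OF P, of "\<lambda>i. 4 - i"] by simp
  hence "definable (\<lambda>v. \<exists>a b c d e. a = f0 v \<and> b = f1 v \<and> c = f2 v \<and> d = f3 v \<and> e = f4 v \<and> P a b c d e)"
    using arg[OF f(1), of 4] arg[OF f(2), of 3] arg[OF f(3), of 2] arg[OF f(4), of 1] arg[OF f(5), of 0]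
    by (intro definable_ex definable_conj) (simp_all add: eval_nat_numeral)
  thus ?thesis by simp
qed

lemma definable_app4:
  "\<lbrakk>definable (\<lambda>v. P (v 0) (v 1) (v 2) (v 3)); definable_fn f; definable_fn g; definable_fn h; definable_fn k\<rbrakk> \<Longrightarrow>
    definable (\<lambda>v. P (f v) (g v) (h v) (k v))"
  by (rule definable_app5[of "\<lambda>a b c d _. P a b c d" f g h k f])

lemma definable_app1: "definable (\<lambda>v. P (v 0)) \<Longrightarrow> definable_fn f \<Longrightarrow> definable (\<lambda>v. P (f v))"
  by (rule definable_app5[of "\<lambda>a _ _ _ _. P a" f f f f f])

lemma definable_app3:
  "\<lbrakk>definable (\<lambda>v. P (v 0) (v 1) (v 2)); definable_fn f; definable_fn g; definable_fn h\<rbrakk> \<Longrightarrow>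
    definable (\<lambda>v. P (f v) (g v) (h v))"
  by (rule definable_app4[of "\<lambda>a b c _. P a b c" f g h f])

lemma definable_app2: "\<lbrakk>definable (\<lambda>v. P (v 0) (v 1)); definable_fn f; definable_fn g\<rbrakk> \<Longrightarrow>
    definable (\<lambda>v. P (f v) (g v))"
  by (rule definable_app3[of "\<lambda>a b _. P a b" f g f])

lemma definable_fn_app4:
  assumes "definable_fn (\<lambda>v. F (v 0) (v 1) (v 2) (v 3))" "definable_fn f" "definable_fn g" "definable_fn h" "definable_fn k"
  shows "definable_fn (\<lambda>v. F (f v) (g v) (h v) (k v))"
  unfolding definable_fn_def
  by (rule definable_app5[of "\<lambda>x a b c d. x = F a b c d" "\<lambda>v. v 0", OF _ definable_fn_var])
    (use assms definable_fn_reindex[of _ Suc] in \<open>simp_all add: definable_fn_def numeral_eq_Suc\<close>)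

lemma definable_fn_app3:
  "\<lbrakk>definable_fn (\<lambda>v. F (v 0) (v 1) (v 2)); definable_fn f; definable_fn g; definable_fn h\<rbrakk> \<Longrightarrow>
    definable_fn (\<lambda>v. F (f v) (g v) (h v))"
  by (rule definable_fn_app4[of "\<lambda>a b c _. F a b c" f g h f])

lemma definable_fn_app2: "\<lbrakk>definable_fn (\<lambda>v. F (v 0) (v 1)); definable_fn f; definable_fn g\<rbrakk> \<Longrightarrow>
    definable_fn (\<lambda>v. F (f v) (g v))"
  by (rule definable_fn_app3[of "\<lambda>a b _. F a b" f g f])

lemma definable_fn_app1: "definable_map F \<Longrightarrow> definable_fn f \<Longrightarrow> definable_fn (\<lambda>v. F (f v))"
  by (rule definable_fn_app2[of "\<lambda>a _. F a" f f])

lemma definable_mem [definable]: "definable_fn f \<Longrightarrow> definable_fn g \<Longrightarrow> definable (\<lambda>v. f v \<in> g v)"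
  by (rule definable_app2[of "(\<in>)", OF definable_var_mem])

lemma definable_eq [definable]: "definable_fn f \<Longrightarrow> definable_fn g \<Longrightarrow> definable (\<lambda>v. f v = g v)"
  by (rule definable_app2[of "(=)", OF definable_var_eq])

lemma definable_fn_if [definable]:
  assumes P: "definable P" and f: "definable_fn f" and g: "definable_fn g"
  shows "definable_fn (\<lambda>v. if P v then f v else g v)"
proof -
  have "definable (\<lambda>v. (P (\<lambda>i. v (Suc i)) \<and> v 0 = f (\<lambda>i. v (Suc i))) \<or>
        (\<not> P (\<lambda>i. v (Suc i)) \<and> v 0 = g (\<lambda>i. v (Suc i))))"
    by (intro definable_disj definable_conj definable_neg definable_reindex[OF P, of Suc] f[unfolded definable_fn_def] g[unfolded definable_fn_def])
  thus ?thesis unfolding definable_fn_def by (rule definable_iff_cong) auto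
qed

lemma definable_subset [definable]: "definable_fn f \<Longrightarrow> definable_fn g \<Longrightarrow> definable (\<lambda>v. f v \<subseteq> g v)"
  by (rule definable_app2[of "(\<subseteq>)"]) (unfold subset_def, intro definable)

end

context zf_model
begin

lemma definable_formula:
  assumes "definable (\<lambda>v. P (v 0) (v 1))"
  obtains V p where "\<And>x y. sat (\<in>) (V(0 := x, 1 := y)) p \<longleftrightarrow> P x y"
proof -
  obtain Q w where Q: "first_order (\<in>) Q" "\<And>v. P (v 0) (v 1) \<longleftrightarrow> Q (interleave v w)"
    using assms unfolding definable_def by blast
  let ?r = "\<lambda>i::nat. if i = 2 then 1 else 2 * i"
  have "range (\<lambda>i. 2 * i + 3) \<le> - range ?r"
  proof safe
    fix x y :: nat assume "2 * x + 3 = ?r y"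
    thus False by (cases "y = 2"; simp; presburger)
  qed
  moreover have "infinite (range (\<lambda>i::nat. 2 * i + 3))"
    by (simp add: finite_image_iff inj_def)
  ultimately have "infinite (- range ?r)" using rev_finite_subset by blast
  then obtain p where p: "\<And>v. sat (\<in>) v p \<longleftrightarrow> Q (\<lambda>i. v (?r i))"
    using first_order_formula[OF Q(1)] by metis
  let ?V = "\<lambda>i. interleave (\<lambda>_. undefined) w (i div 2)"
  have "(\<lambda>i. (?V(0 := x, 1 := y)) (?r i)) = interleave ((\<lambda>_. undefined)(0 := x, 1 := y)) w" for x y
  proof
    fix i show "(?V(0 := x, 1 := y)) (?r i) = interleave ((\<lambda>_. undefined)(0 := x, 1 := y)) w i"
      by (cases "even i") (auto simp: interleave_def)
  qed
  hence "sat (\<in>) (?V(0 := x, 1 := y)) p \<longleftrightarrow> P x y" for x y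
    using p[of "?V(0 := x, 1 := y)"] Q(2)[of "(\<lambda>_. undefined)(0 := x, 1 := y)"] by simp
  thus ?thesis by (rule that)
qed

lemma definable_separation:
  assumes "definable (\<lambda>v. P (v 0))"
  shows "\<exists>u. \<forall>x. x \<in> u \<longleftrightarrow> x \<in> a \<and> P x"
proof -
  obtain V p where "\<And>x y. sat (\<in>) (V(0 := x, 1 := y)) p \<longleftrightarrow> P x"
    by (rule definable_formula[of "\<lambda>x y. P x", OF assms]) (rule that)
  moreover have "V(0 := x, 1 := V 1) = V(0 := x)" for x
    by auto
  ultimately have "sat (\<in>) (V(0 := x)) p \<longleftrightarrow> P x" for x
    by metis
  thus ?thesis using separation[rule_format, of a V p] by simp
qed

lemma definable_replacement:
  assumes "definable (\<lambda>v. P (v 0) (v 1))" and "\<And>x. x \<in> a \<Longrightarrow> \<exists>!y. P x y"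
  shows "\<exists>u. \<forall>y. y \<in> u \<longleftrightarrow> (\<exists>x. x \<in> a \<and> P x y)"
proof -
  obtain V p where "\<And>x y. sat (\<in>) (V(0 := x, 1 := y)) p \<longleftrightarrow> P x y"
    by (rule definable_formula[OF assms(1)]) (rule that)
  thus ?thesis using replacement[rule_format, of a V p] assms(2) by simp
qed

end

subsection \<open>Sets and functions\<close>

context membership
begin

declare definable [simp]

lemma definable_ex1 [definable, simp]:
  assumes "definable (\<lambda>v. P (v 0) (\<lambda>i. v (Suc i)))"
  shows "definable (\<lambda>v. \<exists>!x. P x v)"
  unfolding Ex1_def using definable_reindex_tail[OF assms, of "\<lambda>i. Suc (Suc i)"] assms by simp

definition elts :: "'a \<Rightarrow> 'a set" where
  "elts A = {x. x \<in> A}"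

lemma in_elts [simp]: "Set.member x (elts A) \<longleftrightarrow> x \<in> A"
  by (simp add: elts_def)

lemma bij_elts_iff: "bij_betw F (elts A) (elts B) \<longleftrightarrow> (\<forall>x. x \<in> A \<longrightarrow> F x \<in> B) \<and>
    (\<forall>x y. x \<in> A \<and> y \<in> A \<and> F x = F y \<longrightarrow> x = y) \<and> (\<forall>y. y \<in> B \<longrightarrow> (\<exists>x. x \<in> A \<and> F x = y))"
  unfolding bij_betw_def inj_on_def by (auto simp: elts_def dest: equalityD2[THEN Set.subsetD])

lemma bij_elts_iff_ex1: "bij_betw F (elts A) (elts B) \<longleftrightarrow>
    (\<forall>x. x \<in> A \<longrightarrow> F x \<in> B) \<and> (\<forall>y. y \<in> B \<longrightarrow> (\<exists>!x. x \<in> A \<and> F x = y))"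
  unfolding bij_elts_iff by (intro iffI conjI allI impI; (elim conjE)?; metis)

lemma bij_eltsI:
  assumes "\<And>x. x \<in> A \<Longrightarrow> F x \<in> B" "\<And>x y. \<lbrakk>x \<in> A; y \<in> A; F x = F y\<rbrakk> \<Longrightarrow> x = y"
    and "\<And>y. y \<in> B \<Longrightarrow> \<exists>x. x \<in> A \<and> F x = y"
  shows "bij_betw F (elts A) (elts B)"
  unfolding bij_elts_iff using assms by blast

lemma bij_eltsD:
  assumes "bij_betw F (elts A) (elts B)"
  shows bij_elts_mem: "\<And>x. x \<in> A \<Longrightarrow> F x \<in> B"
    and bij_elts_inj: "\<And>x y. \<lbrakk>x \<in> A; y \<in> A; F x = F y\<rbrakk> \<Longrightarrow> x = y"
    and bij_elts_surj: "\<And>y. y \<in> B \<Longrightarrow> \<exists>x. x \<in> A \<and> F x = y"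
  using assms unfolding bij_elts_iff by blast+

definition sep :: "'a \<Rightarrow> ('a \<Rightarrow> bool) \<Rightarrow> 'a" where
  "sep A P = setof (\<lambda>z. z \<in> A \<and> P z)"

definition img :: "('a \<Rightarrow> 'a) \<Rightarrow> 'a \<Rightarrow> 'a" where
  "img F A = setof (\<lambda>y. \<exists>x. x \<in> A \<and> y = F x)"

definition lam :: "'a \<Rightarrow> ('a \<Rightarrow> 'a) \<Rightarrow> 'a" where
  "lam A F = setof (\<lambda>p. \<exists>x. x \<in> A \<and> p = opair x (F x))"

definition times :: "'a \<Rightarrow> 'a \<Rightarrow> 'a" where
  "times A B = setof (\<lambda>p. \<exists>x y. x \<in> A \<and> y \<in> B \<and> p = opair x y)"

definition big_union :: "'a \<Rightarrow> 'a" where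
  "big_union A = setof (\<lambda>z. \<exists>y. y \<in> A \<and> z \<in> y)"

definition powerset :: "'a \<Rightarrow> 'a" where
  "powerset A = setof (\<lambda>z. z \<subseteq> A)"

definition union :: "'a \<Rightarrow> 'a \<Rightarrow> 'a" where
  "union A B = setof (\<lambda>z. z \<in> A \<or> z \<in> B)"

text \<open>Unlike \<open>THE\<close> it is definable even where it does not denote.\<close>

definition desc :: "('a \<Rightarrow> bool) \<Rightarrow> 'a" where
  "desc P = setof (\<lambda>z. \<exists>x. P x \<and> z \<in> x)"

text \<open>Agrees with \<open>app\<close> on functions.\<close>

definition ap :: "'a \<Rightarrow> 'a \<Rightarrow> 'a" where
  "ap f x = desc (\<lambda>y. opair x y \<in> f)"

definition inv_on :: "'a \<Rightarrow> ('a \<Rightarrow> 'a) \<Rightarrow> 'a \<Rightarrow> 'a" where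
  "inv_on A F y = desc (\<lambda>x. x \<in> A \<and> F x = y)"

definition pfst :: "'a \<Rightarrow> 'a" where
  "pfst p = desc (\<lambda>x. \<exists>y. p = opair x y)"

definition psnd :: "'a \<Rightarrow> 'a" where
  "psnd p = desc (\<lambda>y. \<exists>x. p = opair x y)"

end

context zf_model
begin

lemma ext_iff: "x = y \<longleftrightarrow> (\<forall>z. z \<in> x \<longleftrightarrow> z \<in> y)"
  using extensionality by blast

lemma mem_ext: "(\<And>z. z \<in> x \<longleftrightarrow> z \<in> y) \<Longrightarrow> x = y"
  using extensionality by blast

lemma mem_setof:
  assumes "\<exists>u. \<forall>z. z \<in> u \<longleftrightarrow> P z"
  shows "z \<in> setof P \<longleftrightarrow> P z"
proof -
  have "\<exists>!u. \<forall>z. z \<in> u \<longleftrightarrow> P z" using assms extensionality by blast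
  from theI'[OF this] show ?thesis by (simp add: setof_def)
qed

lemma definable_fn_setof [definable, simp]:
  assumes P: "definable (\<lambda>v. P (v 0) (\<lambda>i. v (Suc i)))"
  shows "definable_fn (\<lambda>v. setof (\<lambda>z. P z v))"
proof -
  let ?ext = "\<lambda>x v. \<forall>z. z \<in> x \<longleftrightarrow> P z v"
  have "definable (\<lambda>v. ?ext (v 0) (\<lambda>i. v (Suc i)) \<or>
      \<not> (\<exists>x. ?ext x (\<lambda>i. v (Suc i))) \<and> v 0 = (THE x. False))"
    using definable_reindex_tail[OF P, of "\<lambda>i. Suc (Suc i)"]
      definable_reindex_tail[OF P, of "\<lambda>i. Suc (Suc (Suc i))"] by simp
  moreover have "(?ext x v \<or> \<not> (\<exists>x. ?ext x v) \<and> x = (THE x. False)) \<longleftrightarrow> x = setof (\<lambda>z. P z v)" for x v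
  proof (cases "\<exists>u. ?ext u v")
    case True
    thus ?thesis using mem_setof[of "\<lambda>z. P z v"] by (auto simp: ext_iff)
  next
    case False
    hence "(\<lambda>x. ?ext x v) = (\<lambda>x. False)" by (simp add: fun_eq_iff)
    hence "setof (\<lambda>z. P z v) = (THE x. False)" unfolding setof_def by simp
    thus ?thesis using False by auto
  qed
  ultimately show ?thesis unfolding definable_fn_def by (rule definable_iff_cong)
qed

lemma definable_fn_sep [definable, simp]:
  "definable_fn A \<Longrightarrow> definable (\<lambda>v. P (v 0) (\<lambda>i. v (Suc i))) \<Longrightarrow> definable_fn (\<lambda>v. sep (A v) (\<lambda>z. P z v))"
  unfolding sep_def by (intro definable_fn_setof definable definable_fn_reindex[of A Suc])

lemma definable_fn_desc [definable, simp]: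
  assumes "definable (\<lambda>v. P (v 0) (\<lambda>i. v (Suc i)))"
  shows "definable_fn (\<lambda>v. desc (\<lambda>x. P x v))"
  unfolding desc_def by (intro definable definable_reindex_tail[OF assms])

lemma definable_fn_succ [definable, simp]: "definable_fn f \<Longrightarrow> definable_fn (\<lambda>v. succ (f v))"
  by (rule definable_fn_app1[of succ]) (unfold succ_def, intro definable)

lemma definable_fn_upair [definable, simp]:
  "definable_fn f \<Longrightarrow> definable_fn g \<Longrightarrow> definable_fn (\<lambda>v. upair (f v) (g v))"
  by (rule definable_fn_app2[of upair]) (unfold upair_def, intro definable)

lemma definable_fn_opair [definable, simp]:
  "definable_fn f \<Longrightarrow> definable_fn g \<Longrightarrow> definable_fn (\<lambda>v. opair (f v) (g v))"
  unfolding opair_def by (intro definable)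

lemma definable_fn_ap [definable, simp]:
  "definable_fn f \<Longrightarrow> definable_fn g \<Longrightarrow> definable_fn (\<lambda>v. ap (f v) (g v))"
  by (rule definable_fn_app2[of ap]) (unfold ap_def, intro definable)

lemma definable_fn_pfst [definable, simp]: "definable_fn f \<Longrightarrow> definable_fn (\<lambda>v. pfst (f v))"
  by (rule definable_fn_app1[of pfst]) (unfold pfst_def, intro definable)

lemma definable_fn_psnd [definable, simp]: "definable_fn f \<Longrightarrow> definable_fn (\<lambda>v. psnd (f v))"
  by (rule definable_fn_app1[of psnd]) (unfold psnd_def, intro definable)

lemma definable_fn_times [definable, simp]:
  "definable_fn f \<Longrightarrow> definable_fn g \<Longrightarrow> definable_fn (\<lambda>v. times (f v) (g v))"
  by (rule definable_fn_app2[of times]) (unfold times_def, intro definable)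

lemma definable_fn_union [definable, simp]:
  "definable_fn f \<Longrightarrow> definable_fn g \<Longrightarrow> definable_fn (\<lambda>v. union (f v) (g v))"
  by (rule definable_fn_app2[of union]) (unfold union_def, intro definable)

lemma definable_fn_big_union [definable, simp]:
  "definable_fn f \<Longrightarrow> definable_fn (\<lambda>v. big_union (f v))"
  by (rule definable_fn_app1[of big_union]) (unfold big_union_def, intro definable)

lemma definable_fn_img [definable, simp]:
  assumes "definable_fn (\<lambda>v. F (v 0) (\<lambda>i. v (Suc i)))" and "definable_fn A"
  shows "definable_fn (\<lambda>v. img (\<lambda>x. F x v) (A v))"
  unfolding img_def
  by (intro definable definable_fn_reindex_tail[OF assms(1)] definable_fn_reindex[OF assms(2)])

lemma definable_fn_lam [definable, simp]:
  assumes "definable_fn (\<lambda>v. F (v 0) (\<lambda>i. v (Suc i)))" and "definable_fn A"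
  shows "definable_fn (\<lambda>v. lam (A v) (\<lambda>x. F x v))"
  unfolding lam_def
  by (intro definable definable_fn_reindex_tail[OF assms(1)] definable_fn_reindex[OF assms(2)])

lemma definable_fn_inv_on [definable, simp]:
  assumes "definable_fn (\<lambda>v. F (v 0) (\<lambda>i. v (Suc i)))" and "definable_fn A" and "definable_fn y"
  shows "definable_fn (\<lambda>v. inv_on (A v) (\<lambda>x. F x v) (y v))"
  unfolding inv_on_def
  by (intro definable definable_fn_reindex_tail[OF assms(1)] assms(2,3)[THEN definable_fn_reindex])

lemma mem_sep [simp]: "definable (\<lambda>v. P (v 0)) \<Longrightarrow> z \<in> sep A P \<longleftrightarrow> z \<in> A \<and> P z"
  unfolding sep_def by (rule mem_setof) (rule definable_separation)

lemma mem_img [simp]: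
  assumes "definable_map F"
  shows "y \<in> img F A \<longleftrightarrow> (\<exists>x. x \<in> A \<and> y = F x)"
  unfolding img_def
proof (rule mem_setof, rule definable_replacement)
  show "definable (\<lambda>v. v 1 = F (v 0))" using definable_fn_reindex[OF assms, of "\<lambda>i. i"] by simp
qed simp

lemma desc_eq:
  assumes "P x" "\<And>y. P y \<Longrightarrow> y = x"
  shows "desc P = x"
proof (rule mem_ext)
  have "(\<exists>x. P x \<and> z \<in> x) \<longleftrightarrow> z \<in> x" for z using assms by blast
  thus "z \<in> desc P \<longleftrightarrow> z \<in> x" for z unfolding desc_def by (subst mem_setof) blast+
qed

lemma not_mem_zero [simp]: "\<not> x \<in> zero"
proof -
  have "\<exists>u. \<forall>z. z \<in> u \<longleftrightarrow> z \<in> undefined \<and> False" by (rule definable_separation) simp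
  thus ?thesis unfolding zero_def by (subst mem_setof) auto
qed

lemma mem_upair [simp]: "z \<in> upair x y \<longleftrightarrow> z = x \<or> z = y"
  unfolding upair_def by (rule mem_setof) (use pairing in auto)

lemma mem_big_union [simp]: "z \<in> big_union A \<longleftrightarrow> (\<exists>y. y \<in> A \<and> z \<in> y)"
  unfolding big_union_def by (rule mem_setof) (use union in auto)

lemma mem_powerset [simp]: "z \<in> powerset A \<longleftrightarrow> z \<subseteq> A"
  unfolding powerset_def by (rule mem_setof) (use power_set in auto)

lemma mem_union [simp]: "z \<in> union A B \<longleftrightarrow> z \<in> A \<or> z \<in> B"
  unfolding union_def by (rule mem_setof, rule exI[of _ "big_union (upair A B)"]) auto

lemma mem_succ [simp]: "z \<in> succ x \<longleftrightarrow> z \<in> x \<or> z = x"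
  unfolding succ_def by (rule mem_setof, rule exI[of _ "union x (upair x x)"]) auto

lemma upair_eq: "upair x y = upair z w \<longleftrightarrow> (x = z \<and> y = w) \<or> (x = w \<and> y = z)"
  using ext_iff[of "upair x y" "upair z w"] by (metis mem_upair)

lemma opair_eq [simp]: "opair a b = opair c d \<longleftrightarrow> a = c \<and> b = d"
  unfolding opair_def upair_eq by auto

lemma pfst_opair [simp]: "pfst (opair x y) = x"
  unfolding pfst_def by (rule desc_eq) auto

lemma psnd_opair [simp]: "psnd (opair x y) = y"
  unfolding psnd_def by (rule desc_eq) auto

lemma mem_times [simp]: "p \<in> times A B \<longleftrightarrow> (\<exists>x y. x \<in> A \<and> y \<in> B \<and> p = opair x y)"
  unfolding times_def
proof (rule mem_setof, rule exI[of _ "big_union (img (\<lambda>x. img (opair x) B) A)"], rule allI)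
  have "definable_map (\<lambda>x. img (opair x) B)" "definable_map (opair x)" for x by (intro definable)+
  thus "z \<in> big_union (img (\<lambda>x. img (opair x) B) A) \<longleftrightarrow> (\<exists>x y. x \<in> A \<and> y \<in> B \<and> z = opair x y)" for z
    by auto
qed

lemma mem_lam [simp]:
  assumes "definable_map F"
  shows "p \<in> lam A F \<longleftrightarrow> (\<exists>x. x \<in> A \<and> p = opair x (F x))"
proof -
  have "definable_fn (\<lambda>v. opair (v 0) (F (v 0)))" using assms by (intro definable)
  thus ?thesis using mem_img[of "\<lambda>x. opair x (F x)"] unfolding lam_def img_def by simp
qed

lemma fun_on_ap:
  assumes "fun_on f A" "x \<in> A"
  shows mem_fun_on_iff: "opair x y \<in> f \<longleftrightarrow> y = ap f x" and app_eq_ap: "app f x = ap f x"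
proof -
  obtain w where w: "opair x w \<in> f" "\<And>y. opair x y \<in> f \<Longrightarrow> y = w"
    using assms unfolding fun_on_def by metis
  hence "ap f x = w" unfolding ap_def by (rule desc_eq)
  moreover have "app f x = w" unfolding app_def using w by (rule the_equality)
  ultimately show "opair x y \<in> f \<longleftrightarrow> y = ap f x" "app f x = ap f x" using w by blast+
qed

lemma ap_eqI: "fun_on f A \<Longrightarrow> opair x y \<in> f \<Longrightarrow> ap f x = y"
  by (metis mem_fun_on_iff fun_on_def opair_eq)

lemma mem_fun_on:
  assumes "fun_on f A" shows "p \<in> f \<longleftrightarrow> (\<exists>x. x \<in> A \<and> p = opair x (ap f x))"
  using assms mem_fun_on_iff[OF assms] unfolding fun_on_def by metis

lemma fun_on_ext:
  assumes "fun_on f A" "fun_on g A" "\<And>x. x \<in> A \<Longrightarrow> ap f x = ap g x"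
  shows "f = g"
  by (rule mem_ext) (use assms(3) in \<open>auto simp: mem_fun_on[OF assms(1)] mem_fun_on[OF assms(2)]\<close>)

lemma fun_on_lam [simp]: "definable_map F \<Longrightarrow> fun_on (lam A F) A"
  unfolding fun_on_def by auto

lemma ap_lam [simp]: "definable_map F \<Longrightarrow> x \<in> A \<Longrightarrow> ap (lam A F) x = F x"
  by (rule ap_eqI[OF fun_on_lam]) auto

lemma lam_cong: "(\<And>x. x \<in> A \<Longrightarrow> F x = G x) \<Longrightarrow> lam A F = lam A G"
  unfolding lam_def by (rule arg_cong[of _ _ setof]) (auto simp: fun_eq_iff)

lemma maps_iff: "maps f A B \<longleftrightarrow> fun_on f A \<and> (\<forall>x. x \<in> A \<longrightarrow> ap f x \<in> B)"
  unfolding maps_def using app_eq_ap by metis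

lemma bijection_iff: "bijection f A B \<longleftrightarrow> fun_on f A \<and> bij_betw (ap f) (elts A) (elts B)"
proof (cases "fun_on f A")
  case True
  have "(x \<in> A \<and> app f x = y) \<longleftrightarrow> (x \<in> A \<and> ap f x = y)" for x y using app_eq_ap[OF True] by auto
  thus ?thesis unfolding bijection_def maps_iff bij_elts_iff_ex1 by auto
qed (simp add: bijection_def maps_iff)

definition order_iso :: "'a \<Rightarrow> 'a \<Rightarrow> 'a \<Rightarrow> 'a \<Rightarrow> 'a \<Rightarrow> bool" where
  "order_iso f A R B S \<longleftrightarrow> fun_on f A \<and> bij_betw (ap f) (elts A) (elts B) \<and>
     (\<forall>x y. x \<in> A \<and> y \<in> A \<longrightarrow> (lt R x y \<longleftrightarrow> lt S (ap f x) (ap f y)))"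

lemma order_isoD:
  assumes "order_iso f A R B S"
  shows order_iso_fun_on: "fun_on f A" and order_iso_bij: "bij_betw (ap f) (elts A) (elts B)"
    and order_iso_less_iff: "\<And>x y. x \<in> A \<Longrightarrow> y \<in> A \<Longrightarrow> lt R x y \<longleftrightarrow> lt S (ap f x) (ap f y)"
    and order_iso_mem: "\<And>x. x \<in> A \<Longrightarrow> ap f x \<in> B"
    and order_iso_inj: "\<And>x y. \<lbrakk>x \<in> A; y \<in> A; ap f x = ap f y\<rbrakk> \<Longrightarrow> x = y"
    and order_iso_surj: "\<And>y. y \<in> B \<Longrightarrow> \<exists>x. x \<in> A \<and> ap f x = y"
  using assms unfolding order_iso_def bij_elts_iff by blast+

lemma isomorphic_iff: "isomorphic A R B S \<longleftrightarrow> (\<exists>f. order_iso f A R B S)"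
  unfolding isomorphic_def order_iso_def bijection_iff using app_eq_ap by (metis (no_types, lifting))

lemma bij_betw_ap_lam:
  assumes "definable_map F" "bij_betw F (elts A) (elts B)"
  shows "bij_betw (ap (lam A F)) (elts A) (elts B)"
  using assms(2) by (rule bij_betw_cong[THEN iffD1, rotated]) (simp add: assms(1))

lemma isomorphicI:
  assumes "definable_map F" "bij_betw F (elts A) (elts B)"
    and "\<And>x y. x \<in> A \<Longrightarrow> y \<in> A \<Longrightarrow> lt R x y \<longleftrightarrow> lt S (F x) (F y)"
  shows "isomorphic A R B S"
  unfolding isomorphic_iff order_iso_def
  by (intro exI[of _ "lam A F"]) (simp add: assms bij_betw_ap_lam[OF assms(1,2)])

lemma equipotent_iff: "equipotent A B \<longleftrightarrow> (\<exists>f. fun_on f A \<and> bij_betw (ap f) (elts A) (elts B))"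
  unfolding equipotent_def bijection_iff ..

lemma equipotentI: "definable_map F \<Longrightarrow> bij_betw F (elts A) (elts B) \<Longrightarrow> equipotent A B"
  unfolding equipotent_iff using fun_on_lam bij_betw_ap_lam by blast

lemma inv_on_eq: "inj_on F (elts A) \<Longrightarrow> x \<in> A \<Longrightarrow> inv_on A F (F x) = x"
  unfolding inv_on_def by (rule desc_eq) (auto dest: inj_onD)

lemma bij_betw_inv_on:
  assumes "bij_betw F (elts A) (elts B)"
  shows inv_on_mem: "\<And>y. y \<in> B \<Longrightarrow> inv_on A F y \<in> A" and ap_inv_on: "\<And>y. y \<in> B \<Longrightarrow> F (inv_on A F y) = y"
    and inv_on_ap: "\<And>x. x \<in> A \<Longrightarrow> inv_on A F (F x) = x"
    and bij_inv_on: "bij_betw (inv_on A F) (elts B) (elts A)"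
proof -
  show left: "\<And>x. x \<in> A \<Longrightarrow> inv_on A F (F x) = x"
    using inv_on_eq assms by (simp add: bij_betw_def)
  show mem: "\<And>y. y \<in> B \<Longrightarrow> inv_on A F y \<in> A" and right: "\<And>y. y \<in> B \<Longrightarrow> F (inv_on A F y) = y"
    using left bij_elts_surj[OF assms] by metis+
  show "bij_betw (inv_on A F) (elts B) (elts A)"
    by (rule bij_eltsI) (use mem right left bij_elts_mem[OF assms] in metis)+
qed

lemma isomorphic_refl: "isomorphic A R A R"
  by (rule isomorphicI[of "\<lambda>x. x"]) (auto simp: bij_betw_def)

lemma isomorphic_sym:
  assumes "isomorphic A R B S" shows "isomorphic B S A R"
proof -
  obtain f where f: "order_iso f A R B S" using assms isomorphic_iff by blast
  note inv = bij_betw_inv_on[OF order_iso_bij[OF f]]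
  show ?thesis
    by (rule isomorphicI[OF _ inv(4)]) (simp_all add: inv order_iso_less_iff[OF f])
qed

lemma isomorphic_trans:
  assumes "isomorphic A R B S" "isomorphic B S C Q" shows "isomorphic A R C Q"
proof -
  obtain f g where f: "order_iso f A R B S" and g: "order_iso g B S C Q"
    using assms isomorphic_iff by metis
  show ?thesis
  proof (rule isomorphicI[of "\<lambda>x. ap g (ap f x)"])
    show "bij_betw (\<lambda>x. ap g (ap f x)) (elts A) (elts C)"
      using bij_betw_trans[OF order_iso_bij[OF f] order_iso_bij[OF g]] by (simp add: comp_def)
  qed (simp_all add: order_iso_less_iff[OF f] order_iso_less_iff[OF g] order_iso_mem[OF f])
qed

lemma definable_fun_on [definable, simp]:
  "definable_fn f \<Longrightarrow> definable_fn g \<Longrightarrow> definable (\<lambda>v. fun_on (f v) (g v))"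
  by (rule definable_app2[of fun_on]) (unfold fun_on_def, intro definable)

lemma definable_maps [definable, simp]:
  "\<lbrakk>definable_fn f; definable_fn g; definable_fn h\<rbrakk> \<Longrightarrow> definable (\<lambda>v. maps (f v) (g v) (h v))"
  by (rule definable_app3[of maps]) (unfold maps_iff, intro definable)

lemma definable_order_iso [definable, simp]:
  "\<lbrakk>definable_fn f; definable_fn A; definable_fn R; definable_fn B; definable_fn S\<rbrakk> \<Longrightarrow>
    definable (\<lambda>v. order_iso (f v) (A v) (R v) (B v) (S v))"
  by (rule definable_app5[of order_iso]) (unfold order_iso_def bij_elts_iff, intro definable)

lemma definable_isomorphic [definable, simp]:
  "\<lbrakk>definable_fn A; definable_fn R; definable_fn B; definable_fn S\<rbrakk> \<Longrightarrow>
    definable (\<lambda>v. isomorphic (A v) (R v) (B v) (S v))"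
  by (rule definable_app4[of isomorphic]) (unfold isomorphic_iff, intro definable)

lemma definable_equipotent [definable, simp]:
  "definable_fn A \<Longrightarrow> definable_fn B \<Longrightarrow> definable (\<lambda>v. equipotent (A v) (B v))"
  by (rule definable_app2[of equipotent]) (unfold equipotent_iff bij_elts_iff, intro definable)

lemma subsetI: "(\<And>z. z \<in> x \<Longrightarrow> z \<in> y) \<Longrightarrow> x \<subseteq> y"
  by (simp add: subset_def)

lemma subsetD: "x \<subseteq> y \<Longrightarrow> z \<in> x \<Longrightarrow> z \<in> y"
  by (simp add: subset_def)

lemma subset_refl [simp]: "x \<subseteq> x"
  by (simp add: subset_def)

lemma subset_trans [trans]: "x \<subseteq> y \<Longrightarrow> y \<subseteq> z \<Longrightarrow> x \<subseteq> z"
  by (simp add: subset_def)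

lemma subset_antisym: "x \<subseteq> y \<Longrightarrow> y \<subseteq> x \<Longrightarrow> x = y"
  by (rule mem_ext) (auto simp: subset_def)

lemma sep_subset [simp]: "definable (\<lambda>v. P (v 0)) \<Longrightarrow> sep A P \<subseteq> A"
  by (simp add: subset_def)

lemma mem_irrefl [simp]: "\<not> x \<in> x"
  using foundation[rule_format, of "upair x x"] by auto

lemma mem_asym: "x \<in> y \<Longrightarrow> \<not> y \<in> x"
  using foundation[rule_format, of "upair x y"] by auto

subsection \<open>Partition relations\<close>

lemma mem_subsets_of_type [simp]:
  "H \<in> subsets_of_type A R T S \<longleftrightarrow> H \<subseteq> A \<and> isomorphic H R T S"
proof -
  have "H \<in> sep (powerset A) (\<lambda>H. isomorphic H R T S) \<longleftrightarrow> H \<subseteq> A \<and> isomorphic H R T S" for H by simp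
  thus ?thesis unfolding subsets_of_type_def by (intro mem_setof) blast
qed

definition homogeneous :: "'a \<Rightarrow> 'a \<Rightarrow> 'a \<Rightarrow> 'a \<Rightarrow> 'a \<Rightarrow> bool" where
  "homogeneous F H R T S \<longleftrightarrow> (\<forall>X Y. X \<in> subsets_of_type H R T S \<and> Y \<in> subsets_of_type H R T S \<longrightarrow>
     ap F X = ap F Y)"

lemma arrow_iff:
  "arrow A R P Q T S \<longleftrightarrow> (\<forall>F. maps F (subsets_of_type A R T S) two \<longrightarrow>
     (\<exists>H. H \<in> subsets_of_type A R P Q \<and> homogeneous F H R T S))"
proof -
  have "app F X = ap F X"
    if "maps F (subsets_of_type A R T S) two" "H \<subseteq> A" "X \<subseteq> H" "isomorphic X R T S" for F H X
    using that subset_trans by (intro app_eq_ap[of F "subsets_of_type A R T S"]) (auto simp: maps_iff)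
  thus ?thesis unfolding arrow_def homogeneous_def mem_subsets_of_type by (metis (no_types, lifting))
qed

lemma arrow_cong:
  assumes "isomorphic P Q P' Q'"
  shows "arrow A R P Q P Q \<longleftrightarrow> arrow A R P' Q' P' Q'"
proof -
  have "isomorphic X R P Q \<longleftrightarrow> isomorphic X R P' Q'" for X
    using assms isomorphic_sym isomorphic_trans by blast
  moreover hence "subsets_of_type A R P Q = subsets_of_type A R P' Q'" for A by (intro mem_ext) simp
  ultimately show ?thesis unfolding arrow_iff homogeneous_def by simp
qed

lemma arrow_transfer:
  assumes arrow: "arrow A R T S T S"
    and pull: "\<And>G. maps G (subsets_of_type B Q U V) two \<Longrightarrow> \<exists>F. maps F (subsets_of_type A R T S) two \<and>
      (\<forall>H. H \<in> subsets_of_type A R T S \<and> homogeneous F H R T S \<longrightarrow>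
        (\<exists>K. K \<in> subsets_of_type B Q U V \<and> (\<forall>Z. Z \<in> subsets_of_type K Q U V \<longrightarrow>
          (\<exists>Y. Y \<in> subsets_of_type H R T S \<and> ap F Y = ap G Z))))"
  shows "arrow B Q U V U V"
  unfolding arrow_iff
proof (intro allI impI)
  fix G assume "maps G (subsets_of_type B Q U V) two"
  then obtain F where F: "maps F (subsets_of_type A R T S) two"
    and pull_F: "\<And>H. H \<in> subsets_of_type A R T S \<Longrightarrow> homogeneous F H R T S \<Longrightarrow>
        \<exists>K. K \<in> subsets_of_type B Q U V \<and> (\<forall>Z. Z \<in> subsets_of_type K Q U V \<longrightarrow>
          (\<exists>Y. Y \<in> subsets_of_type H R T S \<and> ap F Y = ap G Z))"
    using pull by blast
  obtain H where H: "H \<in> subsets_of_type A R T S" "homogeneous F H R T S"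
    using arrow F unfolding arrow_iff by blast
  obtain K where K: "K \<in> subsets_of_type B Q U V"
    and copies: "\<And>Z. Z \<in> subsets_of_type K Q U V \<Longrightarrow> \<exists>Y. Y \<in> subsets_of_type H R T S \<and> ap F Y = ap G Z"
    using pull_F[OF H] by blast
  have "homogeneous G K Q U V" unfolding homogeneous_def
    using copies H(2) unfolding homogeneous_def by metis
  thus "\<exists>K. K \<in> subsets_of_type B Q U V \<and> homogeneous G K Q U V" using K by blast
qed

end

subsection \<open>Ordinals\<close>

context zf_model
begin

lemma definable_transitive_set [definable, simp]: "definable_fn f \<Longrightarrow> definable (\<lambda>v. transitive_set (f v))"
  by (rule definable_app1[of transitive_set]) (unfold transitive_set_def, intro definable)

lemma definable_ordinal [definable, simp]: "definable_fn f \<Longrightarrow> definable (\<lambda>v. ordinal (f v))"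
  by (rule definable_app1[of ordinal]) (unfold ordinal_def, intro definable)

lemma ord_trans: "\<lbrakk>ordinal a; x \<in> y; y \<in> a\<rbrakk> \<Longrightarrow> x \<in> a"
  unfolding ordinal_def transitive_set_def subset_def by blast

lemma ord_mem: "ordinal a \<Longrightarrow> x \<in> a \<Longrightarrow> ordinal x"
  unfolding ordinal_def transitive_set_def subset_def by blast

lemma ord_memI: "(\<And>x y. y \<in> a \<Longrightarrow> x \<in> y \<Longrightarrow> x \<in> a) \<Longrightarrow> (\<And>x. x \<in> a \<Longrightarrow> ordinal x) \<Longrightarrow> ordinal a"
  unfolding ordinal_def transitive_set_def subset_def by blast

lemma ord_mem_subset: "ordinal a \<Longrightarrow> x \<in> a \<Longrightarrow> x \<subseteq> a"
  by (auto simp: ordinal_def transitive_set_def)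

lemma ord_zero [simp]: "ordinal zero"
  by (rule ord_memI) auto

lemma ord_succ [simp]: "ordinal a \<Longrightarrow> ordinal (succ a)"
  by (rule ord_memI) (auto intro: ord_trans ord_mem)

lemma ord_induct [consumes 1, case_names defn step]:
  assumes "ordinal a" and P: "definable (\<lambda>v. P (v 0))"
    and step: "\<And>a. ordinal a \<Longrightarrow> (\<And>b. b \<in> a \<Longrightarrow> P b) \<Longrightarrow> P a"
  shows "P a"
proof (rule ccontr)
  assume "\<not> P a"
  define X where "X = sep (succ a) (\<lambda>x. \<not> P x)"
  have X: "z \<in> X \<longleftrightarrow> z \<in> succ a \<and> \<not> P z" for z unfolding X_def using P by (intro mem_sep) simp
  have "\<exists>y. y \<in> X" using X[of a] \<open>\<not> P a\<close> by auto
  then obtain y where y: "y \<in> X" "\<not> (\<exists>z. z \<in> X \<and> z \<in> y)" using foundation by blast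
  have oa: "ordinal (succ a)" using assms(1) by simp
  have ya: "y \<in> succ a" using y X by blast
  have "P z" if "z \<in> y" for z using y(2) X that ord_trans[OF oa that ya] by blast
  hence "P y" using step ord_mem[OF oa ya] by blast
  thus False using y X by blast
qed

lemma ord_least:
  assumes "ordinal a" "P a" and P: "definable (\<lambda>v. P (v 0))"
  obtains b where "ordinal b" "P b" "\<And>c. c \<in> b \<Longrightarrow> \<not> P c"
proof -
  have "\<exists>b. ordinal b \<and> P b \<and> (\<forall>c. c \<in> b \<longrightarrow> \<not> P c)"
  proof (rule ccontr)
    assume n: "\<not> ?thesis"
    have "definable (\<lambda>v. \<not> P (v 0))" using P by simp
    with assms(1) have "\<not> P a" by (rule ord_induct) (use n in blast)
    thus False using assms by blast
  qed
  thus ?thesis using that by blast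
qed

lemma ord_linear: "ordinal a \<Longrightarrow> ordinal b \<Longrightarrow> a \<in> b \<or> a = b \<or> b \<in> a"
proof -
  assume "ordinal a" "ordinal b"
  from \<open>ordinal a\<close> have "\<forall>b. ordinal b \<longrightarrow> a \<in> b \<or> a = b \<or> b \<in> a"
  proof (induction rule: ord_induct)
    case (step a)
    note below_a = step
    have "a \<in> b \<or> a = b \<or> b \<in> a" if "ordinal b" for b using that
    proof (induction rule: ord_induct)
      case (step b)
      show ?case
      proof (rule ccontr)
        assume incomparable: "\<not> ?case"
        have "x \<in> b" if "x \<in> a" for x
          using below_a(2)[OF that] step(1) incomparable that ord_trans[OF below_a(1)] by blast
        moreover have "x \<in> a" if "x \<in> b" for x
          using step(2)[OF that] incomparable that ord_trans[OF step(1)] by blast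
        ultimately have "a = b" by (intro mem_ext) blast
        thus False using incomparable by blast
      qed
    qed simp
    thus ?case by blast
  qed simp
  thus ?thesis using \<open>ordinal b\<close> by blast
qed

lemma ord_subset_iff: "ordinal a \<Longrightarrow> ordinal b \<Longrightarrow> a \<subseteq> b \<longleftrightarrow> a \<in> b \<or> a = b"
  using ord_linear ord_mem_subset mem_irrefl subsetD subset_refl by metis

lemma ord_not_mem: "ordinal a \<Longrightarrow> ordinal b \<Longrightarrow> \<not> a \<in> b \<longleftrightarrow> b \<subseteq> a"
  using ord_linear ord_subset_iff mem_asym mem_irrefl by metis

lemma ord_arg_min:
  assumes "P x" and ord: "\<And>x. P x \<Longrightarrow> ordinal (g x)"
    and P: "definable (\<lambda>v. P (v 0))" and g: "definable_map g"
  obtains m where "P m" "\<And>y. P y \<Longrightarrow> g m \<subseteq> g y"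
proof -
  have attained: "definable (\<lambda>v. \<exists>y. P y \<and> v 0 = g y)"
    by (intro definable definable_app1[OF P] definable_fn_app1[OF g])
  have "\<exists>y. P y \<and> g x = g y" using assms(1) by blast
  from ord[OF assms(1)] this attained obtain b where "\<exists>y. P y \<and> b = g y"
    and least: "\<And>c. c \<in> b \<Longrightarrow> \<not> (\<exists>y. P y \<and> c = g y)"
    by (rule ord_least[where P = "\<lambda>b. \<exists>y. P y \<and> b = g y"]) (rule that)
  then obtain m where m: "P m" "b = g m" by blast
  have "g m \<subseteq> g y" if "P y" for y
    using least[of "g y"] ord_not_mem[OF ord[OF that] ord[OF m(1)]] m(2) that by blast
  thus ?thesis using that m(1) by blast
qed

lemma ord_le_lt: "\<lbrakk>ordinal a; ordinal b; ordinal c; a \<subseteq> b; b \<in> c\<rbrakk> \<Longrightarrow> a \<in> c"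
  using ord_subset_iff ord_trans by metis

lemma ord_big_union: "(\<And>x. x \<in> A \<Longrightarrow> ordinal x) \<Longrightarrow> ordinal (big_union A)"
  by (rule ord_memI; simp; blast intro: ord_trans ord_mem)

lemma increasing_ge:
  assumes "ordinal a" "x \<in> a" and F: "definable_map F"
    and inc: "\<And>x y. y \<in> a \<Longrightarrow> x \<in> y \<Longrightarrow> F x \<in> F y" and ord: "\<And>x. x \<in> a \<Longrightarrow> ordinal (F x)"
  shows "x \<subseteq> F x"
proof -
  have "ordinal x" using assms ord_mem by blast
  hence "x \<in> a \<longrightarrow> x \<subseteq> F x"
  proof (induction rule: ord_induct)
    case defn show ?case using F by simp
  next
    case (step x)
    show ?case
    proof (intro impI, rule ccontr)
      assume x: "x \<in> a" and "\<not> x \<subseteq> F x"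
      hence "F x \<in> x" using ord_not_mem[OF ord step(1)] by blast
      moreover from this have "F x \<subseteq> F (F x)" using step(2) x ord_trans[OF assms(1)] by blast
      ultimately show False using inc[OF x, of "F x"] subsetD mem_irrefl by blast
    qed
  qed
  thus ?thesis using assms by blast
qed

lemma mem_memrel [simp]: "lt (memrel a) x y \<longleftrightarrow> x \<in> a \<and> y \<in> a \<and> x \<in> y"
proof -
  have "p \<in> sep (times a a) (\<lambda>p. \<exists>x y. x \<in> a \<and> y \<in> a \<and> x \<in> y \<and> p = opair x y) \<longleftrightarrow>
    (\<exists>x y. x \<in> a \<and> y \<in> a \<and> x \<in> y \<and> p = opair x y)" for p by auto
  thus ?thesis unfolding memrel_def by (subst mem_setof) (blast, auto)
qed

lemma definable_fn_memrel [definable, simp]: "definable_fn f \<Longrightarrow> definable_fn (\<lambda>v. memrel (f v))"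
  by (rule definable_fn_app1[of memrel]) (unfold memrel_def, intro definable)

subsection \<open>Natural numbers\<close>

lemma mem_omega: "n \<in> omega \<longleftrightarrow> (\<forall>I. zero \<in> I \<and> (\<forall>m. m \<in> I \<longrightarrow> succ m \<in> I) \<longrightarrow> n \<in> I)"
proof -
  obtain u where u: "\<exists>e. e \<in> u \<and> \<not> (\<exists>z. z \<in> e)"
    "\<forall>x. x \<in> u \<longrightarrow> (\<exists>y. y \<in> u \<and> (\<forall>z. z \<in> y \<longleftrightarrow> z \<in> x \<or> z = x))" using infinity by blast
  have zero_u: "zero \<in> u"
  proof -
    obtain e where "e \<in> u" "\<not> (\<exists>z. z \<in> e)" using u(1) by blast
    moreover hence "e = zero" by (intro mem_ext) auto
    ultimately show ?thesis by simp
  qed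
  have succ_u: "succ x \<in> u" if xu: "x \<in> u" for x
  proof -
    obtain y where "y \<in> u" "\<forall>z. z \<in> y \<longleftrightarrow> z \<in> x \<or> z = x" using u(2) xu by blast
    moreover hence "y = succ x" by (intro mem_ext) auto
    ultimately show ?thesis by simp
  qed
  let ?P = "\<lambda>n. \<forall>I. zero \<in> I \<and> (\<forall>m. m \<in> I \<longrightarrow> succ m \<in> I) \<longrightarrow> n \<in> I"
  have "x \<in> sep u ?P \<longleftrightarrow> ?P x" for x
    using zero_u succ_u by (subst mem_sep) (simp, blast)
  thus ?thesis unfolding omega_def by (intro mem_setof) blast
qed

lemma zero_omega [simp]: "zero \<in> omega"
  unfolding mem_omega by blast

lemma succ_omega [simp]: "n \<in> omega \<Longrightarrow> succ n \<in> omega"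
  unfolding mem_omega by blast

lemma omega_induct [consumes 1, case_names defn zero succ]:
  assumes "n \<in> omega" and P: "definable (\<lambda>v. P (v 0))" and "P zero"
    and "\<And>n. n \<in> omega \<Longrightarrow> P n \<Longrightarrow> P (succ n)"
  shows "P n"
proof -
  have m: "x \<in> sep omega P \<longleftrightarrow> x \<in> omega \<and> P x" for x using P by (rule mem_sep)
  have "zero \<in> sep omega P" "\<forall>m. m \<in> sep omega P \<longrightarrow> succ m \<in> sep omega P"
    unfolding m using assms by auto
  hence "n \<in> sep omega P" using assms(1)[unfolded mem_omega] by blast
  thus ?thesis using m by blast
qed

lemma ord_omega_mem: "n \<in> omega \<Longrightarrow> ordinal n"
  by (induction rule: omega_induct) auto

lemma omega_mem_mem: "n \<in> omega \<Longrightarrow> m \<in> n \<Longrightarrow> m \<in> omega"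
proof -
  assume n: "n \<in> omega" and m: "m \<in> n"
  from n have "\<forall>m. m \<in> n \<longrightarrow> m \<in> omega" by (induction rule: omega_induct) auto
  thus ?thesis using m by blast
qed

lemma ord_omega [simp]: "ordinal omega"
  by (rule ord_memI) (auto intro: omega_mem_mem ord_omega_mem)

lemma omega_cases: "n \<in> omega \<Longrightarrow> n = zero \<or> (\<exists>m. m \<in> omega \<and> n = succ m)"
  by (induction rule: omega_induct) auto

lemma succ_eq [simp]: "succ a = succ b \<longleftrightarrow> a = b"
  using mem_succ mem_asym by metis

lemma succ_not_zero [simp]: "succ a \<noteq> zero" "zero \<noteq> succ a"
  using mem_succ not_mem_zero by metis+

lemma succ_subset_iff: "ordinal a \<Longrightarrow> ordinal b \<Longrightarrow> succ a \<subseteq> b \<longleftrightarrow> a \<in> b"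
  by (auto simp: subset_def intro: ord_trans)

lemma succ_mem_succ: "ordinal a \<Longrightarrow> ordinal b \<Longrightarrow> succ a \<in> succ b \<longleftrightarrow> a \<in> b"
  using succ_subset_iff[of a b] ord_subset_iff[of "succ a" b] by auto

lemma zero_subset [simp]: "zero \<subseteq> x"
  by (simp add: subset_def)

lemma ord_zero_mem: "ordinal a \<Longrightarrow> a \<noteq> zero \<Longrightarrow> zero \<in> a"
  using ord_subset_iff[of zero a] by auto

lemma mem_two [simp]: "x \<in> two \<longleftrightarrow> x = zero \<or> x = one"
  by (simp add: two_def one_def)

lemma mem_one [simp]: "x \<in> one \<longleftrightarrow> x = zero"
  by (simp add: one_def)

lemma one_zero [simp]: "one \<noteq> zero" "zero \<noteq> one"
  by (simp_all add: one_def)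

subsection \<open>Recursion on the ordinals\<close>

definition is_recfun :: "('a \<Rightarrow> 'a) \<Rightarrow> 'a \<Rightarrow> 'a \<Rightarrow> bool" where
  "is_recfun G f a \<longleftrightarrow> fun_on f a \<and> (\<forall>b. b \<in> a \<longrightarrow> ap f b = G (lam b (ap f)))"

definition ord_rec :: "('a \<Rightarrow> 'a) \<Rightarrow> 'a \<Rightarrow> 'a" where
  "ord_rec G a = desc (\<lambda>y. \<exists>f. is_recfun G f (succ a) \<and> y = ap f a)"

lemma definable_fn_ord_rec [definable, simp]:
  assumes "definable_map G" and "definable_fn a"
  shows "definable_fn (\<lambda>v. ord_rec G (a v))"
  by (rule definable_fn_app1[OF _ assms(2)])
    (unfold ord_rec_def is_recfun_def, intro definable definable_fn_app1[OF assms(1)])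

lemma is_recfun_unique:
  assumes f: "is_recfun G f a" "ordinal a" and g: "is_recfun G g a'" "ordinal a'"
    and b: "b \<in> a" "b \<in> a'"
  shows "ap f b = ap g b"
proof -
  have "ordinal b" using f b ord_mem by blast
  hence "b \<in> a \<and> b \<in> a' \<longrightarrow> ap f b = ap g b"
  proof (induction rule: ord_induct)
    case (step b)
    have "lam b (ap f) = lam b (ap g)" if "b \<in> a" "b \<in> a'"
      by (rule lam_cong) (use step that f g ord_trans in blast)
    thus ?case using f g unfolding is_recfun_def by metis
  qed simp
  thus ?thesis using b by blast
qed

lemma ord_rec_eq_ap: "is_recfun G f (succ a) \<Longrightarrow> ordinal a \<Longrightarrow> ord_rec G a = ap f a"
  unfolding ord_rec_def
  by (rule desc_eq) (use is_recfun_unique in \<open>metis mem_succ ord_succ\<close>)+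

lemma ord_rec_step:
  assumes a: "ordinal a" and ex: "\<And>b. b \<in> succ a \<Longrightarrow> \<exists>f. is_recfun G f (succ b)"
  shows "ord_rec G a = G (lam a (ord_rec G))"
proof -
  obtain f where f: "is_recfun G f (succ a)" using ex[of a] by auto
  have "ord_rec G a = ap f a" using ord_rec_eq_ap[OF f a] .
  also have "\<dots> = G (lam a (ap f))" using f unfolding is_recfun_def by simp
  also have "lam a (ap f) = lam a (ord_rec G)"
  proof (rule lam_cong)
    fix b assume b: "b \<in> a"
    then obtain g where g: "is_recfun G g (succ b)" using ex[of b] by auto
    have ord_b: "ordinal b" using a b ord_mem by blast
    show "ap f b = ord_rec G b" unfolding ord_rec_eq_ap[OF g ord_b]
      by (rule is_recfun_unique[OF f _ g]) (use a ord_b b in auto)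
  qed
  finally show ?thesis .
qed

lemma is_recfun_ex:
  assumes G: "definable_map G" and "ordinal a"
  shows "\<exists>f. is_recfun G f (succ a)"
  using assms(2)
proof (induction rule: ord_induct)
  case defn
  show ?case unfolding is_recfun_def by (intro definable definable_fn_app1[OF G])
next
  case (step a)
  define h where "h = lam (succ a) (\<lambda>b. G (lam b (ord_rec G)))"
  have map: "definable_map (\<lambda>b. G (lam b (ord_rec G)))" by (intro definable_fn_app1[OF G] definable G)
  have ap_h: "ap h b = G (lam b (ord_rec G))" if "b \<in> succ a" for b
    unfolding h_def using that by (rule ap_lam[OF map])
  have "ap h b = ord_rec G b" if b: "b \<in> a" for b
  proof -
    have "\<exists>f. is_recfun G f (succ c)" if "c \<in> succ b" for c
      using step(2)[of c] that b ord_trans[OF step(1)] by auto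
    thus ?thesis using ap_h[of b] ord_rec_step[OF ord_mem[OF step(1) b], of G] b by simp
  qed
  hence "lam b (ap h) = lam b (ord_rec G)" if "b \<in> succ a" for b
    using that ord_trans[OF step(1)] by (intro lam_cong) auto
  moreover have "fun_on h (succ a)" unfolding h_def by (rule fun_on_lam[OF map])
  ultimately show ?case using ap_h unfolding is_recfun_def by metis
qed

lemma ord_rec:
  assumes "definable_map G" and "ordinal a"
  shows "ord_rec G a = G (lam a (ord_rec G))"
  by (rule ord_rec_step) (use assms is_recfun_ex ord_mem[OF ord_succ] in blast)+

end

subsection \<open>Well-orders and their types\<close>

context zf_model
begin

definition lin_ord :: "'a \<Rightarrow> 'a \<Rightarrow> bool" where
  "lin_ord A R \<longleftrightarrow> (\<forall>x. x \<in> A \<longrightarrow> \<not> lt R x x) \<and>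
     (\<forall>x y z. x \<in> A \<and> y \<in> A \<and> z \<in> A \<and> lt R x y \<and> lt R y z \<longrightarrow> lt R x z) \<and>
     (\<forall>x y. x \<in> A \<and> y \<in> A \<and> x \<noteq> y \<longrightarrow> lt R x y \<or> lt R y x)"

definition well_ord :: "'a \<Rightarrow> 'a \<Rightarrow> bool" where
  "well_ord A R \<longleftrightarrow> lin_ord A R \<and> (\<forall>X. X \<subseteq> A \<and> (\<exists>x. x \<in> X) \<longrightarrow>
     (\<exists>x. x \<in> X \<and> (\<forall>y. y \<in> X \<longrightarrow> y = x \<or> lt R x y)))"

lemma lin_ordD:
  assumes "lin_ord A R"
  shows lin_irrefl: "x \<in> A \<Longrightarrow> \<not> lt R x x"
    and lin_trans: "\<lbrakk>x \<in> A; y \<in> A; z \<in> A; lt R x y; lt R y z\<rbrakk> \<Longrightarrow> lt R x z"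
    and lin_total: "\<lbrakk>x \<in> A; y \<in> A; x \<noteq> y\<rbrakk> \<Longrightarrow> lt R x y \<or> lt R y x"
  using assms unfolding lin_ord_def by blast+

lemma lin_asym: "\<lbrakk>lin_ord A R; x \<in> A; y \<in> A; lt R x y\<rbrakk> \<Longrightarrow> \<not> lt R y x"
  using lin_ordD by metis

lemma well_ord_lin: "well_ord A R \<Longrightarrow> lin_ord A R"
  by (simp add: well_ord_def)

lemma lin_subset: "lin_ord A R \<Longrightarrow> B \<subseteq> A \<Longrightarrow> lin_ord B R"
  unfolding lin_ord_def subset_def by meson

lemma well_ord_subset: "well_ord A R \<Longrightarrow> B \<subseteq> A \<Longrightarrow> well_ord B R"
  unfolding well_ord_def using lin_subset subset_trans by meson

lemma well_ord_least:
  assumes "well_ord A R" "x \<in> A" "P x" and P: "definable (\<lambda>v. P (v 0))"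
  obtains m where "m \<in> A" "P m" "\<And>y. y \<in> A \<Longrightarrow> P y \<Longrightarrow> y = m \<or> lt R m y"
proof -
  have mem: "z \<in> sep A P \<longleftrightarrow> z \<in> A \<and> P z" for z using P by (rule mem_sep)
  hence "sep A P \<subseteq> A" "x \<in> sep A P" using assms by (auto simp: subset_def)
  then obtain m where "m \<in> sep A P" "\<forall>z. z \<in> sep A P \<longrightarrow> z = m \<or> lt R m z"
    using assms(1) unfolding well_ord_def by blast
  thus ?thesis using that mem by blast
qed

lemma definable_lin_ord [definable, simp]:
  "definable_fn A \<Longrightarrow> definable_fn R \<Longrightarrow> definable (\<lambda>v. lin_ord (A v) (R v))"
  by (rule definable_app2[of lin_ord]) (unfold lin_ord_def, intro definable)

lemma definable_well_ord [definable, simp]: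
  "definable_fn A \<Longrightarrow> definable_fn R \<Longrightarrow> definable (\<lambda>v. well_ord (A v) (R v))"
  by (rule definable_app2[of well_ord]) (unfold well_ord_def, intro definable)

lemma well_ord_memrel:
  assumes "ordinal a" shows "well_ord a (memrel a)"
proof -
  have "\<exists>x. x \<in> X \<and> (\<forall>y. y \<in> X \<longrightarrow> y = x \<or> lt (memrel a) x y)" if X: "X \<subseteq> a" "\<exists>x. x \<in> X" for X
  proof -
    obtain x where x: "x \<in> X" "\<not> (\<exists>z. z \<in> X \<and> z \<in> x)" using foundation X(2) by blast
    have "y = x \<or> x \<in> y" if "y \<in> X" for y
      using ord_linear[of x y] ord_mem[OF assms] X(1) x that by (metis subsetD)
    thus ?thesis using x X(1) subsetD mem_memrel by metis
  qed
  moreover have "lin_ord a (memrel a)"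
    unfolding lin_ord_def using ord_linear ord_mem[OF assms] ord_trans by (metis mem_irrefl mem_memrel)
  ultimately show ?thesis unfolding well_ord_def by blast
qed

lemma lin_memrel: "ordinal a \<Longrightarrow> lin_ord a (memrel a)"
  by (rule well_ord_lin[OF well_ord_memrel])

lemma increasing_iff:
  assumes "lin_ord A R" "lin_ord B S" "\<And>x. x \<in> A \<Longrightarrow> G x \<in> B"
    and inc: "\<And>x y. \<lbrakk>x \<in> A; y \<in> A; lt R x y\<rbrakk> \<Longrightarrow> lt S (G x) (G y)"
    and "x \<in> A" "y \<in> A"
  shows "lt R x y \<longleftrightarrow> lt S (G x) (G y)" and increasing_inj: "G x = G y \<Longrightarrow> x = y"
proof -
  note total = lin_total[OF assms(1,5,6)]
  have asym: "\<not> lt S (G x) (G x)" "lt S (G y) (G x) \<Longrightarrow> \<not> lt S (G x) (G y)"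
    using lin_irrefl[OF assms(2)] lin_asym[OF assms(2)] assms by blast+
  show "lt R x y \<longleftrightarrow> lt S (G x) (G y)" using total asym inc assms(5,6) by metis
  show "G x = G y \<Longrightarrow> x = y" using total asym inc assms(5,6) by metis
qed

lemma bij_betw_img:
  assumes "definable_map G" "\<And>x y. \<lbrakk>x \<in> A; y \<in> A; G x = G y\<rbrakk> \<Longrightarrow> x = y"
  shows "bij_betw G (elts A) (elts (img G A))"
  by (rule bij_eltsI) (use assms in \<open>auto simp: mem_img[OF assms(1)]\<close>)

lemma increasing_isomorphic_img:
  assumes "lin_ord A R" "lin_ord B S" "definable_map G" "\<And>x. x \<in> A \<Longrightarrow> G x \<in> B"
    and "\<And>x y. \<lbrakk>x \<in> A; y \<in> A; lt R x y\<rbrakk> \<Longrightarrow> lt S (G x) (G y)"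
  shows "isomorphic A R (img G A) S"
proof (rule isomorphicI[OF assms(3) bij_betw_img[OF assms(3)]])
  show "\<And>x y. \<lbrakk>x \<in> A; y \<in> A; G x = G y\<rbrakk> \<Longrightarrow> x = y" by (rule increasing_inj[OF assms(1,2,4,5)])
  show "\<And>x y. x \<in> A \<Longrightarrow> y \<in> A \<Longrightarrow> lt R x y \<longleftrightarrow> lt S (G x) (G y)"
    by (rule increasing_iff(1)[OF assms(1,2,4,5)])
qed

lemma increasing_isomorphic_vimage:
  assumes lin: "lin_ord A R" "lin_ord B S" and G: "definable_map G" and mem: "\<And>x. x \<in> A \<Longrightarrow> G x \<in> B"
    and less: "\<And>x y. \<lbrakk>x \<in> A; y \<in> A; lt R x y\<rbrakk> \<Longrightarrow> lt S (G x) (G y)" and Y: "Y \<subseteq> img G A"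
  shows img_vimage: "img G (sep A (\<lambda>x. G x \<in> Y)) = Y" and "isomorphic (sep A (\<lambda>x. G x \<in> Y)) R Y S"
proof -
  show img: "img G (sep A (\<lambda>x. G x \<in> Y)) = Y"
    by (rule mem_ext) (use Y G in \<open>auto simp: subset_def\<close>)
  have sub: "sep A (\<lambda>x. G x \<in> Y) \<subseteq> A" using G by simp
  show "isomorphic (sep A (\<lambda>x. G x \<in> Y)) R Y S"
    using increasing_isomorphic_img[OF lin_subset[OF lin(1) sub] lin(2) G mem less] subsetD[OF sub]
    unfolding img by blast
qed

lemma isomorphic_well_ord:
  assumes "isomorphic A R B S" "well_ord B S"
  shows "well_ord A R"
proof -
  obtain f where f: "order_iso f A R B S" using assms isomorphic_iff by blast
  note mem = order_iso_mem[OF f] and less_iff = order_iso_less_iff[OF f] and inj = order_iso_inj[OF f]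
  note lin = lin_ordD[OF well_ord_lin[OF assms(2)]]
  have "lin_ord A R" unfolding lin_ord_def
  proof (intro conjI allI impI)
    show "\<not> lt R x x" if "x \<in> A" for x using that mem less_iff lin(1) by blast
    show "lt R x z" if xyz: "x \<in> A \<and> y \<in> A \<and> z \<in> A \<and> lt R x y \<and> lt R y z" for x y z
    proof -
      have "lt S (ap f x) (ap f y)" "lt S (ap f y) (ap f z)" using less_iff xyz by blast+
      thus ?thesis using lin(2)[OF mem mem mem] less_iff xyz by blast
    qed
    show "lt R x y \<or> lt R y x" if "x \<in> A \<and> y \<in> A \<and> x \<noteq> y" for x y using that mem less_iff inj lin(3) by blast
  qed
  moreover have "\<exists>x. x \<in> X \<and> (\<forall>y. y \<in> X \<longrightarrow> y = x \<or> lt R x y)"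
    if X: "X \<subseteq> A" "\<exists>x. x \<in> X" for X
  proof -
    obtain x where x: "x \<in> X" using X by blast
    obtain b where "\<exists>x. x \<in> X \<and> b = ap f x"
      and b: "\<And>y. y \<in> B \<Longrightarrow> \<exists>x. x \<in> X \<and> y = ap f x \<Longrightarrow> y = b \<or> lt S b y"
      by (rule well_ord_least[OF assms(2), of "ap f x" "\<lambda>b. \<exists>x. x \<in> X \<and> b = ap f x"])
        (use x X mem in \<open>auto simp: subset_def\<close>)
    then obtain m where "m \<in> X" "b = ap f m" by blast
    thus ?thesis using b less_iff inj mem X(1) by (metis subsetD)
  qed
  ultimately show ?thesis unfolding well_ord_def by blast
qed

lemma isomorphic_agree:
  assumes "\<And>x y. x \<in> A \<Longrightarrow> y \<in> A \<Longrightarrow> lt R x y \<longleftrightarrow> lt R' x y"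
  shows "isomorphic A R A R'"
  by (rule isomorphicI[of "\<lambda>x. x"]) (simp_all add: assms bij_betw_def)

lemma well_ord_agree:
  assumes "well_ord A R" "\<And>x y. x \<in> A \<Longrightarrow> y \<in> A \<Longrightarrow> lt R x y \<longleftrightarrow> lt R' x y"
  shows "well_ord A R'"
  by (rule isomorphic_well_ord[OF isomorphic_sym[OF isomorphic_agree] assms(1)]) (rule assms(2))

lemma well_ord_union:
  assumes A: "well_ord A R" and B: "well_ord B R" and lin: "lin_ord (union A B) R"
    and below: "\<And>a b. a \<in> A \<Longrightarrow> b \<in> B \<Longrightarrow> lt R a b"
  shows "well_ord (union A B) R"
  unfolding well_ord_def
proof (intro conjI allI impI lin)
  fix X assume X: "X \<subseteq> union A B \<and> (\<exists>x. x \<in> X)"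
  show "\<exists>x. x \<in> X \<and> (\<forall>y. y \<in> X \<longrightarrow> y = x \<or> lt R x y)"
  proof (cases "\<exists>x. x \<in> X \<and> x \<in> A")
    case True
    then obtain x where "x \<in> X" "x \<in> A" by blast
    then obtain m where "m \<in> A" "m \<in> X" "\<And>y. y \<in> A \<Longrightarrow> y \<in> X \<Longrightarrow> y = m \<or> lt R m y"
      using well_ord_least[OF A, of x "\<lambda>x. x \<in> X"] by auto
    thus ?thesis using X below unfolding subset_def by (metis mem_union)
  next
    case False
    hence in_B: "y \<in> B" if "y \<in> X" for y using X that unfolding subset_def by auto
    obtain x where "x \<in> X" using X by blast
    then obtain m where "m \<in> X" "\<And>y. y \<in> B \<Longrightarrow> y \<in> X \<Longrightarrow> y = m \<or> lt R m y"
      using well_ord_least[OF B in_B, of x "\<lambda>x. x \<in> X"] by auto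
    thus ?thesis using in_B by blast
  qed
qed

text \<open>Agrees with \<open>otype\<close> on well-orders and is definable everywhere.\<close>

definition ordertype :: "'a \<Rightarrow> 'a \<Rightarrow> 'a" where
  "ordertype A R = desc (\<lambda>a. ordinal a \<and> isomorphic A R a (memrel a))"

lemma definable_fn_ordertype [definable, simp]:
  "definable_fn A \<Longrightarrow> definable_fn R \<Longrightarrow> definable_fn (\<lambda>v. ordertype (A v) (R v))"
  by (rule definable_fn_app2[of ordertype]) (unfold ordertype_def, intro definable)

lemma isomorphic_ordinals_subset:
  assumes a: "ordinal a" and b: "ordinal b" and iso: "isomorphic a (memrel a) b (memrel b)"
  shows "a \<subseteq> b"
proof (rule subsetI)
  obtain f where f: "order_iso f a (memrel a) b (memrel b)" using iso isomorphic_iff by blast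
  note f_mem = order_iso_mem[OF f]
  have inc: "ap f x \<in> ap f y" if "y \<in> a" "x \<in> y" for x y
    using order_iso_less_iff[OF f] that ord_trans[OF a] by (metis mem_memrel)
  fix x assume x: "x \<in> a"
  have "x \<subseteq> ap f x"
    by (rule increasing_ge[OF a x]) (use inc f_mem ord_mem[OF b] in auto)
  thus "x \<in> b" by (rule ord_le_lt[OF ord_mem[OF a x] ord_mem[OF b f_mem[OF x]] b _ f_mem[OF x]])
qed

lemma ordertype_eq:
  assumes "ordinal a" "isomorphic A R a (memrel a)"
  shows "ordertype A R = a" and "otype A R = a"
proof -
  have unique: "b = a" if "ordinal b \<and> isomorphic A R b (memrel b)" for b
    using that assms isomorphic_ordinals_subset isomorphic_sym isomorphic_trans subset_antisym by metis
  show "ordertype A R = a" unfolding ordertype_def by (rule desc_eq) (use assms unique in blast)+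
  show "otype A R = a" unfolding otype_def by (rule the_equality) (use assms unique in blast)+
qed

definition pred :: "'a \<Rightarrow> 'a \<Rightarrow> 'a \<Rightarrow> 'a" where
  "pred A R x = sep A (\<lambda>y. lt R y x)"

lemma mem_pred [simp]: "y \<in> pred A R x \<longleftrightarrow> y \<in> A \<and> lt R y x"
  unfolding pred_def by simp

lemma pred_subset: "pred A R x \<subseteq> A"
  by (simp add: subset_def)

lemma definable_fn_pred [definable, simp]:
  "\<lbrakk>definable_fn A; definable_fn R; definable_fn x\<rbrakk> \<Longrightarrow> definable_fn (\<lambda>v. pred (A v) (R v) (x v))"
  by (rule definable_fn_app3[of pred]) (unfold pred_def, intro definable)

definition ordermap :: "'a \<Rightarrow> 'a \<Rightarrow> 'a \<Rightarrow> 'a" where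
  "ordermap A R x = ordertype (pred A R x) R"

definition nth_elt :: "'a \<Rightarrow> 'a \<Rightarrow> 'a \<Rightarrow> 'a" where
  "nth_elt A R z = inv_on A (ordermap A R) z"

lemma definable_fn_ordermap [definable, simp]:
  "\<lbrakk>definable_fn A; definable_fn R; definable_fn x\<rbrakk> \<Longrightarrow> definable_fn (\<lambda>v. ordermap (A v) (R v) (x v))"
  by (rule definable_fn_app3[of ordermap]) (unfold ordermap_def, intro definable)

lemma definable_fn_nth_elt [definable, simp]:
  "\<lbrakk>definable_fn A; definable_fn R; definable_fn z\<rbrakk> \<Longrightarrow> definable_fn (\<lambda>v. nth_elt (A v) (R v) (z v))"
  by (rule definable_fn_app3[of nth_elt]) (unfold nth_elt_def, intro definable)

lemma ordermap_eq_iso: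
  assumes f: "order_iso f A R a (memrel a)" and a: "ordinal a" and x: "x \<in> A"
  shows "ordermap A R x = ap f x"
proof -
  have less_iff: "lt R y z \<longleftrightarrow> ap f y \<in> ap f z" if "y \<in> A" "z \<in> A" for y z
    using order_iso_less_iff[OF f that] order_iso_mem[OF f] that by auto
  have fx: "ap f x \<in> a" by (rule order_iso_mem[OF f x])
  have "bij_betw (ap f) (elts (pred A R x)) (elts (ap f x))"
  proof (rule bij_eltsI)
    fix z assume z: "z \<in> ap f x"
    then obtain y where "y \<in> A" "ap f y = z" using order_iso_surj[OF f] ord_trans[OF a _ fx] by blast
    thus "\<exists>y. y \<in> pred A R x \<and> ap f y = z" using less_iff x z by auto
  qed (use less_iff x order_iso_inj[OF f] in auto)
  hence "isomorphic (pred A R x) R (ap f x) (memrel (ap f x))"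
    by (rule isomorphicI[rotated]) (use less_iff x in auto)
  thus ?thesis unfolding ordermap_def using ordertype_eq(1) ord_mem[OF a fx] by blast
qed

lemma pred_pred: "\<lbrakk>lin_ord A R; x \<in> A; y \<in> A; lt R y x\<rbrakk> \<Longrightarrow> pred (pred A R x) R y = pred A R y"
  by (rule mem_ext) (use lin_trans[of A R _ y x] in auto)

lemma isomorphic_ordinal_if_pred:
  assumes wo: "well_ord A R"
    and preds: "\<And>x. x \<in> A \<Longrightarrow> \<exists>a. ordinal a \<and> isomorphic (pred A R x) R a (memrel a)"
  shows "\<exists>a. ordinal a \<and> isomorphic A R a (memrel a)"
proof -
  note lin = well_ord_lin[OF wo]
  have ord: "ordinal (ordermap A R x)" and less: "\<And>y. y \<in> A \<Longrightarrow> lt R y x \<Longrightarrow> ordermap A R y \<in> ordermap A R x"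
    and onto: "\<And>z. z \<in> ordermap A R x \<Longrightarrow> \<exists>y. y \<in> A \<and> ordermap A R y = z" if x: "x \<in> A" for x
  proof -
    obtain a where a: "ordinal a" and iso: "isomorphic (pred A R x) R a (memrel a)"
      using preds[OF x] by blast
    then obtain f where f: "order_iso f (pred A R x) R a (memrel a)" using isomorphic_iff by blast
    have x_eq: "ordermap A R x = a" unfolding ordermap_def by (rule ordertype_eq(1)[OF a iso])
    have y_eq: "ordermap A R y = ap f y" if "y \<in> A" "lt R y x" for y
      using ordermap_eq_iso[OF f a, of y] pred_pred[OF lin x that] that unfolding ordermap_def by simp
    show "ordinal (ordermap A R x)" unfolding x_eq by (rule a)
    show "ordermap A R y \<in> ordermap A R x" if "y \<in> A" "lt R y x" for y
      unfolding x_eq y_eq[OF that] using order_iso_mem[OF f] that by simp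
    show "\<exists>y. y \<in> A \<and> ordermap A R y = z" if z: "z \<in> ordermap A R x" for z
    proof -
      obtain y where "y \<in> pred A R x" "ap f y = z" using order_iso_surj[OF f] z unfolding x_eq by blast
      thus ?thesis using y_eq[of y] by auto
    qed
  qed
  have map: "definable_map (ordermap A R)" by (intro definable)
  define K where "K = img (ordermap A R) A"
  have K: "z \<in> K \<longleftrightarrow> (\<exists>x. x \<in> A \<and> z = ordermap A R x)" for z unfolding K_def by (rule mem_img[OF map])
  have ord_K: "ordinal K"
  proof (rule ord_memI)
    show "z \<in> K" if y: "y \<in> K" and z: "z \<in> y" for z y
    proof -
      obtain x where "x \<in> A" "z \<in> ordermap A R x" using y z unfolding K by auto
      thus ?thesis using onto[of x z] unfolding K by auto
    qed
  qed (use ord in \<open>auto simp: K\<close>)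
  have "isomorphic A R (img (ordermap A R) A) (memrel K)"
  proof (rule increasing_isomorphic_img[OF lin lin_memrel[OF ord_K] map])
    show mem: "ordermap A R x \<in> K" if "x \<in> A" for x using that unfolding K by auto
    show "lt (memrel K) (ordermap A R x) (ordermap A R y)" if "x \<in> A" "y \<in> A" "lt R x y" for x y
      using mem less that by simp
  qed
  thus ?thesis using ord_K unfolding K_def by blast
qed

lemma well_ord_isomorphic_ordinal:
  assumes wo: "well_ord A R"
  shows "\<exists>a. ordinal a \<and> isomorphic A R a (memrel a)"
proof (rule isomorphic_ordinal_if_pred[OF wo], rule ccontr)
  let ?bad = "\<lambda>x. \<not> (\<exists>a. ordinal a \<and> isomorphic (pred A R x) R a (memrel a))"
  fix x assume x: "x \<in> A" "?bad x"
  obtain m where m: "m \<in> A" "?bad m" and least: "\<And>y. y \<in> A \<Longrightarrow> ?bad y \<Longrightarrow> y = m \<or> lt R m y"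
    by (rule well_ord_least[of _ _ _ ?bad, OF wo x]) (intro definable, rule that)
  note lin = well_ord_lin[OF wo]
  have "\<exists>a. ordinal a \<and> isomorphic (pred (pred A R m) R y) R a (memrel a)" if y: "y \<in> pred A R m" for y
  proof -
    have y': "y \<in> A" "lt R y m" using y by auto
    hence "\<not> (y = m \<or> lt R m y)" using lin_irrefl[OF lin] lin_asym[OF lin] m(1) by blast
    thus ?thesis unfolding pred_pred[OF lin m(1) y'] using least[OF y'(1)] by blast
  qed
  hence "\<exists>a. ordinal a \<and> isomorphic (pred A R m) R a (memrel a)"
    by (rule isomorphic_ordinal_if_pred[OF well_ord_subset[OF wo pred_subset]])
  thus False using m(2) by blast
qed

lemma ordertype:
  assumes "well_ord A R"
  shows ord_ordertype: "ordinal (ordertype A R)"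
    and isomorphic_ordertype: "isomorphic A R (ordertype A R) (memrel (ordertype A R))"
    and otype_eq_ordertype: "otype A R = ordertype A R"
  using well_ord_isomorphic_ordinal[OF assms] ordertype_eq by metis+

lemma ordertype_eq_iff:
  assumes "well_ord A R" "well_ord B S"
  shows "isomorphic A R B S \<longleftrightarrow> ordertype A R = ordertype B S"
  using ordertype[OF assms(1)] ordertype[OF assms(2)] ordertype_eq(1) isomorphic_sym isomorphic_trans by metis

lemma ordertype_agree:
  assumes "well_ord A R" "\<And>x y. x \<in> A \<Longrightarrow> y \<in> A \<Longrightarrow> lt R x y \<longleftrightarrow> lt R' x y"
  shows "ordertype A R = ordertype A R'"
  using ordertype_eq_iff[OF assms(1) well_ord_agree[OF assms]] isomorphic_agree[OF assms(2)] by blast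

lemma ordermap:
  assumes "well_ord A R"
  shows ordermap_bij: "bij_betw (ordermap A R) (elts A) (elts (ordertype A R))"
    and ordermap_iff: "\<And>x y. x \<in> A \<Longrightarrow> y \<in> A \<Longrightarrow> lt R x y \<longleftrightarrow> ordermap A R x \<in> ordermap A R y"
    and ordermap_mem: "\<And>x. x \<in> A \<Longrightarrow> ordermap A R x \<in> ordertype A R"
    and ordermap_inj: "\<And>x y. \<lbrakk>x \<in> A; y \<in> A; ordermap A R x = ordermap A R y\<rbrakk> \<Longrightarrow> x = y"
    and ordermap_surj: "\<And>z. z \<in> ordertype A R \<Longrightarrow> \<exists>x. x \<in> A \<and> ordermap A R x = z"
    and ordermap_ord: "\<And>x. x \<in> A \<Longrightarrow> ordinal (ordermap A R x)"
    and nth_elt_mem: "\<And>z. z \<in> ordertype A R \<Longrightarrow> nth_elt A R z \<in> A"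
    and ordermap_nth_elt: "\<And>z. z \<in> ordertype A R \<Longrightarrow> ordermap A R (nth_elt A R z) = z"
    and nth_elt_ordermap: "\<And>x. x \<in> A \<Longrightarrow> nth_elt A R (ordermap A R x) = x"
proof -
  obtain f where f: "order_iso f A R (ordertype A R) (memrel (ordertype A R))"
    using isomorphic_ordertype[OF assms] isomorphic_iff by blast
  note eq = ordermap_eq_iso[OF f ord_ordertype[OF assms]]
  show bij: "bij_betw (ordermap A R) (elts A) (elts (ordertype A R))"
    using order_iso_bij[OF f] by (rule bij_betw_cong[THEN iffD1, rotated]) (simp add: eq)
  show "\<And>x. x \<in> A \<Longrightarrow> ordermap A R x \<in> ordertype A R"
    "\<And>x y. \<lbrakk>x \<in> A; y \<in> A; ordermap A R x = ordermap A R y\<rbrakk> \<Longrightarrow> x = y"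
    "\<And>z. z \<in> ordertype A R \<Longrightarrow> \<exists>x. x \<in> A \<and> ordermap A R x = z"
    "\<And>z. z \<in> ordertype A R \<Longrightarrow> nth_elt A R z \<in> A"
    "\<And>z. z \<in> ordertype A R \<Longrightarrow> ordermap A R (nth_elt A R z) = z"
    "\<And>x. x \<in> A \<Longrightarrow> nth_elt A R (ordermap A R x) = x"
    unfolding nth_elt_def by (fact bij_eltsD[OF bij] bij_betw_inv_on[OF bij])+
  show "\<And>x y. x \<in> A \<Longrightarrow> y \<in> A \<Longrightarrow> lt R x y \<longleftrightarrow> ordermap A R x \<in> ordermap A R y"
    using order_iso_less_iff[OF f] order_iso_mem[OF f] by (simp add: eq)
  show "\<And>x. x \<in> A \<Longrightarrow> ordinal (ordermap A R x)"
    using bij_elts_mem[OF bij] ord_ordertype[OF assms] ord_mem by blast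
qed

lemma equipotent_ordertype: "well_ord A R \<Longrightarrow> equipotent A (ordertype A R)"
  by (rule equipotentI[OF _ ordermap_bij]) simp

lemma ordermap_iso:
  assumes A: "well_ord A R" and G: "definable_map G" and bij: "bij_betw G (elts A) (elts B)"
    and less_iff: "\<And>x y. x \<in> A \<Longrightarrow> y \<in> A \<Longrightarrow> lt R x y \<longleftrightarrow> lt S (G x) (G y)" and x: "x \<in> A"
  shows "ordermap B S (G x) = ordermap A R x"
proof -
  have B: "well_ord B S"
    by (rule isomorphic_well_ord[OF isomorphic_sym[OF isomorphicI[OF G bij less_iff]] A])
  have "isomorphic (pred A R x) R (pred B S (G x)) S"
  proof (rule isomorphicI[OF G])
    show "bij_betw G (elts (pred A R x)) (elts (pred B S (G x)))"
    proof (rule bij_eltsI)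
      show "\<exists>y. y \<in> pred A R x \<and> G y = z" if "z \<in> pred B S (G x)" for z
        using bij_elts_surj[OF bij, of z] less_iff x that by auto
    qed (use bij_eltsD(1,2)[OF bij] less_iff x in auto)
    show "lt R y z \<longleftrightarrow> lt S (G y) (G z)" if "y \<in> pred A R x" "z \<in> pred A R x" for y z
      using less_iff that by simp
  qed
  thus ?thesis unfolding ordermap_def
    using ordertype_eq_iff[OF well_ord_subset[OF A pred_subset] well_ord_subset[OF B pred_subset]] by metis
qed

lemma nth_elt_iso:
  assumes A: "well_ord A R" and G: "definable_map G" and bij: "bij_betw G (elts A) (elts B)"
    and less_iff: "\<And>x y. x \<in> A \<Longrightarrow> y \<in> A \<Longrightarrow> lt R x y \<longleftrightarrow> lt S (G x) (G y)" and x: "x \<in> A"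
  shows "nth_elt B S (ordermap A R x) = G x"
proof -
  have "well_ord B S"
    by (rule isomorphic_well_ord[OF isomorphic_sym[OF isomorphicI[OF G bij less_iff]] A])
  moreover have "ordermap B S (G x) = ordermap A R x" by (rule ordermap_iso[OF assms])
  ultimately show ?thesis using nth_elt_ordermap[of B S "G x"] bij_elts_mem[OF bij x] by simp
qed

context
  fixes A R B S :: 'a and F :: "'a \<Rightarrow> 'a"
  assumes A: "well_ord A R" and B: "well_ord B S" and F: "definable_map F"
    and F_mem: "\<And>x. x \<in> A \<Longrightarrow> F x \<in> B"
    and F_less: "\<And>x y. \<lbrakk>x \<in> A; y \<in> A; lt R x y\<rbrakk> \<Longrightarrow> lt S (F x) (F y)"
begin

lemma ordermap_le:
  assumes x: "x \<in> A"
  shows "ordermap A R x \<subseteq> ordermap B S (F x)"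
proof -
  define G where "G z = ordermap B S (F (nth_elt A R z))" for z
  have G: "definable_map G" unfolding G_def
    by (intro definable_fn_ordermap definable_fn_const definable_fn_app1[OF F] definable_fn_nth_elt definable_fn_var)
  note nth = nth_elt_mem[OF A] ordermap_nth_elt[OF A]
  have "ordermap A R x \<subseteq> G (ordermap A R x)"
  proof (rule increasing_ge[OF ord_ordertype[OF A] ordermap_mem[OF A x] G])
    fix z w assume w: "w \<in> ordertype A R" and z: "z \<in> w"
    hence z': "z \<in> ordertype A R" using ord_trans[OF ord_ordertype[OF A]] by blast
    have "lt R (nth_elt A R z) (nth_elt A R w)" using ordermap_iff[OF A] nth w z z' by simp
    thus "G z \<in> G w" unfolding G_def using ordermap_iff[OF B F_mem F_mem] F_less nth w z' by blast
  qed (use ordermap_ord[OF B F_mem] nth in \<open>simp add: G_def\<close>)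
  thus ?thesis unfolding G_def nth_elt_ordermap[OF A x] .
qed

lemma ordertype_le: "ordertype A R \<subseteq> ordertype B S"
proof (rule subsetI)
  fix z assume "z \<in> ordertype A R"
  then obtain x where x: "x \<in> A" "ordermap A R x = z" using ordermap_surj[OF A] by blast
  have "z \<subseteq> ordermap B S (F x)" using ordermap_le x by blast
  thus "z \<in> ordertype B S"
    using ord_le_lt ordermap_ord[OF A x(1)] x ordermap_ord[OF B F_mem] ord_ordertype[OF B] ordermap_mem[OF B F_mem]
    by metis
qed

lemma ordertype_less:
  assumes b: "b \<in> B" "\<And>x. x \<in> A \<Longrightarrow> lt S (F x) b"
  shows "ordertype A R \<in> ordertype B S"
proof -
  have "z \<in> ordermap B S b" if z: "z \<in> ordertype A R" for z
  proof -
    obtain x where x: "x \<in> A" "ordermap A R x = z" using ordermap_surj[OF A z] by blast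
    have "ordermap B S (F x) \<in> ordermap B S b" using ordermap_iff[OF B F_mem[OF x(1)] b(1)] b(2) x by blast
    thus ?thesis
      using ord_le_lt ordermap_ord[OF A] x ordermap_ord[OF B F_mem] ordermap_ord[OF B b(1)] ordermap_le by metis
  qed
  hence "ordertype A R \<subseteq> ordermap B S b" by (rule subsetI)
  thus ?thesis
    using ord_le_lt ord_ordertype[OF A] ordermap_ord[OF B b(1)] ord_ordertype[OF B] ordermap_mem[OF B b(1)] by blast
qed

end

lemma well_ord_rigid:
  assumes A: "well_ord A R" and F: "definable_map F" and G: "definable_map G"
    and F_mem: "\<And>x. x \<in> A \<Longrightarrow> F x \<in> A" and G_mem: "\<And>x. x \<in> A \<Longrightarrow> G x \<in> A"
    and F_less: "\<And>x y. \<lbrakk>x \<in> A; y \<in> A; lt R x y\<rbrakk> \<Longrightarrow> lt R (F x) (F y)"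
    and G_less: "\<And>x y. \<lbrakk>x \<in> A; y \<in> A; lt R x y\<rbrakk> \<Longrightarrow> lt R (G x) (G y)"
    and x: "x \<in> A" and inverse: "G (F x) = x"
  shows "F x = x"
proof -
  have "ordermap A R x \<subseteq> ordermap A R (F x)" by (rule ordermap_le[OF A A F F_mem F_less x])
  moreover have "ordermap A R (F x) \<subseteq> ordermap A R x"
    using ordermap_le[OF A A G G_mem G_less F_mem[OF x]] unfolding inverse .
  ultimately show ?thesis using ordermap_inj[OF A F_mem[OF x] x] subset_antisym by blast
qed

lemma ordertype_mono: "well_ord B R \<Longrightarrow> A \<subseteq> B \<Longrightarrow> ordertype A R \<subseteq> ordertype B R"
  by (rule ordertype_le[of _ _ _ _ "\<lambda>x. x"]) (auto intro: well_ord_subset subsetD)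

lemma ordertype_ordinal: "ordinal a \<Longrightarrow> ordertype a (memrel a) = a"
  by (rule ordertype_eq(1)) (auto intro: isomorphic_refl)

lemma ordertype_subset_ordinal: "ordinal a \<Longrightarrow> B \<subseteq> a \<Longrightarrow> ordertype B (memrel a) \<subseteq> a"
  using ordertype_mono[OF well_ord_memrel] ordertype_ordinal by metis

subsection \<open>Finite sets\<close>

definition finite_set :: "'a \<Rightarrow> bool" where
  "finite_set A \<longleftrightarrow> (\<exists>n. n \<in> omega \<and> equipotent A n)"

definition ins :: "'a \<Rightarrow> 'a \<Rightarrow> 'a" where
  "ins x A = union A (upair x x)"

lemma mem_ins [simp]: "y \<in> ins x A \<longleftrightarrow> y = x \<or> y \<in> A"
  by (auto simp: ins_def)

lemma infinite_set_iff: "infinite_set A \<longleftrightarrow> \<not> finite_set A"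
  by (simp add: infinite_set_def finite_set_def)

lemma definable_finite_set [definable, simp]:
  "definable_fn A \<Longrightarrow> definable (\<lambda>v. finite_set (A v))"
  by (rule definable_app1[of finite_set]) (unfold finite_set_def, intro definable)

lemma equipotent_sym: "equipotent A B \<Longrightarrow> equipotent B A"
  unfolding equipotent_iff[of A B] using bij_inv_on equipotentI[of "inv_on A (ap _)"] by fastforce

lemma equipotent_refl: "equipotent A A"
  by (rule equipotentI[of "\<lambda>x. x"]) (auto simp: bij_betw_def)

lemma equipotent_trans: "equipotent A B \<Longrightarrow> equipotent B C \<Longrightarrow> equipotent A C"
  unfolding equipotent_iff[of A B] equipotent_iff[of B C]
proof (elim exE conjE)
  fix f g assume "bij_betw (ap f) (elts A) (elts B)" "bij_betw (ap g) (elts B) (elts C)"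
  hence "bij_betw (\<lambda>x. ap g (ap f x)) (elts A) (elts C)" using bij_betw_trans by (fastforce simp: comp_def)
  thus ?thesis by (rule equipotentI[rotated]) simp
qed

lemma fin_cong: "equipotent A B \<Longrightarrow> finite_set A \<longleftrightarrow> finite_set B"
  unfolding finite_set_def using equipotent_sym equipotent_trans by blast

lemma fin_omega_mem: "n \<in> omega \<Longrightarrow> finite_set n"
  unfolding finite_set_def using equipotent_refl by blast

lemma fin_zero [simp]: "finite_set zero"
  by (simp add: fin_omega_mem)

lemma fin_ins [simp]:
  assumes "finite_set A" shows "finite_set (ins x A)"
proof (cases "x \<in> A")
  case True
  hence "ins x A = A" by (intro mem_ext) auto
  thus ?thesis using assms by simp
next
  case False
  obtain n f where n: "n \<in> omega" and f: "bij_betw (ap f) (elts A) (elts n)"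
    using assms unfolding finite_set_def equipotent_iff by blast
  let ?g = "\<lambda>y. if y = x then n else ap f y"
  have "ap f y \<in> n \<and> ap f y \<noteq> n" if "y \<in> A" for y using bij_elts_mem[OF f that] by auto
  hence "bij_betw ?g (elts (ins x A)) (elts (succ n))"
    using False bij_elts_inj[OF f] bij_elts_surj[OF f] by (intro bij_eltsI) (auto split: if_splits; metis)+
  hence "equipotent (ins x A) (succ n)" by (rule equipotentI[rotated]) simp
  thus ?thesis unfolding finite_set_def using n succ_omega by blast
qed

lemma equipotent_succE:
  assumes "equipotent A (succ n)"
  obtains x B where "A = ins x B" "\<not> x \<in> B" "equipotent B n"
proof -
  obtain f where f: "bij_betw (ap f) (elts A) (elts (succ n))" using assms unfolding equipotent_iff by blast
  obtain x where x: "x \<in> A" "ap f x = n" using bij_elts_surj[OF f, of n] by auto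
  define B where "B = sep A (\<lambda>y. y \<noteq> x)"
  have B: "y \<in> B \<longleftrightarrow> y \<in> A \<and> y \<noteq> x" for y unfolding B_def by simp
  have "bij_betw (ap f) (elts B) (elts n)"
  proof (rule bij_eltsI)
    show "ap f y \<in> n" if "y \<in> B" for y
      using bij_elts_mem[OF f, of y] bij_elts_inj[OF f, of y x] that x B by auto
    show "\<exists>y. y \<in> B \<and> ap f y = z" if "z \<in> n" for z
      using bij_elts_surj[OF f, of z] that x B by (metis mem_irrefl mem_succ)
  qed (use bij_elts_inj[OF f] B in blast)
  hence "equipotent B n" by (rule equipotentI[rotated]) simp
  moreover have "A = ins x B" by (rule mem_ext) (auto simp: B x)
  ultimately show ?thesis using that B by blast
qed

lemma fin_induct [consumes 1, case_names defn empty ins]: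
  assumes "finite_set A" and P: "definable (\<lambda>v. P (v 0))" and empty: "P zero"
    and ins: "\<And>A x. \<lbrakk>finite_set A; P A; \<not> x \<in> A\<rbrakk> \<Longrightarrow> P (ins x A)"
  shows "P A"
proof -
  have "\<forall>A. equipotent A n \<longrightarrow> P A" if "n \<in> omega" for n
    using that
  proof (induction rule: omega_induct)
    case defn show ?case by (intro definable definable_app1[OF P])
  next
    case zero
    have "A = zero" if "equipotent A zero" for A
      using that unfolding equipotent_iff bij_elts_iff by (intro mem_ext) auto
    thus ?case using empty by blast
  next
    case (succ n)
    show ?case
    proof (intro allI impI)
      fix A assume "equipotent A (succ n)"
      then obtain x B where "A = ins x B" "\<not> x \<in> B" "equipotent B n" by (rule equipotent_succE)
      thus "P A" using ins succ unfolding finite_set_def by blast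
    qed
  qed
  thus ?thesis using assms(1) unfolding finite_set_def by blast
qed

lemma fin_subset: "finite_set A \<Longrightarrow> B \<subseteq> A \<Longrightarrow> finite_set B"
proof -
  assume A: "finite_set A" and B: "B \<subseteq> A"
  from A have "\<forall>B. B \<subseteq> A \<longrightarrow> finite_set B"
  proof (induction rule: fin_induct)
    case empty
    have "B = zero" if "B \<subseteq> zero" for B by (rule mem_ext) (use that in \<open>auto simp: subset_def\<close>)
    thus ?case using fin_zero by metis
  next
    case (ins A x)
    show ?case
    proof (intro allI impI)
      fix B assume B: "B \<subseteq> ins x A"
      define C where "C = sep B (\<lambda>y. y \<noteq> x)"
      have C: "y \<in> C \<longleftrightarrow> y \<in> B \<and> y \<noteq> x" for y unfolding C_def by simp
      have "C \<subseteq> A" using B by (auto simp: subset_def C)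
      hence "finite_set C" using ins by blast
      moreover have "B = C \<or> B = ins x C" by (metis C mem_ins mem_ext)
      ultimately show "finite_set B" by auto
    qed
  qed simp
  thus ?thesis using B by blast
qed

lemma fin_union: "finite_set A \<Longrightarrow> finite_set B \<Longrightarrow> finite_set (union A B)"
proof (induction rule: fin_induct)
  case empty
  have "union zero B = B" by (rule mem_ext) auto
  thus ?case using empty by simp
next
  case (ins A x)
  have "union (ins x A) B = ins x (union A B)" by (rule mem_ext) auto
  thus ?case using ins by simp
qed simp

lemma fin_img:
  assumes "finite_set A" and F: "definable_map F"
  shows "finite_set (img F A)"
  using assms(1)
proof (induction rule: fin_induct)
  case defn
  show ?case by (intro definable definable_fn_app1[OF F])
next
  case empty
  have "img F zero = zero" using F by (intro mem_ext) auto
  thus ?case by simp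
next
  case (ins A x)
  have "img F (ins x A) = ins (F x) (img F A)" using F by (intro mem_ext) auto
  thus ?case using ins by simp
qed

lemma fin_big_union: "finite_set A \<Longrightarrow> (\<And>x. x \<in> A \<Longrightarrow> finite_set x) \<Longrightarrow> finite_set (big_union A)"
proof -
  assume A: "finite_set A" and members: "\<And>x. x \<in> A \<Longrightarrow> finite_set x"
  from A have "(\<forall>x. x \<in> A \<longrightarrow> finite_set x) \<longrightarrow> finite_set (big_union A)"
  proof (induction rule: fin_induct)
    case empty
    have "big_union zero = zero" by (rule mem_ext) auto
    thus ?case by simp
  next
    case (ins A x)
    have "big_union (ins x A) = union x (big_union A)" by (rule mem_ext) auto
    thus ?case using ins fin_union by simp
  qed simp
  thus ?thesis using members by blast
qed

lemma fin_big_union_img: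
  assumes "finite_set A" and F: "definable_map F" and "\<And>x. x \<in> A \<Longrightarrow> finite_set (F x)"
  shows "finite_set (big_union (img F A))"
  by (rule fin_big_union[OF fin_img[OF assms(1,2)]]) (use assms(3) in \<open>auto simp: mem_img[OF F]\<close>)

lemma fin_uniform_bound:
  assumes k: "ordinal k" "zero \<in> k" and B: "definable (\<lambda>v. B (v 0) (v 1))"
    and mono: "\<And>x b c. B x b \<Longrightarrow> b \<subseteq> c \<Longrightarrow> B x c"
    and X: "finite_set X" and bounds: "\<And>x. x \<in> X \<Longrightarrow> \<exists>b. b \<in> k \<and> B x b"
  obtains b where "b \<in> k" "\<And>x. x \<in> X \<Longrightarrow> B x b"
proof -
  from X have "(\<forall>x. x \<in> X \<longrightarrow> (\<exists>b. b \<in> k \<and> B x b)) \<longrightarrow> (\<exists>b. b \<in> k \<and> (\<forall>x. x \<in> X \<longrightarrow> B x b))"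
  proof (induction rule: fin_induct)
    case defn
    show ?case by (intro definable definable_app2[OF B])
  next
    case (ins A x)
    have "\<exists>b. b \<in> k \<and> (\<forall>y. y \<in> ins x A \<longrightarrow> B y b)" if bounded: "\<forall>y. y \<in> ins x A \<longrightarrow> (\<exists>b. b \<in> k \<and> B y b)"
    proof -
      have "\<forall>y. y \<in> A \<longrightarrow> (\<exists>b. b \<in> k \<and> B y b)" using bounded by simp
      then obtain a where a: "a \<in> k" "\<And>y. y \<in> A \<Longrightarrow> B y a" using ins.IH by blast
      obtain b where b: "b \<in> k" "B x b" using bounded by auto
      have "a \<subseteq> b \<or> b \<subseteq> a" using ord_linear ord_mem_subset ord_mem[OF k(1)] a(1) b(1) subset_refl by metis
      thus ?thesis using a b mono by (metis mem_ins)
    qed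
    thus ?case by blast
  qed (use k in auto)
  thus ?thesis using that bounds by blast
qed

definition inj_self_map :: "'a \<Rightarrow> 'a \<Rightarrow> bool" where
  "inj_self_map f A \<longleftrightarrow> (\<forall>x. x \<in> A \<longrightarrow> ap f x \<in> A) \<and> (\<forall>x y. x \<in> A \<and> y \<in> A \<and> ap f x = ap f y \<longrightarrow> x = y)"

lemma inj_self_mapD:
  assumes "inj_self_map f A"
  shows inj_self_map_mem: "x \<in> A \<Longrightarrow> ap f x \<in> A"
    and inj_self_map_inj: "\<lbrakk>x \<in> A; y \<in> A; ap f x = ap f y\<rbrakk> \<Longrightarrow> x = y"
  using assms unfolding inj_self_map_def by blast+

lemma inj_self_map_insE:
  assumes f: "inj_self_map f (ins a A)" and a: "\<not> a \<in> A"
  obtains g where "inj_self_map g A" "\<And>x. x \<in> A \<Longrightarrow> ap g x = (if ap f x = a then ap f a else ap f x)"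
proof -
  define g where "g = lam A (\<lambda>x. if ap f x = a then ap f a else ap f x)"
  have g: "ap g x = (if ap f x = a then ap f a else ap f x)" if "x \<in> A" for x
    unfolding g_def using that by simp
  have mem: "ap f x \<in> A \<or> ap f x = a" if "x \<in> A \<or> x = a" for x
    using inj_self_map_mem[OF f, of x] that by auto
  have inj: "x = y" if "x \<in> A \<or> x = a" "y \<in> A \<or> y = a" "ap f x = ap f y" for x y
    using inj_self_map_inj[OF f, of x y] that by auto
  have "inj_self_map g A" unfolding inj_self_map_def
  proof (intro conjI allI impI)
    show "ap g x \<in> A" if "x \<in> A" for x using that g mem inj a by metis
    show "x = y" if "x \<in> A \<and> y \<in> A \<and> ap g x = ap g y" for x y using that g inj a by (metis (full_types))
  qed
  thus ?thesis using that g by blast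
qed

lemma fin_inj_self_map_surj:
  assumes "finite_set A"
  shows "\<forall>f y. inj_self_map f A \<and> y \<in> A \<longrightarrow> (\<exists>x. x \<in> A \<and> ap f x = y)"
  using assms
proof (induction rule: fin_induct)
  case defn
  show ?case unfolding inj_self_map_def by simp
next
  case (ins A a)
  have "\<exists>x. x \<in> ins a A \<and> ap f x = y" if f: "inj_self_map f (ins a A)" and y: "y \<in> ins a A" for f y
  proof -
    obtain g where g: "inj_self_map g A" "\<And>x. x \<in> A \<Longrightarrow> ap g x = (if ap f x = a then ap f a else ap f x)"
      using inj_self_map_insE[OF f ins.hyps(2)] by blast
    have surj: "\<exists>x. x \<in> A \<and> ap g x = z" if "z \<in> A" for z using ins.IH g(1) that by blast
    consider (old) "y \<in> A" | (fixed) "y = a" "ap f a = a" | (moved) "y = a" "ap f a \<in> A"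
      using y inj_self_map_mem[OF f, of a] by auto
    thus ?thesis
    proof cases
      case old
      thus ?thesis using surj g(2) by (metis mem_ins)
    next
      case moved
      then obtain x where "x \<in> A" "ap g x = ap f a" using surj by blast
      moreover have "ap f x \<noteq> ap f a"
        using inj_self_map_inj[OF f, of x a] \<open>x \<in> A\<close> ins.hyps(2) by auto
      ultimately show ?thesis using g(2) moved by (metis mem_ins)
    qed auto
  qed
  thus ?case by blast
qed simp

lemma fin_inj_surj:
  assumes A: "finite_set A" and F: "definable_map F" and F_mem: "\<And>x. x \<in> A \<Longrightarrow> F x \<in> A"
    and inj: "\<And>x y. \<lbrakk>x \<in> A; y \<in> A; F x = F y\<rbrakk> \<Longrightarrow> x = y" and y: "y \<in> A"
  shows "\<exists>x. x \<in> A \<and> F x = y"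
proof -
  have eq: "ap (lam A F) x = F x" if "x \<in> A" for x using F that by (rule ap_lam)
  have "inj_self_map (lam A F) A" unfolding inj_self_map_def using F_mem inj eq by metis
  then obtain x where "x \<in> A" "ap (lam A F) x = y" using fin_inj_self_map_surj[OF A] y by blast
  thus ?thesis using eq by metis
qed

lemma not_fin_omega: "\<not> finite_set omega"
proof
  assume "finite_set omega"
  from fin_inj_surj[OF this, of succ zero] show False by simp
qed

lemma fin_ordinal: "ordinal a \<Longrightarrow> finite_set a \<longleftrightarrow> a \<in> omega"
  using fin_omega_mem not_fin_omega fin_subset ord_not_mem[of a omega] by auto

lemma omega_subset_iff: "ordinal a \<Longrightarrow> omega \<subseteq> a \<longleftrightarrow> \<not> finite_set a"
  using fin_ordinal ord_not_mem[of a omega] by simp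

lemma fin_least:
  assumes "finite_set X"
  shows "lin_ord X R \<and> (\<exists>x. x \<in> X) \<longrightarrow> (\<exists>x. x \<in> X \<and> (\<forall>y. y \<in> X \<longrightarrow> y = x \<or> lt R x y))"
  using assms
proof (induction rule: fin_induct)
  case (ins X x)
  have "\<exists>z. z \<in> ins x X \<and> (\<forall>y. y \<in> ins x X \<longrightarrow> y = z \<or> lt R z y)" if lin: "lin_ord (ins x X) R"
  proof (cases "\<exists>z. z \<in> X")
    case True
    have "lin_ord X R" by (rule lin_subset[OF lin]) (simp add: subset_def)
    then obtain m where m: "m \<in> X" "\<forall>y. y \<in> X \<longrightarrow> y = m \<or> lt R m y" using ins True by blast
    have x: "lt R x y" if "lt R x m" "y \<in> X" for y
      using m that lin_trans[OF lin, of x m y] by auto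
    have "lt R x m \<or> x = m \<or> lt R m x" using lin_total[OF lin, of x m] m by auto
    thus ?thesis using m x by (metis mem_ins)
  qed auto
  thus ?case by blast
qed auto

lemma fin_lin_well_ord:
  assumes "finite_set A" "lin_ord A R"
  shows "well_ord A R"
  unfolding well_ord_def using fin_least fin_subset lin_subset assms by blast

lemma fin_max:
  assumes X: "finite_set X" "x \<in> X" and g: "definable_map g" and ord: "\<And>x. x \<in> X \<Longrightarrow> ordinal (g x)"
  obtains m where "m \<in> X" "\<And>y. y \<in> X \<Longrightarrow> g y \<subseteq> g m"
proof -
  define K where "K = img g X"
  have K: "z \<in> K \<longleftrightarrow> (\<exists>y. y \<in> X \<and> z = g y)" for z unfolding K_def by (rule mem_img[OF g])
  define Q where "Q = sep (times K K) (\<lambda>p. psnd p \<in> pfst p)"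
  have Q: "lt Q a b \<longleftrightarrow> a \<in> K \<and> b \<in> K \<and> b \<in> a" for a b unfolding Q_def by simp
  have ord_K: "ordinal a" if "a \<in> K" for a using that ord unfolding K by auto
  have "lin_ord K Q" unfolding lin_ord_def
  proof (intro conjI allI impI)
    show "lt Q x z" if "x \<in> K \<and> y \<in> K \<and> z \<in> K \<and> lt Q x y \<and> lt Q y z" for x y z
      using that ord_trans[OF ord_K] unfolding Q by blast
  qed (use ord_linear ord_K Q in auto)
  moreover have "finite_set K" unfolding K_def by (rule fin_img[OF X(1) g])
  ultimately obtain a where a: "a \<in> K" "\<And>b. b \<in> K \<Longrightarrow> b = a \<or> b \<in> a"
    using fin_least[of K Q] X(2) unfolding Q K by auto
  then obtain m where m: "m \<in> X" "a = g m" unfolding K by auto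
  have "g y \<subseteq> g m" if "y \<in> X" for y
  proof -
    have "g y = g m \<or> g y \<in> g m" using a(2)[of "g y"] that m(2) unfolding K by blast
    thus ?thesis using ord_mem_subset[OF ord[OF m(1)]] by auto
  qed
  thus ?thesis using that m(1) by blast
qed

lemma omega_arg_max:
  assumes n: "n \<in> omega" and P: "definable (\<lambda>v. P (v 0))" and g: "definable_map g"
    and "P x" and g_mem: "\<And>x. P x \<Longrightarrow> g x \<in> n"
  obtains m where "P m" "\<And>y. P y \<Longrightarrow> g y \<subseteq> g m"
proof -
  define X where "X = sep n (\<lambda>z. \<exists>y. P y \<and> z = g y)"
  have X: "z \<in> X \<longleftrightarrow> z \<in> n \<and> (\<exists>y. P y \<and> z = g y)" for z
    unfolding X_def by (rule mem_sep) (intro definable definable_app1[OF P] definable_fn_app1[OF g])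
  have "X \<subseteq> n" by (simp add: subset_def X)
  hence fin: "finite_set X" using fin_subset fin_omega_mem[OF n] by blast
  have "g x \<in> X" unfolding X using assms(4) g_mem by blast
  then obtain z where z: "z \<in> X" "\<And>y. y \<in> X \<Longrightarrow> y \<subseteq> z"
    by (rule fin_max[OF fin _ definable_fn_var]) (use ord_mem[OF ord_omega_mem[OF n]] X in blast)+
  then obtain m where "P m" "z = g m" unfolding X by auto
  moreover have "g y \<in> X" if "P y" for y unfolding X using g_mem that by auto
  ultimately show ?thesis using that z(2) by blast
qed

lemma fin_ordertype: "finite_set A \<Longrightarrow> well_ord A R \<Longrightarrow> ordertype A R \<in> omega"
  using fin_cong[OF equipotent_ordertype] fin_ordinal[OF ord_ordertype] by blast

end

subsection \<open>Decompositions into pieces\<close>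

context zf_model
begin

definition piece :: "'a \<Rightarrow> 'a \<Rightarrow> 'a \<Rightarrow> 'a" where
  "piece T pc t = sep T (\<lambda>s. ap pc s = ap pc t)"

definition tail :: "'a \<Rightarrow> 'a \<Rightarrow> 'a \<Rightarrow> 'a \<Rightarrow> 'a" where
  "tail T W pc t = sep T (\<lambda>s. ap pc s = ap pc t \<and> (s = t \<or> lt W t s))"

lemma mem_piece [simp]: "s \<in> piece T pc t \<longleftrightarrow> s \<in> T \<and> ap pc s = ap pc t"
  unfolding piece_def by simp

lemma mem_tail [simp]: "s \<in> tail T W pc t \<longleftrightarrow> s \<in> T \<and> ap pc s = ap pc t \<and> (s = t \<or> lt W t s)"
  unfolding tail_def by simp

lemma piece_cong: "ap pc s = ap pc t \<Longrightarrow> piece T pc s = piece T pc t"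
  unfolding piece_def by simp

lemma tail_subset_piece: "tail T W pc t \<subseteq> piece T pc t"
  by (simp add: subset_def)

lemma definable_fn_piece [definable, simp]:
  "\<lbrakk>definable_fn T; definable_fn pc; definable_fn t\<rbrakk> \<Longrightarrow> definable_fn (\<lambda>v. piece (T v) (pc v) (t v))"
  by (rule definable_fn_app3[of piece]) (unfold piece_def, intro definable)

lemma definable_fn_tail [definable, simp]:
  "\<lbrakk>definable_fn T; definable_fn W; definable_fn pc; definable_fn t\<rbrakk> \<Longrightarrow>
    definable_fn (\<lambda>v. tail (T v) (W v) (pc v) (t v))"
  by (rule definable_fn_app4[of tail]) (unfold tail_def, intro definable)

text \<open>
  On the largest size attained by the image of a violation, \<open>k\<close> restricts to an injection of a finite
  set into itself.
\<close>

lemma size_preserved: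
  fixes size :: "'a \<Rightarrow> 'a"
  assumes X: "finite_set X" and k: "definable_map k" and size: "definable_map size"
    and k_mem: "\<And>q. q \<in> X \<Longrightarrow> k q \<in> X" and ord: "\<And>q. q \<in> X \<Longrightarrow> ordinal (size q)"
    and le: "\<And>q. q \<in> X \<Longrightarrow> size q \<subseteq> size (k q)"
    and fibre: "\<And>q r. \<lbrakk>q \<in> X; r \<in> X; size q = size (k q); k r = k q\<rbrakk> \<Longrightarrow> r = q"
    and q: "q \<in> X"
  shows "size (k q) = size q"
proof (rule ccontr)
  assume ne: "size (k q) \<noteq> size q"
  have size_k: "definable_map (\<lambda>q. size (k q))" by (rule definable_fn_app1[OF size k])
  define Y where "Y = sep X (\<lambda>q. size (k q) \<noteq> size q)"
  have Y: "z \<in> Y \<longleftrightarrow> z \<in> X \<and> size (k z) \<noteq> size z" for z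
    unfolding Y_def using size_k size by (intro mem_sep) simp
  have "finite_set Y" by (rule fin_subset[OF X]) (simp add: subset_def Y)
  then obtain m where m: "m \<in> Y" "\<And>y. y \<in> Y \<Longrightarrow> size (k y) \<subseteq> size (k m)"
    by (rule fin_max[OF _ _ size_k]) (use Y ord k_mem q ne in auto)
  have mX: "m \<in> X" "size (k m) \<noteq> size m" using m Y by auto
  define Z where "Z = sep X (\<lambda>s. size s = size (k m))"
  have Z: "s \<in> Z \<longleftrightarrow> s \<in> X \<and> size s = size (k m)" for s unfolding Z_def using size by simp
  have keep: "size (k s) = size s" if s: "s \<in> Z" for s
  proof (rule ccontr)
    assume changed: "size (k s) \<noteq> size s"
    hence "size (k s) \<subseteq> size s" using m(2)[of s] Y Z s by metis
    thus False using le[of s] changed Z s subset_antisym by metis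
  qed
  have "\<exists>s. s \<in> Z \<and> k s = k m"
  proof (rule fin_inj_surj[OF _ k])
    show "finite_set Z" by (rule fin_subset[OF X]) (simp add: subset_def Z)
    show "k s \<in> Z" if "s \<in> Z" for s using keep[OF that] that Z k_mem by metis
    show "s = s'" if "s \<in> Z" "s' \<in> Z" "k s = k s'" for s s'
      using fibre[of s' s] keep[OF that(2)] that Z by metis
    show "k m \<in> Z" using Z k_mem mX by metis
  qed
  then obtain s where s: "s \<in> Z" "k s = k m" by blast
  hence "m = s" using fibre[of s m] keep[of s] Z mX by metis
  thus False using s Z mX by metis
qed

context
  fixes X Y :: 'a and h k size_X size_Y :: "'a \<Rightarrow> 'a"
  assumes X: "finite_set X" and h: "definable_map h" and k: "definable_map k" and size_X: "definable_map size_X"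
    and h_mem: "\<And>x. x \<in> X \<Longrightarrow> h x \<in> Y" and k_mem: "\<And>y. y \<in> Y \<Longrightarrow> k y \<in> X"
    and ord: "\<And>x. x \<in> X \<Longrightarrow> ordinal (size_X x)"
    and h_le: "\<And>x. x \<in> X \<Longrightarrow> size_X x \<subseteq> size_Y (h x)" and k_le: "\<And>y. y \<in> Y \<Longrightarrow> size_Y y \<subseteq> size_X (k y)"
    and h_fibre: "\<And>x z. \<lbrakk>x \<in> X; z \<in> X; size_X x = size_Y (h x); h z = h x\<rbrakk> \<Longrightarrow> z = x"
    and k_fibre: "\<And>y z. \<lbrakk>y \<in> Y; z \<in> Y; size_Y y = size_X (k y); k z = k y\<rbrakk> \<Longrightarrow> z = y"
begin

lemma cycle_fibre:
  assumes "x \<in> X" "z \<in> X" "size_X x = size_X (k (h x))" "k (h z) = k (h x)"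
  shows "z = x"
proof -
  have "size_X x = size_Y (h x)" "size_Y (h x) = size_X (k (h x))"
    using h_le k_le h_mem assms subset_antisym by metis+
  thus ?thesis using k_fibre[OF h_mem h_mem] h_fibre assms by metis
qed

lemma cycle_definable: "definable_map (\<lambda>x. k (h x))"
  by (rule definable_fn_app1[OF k h])

lemma cycle_size:
  assumes "x \<in> X" shows "size_X (k (h x)) = size_X x" and "size_Y (h x) = size_X x"
proof -
  show "size_X (k (h x)) = size_X x"
    by (rule size_preserved[OF X cycle_definable size_X _ ord _ cycle_fibre assms])
      (use h_mem k_mem h_le k_le subset_trans in blast)+
  thus "size_Y (h x) = size_X x" using h_le k_le h_mem assms subset_antisym by metis
qed

lemma cycle_inj: "\<lbrakk>x \<in> X; z \<in> X; h z = h x\<rbrakk> \<Longrightarrow> z = x"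
  using h_fibre cycle_size(2) by metis

lemma cycle_surj:
  assumes y: "y \<in> Y" shows "\<exists>x. x \<in> X \<and> h x = y"
proof -
  have "\<exists>x. x \<in> X \<and> k (h x) = k y"
    by (rule fin_inj_surj[OF X cycle_definable]) (use h_mem k_mem y cycle_fibre cycle_size in metis)+
  then obtain x where x: "x \<in> X" "k (h x) = k y" by blast
  hence "y = h x" using k_fibre[OF h_mem[OF x(1)] y] cycle_size by metis
  thus ?thesis using x(1) by blast
qed

lemmas increasing_cycle = cycle_size(2) cycle_inj cycle_surj

end

end

text \<open>
  \<open>pc\<close> numbers convex pieces of \<open>R\<close>. The relation \<open>W\<close> matters only inside the pieces, where \<open>d\<close> tells
  whether it is \<open>R\<close> or the converse of \<open>R\<close>.
\<close>

locale convex_pieces = zf_model +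
  fixes T R W pc N d :: 'a
  assumes lin_R: "lin_ord T R" and N_omega: "N \<in> omega"
    and pc_mem: "t \<in> T \<Longrightarrow> ap pc t \<in> N"
    and pc_less: "\<lbrakk>s \<in> T; t \<in> T; ap pc s \<in> ap pc t\<rbrakk> \<Longrightarrow> lt R s t"
    and well_ord_piece: "t \<in> T \<Longrightarrow> well_ord (piece T pc t) W"
    and dir: "\<lbrakk>s \<in> T; t \<in> T; ap pc s = ap pc t\<rbrakk> \<Longrightarrow>
      lt W s t \<longleftrightarrow> (if ap d (ap pc t) = zero then lt R s t else lt R t s)"
begin

abbreviation piece_type :: "'a \<Rightarrow> 'a" where
  "piece_type t \<equiv> ordertype (piece T pc t) W"

definition nontrivial :: "'a \<Rightarrow> bool" where
  "nontrivial t \<longleftrightarrow> (\<exists>s. s \<in> T \<and> ap pc s = ap pc t \<and> s \<noteq> t)"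

definition earlier :: "'a \<Rightarrow> 'a \<Rightarrow> bool" where
  "earlier s t \<longleftrightarrow> (if ap d (ap pc t) = zero then ap pc s \<in> ap pc t else ap pc t \<in> ap pc s)"

definition between :: "'a \<Rightarrow> 'a \<Rightarrow> 'a \<Rightarrow> bool" where
  "between s r t \<longleftrightarrow> ap pc s \<in> ap pc r \<and> ap pc r \<in> ap pc t \<or> ap pc t \<in> ap pc r \<and> ap pc r \<in> ap pc s"

lemma pc_ord: "t \<in> T \<Longrightarrow> ordinal (ap pc t)"
  using pc_mem N_omega omega_mem_mem ord_omega_mem by blast

lemma pc_cases: "s \<in> T \<Longrightarrow> t \<in> T \<Longrightarrow> ap pc s \<in> ap pc t \<or> ap pc s = ap pc t \<or> ap pc t \<in> ap pc s"
  using ord_linear pc_ord by blast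

lemma pc_le: "\<lbrakk>s \<in> T; t \<in> T; lt R s t\<rbrakk> \<Longrightarrow> ap pc s \<in> ap pc t \<or> ap pc s = ap pc t"
  using pc_cases pc_less lin_asym[OF lin_R] by blast

lemma W_lin:
  assumes t: "t \<in> T"
  shows W_irrefl: "\<not> lt W t t"
    and W_total: "\<And>s. \<lbrakk>s \<in> T; ap pc s = ap pc t; s \<noteq> t\<rbrakk> \<Longrightarrow> lt W s t \<or> lt W t s"
    and W_trans: "\<And>r s. \<lbrakk>r \<in> T; s \<in> T; ap pc r = ap pc t; ap pc s = ap pc t;
      lt W r s; lt W s t\<rbrakk> \<Longrightarrow> lt W r t"
proof -
  note lin = well_ord_lin[OF well_ord_piece[OF t]]
  show "\<not> lt W t t" using lin_irrefl[OF lin, of t] t by simp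
  show "\<And>s. \<lbrakk>s \<in> T; ap pc s = ap pc t; s \<noteq> t\<rbrakk> \<Longrightarrow> lt W s t \<or> lt W t s"
    using lin_total[OF lin, of _ t] t by simp
  show "\<And>r s. \<lbrakk>r \<in> T; s \<in> T; ap pc r = ap pc t; ap pc s = ap pc t;
      lt W r s; lt W s t\<rbrakk> \<Longrightarrow> lt W r t"
    using lin_trans[OF lin, of _ _ t] t by simp
qed

lemma dir_R:
  assumes "s \<in> T" "t \<in> T" "ap pc s = ap pc t"
  shows "lt R s t \<longleftrightarrow> (if ap d (ap pc t) = zero then lt W s t else lt W t s)"
  using dir[OF assms] dir[OF assms(2,1) assms(3)[symmetric]] assms(3) by simp

lemma well_ord_tail: "t \<in> T \<Longrightarrow> well_ord (tail T W pc t) W"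
  using well_ord_subset[OF well_ord_piece tail_subset_piece] .

lemma tail_refl: "t \<in> T \<Longrightarrow> t \<in> tail T W pc t"
  by simp

lemma tail_trans: "\<lbrakk>t \<in> T; s \<in> tail T W pc t; r \<in> tail T W pc s\<rbrakk> \<Longrightarrow> r \<in> tail T W pc t"
  using W_trans[of r t s] unfolding mem_tail by metis

lemma tail_or: "\<lbrakk>s \<in> T; t \<in> T; ap pc s = ap pc t\<rbrakk> \<Longrightarrow> s \<in> tail T W pc t \<or> t \<in> tail T W pc s"
  using W_total[of t s] unfolding mem_tail by metis

lemma ord_piece_type: "t \<in> T \<Longrightarrow> ordinal (piece_type t)"
  using ord_ordertype well_ord_piece by blast

lemma nontrivial_cong: "\<lbrakk>t \<in> T; s \<in> T; ap pc s = ap pc t\<rbrakk> \<Longrightarrow> nontrivial s \<longleftrightarrow> nontrivial t"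
  unfolding nontrivial_def by metis

lemma not_nontrivial: "\<lbrakk>t \<in> T; \<not> nontrivial t; s \<in> piece T pc t\<rbrakk> \<Longrightarrow> s = t"
  unfolding nontrivial_def by auto

lemma piecewise_mono:
  assumes G: "\<And>t. t \<in> T \<Longrightarrow> G t \<in> T" "\<And>t. t \<in> T \<Longrightarrow> ap pc (G t) = ap pc t"
    and inc: "\<And>s t. \<lbrakk>s \<in> T; t \<in> T; ap pc s = ap pc t; lt W s t\<rbrakk> \<Longrightarrow> lt W (G s) (G t)"
    and st: "s \<in> T" "t \<in> T"
  shows "lt R s t \<longleftrightarrow> lt R (G s) (G t)"
proof (rule increasing_iff(1)[OF lin_R lin_R G(1) _ st])
  show "lt R (G s) (G t)" if "s \<in> T" "t \<in> T" "lt R s t" for s t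
  proof (cases "ap pc s = ap pc t")
    case True
    thus ?thesis using that dir_R[OF that(1,2)] dir_R[of "G s" "G t"] G inc by (auto split: if_splits)
  next
    case False
    hence "ap pc s \<in> ap pc t" using pc_le that by blast
    thus ?thesis using pc_less G that by metis
  qed
qed

definition piece_set :: 'a where
  "piece_set = img (piece T pc) T"

lemma mem_piece_set: "Z \<in> piece_set \<longleftrightarrow> (\<exists>t. t \<in> T \<and> Z = piece T pc t)"
  unfolding piece_set_def by (rule mem_img) simp

lemma fin_piece_set: "finite_set piece_set"
proof -
  define g where "g q = sep T (\<lambda>s. ap pc s = q)" for q
  have g: "definable_map g" unfolding g_def by (intro definable)
  have "finite_set (img g N)" by (rule fin_img[OF fin_omega_mem[OF N_omega] g])
  moreover have "piece_set \<subseteq> img g N"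
    unfolding subset_def mem_piece_set mem_img[OF g] using pc_mem by (auto simp: g_def piece_def)
  ultimately show ?thesis by (rule fin_subset)
qed

lemma piece_set_ord: "Z \<in> piece_set \<Longrightarrow> ordinal (ordertype Z W)"
  using mem_piece_set ord_piece_type by metis

definition full :: "'a \<Rightarrow> bool" where
  "full U \<longleftrightarrow> U \<subseteq> T \<and> (\<forall>t. t \<in> T \<longrightarrow> ordertype (piece U pc t) W = piece_type t)"

definition glue :: "'a \<Rightarrow> 'a \<Rightarrow> 'a" where
  "glue U t = nth_elt (piece U pc t) W (ordermap (piece T pc t) W t)"

lemma definable_fn_glue [simp]: "definable_fn f \<Longrightarrow> definable_fn (\<lambda>v. glue U (f v))"
  by (rule definable_fn_app1[of "glue U"]) (unfold glue_def, intro definable)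

lemma full_subset: "full U \<Longrightarrow> U \<subseteq> T"
  unfolding full_def by blast

context
  fixes U :: 'a
  assumes full: "full U"
begin

lemma full_piece_subset: "piece U pc t \<subseteq> piece T pc t"
  using subsetD[OF full_subset[OF full]] by (simp add: subset_def)

lemma well_ord_full_piece: "t \<in> T \<Longrightarrow> well_ord (piece U pc t) W"
  using well_ord_subset[OF well_ord_piece full_piece_subset] .

lemma full_type: "t \<in> T \<Longrightarrow> ordertype (piece U pc t) W = piece_type t"
  using full unfolding full_def by blast

lemma glue_piece:
  assumes "t \<in> T"
  shows glue_mem_piece: "glue U t \<in> piece U pc t"
    and ordermap_glue: "ordermap (piece U pc t) W (glue U t) = ordermap (piece T pc t) W t"
proof -
  have "ordermap (piece T pc t) W t \<in> ordertype (piece U pc t) W"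
    using ordermap_mem[OF well_ord_piece[OF assms]] full_type assms by simp
  thus "glue U t \<in> piece U pc t" "ordermap (piece U pc t) W (glue U t) = ordermap (piece T pc t) W t"
    unfolding glue_def using nth_elt_mem ordermap_nth_elt well_ord_full_piece[OF assms] by blast+
qed

lemma glue_mem: "t \<in> T \<Longrightarrow> glue U t \<in> U" and glue_pc: "t \<in> T \<Longrightarrow> ap pc (glue U t) = ap pc t"
  using glue_mem_piece by simp_all

lemma glue_T: "t \<in> T \<Longrightarrow> glue U t \<in> T"
  using glue_mem subsetD[OF full_subset[OF full]] by blast

lemma glue_piece_iff:
  assumes st: "s \<in> T" "t \<in> T" and pc: "ap pc s = ap pc t"
  shows "lt W s t \<longleftrightarrow> lt W (glue U s) (glue U t)"
proof -
  have "lt W s t \<longleftrightarrow> ordermap (piece T pc t) W s \<in> ordermap (piece T pc t) W t"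
    by (rule ordermap_iff[OF well_ord_piece[OF st(2)]]) (use st pc in auto)
  also have "\<dots> \<longleftrightarrow> ordermap (piece U pc t) W (glue U s) \<in> ordermap (piece U pc t) W (glue U t)"
    using ordermap_glue st piece_cong[OF pc] by metis
  also have "\<dots> \<longleftrightarrow> lt W (glue U s) (glue U t)"
    using ordermap_iff[OF well_ord_full_piece[OF st(2)]] glue_mem_piece st piece_cong[OF pc] by metis
  finally show ?thesis .
qed

lemma glue_R: "s \<in> T \<Longrightarrow> t \<in> T \<Longrightarrow> lt R s t \<longleftrightarrow> lt R (glue U s) (glue U t)"
  by (rule piecewise_mono[of "glue U"]) (use glue_T glue_pc glue_piece_iff in blast)+

lemma glue_inj: "\<lbrakk>s \<in> T; t \<in> T; glue U s = glue U t\<rbrakk> \<Longrightarrow> s = t"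
  by (rule increasing_inj[OF lin_R lin_R glue_T glue_R[THEN iffD1]])

lemma glue_surj:
  assumes u: "u \<in> U" obtains t where "t \<in> T" "glue U t = u"
proof -
  have uT: "u \<in> T" using u subsetD[OF full_subset[OF full]] by blast
  have "ordermap (piece U pc u) W u \<in> piece_type u"
    using ordermap_mem[OF well_ord_full_piece[OF uT]] full_type[OF uT] u by simp
  then obtain t where t: "t \<in> T" "ap pc t = ap pc u"
    and eq: "ordermap (piece T pc u) W t = ordermap (piece U pc u) W u"
    using ordermap_surj[OF well_ord_piece[OF uT]] by auto
  have "ordermap (piece U pc u) W (glue U t) = ordermap (piece U pc u) W u"
    using ordermap_glue[OF t(1)] eq piece_cong[OF t(2)] by metis
  hence "glue U t = u"
    by (rule ordermap_inj[OF well_ord_full_piece[OF uT], rotated 2]) (use glue_mem_piece[OF t(1)] u t in simp_all)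
  thus ?thesis using that t by blast
qed

lemma glue_bij: "bij_betw (glue U) (elts T) (elts U)"
  by (rule bij_eltsI[OF glue_mem glue_inj]) (use glue_surj in blast)+

lemma full_isomorphic: "isomorphic U R T R"
  by (rule isomorphic_sym[OF isomorphicI[OF _ glue_bij glue_R]]) simp_all

lemma glue_ge:
  assumes t: "t \<in> T" shows "glue U t = t \<or> lt W t (glue U t)"
proof -
  have glue_piece: "glue U t \<in> piece T pc t" using glue_T[OF t] glue_pc[OF t] by simp
  have "ordermap (piece U pc t) W (glue U t) \<subseteq> ordermap (piece T pc t) W (glue U t)"
    by (rule ordermap_le[OF well_ord_full_piece[OF t] well_ord_piece[OF t], of "\<lambda>x. x"])
      (use subsetD[OF full_piece_subset] glue_mem_piece[OF t] in auto)
  hence "ordermap (piece T pc t) W t \<subseteq> ordermap (piece T pc t) W (glue U t)"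
    using ordermap_glue[OF t] by simp
  hence "\<not> lt W (glue U t) t"
    using ordermap_iff[OF well_ord_piece[OF t] glue_piece] t subsetD mem_irrefl by (metis mem_piece)
  thus ?thesis using W_total[OF t] glue_T[OF t] glue_pc[OF t] by blast
qed

end

end

text \<open>
  The piece of \<open>t\<close> is no larger than the pieces it can absorb: those that are earlier, up to the
  nearest infinite piece of the opposite direction.
\<close>

locale indecomposable_pieces = convex_pieces +
  assumes indec: "t \<in> T \<Longrightarrow> ordertype (tail T W pc t) W = piece_type t"
    and sorted: "\<lbrakk>s \<in> T; t \<in> T; earlier s t; nontrivial t;
      \<And>r. r \<in> T \<Longrightarrow> nontrivial r \<Longrightarrow> ap pc r = ap pc s \<or> between s r t \<Longrightarrow>
        ap d (ap pc r) = zero \<longleftrightarrow> ap d (ap pc t) = zero\<rbrakk> \<Longrightarrow> piece_type t \<subseteq> piece_type s"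
begin

lemma nontrivial_next:
  assumes t: "t \<in> T" "nontrivial t"
  obtains s where "s \<in> T" "ap pc s = ap pc t" "lt W t s"
proof -
  have "\<exists>s. s \<in> T \<and> ap pc s = ap pc t \<and> lt W t s"
  proof (rule ccontr)
    assume last: "\<not> ?thesis"
    obtain s where s: "s \<in> T" "ap pc s = ap pc t" "s \<noteq> t" using t unfolding nontrivial_def by blast
    hence "lt W s t" using W_total t last by blast
    moreover have "x = t" if "x \<in> tail T W pc t" for x using that last by auto
    ultimately have "ordertype (tail T W pc t) W \<in> piece_type t"
      using W_irrefl[OF t(1)] s t(1)
      by (intro ordertype_less[OF well_ord_tail well_ord_piece, of _ _ "\<lambda>x. s" t]) auto
    thus False using indec[OF t(1)] by simp
  qed
  thus ?thesis using that by blast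
qed

end

locale piece_embedding = zf_model mem +
  src: indecomposable_pieces mem T R W pc N d + tgt: convex_pieces mem T' R' W' pc' N' d'
  for mem :: "'a \<Rightarrow> 'a \<Rightarrow> bool"  (infix "\<in>" 50) and T R W pc N d T' R' W' pc' N' d' +
  fixes F :: "'a \<Rightarrow> 'a"
  assumes F_definable: "definable_map F"
    and F_mem: "t \<in> T \<Longrightarrow> F t \<in> T'"
    and F_less: "\<lbrakk>s \<in> T; t \<in> T; lt R s t\<rbrakk> \<Longrightarrow> lt R' (F s) (F t)"
begin

definition stable :: "'a \<Rightarrow> bool" where
  "stable t \<longleftrightarrow> t \<in> T \<and> (\<forall>s. s \<in> tail T W pc t \<longrightarrow> ap pc' (F s) = ap pc' (F t))"

lemma stable_mem: "stable t \<Longrightarrow> t \<in> T"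
  and stable_pc: "stable t \<Longrightarrow> s \<in> tail T W pc t \<Longrightarrow> ap pc' (F s) = ap pc' (F t)"
  unfolding stable_def by blast+

lemma definable_stable: "definable_fn f \<Longrightarrow> definable (\<lambda>v. stable (f v))"
  by (rule definable_app1[of stable]) (unfold stable_def, intro definable definable_fn_app1[OF F_definable])

lemma F_inj: "\<lbrakk>s \<in> T; t \<in> T; F s = F t\<rbrakk> \<Longrightarrow> s = t"
  by (rule increasing_inj[OF src.lin_R tgt.lin_R F_mem F_less])

lemma pc_F_mono: "\<lbrakk>s \<in> T; t \<in> T; lt R s t\<rbrakk> \<Longrightarrow> ap pc' (F s) \<subseteq> ap pc' (F t)"
  using tgt.pc_le[OF F_mem F_mem F_less] ord_mem_subset[OF tgt.pc_ord[OF F_mem]] by fastforce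

lemma stable_ex:
  assumes t: "t \<in> T"
  obtains t0 where "stable t0" "ap pc t0 = ap pc t"
proof -
  let ?P = "\<lambda>s. s \<in> T \<and> ap pc s = ap pc t" and ?g = "\<lambda>s. ap pc' (F s)"
  have P: "definable (\<lambda>v. ?P (v 0))" and g: "definable_map ?g" using F_definable by simp_all
  note ord = tgt.pc_ord[OF F_mem]
  have "\<exists>m. ?P m \<and> (\<forall>s. ?P s \<and> lt W m s \<longrightarrow> ?g s = ?g m)"
  proof (cases "ap d (ap pc t) = zero")
    case True
    obtain m where m: "?P m" "\<And>s. ?P s \<Longrightarrow> ?g s \<subseteq> ?g m"
      by (rule omega_arg_max[OF tgt.N_omega P g, of t]) (use t tgt.pc_mem F_mem in auto)
    have "?g s = ?g m" if "?P s" "lt W m s" for s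
      using m that src.dir[of m s] True subset_antisym[OF m(2)[of s] pc_F_mono[of m s]] by simp
    thus ?thesis using m(1) by blast
  next
    case False
    obtain m where m: "?P m" "\<And>s. ?P s \<Longrightarrow> ?g m \<subseteq> ?g s"
      by (rule ord_arg_min[of ?P t, OF _ _ P g]) (use t ord in auto)
    have "?g s = ?g m" if "?P s" "lt W m s" for s
      using m that src.dir[of m s] False subset_antisym[OF pc_F_mono[of s m] m(2)[of s]] by simp
    thus ?thesis using m(1) by blast
  qed
  thus ?thesis using that unfolding stable_def mem_tail by metis
qed

lemma stable_dir:
  assumes t: "stable t" "src.nontrivial t"
  shows "ap d (ap pc t) = zero \<longleftrightarrow> ap d' (ap pc' (F t)) = zero"
proof -
  note tT = stable_mem[OF t(1)]
  have "\<exists>m. m \<in> piece T' pc' (F t) \<and> (\<exists>s. s \<in> tail T W pc t \<and> m = F s) \<and>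
    (\<forall>y. y \<in> piece T' pc' (F t) \<longrightarrow> (\<exists>s. s \<in> tail T W pc t \<and> y = F s) \<longrightarrow> y = m \<or> lt W' m y)"
    by (rule well_ord_least[OF tgt.well_ord_piece[OF F_mem[OF tT]], of "F t" "\<lambda>x. \<exists>s. s \<in> tail T W pc t \<and> x = F s"])
      (use tT F_mem in \<open>auto intro!: definable definable_fn_app1[OF F_definable]\<close>)
  then obtain s where s: "s \<in> tail T W pc t"
    "\<And>y. y \<in> piece T' pc' (F t) \<Longrightarrow> \<exists>s. s \<in> tail T W pc t \<and> y = F s \<Longrightarrow> y = F s \<or> lt W' (F s) y" by blast
  have sT: "s \<in> T" "ap pc s = ap pc t" using s by auto
  then obtain r where r: "r \<in> T" "ap pc r = ap pc s" "lt W s r"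
    using src.nontrivial_next src.nontrivial_cong[OF tT] t(2) by metis
  have rt: "r \<in> tail T W pc t" using src.tail_trans[OF tT s(1)] r by auto
  note same = stable_pc[OF t(1) rt] stable_pc[OF t(1) s(1)]
  have "F r = F s \<or> lt W' (F s) (F r)" by (rule s(2)) (use rt r F_mem same in auto)
  moreover have "r \<noteq> s" using r src.W_irrefl by metis
  ultimately have "lt W' (F s) (F r)" using F_inj r sT by blast
  hence "if ap d' (ap pc' (F t)) = zero then lt R' (F s) (F r) else lt R' (F r) (F s)"
    using tgt.dir[OF F_mem[OF sT(1)] F_mem[OF r(1)]] same by simp
  moreover have "if ap d (ap pc t) = zero then lt R s r else lt R r s"
    using src.dir[OF sT(1) r(1)] r sT by simp
  ultimately show ?thesis
    using F_less sT r lin_asym[OF tgt.lin_R F_mem[OF sT(1)] F_mem[OF r(1)]] by (auto split: if_splits)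
qed

lemma stable_less:
  assumes t: "stable t" and s: "s \<in> tail T W pc t" and r: "r \<in> tail T W pc t" and W: "lt W s r"
  shows "lt W' (F s) (F r)"
proof -
  note tT = stable_mem[OF t]
  have sT: "s \<in> T" "ap pc s = ap pc t" "r \<in> T" "ap pc r = ap pc t" using s r by auto
  have "src.nontrivial s" unfolding src.nontrivial_def using sT W src.W_irrefl by metis
  hence "src.nontrivial t" using src.nontrivial_cong[OF tT] sT by blast
  note same_dir = stable_dir[OF t this]
  show ?thesis
    using src.dir[OF sT(1,3)] tgt.dir[OF F_mem[OF sT(1)] F_mem[OF sT(3)]]
      same_dir stable_pc[OF t s] stable_pc[OF t r] sT W F_less by (auto split: if_splits)
qed

lemma stable_piece: "stable t \<Longrightarrow> s \<in> tail T W pc t \<Longrightarrow> F s \<in> piece T' pc' (F t)"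
  using F_mem stable_pc by auto

lemma stable_type_le:
  assumes t: "stable t" shows "src.piece_type t \<subseteq> tgt.piece_type (F t)"
proof -
  note tT = stable_mem[OF t]
  have "ordertype (tail T W pc t) W \<subseteq> tgt.piece_type (F t)"
    by (rule ordertype_le[OF src.well_ord_tail[OF tT] tgt.well_ord_piece[OF F_mem[OF tT]] F_definable])
      (use stable_piece[OF t] stable_less[OF t] in blast)+
  thus ?thesis using src.indec[OF tT] by simp
qed

lemma stable_bounded:
  assumes t: "stable t" and x: "x \<in> piece T' pc' (F t)"
    and bound: "\<And>s. s \<in> tail T W pc t \<Longrightarrow> lt W' (F s) x"
  shows "src.piece_type t \<in> tgt.piece_type (F t)"
proof -
  note tT = stable_mem[OF t]
  have "ordertype (tail T W pc t) W \<in> tgt.piece_type (F t)"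
    by (rule ordertype_less[OF src.well_ord_tail[OF tT] tgt.well_ord_piece[OF F_mem[OF tT]] F_definable _ _ x])
      (use stable_piece[OF t] stable_less[OF t] bound in blast)+
  thus ?thesis using src.indec[OF tT] by simp
qed

lemma stable_cofinal:
  assumes t: "stable t" and same_type: "src.piece_type t = tgt.piece_type (F t)"
    and x: "x \<in> piece T' pc' (F t)"
  obtains s where "s \<in> tail T W pc t" "\<not> lt W' (F s) x"
  using stable_bounded[OF t x] same_type mem_irrefl by metis

lemma F_between:
  assumes "s \<in> T" "r \<in> T" "t \<in> T" "src.between s r t" "ap pc' (F s) = ap pc' (F t)"
  shows "ap pc' (F r) = ap pc' (F t)"
proof -
  have "ap pc' (F x) \<subseteq> ap pc' (F y)" if "x \<in> T" "y \<in> T" "ap pc x \<in> ap pc y" for x y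
    using pc_F_mono src.pc_less that by blast
  thus ?thesis using assms subset_antisym unfolding src.between_def by metis
qed

lemma F_earlier_iff:
  assumes t: "stable t" "src.nontrivial t" and x: "x \<in> tail T W pc t"
    and s: "s \<in> T" "ap pc s \<noteq> ap pc t" "ap pc' (F s) = ap pc' (F t)"
  shows "lt W' (F s) (F x) \<longleftrightarrow> src.earlier s t" and "lt W' (F x) (F s) \<longleftrightarrow> \<not> src.earlier s t"
proof -
  have xT: "x \<in> T" "ap pc x = ap pc t" "ap pc' (F x) = ap pc' (F t)"
    using x stable_pc[OF t(1) x] by auto
  have R_iff: "lt R' (F s) (F x) \<longleftrightarrow> ap pc s \<in> ap pc t" "lt R' (F x) (F s) \<longleftrightarrow> ap pc t \<in> ap pc s"
    using src.pc_cases[OF s(1) xT(1)] src.pc_less[OF s(1) xT(1)] src.pc_less[OF xT(1) s(1)] s(2) xT(2)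
      F_less s(1) xT(1) lin_asym[OF tgt.lin_R F_mem[OF s(1)] F_mem[OF xT(1)]] mem_asym by metis+
  show "lt W' (F s) (F x) \<longleftrightarrow> src.earlier s t"
    using tgt.dir[OF F_mem[OF s(1)] F_mem[OF xT(1)]] R_iff stable_dir[OF t] s xT
    unfolding src.earlier_def by simp
  show "lt W' (F x) (F s) \<longleftrightarrow> \<not> src.earlier s t"
    using tgt.dir[OF F_mem[OF xT(1)] F_mem[OF s(1)]] R_iff stable_dir[OF t] s xT
      src.pc_cases[OF s(1) stable_mem[OF t(1)]] mem_asym unfolding src.earlier_def by auto
qed

lemma stable_fibre_trivial:
  assumes t: "stable t" and trivial: "\<not> src.nontrivial t" and s: "s \<in> T"
    and same_type: "src.piece_type t = tgt.piece_type (F t)" and same: "ap pc' (F s) = ap pc' (F t)"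
  shows "ap pc s = ap pc t"
proof (rule ccontr)
  assume ne: "ap pc s \<noteq> ap pc t"
  note tT = stable_mem[OF t]
  have single: "x = t" if "x \<in> tail T W pc t" for x
    using trivial that unfolding src.nontrivial_def mem_tail by blast
  have Fs: "F s \<in> piece T' pc' (F t)" using F_mem s same by simp
  have "\<not> lt W' (F t) (F s)" using stable_cofinal[OF t same_type Fs] single by metis
  moreover have "F s \<noteq> F t" using F_inj s tT ne by blast
  ultimately have "lt W' (F s) (F t)" using tgt.W_total[OF F_mem[OF tT] F_mem[OF s]] same by blast
  hence "ordertype (tail T W pc t) W \<in> tgt.piece_type (F t)"
    using single src.W_irrefl[OF tT] F_mem s tT same
    by (intro ordertype_less[OF src.well_ord_tail tgt.well_ord_piece, of _ _ "\<lambda>x. F s" "F t"]) auto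
  thus False using src.indec[OF tT] same_type by simp
qed

lemma stable_fibre:
  assumes t: "stable t" and s: "stable s"
    and same_type: "src.piece_type t = tgt.piece_type (F t)" and same: "ap pc' (F s) = ap pc' (F t)"
  shows "ap pc s = ap pc t"
proof (rule ccontr)
  assume ne: "ap pc s \<noteq> ap pc t"
  note tT = stable_mem[OF t] and sT = stable_mem[OF s]
  have nontrivial: "src.nontrivial t" using stable_fibre_trivial[OF t _ sT same_type same] ne by blast
  note earlier_iff = F_earlier_iff[OF t nontrivial]
  have "F s \<in> piece T' pc' (F t)" using F_mem sT same by simp
  then obtain x where "x \<in> tail T W pc t" "\<not> lt W' (F x) (F s)" using stable_cofinal[OF t same_type] by blast
  hence earlier: "src.earlier s t" using earlier_iff(2) sT ne same by blast
  have "src.piece_type t \<subseteq> src.piece_type s"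
  proof (rule src.sorted[OF sT tT earlier nontrivial])
    fix r assume r: "r \<in> T" "src.nontrivial r" and rs: "ap pc r = ap pc s \<or> src.between s r t"
    obtain q where q: "stable q" "ap pc q = ap pc r" "ap pc' (F q) = ap pc' (F t)"
    proof (cases "ap pc r = ap pc s")
      case False
      have "ap pc' (F y) = ap pc' (F t)" if "y \<in> T" "ap pc y = ap pc r" for y
        using F_between[OF sT that(1) tT _ same] rs False that(2) unfolding src.between_def by simp
      thus ?thesis using that[of r] r(1) unfolding stable_def mem_tail by simp
    qed (use that[OF s] same in simp)
    have "src.nontrivial q" using r q(2) src.nontrivial_cong[OF r(1) stable_mem[OF q(1)]] by blast
    thus "ap d (ap pc r) = zero \<longleftrightarrow> ap d (ap pc t) = zero"
      using stable_dir[OF q(1)] stable_dir[OF t nontrivial] q(2,3) by simp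
  qed
  moreover have "src.piece_type s \<in> tgt.piece_type (F s)"
  proof (rule stable_bounded[OF s, of "F t"])
    show "lt W' (F y) (F t)" if y: "y \<in> tail T W pc s" for y
      using earlier_iff(1)[OF src.tail_refl[OF tT], of y] earlier ne y stable_pc[OF s y] same
      unfolding src.earlier_def by simp
  qed (use F_mem[OF tT] same in simp)
  ultimately show False using same_type piece_cong[OF same] subsetD mem_irrefl by metis
qed

definition target :: "'a \<Rightarrow> 'a" where
  "target Z = desc (\<lambda>Y. \<exists>t. stable t \<and> t \<in> Z \<and> Y = piece T' pc' (F t))"

lemma definable_fn_target: "definable_fn f \<Longrightarrow> definable_fn (\<lambda>v. target (f v))"
  by (rule definable_fn_app1[of target])
    (unfold target_def, intro definable definable_stable definable_fn_app1[OF F_definable])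

lemma stable_pc_cong:
  assumes "stable s" "stable t" "ap pc s = ap pc t"
  shows "ap pc' (F s) = ap pc' (F t)"
  using src.tail_or[OF stable_mem stable_mem] stable_pc assms by metis

lemma target_piece:
  assumes t: "stable t"
  shows "target (piece T pc t) = piece T' pc' (F t)"
  unfolding target_def
proof (rule desc_eq)
  show "\<exists>s. stable s \<and> s \<in> piece T pc t \<and> piece T' pc' (F t) = piece T' pc' (F s)"
    using t stable_mem by auto
  fix Y assume "\<exists>s. stable s \<and> s \<in> piece T pc t \<and> Y = piece T' pc' (F s)"
  then obtain s where s: "stable s" "ap pc s = ap pc t" "Y = piece T' pc' (F s)" by auto
  show "Y = piece T' pc' (F t)" unfolding s(3) by (rule piece_cong[OF stable_pc_cong[OF s(1) t s(2)]])
qed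

lemma piece_set_stable:
  assumes "Z \<in> src.piece_set"
  obtains t where "stable t" "Z = piece T pc t" "target Z = piece T' pc' (F t)"
proof -
  obtain s where s: "s \<in> T" "Z = piece T pc s" using assms src.mem_piece_set by blast
  obtain t where t: "stable t" "ap pc t = ap pc s" using stable_ex[OF s(1)] by blast
  have "Z = piece T pc t" using piece_cong[OF t(2)] s by simp
  thus ?thesis using that t target_piece by blast
qed

lemma target_mem: "Z \<in> src.piece_set \<Longrightarrow> target Z \<in> tgt.piece_set"
  using piece_set_stable F_mem tgt.mem_piece_set stable_mem by metis

lemma target_le: "Z \<in> src.piece_set \<Longrightarrow> ordertype Z W \<subseteq> ordertype (target Z) W'"
  using piece_set_stable stable_type_le by metis

lemma target_fibre:
  assumes Z: "Z \<in> src.piece_set" and Y: "Y \<in> src.piece_set"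
    and same_type: "ordertype Z W = ordertype (target Z) W'" and eq: "target Y = target Z"
  shows "Y = Z"
proof -
  obtain t where t: "stable t" "Z = piece T pc t" "target Z = piece T' pc' (F t)" using piece_set_stable[OF Z] .
  obtain s where s: "stable s" "Y = piece T pc s" "target Y = piece T' pc' (F s)" using piece_set_stable[OF Y] .
  have "F s \<in> piece T' pc' (F t)" using eq s t F_mem[OF stable_mem[OF s(1)]] by (metis mem_piece)
  hence "ap pc s = ap pc t" using stable_fibre[OF t(1) s(1)] same_type t by simp
  thus ?thesis using piece_cong s t by metis
qed

end

locale piece_self_embedding = piece_embedding mem T R W pc N d T R W pc N d F
  for mem :: "'a \<Rightarrow> 'a \<Rightarrow> bool"  (infix "\<in>" 50) and T R W pc N d F
begin

lemma target_cycle: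
  shows target_type: "Z \<in> src.piece_set \<Longrightarrow> ordertype (target Z) W = ordertype Z W"
    and target_surj: "Y \<in> src.piece_set \<Longrightarrow> \<exists>Z. Z \<in> src.piece_set \<and> target Z = Y"
proof -
  have definable: "definable_map target" "definable_map (\<lambda>Z. ordertype Z W)"
    by (simp_all add: definable_fn_target)
  note cycle = increasing_cycle[where size_X = "\<lambda>Z. ordertype Z W"
    and size_Y = "\<lambda>Z. ordertype Z W" and Y = src.piece_set,
    OF src.fin_piece_set definable(1) definable target_mem target_mem src.piece_set_ord target_le target_le
    target_fibre target_fibre]
  show "Z \<in> src.piece_set \<Longrightarrow> ordertype (target Z) W = ordertype Z W" by (rule cycle(1))
  show "Y \<in> src.piece_set \<Longrightarrow> \<exists>Z. Z \<in> src.piece_set \<and> target Z = Y" by (rule cycle(3))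
qed

lemma image_full:
  assumes U: "\<And>t. t \<in> T \<Longrightarrow> F t \<in> U" "U \<subseteq> T"
  shows "src.full U"
  unfolding src.full_def
proof (intro conjI allI impI U(2))
  fix t assume t: "t \<in> T"
  hence "piece T pc t \<in> src.piece_set" using src.mem_piece_set by blast
  then obtain Z where Z: "Z \<in> src.piece_set" "target Z = piece T pc t" using target_surj by blast
  obtain s where s: "stable s" "Z = piece T pc s" "target Z = piece T pc (F s)" using piece_set_stable[OF Z(1)] .
  note sT = stable_mem[OF s(1)]
  have U_sub: "piece U pc t \<subseteq> piece T pc t" using U(2) by (auto simp: subset_def)
  have "src.piece_type t = ordertype (tail T W pc s) W" using target_type[OF Z(1)] Z s src.indec[OF sT] by simp
  also have "\<dots> \<subseteq> ordertype (piece U pc t) W"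
  proof (rule ordertype_le[OF src.well_ord_tail[OF sT] well_ord_subset[OF src.well_ord_piece[OF t] U_sub] F_definable])
    fix x assume x: "x \<in> tail T W pc s"
    hence "F x \<in> piece T pc t" using stable_piece[OF s(1)] s Z by metis
    thus "F x \<in> piece U pc t" using U(1)[of x] x by simp
  qed (use stable_less[OF s(1)] in blast)
  finally show "ordertype (piece U pc t) W = src.piece_type t"
    using ordertype_mono[OF src.well_ord_piece[OF t] U_sub] subset_antisym by blast
qed

end

context indecomposable_pieces
begin

lemma isomorphic_full:
  assumes U: "U \<subseteq> T" and iso: "isomorphic U R T R"
  shows "full U"
proof -
  obtain f where f: "order_iso f T R U R" using isomorphic_sym[OF iso] isomorphic_iff by blast
  note f_mem = order_iso_mem[OF f]
  interpret f: piece_self_embedding mem T R W pc N d "ap f"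
    by unfold_locales (use f_mem subsetD[OF U] order_iso_less_iff[OF f] in auto)
  show ?thesis by (rule f.image_full[OF f_mem U])
qed

end

text \<open>The pieces of \<open>S\<close> listed in a second order \<open>W\<close>, in which no piece is reversed.\<close>

locale beta_structure = zf_model mem +
  s: indecomposable_pieces mem T S W pc N d + w: indecomposable_pieces mem T W W wp M e
  for mem :: "'a \<Rightarrow> 'a \<Rightarrow> bool"  (infix "\<in>" 50) and T S W pc N d wp M e +
  assumes pc_wp: "s \<in> T \<Longrightarrow> t \<in> T \<Longrightarrow> ap pc s = ap pc t \<longleftrightarrow> ap wp s = ap wp t"
    and e_zero: "t \<in> T \<Longrightarrow> ap e (ap wp t) = zero"
    and well_ord_W: "well_ord T W"
begin

lemma piece_eq: "U \<subseteq> T \<Longrightarrow> t \<in> T \<Longrightarrow> piece U wp t = piece U pc t"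
  by (rule mem_ext) (use pc_wp subsetD in auto)

lemma piece_set_eq: "w.piece_set = s.piece_set"
  by (rule mem_ext) (auto simp: w.mem_piece_set s.mem_piece_set piece_eq)

lemma full_eq: "w.full U \<longleftrightarrow> s.full U"
  unfolding w.full_def s.full_def using piece_eq subset_refl by metis

lemma glue_W:
  assumes "s.full U" "s \<in> T" "t \<in> T"
  shows "lt W s t \<longleftrightarrow> lt W (s.glue U s) (s.glue U t)"
  by (rule w.piecewise_mono[of "s.glue U", OF _ _ _ assms(2,3)])
    (use s.glue_T[OF assms(1)] s.glue_pc[OF assms(1)] s.glue_piece_iff[OF assms(1)] pc_wp in metis)+

end

context zf_model
begin

lemma beta_structure_not_less:
  assumes "beta_structure mem T S W1 pc1 N1 d1 wp1 M1 e1" "beta_structure mem T S W2 pc2 N2 d2 wp2 M2 e2"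
  shows "\<not> ordertype T W1 \<in> ordertype T W2"
proof
  assume less: "ordertype T W1 \<in> ordertype T W2"
  interpret b1: beta_structure mem T S W1 pc1 N1 d1 wp1 M1 e1 by (rule assms)
  interpret b2: beta_structure mem T S W2 pc2 N2 d2 wp2 M2 e2 by (rule assms)
  note wo = b1.well_ord_W b2.well_ord_W
  define F where "F t = nth_elt T W2 (ordermap T W1 t)" for t
  have rank: "ordermap T W1 t \<in> ordertype T W2" if "t \<in> T" for t
    using ord_trans[OF ord_ordertype[OF wo(2)] ordermap_mem[OF wo(1) that] less] .
  note F = nth_elt_mem[OF wo(2) rank] ordermap_nth_elt[OF wo(2) rank]
  interpret backward: piece_embedding mem T S W2 pc2 N2 d2 T S W1 pc1 N1 d1 "\<lambda>x. x" by unfold_locales auto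
  interpret forward: piece_embedding mem T W1 W1 wp1 M1 e1 T W2 W2 wp2 M2 e2 F
    by unfold_locales (use F ordermap_iff[OF wo(1)] ordermap_iff[OF wo(2)] in \<open>simp_all add: F_def\<close>)
  have definable: "definable_map forward.target" "definable_map backward.target" "definable_map (\<lambda>Z. ordertype Z W1)"
    by (simp_all add: forward.definable_fn_target backward.definable_fn_target)
  note cycle = increasing_cycle[where size_X = "\<lambda>Z. ordertype Z W1"
    and size_Y = "\<lambda>Z. ordertype Z W2" and Y = b2.s.piece_set,
    OF b1.s.fin_piece_set definable forward.target_mem[unfolded b1.piece_set_eq b2.piece_set_eq] backward.target_mem
    b1.s.piece_set_ord forward.target_le[unfolded b1.piece_set_eq] backward.target_le
    forward.target_fibre[unfolded b1.piece_set_eq] backward.target_fibre]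
  obtain u where u: "u \<in> T" "ordermap T W2 u = ordertype T W1" using ordermap_surj[OF wo(2) less] by blast
  have below: "lt W2 (F t) u" if "t \<in> T" for t
    using ordermap_iff[OF wo(2) F(1)[OF that] u(1)] u(2) F(2)[OF that] ordermap_mem[OF wo(1) that]
    unfolding F_def by simp
  have "piece T wp2 u \<in> b2.s.piece_set" using u b2.w.mem_piece_set unfolding b2.piece_set_eq[symmetric] by blast
  then obtain Z where Z: "Z \<in> b1.s.piece_set" "forward.target Z = piece T wp2 u"
    using cycle(3) by blast
  obtain t where t: "forward.stable t" "Z = piece T wp1 t" "forward.target Z = piece T wp2 (F t)"
    using forward.piece_set_stable Z(1) b1.piece_set_eq by metis
  have "ordertype (forward.target Z) W2 = ordertype Z W1" by (rule cycle(1)) (assumption | rule Z(1))+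
  hence same_type: "b1.w.piece_type t = b2.w.piece_type (F t)" using t by simp
  have "u \<in> piece T wp2 (F t)" using u(1) t(3) Z(2) by (metis mem_piece)
  then obtain s where "s \<in> tail T W1 wp1 t" "\<not> lt W2 (F s) u"
    by (rule forward.stable_cofinal[OF t(1) same_type])
  thus False using below by simp
qed

lemma beta_structure_unique:
  assumes "beta_structure mem T S W1 pc1 N1 d1 wp1 M1 e1" "beta_structure mem T S W2 pc2 N2 d2 wp2 M2 e2"
  shows "ordertype T W1 = ordertype T W2"
  using beta_structure_not_less[OF assms] beta_structure_not_less[OF assms(2,1)]
    ord_linear[OF ord_ordertype ord_ordertype] assms[THEN beta_structure.well_ord_W] by blast

end

subsection \<open>The lexicographic order\<close>

context zf_model
begin

lemma mem_binary_seqs [simp]: "x \<in> binary_seqs a \<longleftrightarrow> maps x a two"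
proof -
  have "x \<subseteq> times a two" if "maps x a two" for x
    using that mem_fun_on[of x a] unfolding maps_iff subset_def mem_times by metis
  hence "x \<in> sep (powerset (times a two)) (\<lambda>x. maps x a two) \<longleftrightarrow> maps x a two" for x by auto
  thus ?thesis unfolding binary_seqs_def by (intro mem_setof) blast
qed

definition first_diff :: "'a \<Rightarrow> 'a \<Rightarrow> 'a \<Rightarrow> 'a" where
  "first_diff a x y = desc (\<lambda>c. c \<in> a \<and> ap x c \<noteq> ap y c \<and> (\<forall>b. b \<in> c \<longrightarrow> ap x b = ap y b))"

lemma definable_fn_first_diff [definable, simp]:
  "\<lbrakk>definable_fn a; definable_fn x; definable_fn y\<rbrakk> \<Longrightarrow> definable_fn (\<lambda>v. first_diff (a v) (x v) (y v))"
  by (rule definable_fn_app3[of first_diff]) (unfold first_diff_def, intro definable)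

lemma first_diff_commute: "first_diff a x y = first_diff a y x"
  unfolding first_diff_def by (rule arg_cong[of _ _ desc]) (metis (no_types, lifting))

lemma first_diff_eqI:
  assumes a: "ordinal a" and c: "c \<in> a" "ap x c \<noteq> ap y c" "\<And>b. b \<in> c \<Longrightarrow> ap x b = ap y b"
  shows "first_diff a x y = c"
  unfolding first_diff_def
proof (rule desc_eq)
  show "c' = c" if "c' \<in> a \<and> ap x c' \<noteq> ap y c' \<and> (\<forall>b. b \<in> c' \<longrightarrow> ap x b = ap y b)" for c'
    using ord_linear[OF ord_mem[OF a c(1)], of c'] ord_mem[OF a] that c by blast
qed (use c in blast)

lemma first_diff:
  assumes a: "ordinal a" and x: "maps x a two" and y: "maps y a two" and ne: "x \<noteq> y"
  shows first_diff_mem: "first_diff a x y \<in> a"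
    and first_diff_neq: "ap x (first_diff a x y) \<noteq> ap y (first_diff a x y)"
    and first_diff_agree: "\<And>b. b \<in> first_diff a x y \<Longrightarrow> ap x b = ap y b"
proof -
  let ?P = "\<lambda>c. c \<in> a \<and> ap x c \<noteq> ap y c"
  obtain c where c: "?P c" using fun_on_ext[of x a y] x y ne unfolding maps_iff by blast
  hence "ordinal c" using ord_mem[OF a] by blast
  then obtain m where m: "?P m" "\<And>b. b \<in> m \<Longrightarrow> \<not> ?P b" by (rule ord_least[of c ?P]) (use c in simp_all)
  hence agree: "ap x b = ap y b" if "b \<in> m" for b using ord_trans[OF a that] that by blast
  have "first_diff a x y = m" by (rule first_diff_eqI[OF a _ _ agree]) (use m in blast)+
  thus "first_diff a x y \<in> a" "ap x (first_diff a x y) \<noteq> ap y (first_diff a x y)"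
    "\<And>b. b \<in> first_diff a x y \<Longrightarrow> ap x b = ap y b" using m agree by simp_all
qed

lemma lex_iff:
  assumes a: "ordinal a"
  shows "lt (lex a) x y \<longleftrightarrow> maps x a two \<and> maps y a two \<and>
    (\<exists>c. c \<in> a \<and> ap x c = zero \<and> ap y c = one \<and> (\<forall>b. b \<in> c \<longrightarrow> ap x b = ap y b))"
proof -
  let ?app_less = "\<lambda>x y. \<exists>d. d \<in> a \<and> app x d \<in> app y d \<and> (\<forall>e. e \<in> d \<longrightarrow> app x e = app y e)"
  let ?less = "\<lambda>x y. \<exists>c. c \<in> a \<and> ap x c = zero \<and> ap y c = one \<and> (\<forall>b. b \<in> c \<longrightarrow> ap x b = ap y b)"
  have "?app_less x y \<longleftrightarrow> ?less x y" if xy: "maps x a two" "maps y a two" for x y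
  proof -
    have eq: "app x d = ap x d" "app y d = ap y d" and bits: "ap x d \<in> two" "ap y d \<in> two" if "d \<in> a" for d
      using xy app_eq_ap that unfolding maps_iff by blast+
    have "app x d \<in> app y d \<and> (\<forall>e. e \<in> d \<longrightarrow> app x e = app y e) \<longleftrightarrow>
        ap x d = zero \<and> ap y d = one \<and> (\<forall>e. e \<in> d \<longrightarrow> ap x e = ap y e)" if d: "d \<in> a" for d
    proof -
      have "app x e = app y e \<longleftrightarrow> ap x e = ap y e" if "e \<in> d" for e using eq ord_trans[OF a that d] by simp
      moreover have "app x d \<in> app y d \<longleftrightarrow> ap x d = zero \<and> ap y d = one" using bits[OF d] eq[OF d] by auto
      ultimately show ?thesis by blast
    qed
    thus ?thesis by blast
  qed
  hence pairs: "x \<in> binary_seqs a \<and> y \<in> binary_seqs a \<and> p = opair x y \<and> ?app_less x y \<longleftrightarrow>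
     x \<in> binary_seqs a \<and> y \<in> binary_seqs a \<and> p = opair x y \<and> ?less x y" for p x y by auto
  have "p \<in> sep (times (binary_seqs a) (binary_seqs a)) (\<lambda>p. ?less (pfst p) (psnd p)) \<longleftrightarrow>
    (\<exists>x y. x \<in> binary_seqs a \<and> y \<in> binary_seqs a \<and> p = opair x y \<and> ?less x y)" for p
    by (subst mem_sep) (intro definable, auto)
  hence "lt (lex a) x y \<longleftrightarrow>
    (\<exists>x' y'. x' \<in> binary_seqs a \<and> y' \<in> binary_seqs a \<and> opair x y = opair x' y' \<and> ?less x' y')"
    unfolding lex_def pairs by (intro mem_setof) blast
  thus ?thesis by auto
qed

lemma lexI:
  assumes a: "ordinal a" and "maps x a two" "maps y a two"
    and c: "c \<in> a" "ap x c = zero" "ap y c = one" "\<And>b. b \<in> c \<Longrightarrow> ap x b = ap y b"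
  shows "lt (lex a) x y" and "first_diff a x y = c"
  using assms first_diff_eqI[OF a c(1) _ c(4)] unfolding lex_iff[OF a] by auto

lemma lexD:
  assumes a: "ordinal a" and less: "lt (lex a) x y"
  shows lex_maps: "maps x a two" "maps y a two" and lex_first_diff_mem: "first_diff a x y \<in> a"
    and lex_bits: "ap x (first_diff a x y) = zero" "ap y (first_diff a x y) = one"
    and lex_agree: "\<And>b. b \<in> first_diff a x y \<Longrightarrow> ap x b = ap y b"
proof -
  obtain c where c: "maps x a two" "maps y a two" "c \<in> a" "ap x c = zero" "ap y c = one"
      "\<forall>b. b \<in> c \<longrightarrow> ap x b = ap y b"
    using less unfolding lex_iff[OF a] by blast
  moreover have "first_diff a x y = c" by (rule lexI(2)[OF a]) (use c in blast)+
  ultimately show "maps x a two" "maps y a two" "first_diff a x y \<in> a"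
    "ap x (first_diff a x y) = zero" "ap y (first_diff a x y) = one"
    "\<And>b. b \<in> first_diff a x y \<Longrightarrow> ap x b = ap y b" by simp_all
qed

lemma lex_trans:
  assumes a: "ordinal a" and xy: "lt (lex a) x y" and yz: "lt (lex a) y z"
  shows "lt (lex a) x z"
    and first_diff_outer: "first_diff a x z \<subseteq> first_diff a x y" "first_diff a x z \<subseteq> first_diff a y z"
proof -
  let ?c = "first_diff a x y" and ?e = "first_diff a y z"
  note x = lexD[OF a xy] and y = lexD[OF a yz]
  have ord: "ordinal ?c" "ordinal ?e" using x(3) y(3) ord_mem[OF a] by blast+
  have "?c \<noteq> ?e" using x(5) y(4) one_zero by metis
  then consider (left) "?c \<in> ?e" | (right) "?e \<in> ?c" using ord_linear[OF ord] by blast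
  hence "lt (lex a) x z \<and> first_diff a x z \<subseteq> ?c \<and> first_diff a x z \<subseteq> ?e"
  proof cases
    case left
    have "ap z ?c = one" "ap x b = ap z b" if "b \<in> ?c" for b
      using left x(5,6) y(6) ord_trans[OF ord(2) that] that by metis+
    hence "lt (lex a) x z" "first_diff a x z = ?c"
      by (rule_tac lexI[OF a x(1) y(2) x(3,4)], use left y(6) x(5) in force, blast)+
    thus ?thesis using ord_mem_subset[OF ord(2) left] by simp
  next
    case right
    have "ap x b = ap z b" if "b \<in> ?e" for b
      using x(6) y(6) ord_trans[OF ord(1) that right] that by metis
    hence "lt (lex a) x z" "first_diff a x z = ?e"
      by (rule_tac lexI[OF a x(1) y(2,3) _ y(5)], use right x(6) y(4) in force, blast)+
    thus ?thesis using ord_mem_subset[OF ord(1) right] by simp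
  qed
  thus "lt (lex a) x z" "first_diff a x z \<subseteq> ?c" "first_diff a x z \<subseteq> ?e" by blast+
qed

lemma lin_lex:
  assumes a: "ordinal a" shows "lin_ord (binary_seqs a) (lex a)"
  unfolding lin_ord_def mem_binary_seqs
proof (intro conjI allI impI)
  show "\<not> lt (lex a) x x" for x using lex_bits[OF a, of x x] by auto
  show "lt (lex a) x z" if "maps x a two \<and> maps y a two \<and> maps z a two \<and> lt (lex a) x y \<and> lt (lex a) y z" for x y z
    using that lex_trans[OF a] by blast
  show "lt (lex a) x y \<or> lt (lex a) y x" if xy: "maps x a two \<and> maps y a two \<and> x \<noteq> y" for x y
  proof -
    let ?c = "first_diff a x y"
    have c: "?c \<in> a" "ap x ?c \<noteq> ap y ?c" "\<And>b. b \<in> ?c \<Longrightarrow> ap x b = ap y b"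
      using first_diff[OF a] xy by blast+
    hence "ap x ?c \<in> two" "ap y ?c \<in> two" using xy unfolding maps_iff by blast+
    hence "ap x ?c = zero \<and> ap y ?c = one \<or> ap y ?c = zero \<and> ap x ?c = one" using c(2) by auto
    thus ?thesis using lexI(1)[OF a, of x y ?c] lexI(1)[OF a, of y x ?c] c xy by auto
  qed
qed

end

context indecomposable_pieces
begin

lemma full_if_tails:
  assumes U: "U \<subseteq> T" and tails: "\<And>t. t \<in> T \<Longrightarrow> \<exists>s. s \<in> T \<and> ap pc s = ap pc t \<and> tail T W pc s \<subseteq> U"
  shows "full U"
  unfolding full_def
proof (intro conjI allI impI U)
  fix t assume t: "t \<in> T"
  obtain s where s: "s \<in> T" "ap pc s = ap pc t" "tail T W pc s \<subseteq> U" using tails[OF t] by blast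
  have sub: "piece U pc t \<subseteq> piece T pc t" using subsetD[OF U] by (simp add: subset_def)
  have "tail T W pc s \<subseteq> piece U pc t" using s by (auto simp: subset_def)
  hence "ordertype (tail T W pc s) W \<subseteq> ordertype (piece U pc t) W"
    using ordertype_mono well_ord_subset[OF well_ord_piece[OF t] sub] by blast
  hence "piece_type t \<subseteq> ordertype (piece U pc t) W" using indec[OF s(1)] piece_cong[OF s(2)] by simp
  thus "ordertype (piece U pc t) W = piece_type t"
    using ordertype_mono[OF well_ord_piece[OF t] sub] subset_antisym by blast
qed

lemma fin_if_trivial:
  assumes "\<And>t. t \<in> T \<Longrightarrow> \<not> nontrivial t"
  shows "finite_set T"
proof -
  have "finite_set Z" if Z: "Z \<in> piece_set" for Z
  proof -
    obtain t where t: "t \<in> T" "Z = piece T pc t" using Z mem_piece_set by blast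
    have "z = t" if "z \<in> Z" for z using not_nontrivial[OF t(1) assms[OF t(1)], of z] t(2) that by simp
    hence "Z \<subseteq> ins t zero" by (auto simp: subset_def)
    thus ?thesis using fin_subset[OF fin_ins[OF fin_zero]] by blast
  qed
  hence "finite_set (big_union piece_set)" by (rule fin_big_union[OF fin_piece_set])
  moreover have "big_union piece_set = T" by (rule mem_ext) (auto simp: mem_piece_set)
  ultimately show ?thesis by simp
qed

lemma nontrivial_not_in_nat:
  assumes t: "t \<in> T" "nontrivial t" and n: "n \<in> omega" and f: "definable_map f"
    and inc: "\<And>s t. \<lbrakk>s \<in> T; t \<in> T; lt W s t\<rbrakk> \<Longrightarrow> f s \<in> f t"
  obtains s where "s \<in> T" "ap pc s = ap pc t" "\<not> f s \<in> n"
proof -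
  have "\<exists>s. s \<in> T \<and> ap pc s = ap pc t \<and> \<not> f s \<in> n"
  proof (rule ccontr)
    assume below: "\<not> ?thesis"
    obtain m where m: "m \<in> T \<and> ap pc m = ap pc t" "\<And>s. s \<in> T \<and> ap pc s = ap pc t \<Longrightarrow> f s \<subseteq> f m"
      by (rule omega_arg_max[OF n _ f, of "\<lambda>s. s \<in> T \<and> ap pc s = ap pc t" t]) (use t below in auto)
    hence "nontrivial m" using nontrivial_cong t by blast
    then obtain s where s: "s \<in> T" "ap pc s = ap pc m" "lt W m s" using nontrivial_next m(1) by blast
    hence "f m \<in> f s" "f s \<subseteq> f m" using inc m by simp_all
    thus False using subsetD mem_irrefl by blast
  qed
  thus ?thesis using that by blast
qed

end

context beta_structure
begin

lemma nontrivial_eq: "t \<in> T \<Longrightarrow> w.nontrivial t \<longleftrightarrow> s.nontrivial t"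
  unfolding s.nontrivial_def w.nontrivial_def using pc_wp by metis

text \<open>The first piece of \<open>W\<close> is infinite because it is the largest one.\<close>

lemma first_nontrivial:
  assumes inf: "\<not> finite_set T" and a: "a \<in> T" "\<And>t. t \<in> T \<Longrightarrow> t = a \<or> lt W a t"
  shows "w.nontrivial a"
proof (rule ccontr)
  assume trivial: "\<not> w.nontrivial a"
  have "\<not> w.nontrivial t" if t: "t \<in> T" for t
  proof
    assume nontrivial: "w.nontrivial t"
    have ne: "ap wp a \<noteq> ap wp t" using nontrivial trivial w.nontrivial_cong a(1) t by metis
    hence "lt W a t" using a(2)[OF t] by auto
    hence "ap wp a \<in> ap wp t" using w.pc_le[OF a(1) t] ne by blast
    hence "w.earlier a t" unfolding w.earlier_def using e_zero[OF t] by simp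
    hence le: "w.piece_type t \<subseteq> w.piece_type a"
      by (rule w.sorted[OF a(1) t _ nontrivial]) (use e_zero t in simp)
    obtain r where r: "r \<in> T" "ap wp r = ap wp t" "r \<noteq> t" using nontrivial unfolding w.nontrivial_def by blast
    have same: "ordermap (piece T wp t) W x = ordermap (piece T wp a) W a" if "x \<in> piece T wp t" for x
    proof -
      have "ordermap (piece T wp t) W x \<in> w.piece_type a"
        using subsetD[OF le ordermap_mem[OF w.well_ord_piece[OF t] that]] .
      then obtain y where "y \<in> piece T wp a" "ordermap (piece T wp a) W y = ordermap (piece T wp t) W x"
        using ordermap_surj[OF w.well_ord_piece[OF a(1)]] by blast
      thus ?thesis using w.not_nontrivial[OF a(1) trivial] by metis
    qed
    have "r = t" by (rule ordermap_inj[OF w.well_ord_piece[OF t]]) (use same r t in simp_all)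
    thus False using r(3) by blast
  qed
  thus False using w.fin_if_trivial inf by blast
qed

lemma exists_above_nat:
  assumes inf: "\<not> finite_set T" and n: "n \<in> omega" and f: "definable_map f"
    and inc: "\<And>s t. \<lbrakk>s \<in> T; t \<in> T; lt W s t\<rbrakk> \<Longrightarrow> f s \<in> f t"
    and t: "t \<in> T"
  obtains s where "s \<in> T" "ap pc s = ap pc t" "\<not> f s \<in> n"
proof (cases "s.nontrivial t")
  case True
  show ?thesis by (rule s.nontrivial_not_in_nat[OF t True n f]) (use inc that in blast)+
next
  case False
  obtain a where a: "a \<in> T" "\<And>y. y \<in> T \<Longrightarrow> y = a \<or> lt W a y"
    by (rule well_ord_least[OF well_ord_W t, of "\<lambda>x. True"]) auto
  have nontrivial: "w.nontrivial a" by (rule first_nontrivial[OF inf a])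
  obtain r where r: "r \<in> T" "ap wp r = ap wp a" "\<not> f r \<in> n"
    by (rule w.nontrivial_not_in_nat[OF a(1) nontrivial n f]) (use inc in blast)+
  have ne: "ap wp a \<noteq> ap wp t"
    using False nontrivial w.nontrivial_cong nontrivial_eq a(1) t by metis
  hence "lt W a t" using a(2)[OF t] by auto
  hence "ap wp r \<in> ap wp t" using w.pc_le[OF a(1) t] ne r(2) by simp
  hence "f r \<in> f t" using inc w.pc_less r(1) t by blast
  hence "\<not> f t \<in> n" using r(3) ord_trans[OF ord_omega_mem[OF n]] by blast
  thus ?thesis using that t by blast
qed

end

subsection \<open>From ordinals to sequences\<close>

context beta_structure
begin

definition code :: "'a \<Rightarrow> 'a \<Rightarrow> 'a \<Rightarrow> 'a" where
  "code k q x = lam k (\<lambda>p. if p \<in> q then one else if p = q then zero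
     else if (ap d q = zero) = (p \<in> x) then one else zero)"

lemma definable_fn_code [simp]: "definable_fn f \<Longrightarrow> definable_fn g \<Longrightarrow> definable_fn (\<lambda>v. code k (f v) (g v))"
  by (rule definable_fn_app2[of "code k"]) (unfold code_def, intro definable)

lemma code_maps: "maps (code k q x) k two"
  unfolding maps_iff code_def by auto

lemma code_ap: "p \<in> k \<Longrightarrow> ap (code k q x) p = (if p \<in> q then one else if p = q then zero
     else if (ap d q = zero) = (p \<in> x) then one else zero)"
  unfolding code_def by (subst ap_lam) (simp_all)

lemma code_less_piece:
  assumes k: "ordinal k" and q: "q \<in> q'" "q \<in> k" "ordinal q'"
  shows "lt (lex k) (code k q x) (code k q' x')"
proof (rule lexI(1)[OF k code_maps code_maps q(2)])
  show "ap (code k q x) q = zero" "ap (code k q' x') q = one" using q by (simp_all add: code_ap)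
  fix b assume b: "b \<in> q"
  hence "b \<in> k" "b \<in> q'" using q ord_trans[OF k] ord_trans[OF q(3)] by blast+
  thus "ap (code k q x) b = ap (code k q' x') b" using b by (simp add: code_ap)
qed

lemma code_less:
  assumes k: "ordinal k" and x: "x \<in> x'" "x' \<in> k" "q \<in> x"
  shows "if ap d q = zero then lt (lex k) (code k q x) (code k q x') else lt (lex k) (code k q x') (code k q x)"
proof -
  have xk: "x \<in> k" using ord_trans[OF k x(1,2)] .
  have ord: "ordinal x" "ordinal x'" using ord_mem[OF k] xk x by blast+
  have q: "\<not> x \<in> q" "x \<noteq> q" using x(3) mem_asym mem_irrefl by blast+
  have agree: "ap (code k q x) b = ap (code k q x') b" if b: "b \<in> x" for b
  proof -
    have "b \<in> x'" "b \<in> k" using ord_trans[OF ord(2) b x(1)] ord_trans[OF k b xk] by blast+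
    thus ?thesis using b by (simp add: code_ap)
  qed
  have "ap (code k q x) x = (if ap d q = zero then zero else one)"
    "ap (code k q x') x = (if ap d q = zero then one else zero)" using xk q x(1) by (simp_all add: code_ap)
  thus ?thesis using lexI(1)[OF k code_maps code_maps xk] agree by simp
qed

definition coded_copy :: "'a \<Rightarrow> 'a \<Rightarrow> 'a" where
  "coded_copy k X = img (\<lambda>t. code k (ap pc t) (nth_elt X (memrel k) (ordermap T W t))) T"

lemma definable_fn_coded_copy [simp]: "definable_fn f \<Longrightarrow> definable_fn (\<lambda>v. coded_copy k (f v))"
  by (rule definable_fn_app1[of "coded_copy k"])
    (unfold coded_copy_def, intro definable_fn_img definable_fn_code definable)

lemma coded_copy_eq:
  assumes h: "definable_map h" "bij_betw h (elts T) (elts X)"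
    and less_iff: "\<And>s t. s \<in> T \<Longrightarrow> t \<in> T \<Longrightarrow> lt W s t \<longleftrightarrow> lt (memrel k) (h s) (h t)"
  shows "coded_copy k X = img (\<lambda>t. code k (ap pc t) (h t)) T"
proof (rule mem_ext)
  have "nth_elt X (memrel k) (ordermap T W t) = h t" if "t \<in> T" for t
    by (rule nth_elt_iso[OF well_ord_W h less_iff that])
  thus "y \<in> coded_copy k X \<longleftrightarrow> y \<in> img (\<lambda>t. code k (ap pc t) (h t)) T" for y
    unfolding coded_copy_def using h(1) by auto
qed

context
  fixes k f H :: 'a
  assumes inf: "\<not> finite_set T" and k: "ordinal k" "omega \<subseteq> k" and f: "order_iso f T W H (memrel k)" and H: "H \<subseteq> k"
begin

text \<open>An image below \<open>N\<close> would interfere with the name of the piece.\<close>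

definition codable :: 'a where
  "codable = sep T (\<lambda>t. \<not> ap f t \<in> N)"

abbreviation point_code :: "'a \<Rightarrow> 'a" where
  "point_code t \<equiv> code k (ap pc t) (ap f t)"

lemma mem_codable: "t \<in> codable \<longleftrightarrow> t \<in> T \<and> \<not> ap f t \<in> N"
  unfolding codable_def by simp

lemma copy_mem_k: "t \<in> T \<Longrightarrow> ap f t \<in> k"
  using order_iso_mem[OF f] subsetD[OF H] by blast

lemma copy_less_iff: "s \<in> T \<Longrightarrow> t \<in> T \<Longrightarrow> lt W s t \<longleftrightarrow> ap f s \<in> ap f t"
  using order_iso_less_iff[OF f] copy_mem_k by simp

lemma codable_full: "s.full codable"
proof (rule s.full_if_tails)
  show "codable \<subseteq> T" by (simp add: subset_def mem_codable)
  fix t assume t: "t \<in> T"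
  obtain s where s: "s \<in> T" "ap pc s = ap pc t" "\<not> ap f s \<in> N"
    by (rule exists_above_nat[OF inf s.N_omega, of "ap f" t]) (use t copy_mem_k copy_less_iff in auto)
  have "u \<in> codable" if "u \<in> tail T W pc s" for u
    using that s copy_less_iff[of s u] ord_trans[OF ord_omega_mem[OF s.N_omega]]
    unfolding mem_codable mem_tail by blast
  hence "tail T W pc s \<subseteq> codable" by (rule subsetI)
  thus "\<exists>s. s \<in> T \<and> ap pc s = ap pc t \<and> tail T W pc s \<subseteq> codable" using s by blast
qed

lemma point_code_less:
  assumes st: "s \<in> codable" "t \<in> codable" and less: "lt S s t"
  shows "lt (lex k) (point_code s) (point_code t)"
proof -
  have T: "s \<in> T" "t \<in> T" using st mem_codable by blast+
  have pc_k: "ap pc s \<in> k" using s.pc_mem[OF T(1)] s.N_omega omega_mem_mem k(2) subsetD by blast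
  show ?thesis
  proof (cases "ap pc s = ap pc t")
    case False
    hence "ap pc s \<in> ap pc t" using s.pc_le[OF T less] by blast
    thus ?thesis using code_less_piece[OF k(1)] pc_k s.pc_ord[OF T(2)] by blast
  next
    case True
    have "ap pc t \<in> ap f x" if "x \<in> codable" for x
    proof -
      have "N \<subseteq> ap f x"
        using that ord_not_mem[OF ord_mem[OF k(1) copy_mem_k] ord_omega_mem[OF s.N_omega]] mem_codable by blast
      thus ?thesis using s.pc_mem[OF T(2)] subsetD by blast
    qed
    note above = this[OF st(1)] this[OF st(2)]
    have "if ap d (ap pc t) = zero then ap f s \<in> ap f t else ap f t \<in> ap f s"
      using s.dir_R[OF T True] less copy_less_iff[OF T] copy_less_iff[OF T(2,1)] by (simp split: if_splits)
    thus ?thesis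
      using code_less[OF k(1) _ copy_mem_k[OF T(2)] above(1)] code_less[OF k(1) _ copy_mem_k[OF T(1)] above(2)] True
      by (auto split: if_splits)
  qed
qed

lemma coded_copy_surj:
  assumes Y: "Y \<subseteq> img point_code codable" "isomorphic Y (lex k) T S"
  obtains X where "X \<subseteq> H" "isomorphic X (memrel k) T W" "coded_copy k X = Y"
proof -
  define V where "V = sep codable (\<lambda>t. point_code t \<in> Y)"
  have "V \<subseteq> codable" unfolding V_def by simp
  hence VT: "V \<subseteq> T" using s.full_subset[OF codable_full] by (rule subset_trans)
  have vimage: "img point_code V = Y" "isomorphic V S Y (lex k)" unfolding V_def
    by (rule increasing_isomorphic_vimage[OF lin_subset[OF s.lin_R s.full_subset[OF codable_full]] lin_lex[OF k(1)] _ _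
        point_code_less Y(1)]; simp add: code_maps)+
  have full: "s.full V" using s.isomorphic_full[OF VT isomorphic_trans[OF vimage(2) Y(2)]] .
  define h where "h t = ap f (s.glue V t)" for t
  have h: "definable_map h" unfolding h_def by simp
  note glue_T = s.glue_T[OF full]
  have h_mem: "h t \<in> k" if "t \<in> T" for t unfolding h_def using copy_mem_k glue_T[OF that] .
  have less_iff: "lt W s t \<longleftrightarrow> lt (memrel k) (h s) (h t)" if "s \<in> T" "t \<in> T" for s t
    using glue_W[OF full that] copy_less_iff[OF glue_T glue_T] h_mem that unfolding h_def by simp
  note increasing = well_ord_lin[OF well_ord_W] lin_memrel[OF k(1)]
  have iso: "isomorphic (img h T) (memrel k) T W"
    by (rule isomorphic_sym[OF increasing_isomorphic_img[OF increasing h h_mem less_iff[THEN iffD1]]])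
  have "bij_betw h (elts T) (elts (img h T))"
    by (rule bij_betw_img[OF h increasing_inj[OF increasing h_mem less_iff[THEN iffD1]]])
  hence "coded_copy k (img h T) = img (\<lambda>t. code k (ap pc t) (h t)) T"
    by (rule coded_copy_eq[OF h _ less_iff])
  also have "\<dots> = img point_code V"
  proof (rule mem_ext)
    have "code k (ap pc t) (h t) = point_code (s.glue V t)" if "t \<in> T" for t
      using s.glue_pc[OF full that] unfolding h_def by simp
    thus "y \<in> img (\<lambda>t. code k (ap pc t) (h t)) T \<longleftrightarrow> y \<in> img point_code V" for y
      using h s.glue_mem[OF full] s.glue_surj[OF full] by (auto; metis)
  qed
  finally have "coded_copy k (img h T) = Y" unfolding vimage(1) .
  moreover have "img h T \<subseteq> H" using h order_iso_mem[OF f glue_T] by (auto simp: subset_def h_def)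
  ultimately show ?thesis using that iso by blast
qed

lemma exists_coded_copies:
  obtains K where "K \<subseteq> binary_seqs k" "isomorphic K (lex k) T S"
    "\<And>Y. Y \<subseteq> K \<Longrightarrow> isomorphic Y (lex k) T S \<Longrightarrow> \<exists>X. X \<subseteq> H \<and> isomorphic X (memrel k) T W \<and> coded_copy k X = Y"
proof
  show "img point_code codable \<subseteq> binary_seqs k" by (auto simp: subset_def code_maps)
  have "isomorphic codable S (img point_code codable) (lex k)"
    by (rule increasing_isomorphic_img[OF lin_subset[OF s.lin_R s.full_subset[OF codable_full]] lin_lex[OF k(1)] _ _
        point_code_less]; simp add: code_maps)
  thus "isomorphic (img point_code codable) (lex k) T S"
    using s.full_isomorphic[OF codable_full] isomorphic_sym isomorphic_trans by blast
qed (use coded_copy_surj in blast)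

end

theorem arrow_ordinal_imp_arrow_lex:
  assumes "\<not> finite_set T" "ordinal k" "omega \<subseteq> k" and arrow: "arrow k (memrel k) T W T W"
  shows "arrow (binary_seqs k) (lex k) T S T S"
proof (rule arrow_transfer[OF arrow])
  fix G assume G: "maps G (subsets_of_type (binary_seqs k) (lex k) T S) two"
  let ?color = "\<lambda>X. if coded_copy k X \<in> subsets_of_type (binary_seqs k) (lex k) T S then ap G (coded_copy k X) else zero"
  define F where "F = lam (subsets_of_type k (memrel k) T W) ?color"
  have color: "definable_map ?color" by (intro definable definable_fn_coded_copy)
  have F: "ap F X = ?color X" if "X \<subseteq> k" "isomorphic X (memrel k) T W" for X
    unfolding F_def by (rule ap_lam[OF color]) (use that in simp)
  have "?color X \<in> two" for X using G unfolding maps_iff by auto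
  hence "maps F (subsets_of_type k (memrel k) T W) two"
    unfolding maps_iff F_def using fun_on_lam[OF color] ap_lam[OF color] by auto
  moreover have "\<exists>K. K \<in> subsets_of_type (binary_seqs k) (lex k) T S \<and> (\<forall>Y. Y \<in> subsets_of_type K (lex k) T S \<longrightarrow>
      (\<exists>X. X \<in> subsets_of_type H (memrel k) T W \<and> ap F X = ap G Y))"
    if "H \<in> subsets_of_type k (memrel k) T W" for H
  proof -
    have H: "H \<subseteq> k" "isomorphic H (memrel k) T W" using that by simp_all
    then obtain f where f: "order_iso f T W H (memrel k)" using isomorphic_sym isomorphic_iff by blast
    obtain K where K: "K \<subseteq> binary_seqs k" "isomorphic K (lex k) T S"
      and coded: "\<And>Y. Y \<subseteq> K \<Longrightarrow> isomorphic Y (lex k) T S \<Longrightarrow>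
        \<exists>X. X \<subseteq> H \<and> isomorphic X (memrel k) T W \<and> coded_copy k X = Y"
      using exists_coded_copies[OF assms(1-3) f H(1)] by blast
    have "\<exists>X. X \<in> subsets_of_type H (memrel k) T W \<and> ap F X = ap G Y" if Y: "Y \<in> subsets_of_type K (lex k) T S" for Y
    proof -
      obtain X where X: "X \<subseteq> H" "isomorphic X (memrel k) T W" "coded_copy k X = Y" using coded Y by auto
      have "ap F X = ap G Y" using F[OF subset_trans[OF X(1) H(1)] X(2)] X(3) Y subset_trans[OF _ K(1)] by simp
      thus ?thesis using X by auto
    qed
    thus ?thesis using K by auto
  qed
  ultimately show "\<exists>F. maps F (subsets_of_type k (memrel k) T W) two \<and>
      (\<forall>H. H \<in> subsets_of_type k (memrel k) T W \<and> homogeneous F H (memrel k) T W \<longrightarrow>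
        (\<exists>K. K \<in> subsets_of_type (binary_seqs k) (lex k) T S \<and> (\<forall>Y. Y \<in> subsets_of_type K (lex k) T S \<longrightarrow>
          (\<exists>X. X \<in> subsets_of_type H (memrel k) T W \<and> ap F X = ap G Y))))" by blast
qed

end

context zf_model
begin

definition lex_prod :: "'a \<Rightarrow> 'a \<Rightarrow> 'a" where
  "lex_prod A B = sep (times (times A B) (times A B)) (\<lambda>p. pfst (pfst p) \<in> pfst (psnd p) \<or>
     pfst (pfst p) = pfst (psnd p) \<and> psnd (pfst p) \<in> psnd (psnd p))"

lemma definable_fn_lex_prod [definable, simp]:
  "definable_fn A \<Longrightarrow> definable_fn B \<Longrightarrow> definable_fn (\<lambda>v. lex_prod (A v) (B v))"
  by (rule definable_fn_app2[of lex_prod]) (unfold lex_prod_def, intro definable)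

lemma mem_lex_prod: "lt (lex_prod A B) (opair q x) (opair q' x') \<longleftrightarrow>
  q \<in> A \<and> x \<in> B \<and> q' \<in> A \<and> x' \<in> B \<and> (q \<in> q' \<or> q = q' \<and> x \<in> x')"
  unfolding lex_prod_def by (subst mem_sep) (intro definable, auto)

lemma lin_lex_prod:
  assumes A: "ordinal A" and B: "ordinal B"
  shows "lin_ord (times A B) (lex_prod A B)"
  unfolding lin_ord_def
proof (intro conjI allI impI)
  show "\<not> lt (lex_prod A B) p p" if "p \<in> times A B" for p using that by (auto simp: mem_lex_prod)
next
  fix p p' p'' assume less: "p \<in> times A B \<and> p' \<in> times A B \<and> p'' \<in> times A B \<and> lt (lex_prod A B) p p' \<and> lt (lex_prod A B) p' p''"
  then obtain q x q' x' q'' x'' where p: "p = opair q x" "p' = opair q' x'" "p'' = opair q'' x''" by auto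
  hence "q'' \<in> A" "x'' \<in> B" using less by auto
  hence "ordinal q''" "ordinal x''" using A B ord_mem by blast+
  thus "lt (lex_prod A B) p p''" using less ord_trans unfolding p mem_lex_prod by blast
next
  fix p p' assume ne: "p \<in> times A B \<and> p' \<in> times A B \<and> p \<noteq> p'"
  then obtain q x q' x' where p: "p = opair q x" "p' = opair q' x'" "q \<in> A" "x \<in> B" "q' \<in> A" "x' \<in> B" by auto
  have "q \<in> q' \<or> q = q' \<or> q' \<in> q" "x \<in> x' \<or> x = x' \<or> x' \<in> x"
    using ord_linear ord_mem A B p by blast+
  thus "lt (lex_prod A B) p p' \<or> lt (lex_prod A B) p' p" unfolding p(1,2) mem_lex_prod using p ne by blast
qed

lemma well_ord_lex_prod:
  assumes A: "ordinal A" and B: "ordinal B"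
  shows "well_ord (times A B) (lex_prod A B)"
  unfolding well_ord_def
proof (intro conjI allI impI lin_lex_prod[OF A B])
  fix X assume X: "X \<subseteq> times A B \<and> (\<exists>x. x \<in> X)"
  have coords: "ordinal (pfst y)" "ordinal (psnd y)" "y = opair (pfst y) (psnd y)" "pfst y \<in> A" "psnd y \<in> B"
    if "y \<in> X" for y
    using X that ord_mem[OF A] ord_mem[OF B] unfolding subset_def by fastforce+
  obtain x where "x \<in> X" using X by blast
  then obtain p where p: "p \<in> X" "\<And>y. y \<in> X \<Longrightarrow> pfst p \<subseteq> pfst y"
    by (rule ord_arg_min[of "\<lambda>y. y \<in> X" x pfst]) (use coords in auto)
  obtain m where m: "m \<in> X \<and> pfst m = pfst p" "\<And>y. y \<in> X \<and> pfst y = pfst p \<Longrightarrow> psnd m \<subseteq> psnd y"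
    by (rule ord_arg_min[of "\<lambda>y. y \<in> X \<and> pfst y = pfst p" p psnd]) (use p(1) coords in auto)
  have "y = m \<or> lt (lex_prod A B) m y" if y: "y \<in> X" for y
  proof -
    have mX: "m \<in> X" "pfst m = pfst p" using m(1) by blast+
    have "pfst m \<in> pfst y \<or> pfst m = pfst y"
      using p(2)[OF y] ord_subset_iff[OF coords(1)[OF p(1)] coords(1)[OF y]] mX by simp
    moreover have "psnd m \<in> psnd y \<or> psnd m = psnd y" if "pfst m = pfst y"
      using m(2)[of y] that mX y ord_subset_iff[OF coords(2)[OF mX(1)] coords(2)[OF y]] by simp
    moreover have "lt (lex_prod A B) m y \<longleftrightarrow> pfst m \<in> pfst y \<or> pfst m = pfst y \<and> psnd m \<in> psnd y"
      using mem_lex_prod[of "pfst m" "psnd m" "pfst y" "psnd y" A B] coords(3-5)[OF mX(1)] coords(3-5)[OF y] by metis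
    ultimately show ?thesis using coords(3)[OF mX(1)] coords(3)[OF y] by metis
  qed
  thus "\<exists>m. m \<in> X \<and> (\<forall>y. y \<in> X \<longrightarrow> y = m \<or> lt (lex_prod A B) m y)" using m(1) by blast
qed

subsection \<open>Initial ordinals\<close>

lemma initial_ord: "initial_ordinal k \<Longrightarrow> ordinal k"
  unfolding initial_ordinal_def by blast

definition injects_below :: "'a \<Rightarrow> 'a \<Rightarrow> bool" where
  "injects_below k A \<longleftrightarrow> (\<exists>l f. l \<in> k \<and> (\<forall>x. x \<in> A \<longrightarrow> ap f x \<in> l) \<and> (\<forall>x y. x \<in> A \<and> y \<in> A \<and> ap f x = ap f y \<longrightarrow> x = y))"

lemma definable_injects_below [definable, simp]:
  "definable_fn k \<Longrightarrow> definable_fn A \<Longrightarrow> definable (\<lambda>v. injects_below (k v) (A v))"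
  by (rule definable_app2[of injects_below]) (unfold injects_below_def, intro definable)

lemma injects_belowI:
  assumes "l \<in> k" "definable_map F" "\<And>x. x \<in> A \<Longrightarrow> F x \<in> l" "\<And>x y. \<lbrakk>x \<in> A; y \<in> A; F x = F y\<rbrakk> \<Longrightarrow> x = y"
  shows "injects_below k A"
proof -
  have eq: "ap (lam A F) x = F x" if "x \<in> A" for x using ap_lam[OF assms(2) that] .
  have "ap (lam A F) x \<in> l" if "x \<in> A" for x using eq[OF that] assms(3)[OF that] by simp
  moreover have "x = y" if "x \<in> A" "y \<in> A" "ap (lam A F) x = ap (lam A F) y" for x y
    using assms(4)[OF that(1,2)] that(3) eq[OF that(1)] eq[OF that(2)] by simp
  ultimately show ?thesis unfolding injects_below_def using assms(1) by blast
qed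

lemma injects_below_inj:
  assumes "injects_below k A" "definable_map G" "\<And>x. x \<in> B \<Longrightarrow> G x \<in> A" "\<And>x y. \<lbrakk>x \<in> B; y \<in> B; G x = G y\<rbrakk> \<Longrightarrow> x = y"
  shows "injects_below k B"
proof -
  obtain l f where f: "l \<in> k" "\<And>x. x \<in> A \<Longrightarrow> ap f x \<in> l" "\<And>x y. \<lbrakk>x \<in> A; y \<in> A; ap f x = ap f y\<rbrakk> \<Longrightarrow> x = y"
    using assms(1) unfolding injects_below_def by blast
  show ?thesis
  proof (rule injects_belowI[OF f(1), of "\<lambda>x. ap f (G x)"])
    show "definable_fn (\<lambda>v. ap f (G (v 0)))" using assms(2) by simp
    show "\<And>x. x \<in> B \<Longrightarrow> ap f (G x) \<in> l" using f(2) assms(3) by blast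
    show "\<And>x y. \<lbrakk>x \<in> B; y \<in> B; ap f (G x) = ap f (G y)\<rbrakk> \<Longrightarrow> x = y" using f(3) assms(3,4) by blast
  qed
qed

lemma initial_not_injects_below:
  assumes k: "initial_ordinal k" shows "\<not> injects_below k k"
proof
  assume "injects_below k k"
  then obtain l f where f: "l \<in> k" "\<And>x. x \<in> k \<Longrightarrow> ap f x \<in> l" "\<And>x y. \<lbrakk>x \<in> k; y \<in> k; ap f x = ap f y\<rbrakk> \<Longrightarrow> x = y"
    unfolding injects_below_def by blast
  have l: "ordinal l" using ord_mem[OF initial_ord[OF k] f(1)] .
  define B where "B = img (ap f) k"
  have B: "B \<subseteq> l" unfolding B_def subset_def using f(2) by auto
  have wo: "well_ord B (memrel l)" using well_ord_subset[OF well_ord_memrel[OF l] B] .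
  have "ordertype B (memrel l) \<subseteq> l" using ordertype_subset_ordinal[OF l B] .
  hence "ordertype B (memrel l) \<in> k" using ord_le_lt[OF ord_ordertype[OF wo] l initial_ord[OF k] _ f(1)] by blast
  moreover have "bij_betw (ap f) (elts k) (elts B)" unfolding B_def by (rule bij_betw_img) (use f(3) in auto)
  hence "equipotent k B" by (rule equipotentI[rotated]) simp
  hence "equipotent (ordertype B (memrel l)) k"
    using equipotent_ordertype[OF wo] equipotent_sym equipotent_trans by blast
  ultimately show False using k unfolding initial_ordinal_def by blast
qed

lemma injects_below_ordertype:
  assumes k: "initial_ordinal k" and A: "well_ord A R" and small: "injects_below k A"
  shows "ordertype A R \<in> k"
proof (rule ccontr)
  assume "\<not> ordertype A R \<in> k"
  hence sub: "k \<subseteq> ordertype A R" using ord_not_mem[OF ord_ordertype[OF A] initial_ord[OF k]] by blast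
  have "injects_below k k"
  proof (rule injects_below_inj[OF small, of "nth_elt A R"])
    show "nth_elt A R x \<in> A" if "x \<in> k" for x using nth_elt_mem[OF A subsetD[OF sub that]] .
    show "x = y" if "x \<in> k" "y \<in> k" "nth_elt A R x = nth_elt A R y" for x y
      using ordermap_nth_elt[OF A subsetD[OF sub]] that by metis
  qed simp
  thus False using initial_not_injects_below[OF k] by blast
qed

lemma injects_below_fin:
  assumes "omega \<subseteq> k" "finite_set A" shows "injects_below k A"
proof -
  obtain n f where n: "n \<in> omega" and f: "bij_betw (ap f) (elts A) (elts n)"
    using assms unfolding finite_set_def equipotent_iff by blast
  show ?thesis
    by (rule injects_belowI[OF subsetD[OF assms(1) n], of "ap f"]) (use bij_elts_mem[OF f] bij_elts_inj[OF f] in simp_all)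
qed

lemma initial_equipotent:
  assumes "ordinal x"
  obtains l where "initial_ordinal l" "l \<subseteq> x" "equipotent x l"
proof -
  have "definable (\<lambda>v. equipotent x (v 0))" by simp
  then obtain l where l: "ordinal l" "equipotent x l" "\<And>c. c \<in> l \<Longrightarrow> \<not> equipotent x c"
    using ord_least[OF assms, of "equipotent x"] equipotent_refl by blast
  have "\<not> equipotent c l" if "c \<in> l" for c using l(3)[OF that] l(2) equipotent_sym equipotent_trans by blast
  hence "initial_ordinal l" unfolding initial_ordinal_def using l(1) by blast
  moreover have "l \<subseteq> x" using ord_not_mem[OF assms l(1)] l(3) equipotent_refl by blast
  ultimately show ?thesis using that l(2) by blast
qed

lemma fin_times:
  assumes A: "finite_set A" and B: "finite_set B"
  shows "finite_set (times A B)"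
proof -
  have rows: "definable_map (\<lambda>a. img (opair a) B)" and row: "definable_map (opair a)" for a by (intro definable)+
  have "finite_set (big_union (img (\<lambda>a. img (opair a) B) A))"
    by (rule fin_big_union_img[OF A rows fin_img[OF B row]])
  moreover have "big_union (img (\<lambda>a. img (opair a) B) A) = times A B"
    by (rule mem_ext) (auto simp: mem_img[OF rows] mem_img[OF row])
  ultimately show ?thesis by simp
qed

text \<open>Hilbert's hotel.\<close>

definition hotel :: "'a \<Rightarrow> 'a \<Rightarrow> 'a" where
  "hotel x z = (if z = x then zero else if z \<in> omega then succ z else z)"

lemma definable_fn_hotel [definable, simp]:
  "definable_fn x \<Longrightarrow> definable_fn z \<Longrightarrow> definable_fn (\<lambda>v. hotel (x v) (z v))"
  unfolding hotel_def by (intro definable)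

lemma hotel_mem: "omega \<subseteq> x \<Longrightarrow> z \<in> succ x \<Longrightarrow> hotel x z \<in> x"
  using subsetD[OF _ zero_omega] subsetD[OF _ succ_omega] unfolding hotel_def by auto

lemma hotel_inj: "hotel x z = hotel x y \<Longrightarrow> z = y"
  unfolding hotel_def by (auto split: if_splits)

lemma segments_of_times_nat:
  assumes l: "initial_ordinal l" and M: "M \<in> omega"
    and rows: "\<And>y. y \<in> l \<Longrightarrow> injects_below l (times (succ y) M)" and p: "p \<in> times l M"
  shows "ordermap (times l M) (lex_prod l M) p \<in> l"
proof -
  obtain y i where y: "p = opair y i" "y \<in> l" "i \<in> M" using p by auto
  have sub: "pred (times l M) (lex_prod l M) p \<subseteq> times (succ y) M"
    unfolding subset_def mem_pred y(1) by (auto simp: mem_lex_prod)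
  have "injects_below l (pred (times l M) (lex_prod l M) p)"
    by (rule injects_below_inj[OF rows[OF y(2)] definable_fn_var subsetD[OF sub]])
  moreover have "well_ord (pred (times l M) (lex_prod l M) p) (lex_prod l M)"
    by (rule well_ord_subset[OF well_ord_lex_prod[OF initial_ord[OF l] ord_omega_mem[OF M]] pred_subset])
  ultimately show ?thesis unfolding ordermap_def using injects_below_ordertype[OF l] by blast
qed

lemma injects_below_times_nat:
  assumes l: "initial_ordinal l" "l \<in> k" and x: "omega \<subseteq> x" "equipotent x l" and M: "M \<in> omega"
    and rows: "\<And>y. y \<in> l \<Longrightarrow> injects_below l (times (succ y) M)"
  shows "injects_below k (times (succ x) M)"
proof -
  obtain f where f: "bij_betw (ap f) (elts x) (elts l)" using x(2) unfolding equipotent_iff by blast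
  let ?place = "\<lambda>p. opair (ap f (hotel x (pfst p))) (psnd p)"
  have place: "?place p \<in> times l M" if "p \<in> times (succ x) M" for p
    using that bij_elts_mem[OF f] hotel_mem[OF x(1)] by (auto simp del: mem_succ)
  have inj: "p = p'" if pp': "p \<in> times (succ x) M" "p' \<in> times (succ x) M" "?place p = ?place p'" for p p'
  proof -
    obtain z i z' i' where p: "p = opair z i" "p' = opair z' i'" "z \<in> succ x" "z' \<in> succ x"
      using pp'(1,2) unfolding mem_times by blast
    hence "ap f (hotel x z) = ap f (hotel x z')" "i = i'" using pp'(3) by simp_all
    thus ?thesis using bij_elts_inj[OF f] hotel_mem[OF x(1)] hotel_inj p by metis
  qed
  show ?thesis
  proof (rule injects_belowI[OF l(2), of "\<lambda>p. ordermap (times l M) (lex_prod l M) (?place p)"])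
    show "p = p'" if "p \<in> times (succ x) M" "p' \<in> times (succ x) M"
      "ordermap (times l M) (lex_prod l M) (?place p) = ordermap (times l M) (lex_prod l M) (?place p')" for p p'
      using inj ordermap_inj[OF well_ord_lex_prod[OF initial_ord[OF l(1)] ord_omega_mem[OF M]] place place] that
      by blast
  qed (use segments_of_times_nat[OF l(1) M rows place] in simp_all)
qed

lemma initial_times_nat:
  assumes "initial_ordinal k" "omega \<subseteq> k" and M: "M \<in> omega" and "x \<in> k"
  shows "injects_below k (times (succ x) M)"
proof -
  have "ordinal k" using initial_ord[OF assms(1)] .
  hence "initial_ordinal k \<and> omega \<subseteq> k \<longrightarrow> (\<forall>x. x \<in> k \<longrightarrow> injects_below k (times (succ x) M))"
  proof (induction rule: ord_induct)
    case defn
    show ?case unfolding initial_ordinal_def by (intro definable)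
  next
    case (step k)
    have "injects_below k (times (succ x) M)" if k: "initial_ordinal k" "omega \<subseteq> k" and x: "x \<in> k" for x
    proof (cases "x \<in> omega")
      case True
      thus ?thesis using injects_below_fin[OF k(2)] fin_times fin_omega_mem succ_omega M by blast
    next
      case False
      have x_ord: "ordinal x" using ord_mem[OF step(1) x] .
      have x_inf: "omega \<subseteq> x" using ord_not_mem[OF x_ord ord_omega] False by blast
      obtain l where l: "initial_ordinal l" "l \<subseteq> x" "equipotent x l" using initial_equipotent[OF x_ord] .
      have lk: "l \<in> k" using ord_le_lt[OF initial_ord[OF l(1)] x_ord step(1) l(2) x] .
      have "omega \<subseteq> l"
        using omega_subset_iff[OF initial_ord[OF l(1)]] omega_subset_iff[OF x_ord] fin_cong[OF l(3)] x_inf by blast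
      thus ?thesis using injects_below_times_nat[OF l(1) lk x_inf l(3) M] step(2)[OF lk] l(1) by blast
    qed
    thus ?case by blast
  qed
  thus ?thesis using assms by blast
qed

text \<open>The position of \<open>(q,x)\<close> in the lexicographic order of \<open>m \<times> s\<close>, that is, \<open>s \<cdot> q + x\<close>.\<close>

definition lexpos :: "'a \<Rightarrow> 'a \<Rightarrow> 'a \<Rightarrow> 'a \<Rightarrow> 'a" where
  "lexpos m s q x = ordermap (times m s) (lex_prod m s) (opair q x)"

lemma definable_fn_lexpos [definable, simp]:
  "\<lbrakk>definable_fn m; definable_fn s; definable_fn q; definable_fn x\<rbrakk> \<Longrightarrow>
    definable_fn (\<lambda>v. lexpos (m v) (s v) (q v) (x v))"
  by (rule definable_fn_app4[of lexpos]) (unfold lexpos_def, intro definable)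

lemma lexpos_less_iff:
  assumes "ordinal m" "ordinal s" and "q \<in> m" "x \<in> s" "q' \<in> m" "x' \<in> s"
  shows "lexpos m s q x \<in> lexpos m s q' x' \<longleftrightarrow> q \<in> q' \<or> q = q' \<and> x \<in> x'"
proof -
  have "opair q x \<in> times m s" "opair q' x' \<in> times m s" using assms by simp_all
  hence "lexpos m s q x \<in> lexpos m s q' x' \<longleftrightarrow> lt (lex_prod m s) (opair q x) (opair q' x')"
    unfolding lexpos_def using ordermap_iff[OF well_ord_lex_prod[OF assms(1,2)]] by blast
  thus ?thesis using assms by (simp add: mem_lex_prod)
qed

lemma lexpos_mem_initial:
  assumes k: "initial_ordinal k" "omega \<subseteq> k" and m: "m \<in> omega" and s: "s \<in> k" and q: "q \<in> m" "x \<in> s"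
  shows "lexpos m s q x \<in> k"
proof -
  have wo: "well_ord (times m s) (lex_prod m s)"
    by (rule well_ord_lex_prod[OF ord_omega_mem[OF m] ord_mem[OF initial_ord[OF k(1)] s]])
  have "injects_below k (times m s)"
    by (rule injects_below_inj[OF initial_times_nat[OF k m s], of "\<lambda>p. opair (psnd p) (pfst p)"]) auto
  hence "ordertype (times m s) (lex_prod m s) \<in> k" by (rule injects_below_ordertype[OF k(1) wo])
  moreover have "opair q x \<in> times m s" using q by simp
  ultimately show ?thesis unfolding lexpos_def using ord_trans[OF initial_ord[OF k(1)] ordermap_mem[OF wo]] by blast
qed

end

subsection \<open>From sequences to ordinals\<close>

context piece_self_embedding
begin

lemma stable_pc_inj:
  assumes s: "stable s" and t: "stable t" and same: "ap pc (F s) = ap pc (F t)"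
  shows "ap pc s = ap pc t"
proof -
  have "piece T pc t \<in> src.piece_set" using src.mem_piece_set stable_mem[OF t] by blast
  hence "src.piece_type t = src.piece_type (F t)" using target_type target_piece[OF t] by metis
  thus ?thesis by (rule stable_fibre[OF t s _ same])
qed

lemma stable_pc_mono:
  assumes s: "stable s" and t: "stable t" and less: "ap pc s \<in> ap pc t"
  shows "ap pc (F s) \<in> ap pc (F t)"
proof -
  note T = stable_mem[OF s] stable_mem[OF t]
  have "lt R (F s) (F t)" using F_less[OF T] src.pc_less[OF T less] by blast
  hence "ap pc (F s) \<in> ap pc (F t) \<or> ap pc (F s) = ap pc (F t)" using src.pc_le[OF F_mem F_mem] T by blast
  thus ?thesis using stable_pc_inj[OF s t] less mem_irrefl by metis
qed

lemma stable_onto: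
  assumes s: "s \<in> T"
  obtains r where "stable r" "ap pc (F r) = ap pc s"
proof -
  have "piece T pc s \<in> src.piece_set" using s src.mem_piece_set by blast
  then obtain Z where Z: "Z \<in> src.piece_set" "target Z = piece T pc s" using target_surj by blast
  obtain r where r: "stable r" "target Z = piece T pc (F r)" using piece_set_stable[OF Z(1)] by metis
  have "s \<in> piece T pc (F r)" using r Z s by (metis mem_piece)
  thus ?thesis using that r(1) by simp
qed

text \<open>By induction along the pieces: a strictly increasing permutation of a finite linear order is the identity.\<close>

lemma stable_fixed:
  assumes t: "stable t" shows "ap pc (F t) = ap pc t"
proof (rule ccontr)
  assume moved: "ap pc (F t) \<noteq> ap pc t"
  let ?P = "\<lambda>t. stable t \<and> ap pc (F t) \<noteq> ap pc t"
  have "definable (\<lambda>v. ?P (v 0))" by (intro definable definable_stable F_definable)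
  then obtain m where m: "?P m" and least: "\<And>r. ?P r \<Longrightarrow> ap pc m \<subseteq> ap pc r"
    by (rule_tac ord_arg_min[of ?P t "ap pc"]) (use t moved src.pc_ord stable_mem in auto)
  have fixed: "ap pc (F r) = ap pc r" if "stable r" "ap pc r \<in> ap pc m" for r
    using least[of r] that subsetD mem_irrefl by blast
  note mT = stable_mem[OF conjunct1[OF m]]
  consider (down) "ap pc (F m) \<in> ap pc m" | (up) "ap pc m \<in> ap pc (F m)"
    using src.pc_cases[OF mT F_mem[OF mT]] m by metis
  thus False
  proof cases
    case down
    obtain r where r: "stable r" "ap pc r = ap pc (F m)" using stable_ex[OF F_mem[OF mT]] .
    hence "ap pc (F r) = ap pc (F m)" using fixed down by metis
    thus False using stable_pc_inj[OF r(1)] m r(2) by metis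
  next
    case up
    obtain r where r: "stable r" "ap pc (F r) = ap pc m" using stable_onto[OF mT] .
    have "\<not> ap pc r \<in> ap pc m" using fixed r mem_irrefl by metis
    moreover have "ap pc r \<noteq> ap pc m" using stable_pc_cong[OF r(1), of m] r(2) m by metis
    ultimately have "ap pc m \<in> ap pc r" using src.pc_cases[OF mT stable_mem[OF r(1)]] by metis
    hence "ap pc (F m) \<in> ap pc m" using stable_pc_mono[OF _ r(1)] m r(2) by metis
    thus False using up mem_asym by blast
  qed
qed

lemma fixed_tail:
  assumes t: "t \<in> T"
  obtains u where "u \<in> T" "ap pc u = ap pc t" "\<And>s. s \<in> tail T W pc u \<Longrightarrow> ap pc (F s) = ap pc t"
proof -
  obtain u where u: "stable u" "ap pc u = ap pc t" using stable_ex[OF t] .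
  have "ap pc (F s) = ap pc t" if "s \<in> tail T W pc u" for s
    using stable_pc[OF u(1) that] stable_fixed[OF u(1)] u(2) by simp
  thus ?thesis using that stable_mem[OF u(1)] u(2) by blast
qed

lemma image_earlier:
  assumes t: "t \<in> T" and moved: "ap pc (F t) \<noteq> ap pc t"
  shows "src.earlier (F t) t"
proof -
  obtain u where u: "u \<in> T" "ap pc u = ap pc t" "\<And>s. s \<in> tail T W pc u \<Longrightarrow> ap pc (F s) = ap pc t"
    using fixed_tail[OF t] by blast
  have "\<not> t \<in> tail T W pc u" using u(3) moved by blast
  hence "u \<in> tail T W pc t" "u \<noteq> t" using src.tail_or[OF u(1) t u(2)] t by auto
  hence "lt W t u" by simp
  moreover have "ap pc (F u) = ap pc t" using u(3) src.tail_refl[OF u(1)] by blast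
  ultimately show ?thesis
    using src.dir[OF t u(1)] u(2) F_less[OF t u(1)] F_less[OF u(1) t] src.pc_le[OF F_mem[OF t] F_mem[OF u(1)]]
      src.pc_le[OF F_mem[OF u(1)] F_mem[OF t]] moved unfolding src.earlier_def by (auto split: if_splits)
qed

end

text \<open>
  If \<open>k\<close> is singular then \<open>c\<close> maps some \<open>\<rho> < k\<close> cofinally into \<open>k\<close>; otherwise \<open>\<rho>\<close> and \<open>c\<close> are arbitrary.
\<close>

locale lex_reduction = beta_structure mem T S W pc N d wp M e
  for mem :: "'a \<Rightarrow> 'a \<Rightarrow> bool"  (infix "\<in>" 50) and T S W pc N d wp M e +
  fixes k \<rho> c :: 'a
  assumes initial: "initial_ordinal k" and omega_subset: "omega \<subseteq> k"
    and small: "t \<in> T \<Longrightarrow> s.piece_type t \<in> k"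
    and singular: "\<lbrakk>r \<in> k; \<And>x. x \<in> r \<Longrightarrow> ap c' x \<in> k; \<And>x. x \<in> k \<Longrightarrow> \<exists>y. y \<in> r \<and> x \<subseteq> ap c' y\<rbrakk> \<Longrightarrow>
      \<rho> \<in> k \<and> (\<forall>x. x \<in> \<rho> \<longrightarrow> ap c x \<in> k) \<and> (\<forall>x. x \<in> k \<longrightarrow> (\<exists>y. y \<in> \<rho> \<and> x \<subseteq> ap c y))"
begin

lemma ord_k: "ordinal k"
  using initial_ord[OF initial] .

definition after :: "'a \<Rightarrow> 'a \<Rightarrow> bool" where
  "after t s \<longleftrightarrow> s \<in> T \<and> ap pc s = ap pc t \<and> lt W t s"

lemma definable_after [definable, simp]: "definable_fn f \<Longrightarrow> definable_fn g \<Longrightarrow> definable (\<lambda>v. after (f v) (g v))"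
  by (rule definable_app2[of after]) (unfold after_def, intro definable)

lemma afterD: "after t s \<Longrightarrow> s \<in> T" "after t s \<Longrightarrow> ap pc s = ap pc t"
  unfolding after_def by blast+

lemma after_trans: "\<lbrakk>t \<in> T; after t s; after s r\<rbrakk> \<Longrightarrow> after t r"
  unfolding after_def using s.W_trans[of r t s] by metis

lemma after_ne: "t \<in> T \<Longrightarrow> after t s \<Longrightarrow> s \<noteq> t"
  unfolding after_def using s.W_irrefl by blast

lemma after_asym: "t \<in> T \<Longrightarrow> after t s \<Longrightarrow> \<not> after s t"
  using after_trans after_ne by blast

lemma after_total: "\<lbrakk>t \<in> T; s \<in> T; ap pc s = ap pc t\<rbrakk> \<Longrightarrow> s = t \<or> after t s \<or> after s t"
  unfolding after_def using s.W_total[of t s] by metis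

lemma mem_tail_iff_after: "t \<in> T \<Longrightarrow> s \<in> tail T W pc t \<longleftrightarrow> s = t \<or> after t s"
  unfolding after_def mem_tail by auto

lemma after_next: "t \<in> T \<Longrightarrow> after t s \<Longrightarrow> \<exists>r. after s r"
  using s.nontrivial_next[of s] s.W_irrefl unfolding after_def s.nontrivial_def by metis

lemma after_S:
  assumes t: "t \<in> T" and s: "after t s"
  shows "if ap d (ap pc t) = zero then lt S t s else lt S s t"
  using s.dir[OF t afterD(1)[OF s]] afterD(2)[OF s] s unfolding after_def by (auto split: if_splits)

lemma after_glue:
  assumes U: "s.full U" and T: "s \<in> T" "t \<in> T"
  shows "after (s.glue U s) (s.glue U t) \<longleftrightarrow> after s t"
  unfolding after_def using s.glue_T[OF U] s.glue_pc[OF U] glue_W[OF U] T by simp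

lemma glue_after: "s.full U \<Longrightarrow> t \<in> T \<Longrightarrow> s.glue U t = t \<or> after t (s.glue U t)"
  unfolding after_def using s.glue_ge s.glue_T s.glue_pc by blast

subsection \<open>Splitting positions\<close>

definition embedding :: "'a \<Rightarrow> 'a \<Rightarrow> bool" where
  "embedding f Y \<longleftrightarrow> order_iso f T S Y (lex k) \<and> Y \<subseteq> binary_seqs k"

abbreviation diff :: "'a \<Rightarrow> 'a \<Rightarrow> 'a \<Rightarrow> 'a" where
  "diff f s t \<equiv> first_diff k (ap f s) (ap f t)"

lemma definable_embedding [definable, simp]:
  "definable_fn f \<Longrightarrow> definable_fn Y \<Longrightarrow> definable (\<lambda>v. embedding (f v) (Y v))"
  by (rule definable_app2[of embedding]) (unfold embedding_def, intro definable)

lemma embeddingD: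
  assumes "embedding f Y"
  shows embedding_order_iso: "order_iso f T S Y (lex k)" and embedding_maps: "\<And>t. t \<in> T \<Longrightarrow> maps (ap f t) k two"
    and embedding_isomorphic: "isomorphic Y (lex k) T S"
proof -
  have f: "order_iso f T S Y (lex k)" "Y \<subseteq> binary_seqs k" using assms unfolding embedding_def by blast+
  show "order_iso f T S Y (lex k)" by (rule f(1))
  show "maps (ap f t) k two" if "t \<in> T" for t using subsetD[OF f(2) order_iso_mem[OF f(1) that]] by simp
  show "isomorphic Y (lex k) T S" using f(1) isomorphic_iff isomorphic_sym by blast
qed

lemmas embedding_mem = order_iso_mem[OF embedding_order_iso] and embedding_inj = order_iso_inj[OF embedding_order_iso]
  and embedding_less_iff = order_iso_less_iff[OF embedding_order_iso]

context
  fixes f Y :: 'a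
  assumes f: "embedding f Y"
begin

lemma diff_mem:
  assumes "s \<in> T" "t \<in> T" "s \<noteq> t"
  shows "diff f s t \<in> k"
  using first_diff_mem[OF ord_k embedding_maps[OF f assms(1)] embedding_maps[OF f assms(2)]]
    embedding_inj[OF f assms(1,2)] assms(3) by blast

lemma diff_bits:
  assumes "s \<in> T" "t \<in> T" "lt S s t"
  shows "ap (ap f s) (diff f s t) = zero" "ap (ap f t) (diff f s t) = one"
  using lex_bits[OF ord_k] embedding_less_iff[OF f] assms by blast+

lemma diff_outer:
  assumes "r \<in> T" "s \<in> T" "t \<in> T" "lt S r s" "lt S s t"
  shows "diff f r t \<subseteq> diff f r s" "diff f r t \<subseteq> diff f s t"
  using first_diff_outer[OF ord_k] embedding_less_iff[OF f] assms by blast+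

lemma diff_after_bits:
  assumes t: "t \<in> T" and s: "after t s"
  shows "ap (ap f t) (diff f t s) = (if ap d (ap pc t) = zero then zero else one)"
    and "ap (ap f s) (diff f t s) = (if ap d (ap pc t) = zero then one else zero)"
  using after_S[OF t s] diff_bits[OF t afterD(1)[OF s]] diff_bits[OF afterD(1)[OF s] t]
    first_diff_commute[of k "ap f s" "ap f t"] by (auto split: if_splits)

lemma diff_after_mem: "t \<in> T \<Longrightarrow> after t s \<Longrightarrow> diff f t s \<in> k"
  using diff_mem afterD(1) after_ne by metis

lemma diff_after:
  assumes t: "t \<in> T" and s: "after t s" and r: "after s r"
  shows "diff f t r \<subseteq> diff f t s" "diff f t r \<subseteq> diff f s r"
proof -
  note T = afterD(1)[OF s] afterD(1)[OF r]
  have "diff f t r \<subseteq> diff f t s \<and> diff f t r \<subseteq> diff f s r"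
  proof (cases "ap d (ap pc t) = zero")
    case True
    thus ?thesis using diff_outer[OF t T] after_S[OF t s] after_S[OF T(1) r] afterD(2)[OF s] by simp
  next
    case False
    thus ?thesis using diff_outer[OF T(2,1) t] after_S[OF t s] after_S[OF T(1) r] afterD(2)[OF s]
      first_diff_commute[of k "ap f t"] first_diff_commute[of k "ap f s" "ap f r"] by simp
  qed
  thus "diff f t r \<subseteq> diff f t s" "diff f t r \<subseteq> diff f s r" by blast+
qed

end

definition least_diff :: "'a \<Rightarrow> 'a \<Rightarrow> 'a" where
  "least_diff f t = sep k (\<lambda>z. (\<exists>s. after t s) \<and> (\<forall>s. after t s \<longrightarrow> z \<in> diff f t s))"

lemma definable_fn_least_diff [definable, simp]:
  "definable_fn f \<Longrightarrow> definable_fn g \<Longrightarrow> definable_fn (\<lambda>v. least_diff (f v) (g v))"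
  by (rule definable_fn_app2[of least_diff]) (unfold least_diff_def, intro definable)

lemma mem_least_diff: "z \<in> least_diff f t \<longleftrightarrow> z \<in> k \<and> (\<exists>s. after t s) \<and> (\<forall>s. after t s \<longrightarrow> z \<in> diff f t s)"
  unfolding least_diff_def by simp

lemma least_diff_le: "after t s \<Longrightarrow> least_diff f t \<subseteq> diff f t s"
  by (simp add: subset_def mem_least_diff)

lemma least_diff_last: "\<not> (\<exists>s. after t s) \<Longrightarrow> least_diff f t = zero"
  by (rule mem_ext) (simp add: mem_least_diff)

context
  fixes f Y :: 'a
  assumes f: "embedding f Y"
begin

lemma least_diff_attained:
  assumes t: "t \<in> T" and s: "after t s"
  obtains r where "after t r" "least_diff f t = diff f t r"
proof -
  obtain r where r: "after t r" "\<And>x. after t x \<Longrightarrow> diff f t r \<subseteq> diff f t x"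
    by (rule ord_arg_min[of "after t" s "diff f t"]) (use s diff_after_mem[OF f t] ord_mem[OF ord_k] in auto)
  have "z \<in> least_diff f t \<longleftrightarrow> z \<in> diff f t r" for z
    using r subsetD ord_trans[OF ord_k _ diff_after_mem[OF f t r(1)]] unfolding mem_least_diff by blast
  thus ?thesis using that[OF r(1)] mem_ext by blast
qed

lemma least_diff_mem:
  assumes "t \<in> T" shows "least_diff f t \<in> k"
proof (cases "\<exists>s. after t s")
  case True
  thus ?thesis using least_diff_attained[OF assms] diff_after_mem[OF f assms] by metis
next
  case False
  thus ?thesis using least_diff_last subsetD[OF omega_subset zero_omega] by simp
qed

lemma least_diff_ord: "t \<in> T \<Longrightarrow> ordinal (least_diff f t)"
  using least_diff_mem ord_mem[OF ord_k] by blast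

lemma least_diff_mono:
  assumes t: "t \<in> T" and s: "after t s"
  shows "least_diff f t \<subseteq> least_diff f s"
proof -
  obtain r where r: "after s r" "least_diff f s = diff f s r"
    using after_next[OF t s] least_diff_attained[OF afterD(1)[OF s]] by metis
  have "least_diff f t \<subseteq> diff f t r" using least_diff_le[OF after_trans[OF t s r(1)]] .
  also have "\<dots> \<subseteq> diff f s r" using diff_after(2)[OF f t s r(1)] .
  finally show ?thesis using r by simp
qed

text \<open>A sequence that splits at the same place from an earlier and from a later one would take both values there.\<close>

lemma least_diff_increases:
  assumes t: "t \<in> T" and s: "after t s"
  obtains r where "after t r" "least_diff f t \<in> least_diff f r"
proof -
  obtain r where r: "after t r" "least_diff f t = diff f t r" using least_diff_attained[OF t s] .
  note rT = afterD(1)[OF r(1)]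
  obtain q where q: "after r q" "least_diff f r = diff f r q"
    using after_next[OF t r(1)] least_diff_attained[OF rT] by metis
  have "least_diff f t \<noteq> least_diff f r"
    using diff_after_bits(2)[OF f t r(1)] diff_after_bits(1)[OF f rT q(1)] afterD(2)[OF r(1)] r(2) q(2)
    by (auto split: if_splits)
  hence "least_diff f t \<in> least_diff f r"
    using least_diff_mono[OF t r(1)] ord_subset_iff[OF least_diff_ord[OF t] least_diff_ord[OF rT]] by blast
  thus ?thesis using that r(1) by blast
qed

end

subsection \<open>Levels\<close>

definition unbounded :: "'a \<Rightarrow> 'a \<Rightarrow> bool" where
  "unbounded f t \<longleftrightarrow> (\<forall>x. x \<in> k \<longrightarrow> (\<exists>s. s \<in> T \<and> ap pc s = ap pc t \<and> x \<subseteq> least_diff f s))"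

definition cof_index :: "'a \<Rightarrow> 'a" where
  "cof_index x = desc (\<lambda>y. y \<in> \<rho> \<and> x \<subseteq> ap c y \<and> (\<forall>z. z \<in> y \<longrightarrow> \<not> x \<subseteq> ap c z))"

definition level :: "'a \<Rightarrow> 'a \<Rightarrow> 'a" where
  "level f t = (if unbounded f t then cof_index (least_diff f t) else least_diff f t)"

lemma definable_unbounded [definable, simp]:
  "definable_fn f \<Longrightarrow> definable_fn g \<Longrightarrow> definable (\<lambda>v. unbounded (f v) (g v))"
  by (rule definable_app2[of unbounded]) (unfold unbounded_def, intro definable)

lemma definable_fn_cof_index [definable, simp]: "definable_fn f \<Longrightarrow> definable_fn (\<lambda>v. cof_index (f v))"
  by (rule definable_fn_app1[of cof_index]) (unfold cof_index_def, intro definable)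

lemma definable_fn_level [definable, simp]:
  "definable_fn f \<Longrightarrow> definable_fn g \<Longrightarrow> definable_fn (\<lambda>v. level (f v) (g v))"
  unfolding level_def by (intro definable)

lemma unbounded_cong: "ap pc s = ap pc t \<Longrightarrow> unbounded f s \<longleftrightarrow> unbounded f t"
  unfolding unbounded_def by simp

lemma unbounded_singular:
  assumes f: "embedding f Y" and t: "t \<in> T" and unbounded: "unbounded f t"
  shows "\<rho> \<in> k" "\<And>x. x \<in> \<rho> \<Longrightarrow> ap c x \<in> k" "\<And>x. x \<in> k \<Longrightarrow> \<exists>y. y \<in> \<rho> \<and> x \<subseteq> ap c y"
proof -
  let ?P = "piece T pc t"
  note wo = s.well_ord_piece[OF t]
  define c' where "c' = lam (s.piece_type t) (\<lambda>x. least_diff f (nth_elt ?P W x))"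
  have c': "ap c' x = least_diff f (nth_elt ?P W x)" if "x \<in> s.piece_type t" for x
    unfolding c'_def using that by (intro ap_lam) simp_all
  have "\<rho> \<in> k \<and> (\<forall>x. x \<in> \<rho> \<longrightarrow> ap c x \<in> k) \<and> (\<forall>x. x \<in> k \<longrightarrow> (\<exists>y. y \<in> \<rho> \<and> x \<subseteq> ap c y))"
  proof (rule singular[OF small[OF t], of c'])
    show "ap c' x \<in> k" if "x \<in> s.piece_type t" for x
      using c'[OF that] least_diff_mem[OF f] nth_elt_mem[OF wo that] by simp
    show "\<exists>y. y \<in> s.piece_type t \<and> x \<subseteq> ap c' y" if "x \<in> k" for x
    proof -
      obtain s where s: "s \<in> ?P" "x \<subseteq> least_diff f s" using unbounded \<open>x \<in> k\<close> unfolding unbounded_def by auto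
      thus ?thesis
        using c'[OF ordermap_mem[OF wo s(1)]] nth_elt_ordermap[OF wo s(1)] ordermap_mem[OF wo s(1)] by metis
    qed
  qed
  thus "\<rho> \<in> k" "\<And>x. x \<in> \<rho> \<Longrightarrow> ap c x \<in> k" "\<And>x. x \<in> k \<Longrightarrow> \<exists>y. y \<in> \<rho> \<and> x \<subseteq> ap c y" by blast+
qed

context
  assumes \<rho>: "\<rho> \<in> k" and cofinal: "\<And>x. x \<in> k \<Longrightarrow> \<exists>y. y \<in> \<rho> \<and> x \<subseteq> ap c y"
begin

lemma cof_index:
  assumes x: "x \<in> k"
  shows cof_index_mem: "cof_index x \<in> \<rho>" and cof_index_le: "x \<subseteq> ap c (cof_index x)"
    and cof_index_least: "\<And>z. z \<in> cof_index x \<Longrightarrow> \<not> x \<subseteq> ap c z"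
proof -
  note ord_\<rho> = ord_mem[OF ord_k \<rho>]
  let ?P = "\<lambda>y. y \<in> \<rho> \<and> x \<subseteq> ap c y"
  obtain y where y: "?P y" using cofinal x by blast
  hence "ordinal y" using ord_mem[OF ord_\<rho>] by blast
  then obtain m where m: "?P m" "\<And>z. z \<in> m \<Longrightarrow> \<not> ?P z" by (rule ord_least[of y ?P]) (use y in simp_all)
  have least: "\<not> x \<subseteq> ap c z" if "z \<in> m" for z using m ord_trans[OF ord_\<rho> that] that by blast
  have "cof_index x = m" unfolding cof_index_def
  proof (rule desc_eq)
    show "y = m" if "y \<in> \<rho> \<and> x \<subseteq> ap c y \<and> (\<forall>z. z \<in> y \<longrightarrow> \<not> x \<subseteq> ap c z)" for y
      using ord_linear[OF ord_mem[OF ord_\<rho>, of y] ord_mem[OF ord_\<rho>, of m]] m(1) least that by blast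
  qed (use m(1) least in blast)
  thus "cof_index x \<in> \<rho>" "x \<subseteq> ap c (cof_index x)" "\<And>z. z \<in> cof_index x \<Longrightarrow> \<not> x \<subseteq> ap c z" using m least by simp_all
qed

lemma cof_index_ord: "x \<in> k \<Longrightarrow> ordinal (cof_index x)"
  using cof_index_mem ord_mem ord_mem[OF ord_k \<rho>] by blast

lemma cof_index_mono: "\<lbrakk>x \<in> k; y \<in> k; x \<subseteq> y\<rbrakk> \<Longrightarrow> cof_index x \<subseteq> cof_index y"
  using cof_index_least cof_index_le subset_trans ord_not_mem[OF cof_index_ord cof_index_ord] by metis

lemma cof_index_less:
  assumes "x \<in> k" "y \<in> k" "x \<subseteq> y" "ap c (cof_index x) \<in> y"
  shows "cof_index x \<in> cof_index y"
proof -
  have "cof_index x \<noteq> cof_index y" using cof_index_le[OF assms(2)] assms(4) subsetD mem_irrefl by metis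
  thus ?thesis using cof_index_mono[OF assms(1-3)] ord_subset_iff[OF cof_index_ord cof_index_ord] assms(1,2) by blast
qed

end

context
  fixes f Y :: 'a
  assumes f: "embedding f Y"
begin

lemma level_mono:
  assumes t: "t \<in> T" and s: "after t s"
  shows "level f t \<subseteq> level f s"
  unfolding level_def unbounded_cong[OF afterD(2)[OF s]]
  using cof_index_mono[OF unbounded_singular(1,3)[OF f t] least_diff_mem[OF f t] least_diff_mem[OF f afterD(1)[OF s]]]
    least_diff_mono[OF f t s] by simp

lemma unbounded_above:
  assumes t: "t \<in> T" and next_ex: "after t q" and unbounded: "unbounded f t" and x: "x \<in> k"
  obtains s where "after t s" "x \<in> least_diff f s"
proof -
  obtain r where r: "r \<in> T" "ap pc r = ap pc t" "x \<subseteq> least_diff f r"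
    using unbounded x unfolding unbounded_def by blast
  obtain u where u: "after t u" "x \<subseteq> least_diff f u"
  proof -
    consider "after t r" | "r = t" | "after r t" using after_total[OF t r(1,2)] by blast
    hence "after t r \<or> after r q" using next_ex after_trans[OF r(1)] by cases blast+
    thus ?thesis using that next_ex r least_diff_mono[OF f r(1)] subset_trans by blast
  qed
  note uT = afterD(1)[OF u(1)]
  obtain v where v: "after u v" using after_next[OF t u(1)] by blast
  then obtain s where s: "after u s" "least_diff f u \<in> least_diff f s" using least_diff_increases[OF f uT] by blast
  have "x \<in> least_diff f s"
    by (rule ord_le_lt[OF ord_mem[OF ord_k x] least_diff_ord[OF f uT] least_diff_ord[OF f afterD(1)[OF s(1)]] u(2) s(2)])
  thus ?thesis using that after_trans[OF t u(1) s(1)] by blast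
qed

lemma level_increases:
  assumes t: "t \<in> T" and q: "after t q"
  obtains s where "after t s" "level f t \<in> level f s"
proof (cases "unbounded f t")
  case True
  note singular = unbounded_singular[OF f t True]
  have "ap c (cof_index (least_diff f t)) \<in> k"
    by (rule singular(2)[OF cof_index_mem[OF singular(1,3) least_diff_mem[OF f t]]])
  then obtain s where s: "after t s" "ap c (cof_index (least_diff f t)) \<in> least_diff f s"
    using unbounded_above[OF t q True] by blast
  have "cof_index (least_diff f t) \<in> cof_index (least_diff f s)"
    by (rule cof_index_less[OF singular(1,3) least_diff_mem[OF f t] least_diff_mem[OF f afterD(1)[OF s(1)]]
        least_diff_mono[OF f t s(1)] s(2)])
  thus ?thesis using that[OF s(1)] True unbounded_cong[OF afterD(2)[OF s(1)]] unfolding level_def by simp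
next
  case False
  obtain s where s: "after t s" "least_diff f t \<in> least_diff f s" using least_diff_increases[OF f t q] .
  thus ?thesis using that[OF s(1)] False unbounded_cong[OF afterD(2)[OF s(1)]] unfolding level_def by simp
qed

lemma level_bounded:
  assumes t: "t \<in> T"
  shows "\<exists>b. b \<in> k \<and> (\<forall>s. s \<in> T \<and> ap pc s = ap pc t \<longrightarrow> level f s \<in> b)"
proof (cases "unbounded f t")
  case True
  note singular = unbounded_singular[OF f t True]
  have "level f s \<in> \<rho>" if "s \<in> T" "ap pc s = ap pc t" for s
    unfolding level_def
    using True unbounded_cong[OF that(2)] cof_index_mem[OF singular(1,3) least_diff_mem[OF f that(1)]] by simp
  thus ?thesis using singular(1) by blast
next
  case False
  then obtain b where b: "b \<in> k" "\<And>s. s \<in> T \<Longrightarrow> ap pc s = ap pc t \<Longrightarrow> \<not> b \<subseteq> least_diff f s"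
    unfolding unbounded_def by blast
  have "level f s \<in> b" if "s \<in> T" "ap pc s = ap pc t" for s
    unfolding level_def using False unbounded_cong[OF that(2)] b(2)[OF that]
      ord_not_mem[OF least_diff_ord[OF f that(1)] ord_mem[OF ord_k b(1)]] by auto
  thus ?thesis using b(1) by blast
qed

lemma level_mem: "t \<in> T \<Longrightarrow> level f t \<in> k"
  using level_bounded ord_trans[OF ord_k] by blast

lemma level_ord: "t \<in> T \<Longrightarrow> ordinal (level f t)"
  using level_mem ord_mem[OF ord_k] by blast

end

definition level_sup :: "'a \<Rightarrow> 'a" where
  "level_sup f = sep k (\<lambda>z. \<exists>t. t \<in> T \<and> z \<subseteq> level f t)"

lemma definable_fn_level_sup [definable, simp]: "definable_fn f \<Longrightarrow> definable_fn (\<lambda>v. level_sup (f v))"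
  by (rule definable_fn_app1[of level_sup]) (unfold level_sup_def, intro definable)

lemma mem_level_sup: "z \<in> level_sup f \<longleftrightarrow> z \<in> k \<and> (\<exists>t. t \<in> T \<and> z \<subseteq> level f t)"
  unfolding level_sup_def by simp

lemma level_mem_sup: "embedding f Y \<Longrightarrow> t \<in> T \<Longrightarrow> level f t \<in> level_sup f"
  unfolding mem_level_sup using level_mem subset_refl by blast

lemma level_sup_mem:
  assumes f: "embedding f Y" shows "level_sup f \<in> k"
proof -
  obtain b where b: "b \<in> k" "\<And>Z. Z \<in> s.piece_set \<Longrightarrow> \<forall>t. t \<in> Z \<longrightarrow> level f t \<in> b"
  proof (rule fin_uniform_bound[OF ord_k subsetD[OF omega_subset zero_omega] _ _ s.fin_piece_set, of "\<lambda>Z b. \<forall>t. t \<in> Z \<longrightarrow> level f t \<in> b"])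
    show "\<exists>b. b \<in> k \<and> (\<forall>t. t \<in> Z \<longrightarrow> level f t \<in> b)" if "Z \<in> s.piece_set" for Z
      using that level_bounded[OF f] s.mem_piece_set by auto
  qed (use subsetD in auto)
  have bound: "level f t \<in> b" if "t \<in> T" for t using b(2)[of "piece T pc t"] that s.mem_piece_set by auto
  have "z \<in> b" if z: "z \<in> level_sup f" for z
  proof -
    obtain t where t: "z \<in> k" "t \<in> T" "z \<subseteq> level f t" using z unfolding mem_level_sup by blast
    show ?thesis
      by (rule ord_le_lt[OF ord_mem[OF ord_k t(1)] level_ord[OF f t(2)] ord_mem[OF ord_k b(1)] t(3) bound[OF t(2)]])
  qed
  hence "level_sup f \<subseteq> b" by (rule subsetI)
  moreover have "ordinal (level_sup f)"
  proof (rule ord_memI)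
    show "x \<in> level_sup f" if "y \<in> level_sup f" "x \<in> y" for x y
      using that ord_trans[OF ord_k] ord_mem_subset[OF ord_mem[OF ord_k]] subset_trans
      unfolding mem_level_sup by metis
  qed (use ord_mem[OF ord_k] mem_level_sup in blast)
  ultimately show ?thesis using ord_le_lt[OF _ ord_mem[OF ord_k b(1)] ord_k _ b(1)] by blast
qed

definition position :: "'a \<Rightarrow> 'a \<Rightarrow> 'a" where
  "position f t = lexpos M (level_sup f) (ap wp t) (level f t)"

lemma definable_fn_position [definable, simp]:
  "definable_fn f \<Longrightarrow> definable_fn g \<Longrightarrow> definable_fn (\<lambda>v. position (f v) (g v))"
  unfolding position_def by (intro definable)

definition first_in :: "'a \<Rightarrow> 'a \<Rightarrow> bool" where
  "first_in U s \<longleftrightarrow> s \<in> U \<and> \<not> (\<exists>r. r \<in> U \<and> after r s)"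

definition repeated_in :: "'a \<Rightarrow> 'a \<Rightarrow> 'a \<Rightarrow> bool" where
  "repeated_in U f s \<longleftrightarrow> s \<in> U \<and> (\<exists>t. t \<in> U \<and> after s t \<and> level f s = level f t)"

definition repeats :: "'a \<Rightarrow> 'a \<Rightarrow> bool" where
  "repeats U f \<longleftrightarrow> (\<exists>s. repeated_in U f s)"

definition repeats_first :: "'a \<Rightarrow> 'a \<Rightarrow> bool" where
  "repeats_first U f \<longleftrightarrow> (\<exists>s. first_in U s \<and> repeated_in U f s)"

lemma definable_first_in [definable, simp]:
  "definable_fn U \<Longrightarrow> definable_fn g \<Longrightarrow> definable (\<lambda>v. first_in (U v) (g v))"
  by (rule definable_app2[of first_in]) (unfold first_in_def, intro definable)

lemma definable_repeated_in [definable, simp]: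
  "\<lbrakk>definable_fn U; definable_fn f; definable_fn g\<rbrakk> \<Longrightarrow> definable (\<lambda>v. repeated_in (U v) (f v) (g v))"
  by (rule definable_app3[of repeated_in]) (unfold repeated_in_def, intro definable)

lemma definable_repeats [definable, simp]:
  "definable_fn U \<Longrightarrow> definable_fn f \<Longrightarrow> definable (\<lambda>v. repeats (U v) (f v))"
  by (rule definable_app2[of repeats]) (unfold repeats_def, intro definable)

lemma definable_repeats_first [definable, simp]:
  "definable_fn U \<Longrightarrow> definable_fn f \<Longrightarrow> definable (\<lambda>v. repeats_first (U v) (f v))"
  by (rule definable_app2[of repeats_first]) (unfold repeats_first_def, intro definable)

lemma position_mem: "embedding f Y \<Longrightarrow> t \<in> T \<Longrightarrow> position f t \<in> k"
  unfolding position_def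
  using lexpos_mem_initial[OF initial omega_subset w.N_omega level_sup_mem w.pc_mem level_mem_sup] by blast

lemma position_less:
  assumes f: "embedding f Y" and inj: "\<not> repeats T f" and st: "s \<in> T" "t \<in> T" and less: "lt W s t"
  shows "position f s \<in> position f t"
proof -
  have "level f s \<in> level f t" if "ap wp s = ap wp t"
  proof -
    have a: "after s t" unfolding after_def using that pc_wp[OF st] st less by simp
    hence "level f s \<noteq> level f t" using inj st unfolding repeats_def repeated_in_def by blast
    thus ?thesis using level_mono[OF f st(1) a] ord_subset_iff level_ord[OF f] st by blast
  qed
  moreover have "ap wp s \<in> ap wp t \<or> ap wp s = ap wp t" using w.pc_le[OF st less] .
  moreover have "position f s \<in> position f t \<longleftrightarrow> ap wp s \<in> ap wp t \<or> ap wp s = ap wp t \<and> level f s \<in> level f t"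
    unfolding position_def
    by (rule lexpos_less_iff[OF ord_omega_mem[OF w.N_omega] ord_mem[OF ord_k level_sup_mem[OF f]]])
      (use w.pc_mem level_mem_sup[OF f] st in blast)+
  ultimately show ?thesis by blast
qed

subsection \<open>Passing to a subcopy\<close>

definition subcopy :: "'a \<Rightarrow> 'a \<Rightarrow> 'a" where
  "subcopy f U = lam T (\<lambda>t. ap f (s.glue U t))"

lemma subcopy_ap: "t \<in> T \<Longrightarrow> ap (subcopy f U) t = ap f (s.glue U t)"
  unfolding subcopy_def by (rule ap_lam) simp_all

context
  fixes f Y U :: 'a
  assumes f: "embedding f Y" and U: "s.full U"
begin

lemma img_full_subset: "img (ap f) U \<subseteq> Y"
  using embedding_mem[OF f] subsetD[OF s.full_subset[OF U]] by (auto simp: subset_def)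

lemma subcopy_embedding: "embedding (subcopy f U) (img (ap f) U)"
  unfolding embedding_def order_iso_def
proof (intro conjI allI impI)
  note glue_T = s.glue_T[OF U]
  have "bij_betw (ap f) (elts U) (elts (img (ap f) U))"
    by (rule bij_betw_img) (use embedding_inj[OF f] subsetD[OF s.full_subset[OF U]] in auto)
  hence "bij_betw (\<lambda>t. ap f (s.glue U t)) (elts T) (elts (img (ap f) U))"
    using bij_betw_trans[OF s.glue_bij[OF U]] by (simp add: comp_def)
  thus "bij_betw (ap (subcopy f U)) (elts T) (elts (img (ap f) U))"
    unfolding subcopy_def by (rule bij_betw_ap_lam[rotated]) simp
  show "fun_on (subcopy f U) T" unfolding subcopy_def by simp
  show "lt S s t \<longleftrightarrow> lt (lex k) (ap (subcopy f U) s) (ap (subcopy f U) t)" if "s \<in> T \<and> t \<in> T" for s t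
    using s.glue_R[OF U] embedding_less_iff[OF f glue_T glue_T] subcopy_ap that by simp
  show "img (ap f) U \<subseteq> binary_seqs k" using img_full_subset f subset_trans unfolding embedding_def by blast
qed

lemma least_diff_glue: "t \<in> T \<Longrightarrow> least_diff f t \<subseteq> least_diff f (s.glue U t)"
  using glue_after[OF U] least_diff_mono[OF f] subset_refl by metis

lemma least_diff_subcopy:
  assumes t: "t \<in> T"
  shows "least_diff (subcopy f U) t = least_diff f (s.glue U t)"
proof (cases "\<exists>s. after t s")
  case True
  have glue_t: "s.glue U t \<in> T" using s.glue_T[OF U t] .
  have diff_eq: "diff (subcopy f U) t s = diff f (s.glue U t) (s.glue U s)" if "s \<in> T" for s
    using subcopy_ap t that by simp
  obtain s where s: "after t s" "least_diff (subcopy f U) t = diff (subcopy f U) t s"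
    using True least_diff_attained[OF subcopy_embedding t] by blast
  hence glue_s: "after (s.glue U t) (s.glue U s)" using after_glue[OF U t afterD(1)] by blast
  obtain r where r: "after (s.glue U t) r" "least_diff f (s.glue U t) = diff f (s.glue U t) r"
    using least_diff_attained[OF f glue_t glue_s] .
  note rT = afterD(1)[OF r(1)]
  have "after (s.glue U t) (s.glue U r)" "diff f (s.glue U t) (s.glue U r) \<subseteq> diff f (s.glue U t) r"
    using glue_after[OF U rT] after_trans[OF glue_t r(1)] diff_after(1)[OF f glue_t r(1)] r(1) subset_refl by metis+
  hence "least_diff (subcopy f U) t \<subseteq> least_diff f (s.glue U t)"
    using least_diff_le[of t r "subcopy f U"] after_glue[OF U t rT] diff_eq[OF rT] r(2) subset_trans by metis
  moreover have "least_diff f (s.glue U t) \<subseteq> least_diff (subcopy f U) t"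
    using least_diff_le[OF glue_s] diff_eq[OF afterD(1)[OF s(1)]] s(2) by simp
  ultimately show ?thesis by (rule subset_antisym)
next
  case False
  have "\<not> after (s.glue U t) r" for r
  proof
    assume r: "after (s.glue U t) r"
    note rT = afterD(1)[OF r]
    have "after (s.glue U t) (s.glue U r)" using glue_after[OF U rT] after_trans[OF s.glue_T[OF U t] r] r by metis
    thus False using after_glue[OF U t rT] False by blast
  qed
  thus ?thesis using least_diff_last False by metis
qed

lemma unbounded_subcopy:
  assumes t: "t \<in> T"
  shows "unbounded (subcopy f U) t \<longleftrightarrow> unbounded f (s.glue U t)"
proof -
  have "(\<exists>s. s \<in> T \<and> ap pc s = ap pc t \<and> x \<subseteq> least_diff (subcopy f U) s) \<longleftrightarrow>
    (\<exists>s. s \<in> T \<and> ap pc s = ap pc t \<and> x \<subseteq> least_diff f s)" (is "?L \<longleftrightarrow> ?R") for x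
  proof
    assume ?L
    then obtain s where s: "s \<in> T" "ap pc s = ap pc t" "x \<subseteq> least_diff (subcopy f U) s" by blast
    thus ?R using least_diff_subcopy s.glue_T[OF U] s.glue_pc[OF U] by metis
  next
    assume ?R
    then obtain s where s: "s \<in> T" "ap pc s = ap pc t" "x \<subseteq> least_diff f s" by blast
    hence "x \<subseteq> least_diff (subcopy f U) s" using subset_trans least_diff_glue least_diff_subcopy by metis
    thus ?L using s by blast
  qed
  thus ?thesis unfolding unbounded_def s.glue_pc[OF U t] by blast
qed

lemma level_subcopy: "t \<in> T \<Longrightarrow> level (subcopy f U) t = level f (s.glue U t)"
  unfolding level_def by (simp add: least_diff_subcopy unbounded_subcopy)

lemma level_sup_subcopy: "level_sup (subcopy f U) = level_sup f"
proof (rule mem_ext)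
  have le: "level f t \<subseteq> level (subcopy f U) t" if "t \<in> T" for t
    using glue_after[OF U that] level_mono[OF f that] level_subcopy[OF that] subset_refl by metis
  have "\<exists>s. s \<in> T \<and> z \<subseteq> level f s" if "t \<in> T" "z \<subseteq> level (subcopy f U) t" for t z
    using that level_subcopy s.glue_T[OF U] by metis
  thus "z \<in> level_sup (subcopy f U) \<longleftrightarrow> z \<in> level_sup f" for z
    unfolding mem_level_sup using subset_trans[OF _ le] by blast
qed

lemma position_subcopy: "t \<in> T \<Longrightarrow> position (subcopy f U) t = position f (s.glue U t)"
  unfolding position_def using pc_wp[of "s.glue U t" t]
  by (simp add: level_sup_subcopy level_subcopy s.glue_pc[OF U] s.glue_T[OF U])

lemma glue_ex: "u \<in> U \<longleftrightarrow> (\<exists>t. t \<in> T \<and> u = s.glue U t)"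
  using s.glue_mem[OF U] s.glue_surj[OF U] by metis

lemma first_in_glue: "t \<in> T \<Longrightarrow> first_in T t \<longleftrightarrow> first_in U (s.glue U t)"
  unfolding first_in_def using after_glue[OF U] s.glue_mem[OF U] glue_ex by metis

lemma repeated_in_subcopy: "t \<in> T \<Longrightarrow> repeated_in T (subcopy f U) t \<longleftrightarrow> repeated_in U f (s.glue U t)"
  unfolding repeated_in_def using after_glue[OF U] s.glue_mem[OF U] glue_ex level_subcopy by metis

lemma repeats_subcopy: "repeats T (subcopy f U) \<longleftrightarrow> repeats U f" "repeats_first T (subcopy f U) \<longleftrightarrow> repeats_first U f"
proof -
  have mem: "s \<in> U" if "repeated_in U g s" for s g using that unfolding repeated_in_def by blast
  show "repeats T (subcopy f U) \<longleftrightarrow> repeats U f"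
    unfolding repeats_def using repeated_in_subcopy mem s.glue_surj[OF U] repeated_in_def by metis
  show "repeats_first T (subcopy f U) \<longleftrightarrow> repeats_first U f"
    unfolding repeats_first_def using repeated_in_subcopy first_in_glue mem s.glue_surj[OF U] repeated_in_def by metis
qed

end

subsection \<open>Canonical embeddings\<close>

text \<open>
  Consecutive pieces of which the left one is reversed and the right one is not: the only place
  where an automorphism of \<open>T\<close> can move points between pieces.
\<close>

definition junction :: "'a \<Rightarrow> 'a \<Rightarrow> bool" where
  "junction s t \<longleftrightarrow> s \<in> T \<and> t \<in> T \<and> ap d (ap pc s) \<noteq> zero \<and> ap d (ap pc t) = zero \<and> ap pc s \<in> ap pc t \<and>
     \<not> (\<exists>r. r \<in> T \<and> ap pc s \<in> ap pc r \<and> ap pc r \<in> ap pc t)"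

definition facing :: "'a \<Rightarrow> 'a \<Rightarrow> bool" where
  "facing s t \<longleftrightarrow> junction s t \<or> junction t s"

definition canonical :: "'a \<Rightarrow> bool" where
  "canonical f \<longleftrightarrow> (\<forall>s t s' t'. facing s t \<and> facing s' t' \<and> ap pc s' = ap pc s \<and> ap pc t' = ap pc t \<longrightarrow>
     diff f s' t' = diff f s t)"

lemma canonicalD:
  "\<lbrakk>canonical f; facing s t; facing s' t'; ap pc s' = ap pc s; ap pc t' = ap pc t\<rbrakk> \<Longrightarrow> diff f s' t' = diff f s t"
  unfolding canonical_def by blast

lemma definable_junction [definable, simp]:
  "definable_fn f \<Longrightarrow> definable_fn g \<Longrightarrow> definable (\<lambda>v. junction (f v) (g v))"
  by (rule definable_app2[of junction]) (unfold junction_def, intro definable)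

lemma definable_facing [definable, simp]:
  "definable_fn f \<Longrightarrow> definable_fn g \<Longrightarrow> definable (\<lambda>v. facing (f v) (g v))"
  unfolding facing_def by (intro definable)

lemma definable_canonical [definable, simp]: "definable_fn f \<Longrightarrow> definable (\<lambda>v. canonical (f v))"
  by (rule definable_app1[of canonical]) (unfold canonical_def, intro definable)

lemma junction_less: "junction s t \<Longrightarrow> lt S s t"
  unfolding junction_def using s.pc_less by blast

lemma facing_commute: "facing s t \<longleftrightarrow> facing t s"
  unfolding facing_def by blast

lemma facing_mem: "facing s t \<Longrightarrow> s \<in> T" "facing s t \<Longrightarrow> t \<in> T"
  unfolding facing_def junction_def by blast+

lemma facing_ne: "facing s t \<Longrightarrow> ap pc s \<noteq> ap pc t"
  unfolding facing_def junction_def using mem_irrefl by metis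

lemma junction_cong:
  "\<lbrakk>junction s t; s' \<in> T; ap pc s' = ap pc s; t' \<in> T; ap pc t' = ap pc t\<rbrakk> \<Longrightarrow> junction s' t'"
  unfolding junction_def by simp

lemma facing_cong:
  "\<lbrakk>facing s t; s' \<in> T; ap pc s' = ap pc s; t' \<in> T; ap pc t' = ap pc t\<rbrakk> \<Longrightarrow> facing s' t'"
  unfolding facing_def using junction_cong by blast

lemma facing_unique:
  assumes "facing t s" "facing t s'" shows "ap pc s = ap pc s'"
  using assms s.pc_cases[OF facing_mem(2)[OF assms(1)] facing_mem(2)[OF assms(2)]]
  unfolding facing_def junction_def by auto

lemma facing_after:
  assumes f: "embedding f Y" and facing: "facing t s" and u: "after t u"
  shows "facing u s" and "diff f u s \<subseteq> diff f t s"
proof -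
  note T = facing_mem[OF facing] afterD(1)[OF u]
  show "facing u s" by (rule facing_cong[OF facing T(3) afterD(2)[OF u] T(2) refl])
  show "diff f u s \<subseteq> diff f t s"
  proof (cases "junction t s")
    case True
    hence "lt S u t" using after_S[OF T(1) u] unfolding junction_def by simp
    thus ?thesis using diff_outer(2)[OF f T(3,1,2)] junction_less[OF True] by blast
  next
    case False
    hence st: "junction s t" using facing unfolding facing_def by blast
    hence "lt S t u" using after_S[OF T(1) u] unfolding junction_def by simp
    hence "diff f s u \<subseteq> diff f s t" using diff_outer(1)[OF f T(2,1,3)] junction_less[OF st] by blast
    thus ?thesis using first_diff_commute by metis
  qed
qed

lemma canonical_subcopy:
  assumes U: "s.full U" and split: "\<And>s t s' t'. \<lbrakk>s \<in> U; t \<in> U; s' \<in> U; t' \<in> U; facing s t; facing s' t';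
      ap pc s' = ap pc s; ap pc t' = ap pc t\<rbrakk> \<Longrightarrow> diff f s' t' = diff f s t"
  shows "canonical (subcopy f U)"
  unfolding canonical_def
proof (intro allI impI)
  fix s t s' t' assume st: "facing s t \<and> facing s' t' \<and> ap pc s' = ap pc s \<and> ap pc t' = ap pc t"
  hence T: "s \<in> T" "t \<in> T" "s' \<in> T" "t' \<in> T" using facing_mem by blast+
  note glue = s.glue_mem[OF U] s.glue_pc[OF U] s.glue_T[OF U]
  have "facing (s.glue U s) (s.glue U t)" "facing (s.glue U s') (s.glue U t')"
    using facing_cong[of s t "s.glue U s" "s.glue U t"] facing_cong[of s' t' "s.glue U s'" "s.glue U t'"] st glue T
    by simp_all
  hence "diff f (s.glue U s') (s.glue U t') = diff f (s.glue U s) (s.glue U t)"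
    by (intro split) (use st glue T in simp_all)
  thus "diff (subcopy f U) s' t' = diff (subcopy f U) s t" using subcopy_ap T by simp
qed

lemma moved_up_junction:
  assumes a: "piece_self_embedding mem T S W pc N d a" and b: "piece_self_embedding mem T S W pc N d b"
    and inverse: "b (a t) = t" and t: "t \<in> T" and up: "ap pc t \<in> ap pc (a t)"
  shows "junction t (a t)"
proof -
  interpret a: piece_self_embedding mem T S W pc N d a by (rule a)
  interpret b: piece_self_embedding mem T S W pc N d b by (rule b)
  note at = a.F_mem[OF t]
  have ne: "ap pc t \<noteq> ap pc (a t)" "\<not> ap pc (a t) \<in> ap pc t" using up mem_irrefl mem_asym by metis+
  have "s.earlier (a t) t" using a.image_earlier[OF t] ne by metis
  hence left: "ap d (ap pc t) \<noteq> zero" using ne(2) unfolding s.earlier_def by auto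
  have "s.earlier t (a t)" using b.image_earlier[OF at] ne inverse by metis
  hence right: "ap d (ap pc (a t)) = zero" using ne(2) unfolding s.earlier_def by (auto split: if_splits)
  have "\<not> ap pc r \<in> ap pc (a t)" if r: "r \<in> T" "ap pc t \<in> ap pc r" for r
  proof -
    obtain u where u: "u \<in> T" "ap pc u = ap pc r" "\<And>s. s \<in> tail T W pc u \<Longrightarrow> ap pc (a s) = ap pc r"
      using a.fixed_tail[OF r(1)] by blast
    have "lt S (a t) (a u)" using a.F_less[OF t u(1)] s.pc_less[OF t u(1)] r(2) u(2) by simp
    hence "ap pc (a t) \<in> ap pc r \<or> ap pc (a t) = ap pc r"
      using s.pc_le[OF at a.F_mem[OF u(1)]] u(3)[OF s.tail_refl[OF u(1)]] by simp
    thus ?thesis using mem_asym mem_irrefl by metis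
  qed
  thus ?thesis unfolding junction_def using t at left right up by blast
qed

lemma canonical_not_moved_up:
  assumes f: "embedding f Y" "canonical f" and f': "embedding f' Y" "canonical f'"
    and a: "piece_self_embedding mem T S W pc N d a" and b: "piece_self_embedding mem T S W pc N d b"
    and inverse: "\<And>t. t \<in> T \<Longrightarrow> b (a t) = t" "\<And>t. t \<in> T \<Longrightarrow> a (b t) = t"
    and eq: "\<And>t. t \<in> T \<Longrightarrow> ap f t = ap f' (a t)" and t: "t \<in> T"
  shows "\<not> ap pc t \<in> ap pc (a t)"
proof
  assume up: "ap pc t \<in> ap pc (a t)"
  interpret a: piece_self_embedding mem T S W pc N d a by (rule a)
  interpret b: piece_self_embedding mem T S W pc N d b by (rule b)
  note at = a.F_mem[OF t]
  have junction: "junction t (a t)" by (rule moved_up_junction[OF a b inverse(1)[OF t] t up])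
  obtain u where u: "u \<in> T" "ap pc u = ap pc t" "\<And>s. s \<in> tail T W pc u \<Longrightarrow> ap pc (a s) = ap pc t"
    using a.fixed_tail[OF t] by blast
  obtain r where r: "r \<in> T" "ap pc r = ap pc (a t)" "\<And>s. s \<in> tail T W pc r \<Longrightarrow> ap pc (b s) = ap pc (a t)"
    using b.fixed_tail[OF at] by blast
  have au: "a u \<in> T" "ap pc (a u) = ap pc t" using a.F_mem u s.tail_refl by blast+
  have br: "b r \<in> T" "ap pc (b r) = ap pc (a t)" using b.F_mem r s.tail_refl by blast+
  have junctions: "junction u (b r)" "junction t (b r)" "junction (a u) r" "junction (a u) (a t)"
    using junction_cong[OF junction] t at u(1,2) r(1,2) au br by simp_all
  hence facing: "facing u (b r)" "facing t (b r)" "facing (a u) r" "facing (a u) (a t)"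
    unfolding facing_def by blast+
  have "diff f t (b r) = diff f u (b r)"
    by (rule canonicalD[OF f(2) facing(1,2) u(2)[symmetric] refl])
  also have "\<dots> = diff f' (a u) r" using eq[OF u(1)] eq[OF br(1)] inverse(2)[OF r(1)] by simp
  also have "\<dots> = diff f' (a u) (a t)"
    by (rule canonicalD[OF f'(2) facing(4,3) refl r(2)])
  finally have "diff f t (b r) = diff f' (a u) (a t)" .
  moreover have "ap (ap f t) (diff f t (b r)) = zero"
    using diff_bits(1)[OF f(1) t br(1) junction_less[OF junctions(2)]] .
  moreover have "ap (ap f' (a t)) (diff f' (a u) (a t)) = one"
    using diff_bits(2)[OF f'(1) au(1) at junction_less[OF junctions(4)]] .
  ultimately show False using eq[OF t] by simp
qed

lemma piece_automorphism_trivial: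
  assumes a: "piece_self_embedding mem T S W pc N d a" and b: "piece_self_embedding mem T S W pc N d b"
    and inverse: "\<And>t. t \<in> T \<Longrightarrow> b (a t) = t" "\<And>t. t \<in> T \<Longrightarrow> a (b t) = t"
    and pc: "\<And>t. t \<in> T \<Longrightarrow> ap pc (a t) = ap pc t" and t: "t \<in> T"
  shows "a t = t"
proof -
  interpret a: piece_self_embedding mem T S W pc N d a by (rule a)
  interpret b: piece_self_embedding mem T S W pc N d b by (rule b)
  have pc_b: "ap pc (b s) = ap pc s" if "s \<in> T" for s using pc[OF b.F_mem[OF that]] inverse(2)[OF that] by simp
  have a_less: "lt W (a x) (a y)" if "x \<in> T" "y \<in> T" "ap pc x = ap pc y" "lt W x y" for x y
    using s.dir[OF that(1-3)] s.dir[OF a.F_mem[OF that(1)] a.F_mem[OF that(2)]] that pc a.F_less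
    by (auto split: if_splits)
  have b_less: "lt W (b x) (b y)" if "x \<in> T" "y \<in> T" "ap pc x = ap pc y" "lt W x y" for x y
    using s.dir[OF that(1-3)] s.dir[OF b.F_mem[OF that(1)] b.F_mem[OF that(2)]] that pc_b b.F_less
    by (auto split: if_splits)
  show ?thesis
    by (rule well_ord_rigid[OF s.well_ord_piece[OF t] a.F_definable b.F_definable])
      (use t a.F_mem b.F_mem pc pc_b a_less b_less inverse(1) in simp_all)
qed

lemma canonical_unique:
  assumes f: "embedding f Y" "canonical f" and f': "embedding f' Y" "canonical f'"
  shows "f = f'"
proof -
  define a where "a t = inv_on T (ap f') (ap f t)" for t
  define b where "b t = inv_on T (ap f) (ap f' t)" for t
  have definable: "definable_map a" "definable_map b" unfolding a_def b_def by (intro definable)+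
  note bij = order_iso_bij[OF embedding_order_iso]
  note mem = embedding_mem[OF f(1)] embedding_mem[OF f'(1)]
  have a: "a t \<in> T" "ap f' (a t) = ap f t" if "t \<in> T" for t
    unfolding a_def using inv_on_mem[OF bij[OF f'(1)]] ap_inv_on[OF bij[OF f'(1)]] mem that by blast+
  have b: "b t \<in> T" "ap f (b t) = ap f' t" if "t \<in> T" for t
    unfolding b_def using inv_on_mem[OF bij[OF f(1)]] ap_inv_on[OF bij[OF f(1)]] mem that by blast+
  have inverse: "b (a t) = t" "a (b t) = t" if "t \<in> T" for t
    using embedding_inj[OF f(1)] embedding_inj[OF f'(1)] a b that by metis+
  note less_iff = embedding_less_iff[OF f(1)] embedding_less_iff[OF f'(1)]
  have "lt S s t \<longleftrightarrow> lt S (a s) (a t)" "lt S s t \<longleftrightarrow> lt S (b s) (b t)" if "s \<in> T" "t \<in> T" for s t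
    using less_iff(1)[OF that] less_iff(2)[OF a(1)[OF that(1)] a(1)[OF that(2)]] a(2)[OF that(1)] a(2)[OF that(2)]
      less_iff(2)[OF that] less_iff(1)[OF b(1)[OF that(1)] b(1)[OF that(2)]] b(2)[OF that(1)] b(2)[OF that(2)]
        by simp_all
  hence a_embedding: "piece_self_embedding mem T S W pc N d a"
    and b_embedding: "piece_self_embedding mem T S W pc N d b"
    using definable a b by unfold_locales auto
  have "ap pc (a t) = ap pc t" if t: "t \<in> T" for t
  proof -
    have "\<not> ap pc t \<in> ap pc (a t)"
      by (rule canonical_not_moved_up[OF f f' a_embedding b_embedding inverse _ t]) (use a(2) in simp_all)
    moreover have "\<not> ap pc (a t) \<in> ap pc (b (a t))"
      by (rule canonical_not_moved_up[OF f' f b_embedding a_embedding inverse(2,1) _ a(1)[OF t]]) (use b(2) in simp_all)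
    ultimately show ?thesis using s.pc_cases[OF t a(1)[OF t]] inverse(1)[OF t] by metis
  qed
  hence "a t = t" if "t \<in> T" for t
    using piece_automorphism_trivial[OF a_embedding b_embedding inverse _ that] by blast
  thus ?thesis
    using fun_on_ext[OF order_iso_fun_on[OF embedding_order_iso[OF f(1)]] order_iso_fun_on[OF embedding_order_iso[OF f'(1)]]] a(2)
    by metis
qed

definition least_split :: "'a \<Rightarrow> 'a \<Rightarrow> 'a \<Rightarrow> bool" where
  "least_split f s t \<longleftrightarrow> facing s t \<and>
     (\<forall>s' t'. facing s' t' \<and> ap pc s' = ap pc s \<and> ap pc t' = ap pc t \<longrightarrow> diff f s t \<subseteq> diff f s' t')"

lemma definable_least_split [definable, simp]:
  "\<lbrakk>definable_fn f; definable_fn g; definable_fn h\<rbrakk> \<Longrightarrow> definable (\<lambda>v. least_split (f v) (g v) (h v))"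
  by (rule definable_app3[of least_split]) (unfold least_split_def, intro definable)

lemma least_split_commute: "least_split f s t \<Longrightarrow> least_split f t s"
  unfolding least_split_def using facing_commute first_diff_commute by metis

lemma least_split_eq:
  "\<lbrakk>least_split f s t; least_split f s' t'; ap pc s' = ap pc s; ap pc t' = ap pc t\<rbrakk> \<Longrightarrow> diff f s t = diff f s' t'"
  unfolding least_split_def using subset_antisym by metis

context
  fixes f Y :: 'a
  assumes f: "embedding f Y"
begin

lemma diff_facing_mem: "facing s t \<Longrightarrow> diff f s t \<in> k"
  using diff_mem[OF f facing_mem] facing_ne by metis

lemma least_split_ex:
  assumes st: "facing s t"
  obtains s' t' where "least_split f s' t'" "ap pc s' = ap pc s" "ap pc t' = ap pc t"
proof -
  let ?P = "\<lambda>p. facing (pfst p) (psnd p) \<and> ap pc (pfst p) = ap pc s \<and> ap pc (psnd p) = ap pc t"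
  obtain p where p: "?P p" "\<And>q. ?P q \<Longrightarrow> diff f (pfst p) (psnd p) \<subseteq> diff f (pfst q) (psnd q)"
    by (rule ord_arg_min[of ?P "opair s t" "\<lambda>p. diff f (pfst p) (psnd p)"])
      (use st diff_facing_mem ord_mem[OF ord_k] in auto)
  have "diff f (pfst p) (psnd p) \<subseteq> diff f s' t'"
    if "facing s' t' \<and> ap pc s' = ap pc (pfst p) \<and> ap pc t' = ap pc (psnd p)" for s' t'
    using p(1) p(2)[of "opair s' t'"] that by simp
  hence "least_split f (pfst p) (psnd p)" unfolding least_split_def using p(1) by blast
  thus ?thesis using that p(1) by blast
qed

definition least_splitting :: 'a where
  "least_splitting = sep T (\<lambda>t. \<forall>s. facing t s \<longrightarrow> (\<exists>s'. ap pc s' = ap pc s \<and> least_split f t s'))"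

lemma mem_least_splitting:
  "t \<in> least_splitting \<longleftrightarrow> t \<in> T \<and> (\<forall>s. facing t s \<longrightarrow> (\<exists>s'. ap pc s' = ap pc s \<and> least_split f t s'))"
  unfolding least_splitting_def by simp

lemma least_splitting_full: "s.full least_splitting"
proof (rule s.full_if_tails)
  show "least_splitting \<subseteq> T" by (simp add: subset_def mem_least_splitting)
  fix t assume t: "t \<in> T"
  show "\<exists>s. s \<in> T \<and> ap pc s = ap pc t \<and> tail T W pc s \<subseteq> least_splitting"
  proof (cases "\<exists>s. facing t s")
    case True
    then obtain s where "facing t s" by blast
    then obtain u r where ur: "least_split f u r" "ap pc u = ap pc t" "ap pc r = ap pc s"
      using least_split_ex by blast
    have facing: "facing u r" using ur(1) unfolding least_split_def by blast
    note uT = facing_mem(1)[OF facing]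
    have "x \<in> least_splitting" if x: "x = u \<or> after u x" for x
    proof -
      have xT: "x \<in> T" "ap pc x = ap pc u" using x uT afterD by blast+
      have xr: "facing x r" "diff f x r \<subseteq> diff f u r" using facing_after[OF f facing] facing x subset_refl by metis+
      hence "least_split f x r" using ur(1) xT(2) subset_trans unfolding least_split_def by metis
      thus ?thesis unfolding mem_least_splitting using xT(1) facing_unique[OF xr(1)] by metis
    qed
    hence "tail T W pc u \<subseteq> least_splitting" using mem_tail_iff_after[OF uT] subsetI by metis
    thus ?thesis using uT ur(2) by blast
  next
    case False
    have "x \<in> least_splitting" if "x \<in> tail T W pc t" for x
      unfolding mem_least_splitting using that False facing_cong[of x _ t] t facing_mem by (metis mem_tail)
    thus ?thesis using t subsetI by blast
  qed
qed

lemma least_splitting_junction: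
  assumes st: "s \<in> least_splitting" "t \<in> least_splitting" and junction: "junction s t"
  shows "least_split f s t"
proof -
  have facing: "facing s t" "facing t s" using junction unfolding facing_def by blast+
  note T = facing_mem[OF facing(1)]
  obtain t' where t': "ap pc t' = ap pc t" "least_split f s t'"
    using st(1) facing(1) unfolding mem_least_splitting by blast
  obtain s' where s': "ap pc s' = ap pc s" "least_split f t s'"
    using st(2) facing(2) unfolding mem_least_splitting by blast
  have split_s: "facing s t'" and split_t: "facing s' t"
    using t' least_split_commute[OF s'(2)] unfolding least_split_def by blast+
  have junctions: "junction s t'" "junction s' t"
    using junction_cong[OF junction] T facing_mem[OF split_s] facing_mem[OF split_t] t'(1) s'(1) by simp_all
  have eq: "diff f s t' = diff f s' t"
    by (rule least_split_eq[OF t'(2) least_split_commute[OF s'(2)]]) (use t' s' in simp_all)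
  have "ap (ap f s) (diff f s t') = zero" "ap (ap f t) (diff f s t') = one"
    using diff_bits(1)[OF f T(1) facing_mem(2)[OF split_s] junction_less[OF junctions(1)]]
      diff_bits(2)[OF f facing_mem(1)[OF split_t] T(2) junction_less[OF junctions(2)]] eq by simp_all
  hence "\<not> diff f s t' \<in> diff f s t"
    using lex_agree[OF ord_k embedding_less_iff[OF f T, THEN iffD1, OF junction_less[OF junction]], of "diff f s t'"]
    by auto
  hence "diff f s t \<subseteq> diff f s t'"
    using ord_not_mem[OF ord_mem[OF ord_k diff_facing_mem[OF split_s]] ord_mem[OF ord_k diff_facing_mem[OF facing(1)]]] by blast
  thus ?thesis using t' facing(1) subset_trans unfolding least_split_def by metis
qed

lemma canonical_subcopy_ex:
  obtains U where "s.full U" "canonical (subcopy f U)"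
proof -
  have split: "least_split f s t" if "s \<in> least_splitting" "t \<in> least_splitting" "facing s t" for s t
    using that least_splitting_junction least_split_commute unfolding facing_def by blast
  have "canonical (subcopy f least_splitting)"
    by (rule canonical_subcopy[OF least_splitting_full]) (use least_split_eq split in metis)
  thus ?thesis using that least_splitting_full by blast
qed

end

subsection \<open>The induced colouring\<close>

definition positions :: "'a \<Rightarrow> 'a" where
  "positions f = img (position f) T"

definition red :: "'a \<Rightarrow> 'a \<Rightarrow> bool" where
  "red G f \<longleftrightarrow> repeats T f \<and> repeats_first T f \<or> \<not> repeats T f \<and> ap G (positions f) = one"

definition induced_coloring :: "'a \<Rightarrow> 'a" where
  "induced_coloring G = lam (subsets_of_type (binary_seqs k) (lex k) T S)
     (\<lambda>Y. if \<exists>f. embedding f Y \<and> canonical f \<and> red G f then one else zero)"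

lemma definable_fn_positions [definable, simp]: "definable_fn f \<Longrightarrow> definable_fn (\<lambda>v. positions (f v))"
  by (rule definable_fn_app1[of positions]) (unfold positions_def, intro definable)

lemma induced_coloring_definable: "definable_map (\<lambda>Y. if \<exists>f. embedding f Y \<and> canonical f \<and> red G f then one else zero)"
  unfolding red_def by (intro definable)

lemma induced_coloring_maps: "maps (induced_coloring G) (subsets_of_type (binary_seqs k) (lex k) T S) two"
  unfolding maps_iff induced_coloring_def
  using fun_on_lam[OF induced_coloring_definable] ap_lam[OF induced_coloring_definable] by auto

lemma induced_coloring_eq:
  assumes f: "embedding f Y" "canonical f"
  shows "ap (induced_coloring G) Y = (if red G f then one else zero)"
proof -
  have "Y \<in> subsets_of_type (binary_seqs k) (lex k) T S"
    using f(1) embedding_isomorphic[OF f(1)] unfolding embedding_def by simp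
  hence "ap (induced_coloring G) Y = (if \<exists>f. embedding f Y \<and> canonical f \<and> red G f then one else zero)"
    unfolding induced_coloring_def by (rule ap_lam[OF induced_coloring_definable])
  moreover have "(\<exists>f. embedding f Y \<and> canonical f \<and> red G f) \<longleftrightarrow> red G f" using canonical_unique[OF f] f by blast
  ultimately show ?thesis by simp
qed

lemma canonical_full_subcopy:
  assumes f: "canonical f" and U: "s.full U"
  shows "canonical (subcopy f U)"
  by (rule canonical_subcopy[OF U]) (use canonicalD[OF f] in blast)

lemma first_in_piece:
  assumes t: "t \<in> T"
  obtains r where "first_in T r" "ap pc r = ap pc t"
proof -
  obtain m where m: "m \<in> piece T pc t" "\<And>y. y \<in> piece T pc t \<Longrightarrow> y = m \<or> lt W m y"
    by (rule well_ord_least[OF s.well_ord_piece[OF t], of t "\<lambda>x. True"]) (use t in auto)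
  have "first_in T m" unfolding first_in_def
  proof (intro conjI notI)
    assume "\<exists>r. r \<in> T \<and> after r m"
    then obtain r where r: "r \<in> T" "after r m" by blast
    hence "r \<in> piece T pc t" using m(1) afterD(2)[OF r(2)] by simp
    hence "r = m \<or> after m r" using m unfolding after_def by auto
    thus False using after_ne[OF r] after_asym[OF r] by blast
  qed (use m(1) in simp)
  thus ?thesis using that m(1) by simp
qed

lemma first_in_unique:
  assumes "first_in T r" "first_in T s" "ap pc r = ap pc s"
  shows "r = s"
  using after_total[of r s] assms unfolding first_in_def by metis

lemma full_tail_piece:
  assumes s: "s \<in> T"
  shows "s.full (sep T (\<lambda>t. ap pc t \<noteq> ap pc s \<or> t \<in> tail T W pc s))"
proof (rule s.full_if_tails)
  let ?U = "sep T (\<lambda>t. ap pc t \<noteq> ap pc s \<or> t \<in> tail T W pc s)"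
  show "?U \<subseteq> T" by (simp add: subset_def)
  fix t assume t: "t \<in> T"
  show "\<exists>r. r \<in> T \<and> ap pc r = ap pc t \<and> tail T W pc r \<subseteq> ?U"
  proof (cases "ap pc t = ap pc s")
    case True
    have "tail T W pc s \<subseteq> ?U" by (simp add: subset_def)
    thus ?thesis using s True[symmetric] by blast
  next
    case False
    have "tail T W pc t \<subseteq> ?U" using False by (simp add: subset_def)
    thus ?thesis using t by blast
  qed
qed

context
  fixes G H f Y :: 'a
  assumes homogeneous: "homogeneous (induced_coloring G) H (lex k) T S"
    and f: "embedding f Y" "canonical f" and Y: "Y \<subseteq> H"
begin

lemma red_subcopies:
  assumes U: "s.full U" and V: "s.full V"
  shows "red G (subcopy f U) \<longleftrightarrow> red G (subcopy f V)"
proof -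
  have "img (ap f) X \<in> subsets_of_type H (lex k) T S" if X: "s.full X" for X
    using embedding_isomorphic[OF subcopy_embedding[OF f(1) X]] subset_trans[OF img_full_subset[OF f(1) X] Y] by simp
  hence "ap (induced_coloring G) (img (ap f) U) = ap (induced_coloring G) (img (ap f) V)"
    using homogeneous U V unfolding homogeneous_def by blast
  thus ?thesis
    using induced_coloring_eq[OF subcopy_embedding[OF f(1)] canonical_full_subcopy[OF f(2)]] U V
    by (metis one_zero(1))
qed

text \<open>
  If every tail of a piece repeated a level, one could cut the piece at a repeated point, or thin
  it out so that its first level is not repeated.
\<close>

lemma repeating_red:
  assumes s: "repeated_in T f s"
  obtains U where "s.full U" "red G (subcopy f U)"
proof -
  obtain s' where s': "s \<in> T" "after s s'" "level f s = level f s'" using s unfolding repeated_in_def by blast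
  let ?U = "sep T (\<lambda>t. ap pc t \<noteq> ap pc s \<or> t \<in> tail T W pc s)"
  have U: "s.full ?U" by (rule full_tail_piece[OF s'(1)])
  have mem: "t \<in> ?U \<longleftrightarrow> t \<in> T \<and> (ap pc t \<noteq> ap pc s \<or> t = s \<or> after s t)" for t
    using mem_tail_iff_after[OF s'(1)] by simp
  have "\<not> after r s" if r: "r \<in> ?U" for r
  proof
    assume rs: "after r s"
    hence "r = s \<or> after s r" using r mem[of r] afterD(2)[OF rs] by simp
    thus False using rs after_asym[OF s'(1)] after_ne[OF s'(1)] by blast
  qed
  hence "first_in ?U s" unfolding first_in_def using mem s'(1) by blast
  moreover have "repeated_in ?U f s"
    unfolding repeated_in_def using mem s' afterD(1)[OF s'(2)] by blast
  ultimately have "repeats ?U f" "repeats_first ?U f" unfolding repeats_def repeats_first_def by blast+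
  hence "red G (subcopy f ?U)" unfolding red_def using repeats_subcopy[OF f(1) U] by blast
  thus ?thesis using that U by blast
qed

definition first_unrepeated :: 'a where
  "first_unrepeated = sep T (\<lambda>t. first_in T t \<or> (\<exists>r. first_in T r \<and> after r t \<and> level f r \<in> level f t))"

lemma mem_first_unrepeated:
  "t \<in> first_unrepeated \<longleftrightarrow> t \<in> T \<and> (first_in T t \<or> (\<exists>r. first_in T r \<and> after r t \<and> level f r \<in> level f t))"
  unfolding first_unrepeated_def by simp

lemma first_unrepeated_tail:
  assumes t: "t \<in> T"
  obtains q where "q \<in> T" "ap pc q = ap pc t" "tail T W pc q \<subseteq> first_unrepeated"
proof -
  obtain r where r: "first_in T r" "ap pc r = ap pc t" by (rule first_in_piece[OF t])
  have rT: "r \<in> T" using r(1) unfolding first_in_def by blast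
  show ?thesis
  proof (cases "\<exists>x. after r x")
    case True
    then obtain q where q: "after r q" "level f r \<in> level f q" using level_increases[OF f(1) rT] by blast
    note qT = afterD[OF q(1)]
    have "u \<in> first_unrepeated" if "u = q \<or> after q u" for u
    proof -
      have "after r u" using that q(1) after_trans[OF rT q(1)] by blast
      moreover have "level f q \<subseteq> level f u" using that level_mono[OF f(1) qT(1)] subset_refl by blast
      ultimately show ?thesis unfolding mem_first_unrepeated using q(2) subsetD r(1) afterD(1) by blast
    qed
    hence "tail T W pc q \<subseteq> first_unrepeated" using mem_tail_iff_after[OF qT(1)] subsetI by metis
    thus ?thesis using that qT r(2) by simp
  next
    case False
    hence "tail T W pc r \<subseteq> first_unrepeated"
      using mem_tail_iff_after[OF rT] r(1) rT mem_first_unrepeated subsetI by metis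
    thus ?thesis using that rT r(2) by blast
  qed
qed

lemma first_unrepeated_full: "s.full first_unrepeated"
proof (rule s.full_if_tails)
  show "first_unrepeated \<subseteq> T" by (simp add: subset_def mem_first_unrepeated)
  show "\<exists>q. q \<in> T \<and> ap pc q = ap pc t \<and> tail T W pc q \<subseteq> first_unrepeated" if "t \<in> T" for t
    by (rule first_unrepeated_tail[OF that]) blast
qed

lemma first_unrepeated_not_repeats_first: "\<not> repeats_first first_unrepeated f"
proof
  assume "repeats_first first_unrepeated f"
  then obtain x y where x: "x \<in> first_unrepeated" "\<And>r. r \<in> first_unrepeated \<Longrightarrow> \<not> after r x"
    and y: "y \<in> first_unrepeated" "after x y" "level f x = level f y"
    unfolding repeats_first_def first_in_def repeated_in_def by blast
  have T: "x \<in> T" "y \<in> T" using x(1) y(1) mem_first_unrepeated by blast+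
  have first: "first_in T x"
  proof (rule ccontr)
    assume "\<not> first_in T x"
    then obtain r where "first_in T r" "after r x" using x(1) mem_first_unrepeated by blast
    moreover from this have "r \<in> first_unrepeated" unfolding mem_first_unrepeated first_in_def by blast
    ultimately show False using x(2) by blast
  qed
  have "\<not> first_in T y" using y(2) T(1) unfolding first_in_def by blast
  then obtain r where r: "first_in T r" "after r y" "level f r \<in> level f y" using y(1) mem_first_unrepeated by blast
  have "r = x" using first_in_unique[OF r(1) first] afterD(2)[OF r(2)] afterD(2)[OF y(2)] by simp
  thus False using r(3) y(3) mem_irrefl by simp
qed

lemma not_repeating_tail:
  assumes t: "t \<in> T"
  obtains u where "u \<in> T" "ap pc u = ap pc t" "\<And>s. s \<in> tail T W pc u \<Longrightarrow> \<not> repeated_in T f s"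
proof -
  have "\<exists>u. u \<in> T \<and> ap pc u = ap pc t \<and> (\<forall>s. s \<in> tail T W pc u \<longrightarrow> \<not> repeated_in T f s)"
  proof (rule ccontr)
    assume "\<not> ?thesis"
    hence repeated: "\<exists>s. s \<in> tail T W pc u \<and> repeated_in T f s" if "u \<in> T" "ap pc u = ap pc t" for u
      using that by blast
    obtain U where U: "s.full U" "red G (subcopy f U)" using repeated[OF t refl] repeating_red by blast
    obtain q where q: "q \<in> T" "ap pc q = ap pc t" "tail T W pc q \<subseteq> first_unrepeated"
      using first_unrepeated_tail[OF t] .
    obtain x y where xy: "x \<in> tail T W pc q" "after x y" "level f x = level f y"
      using repeated[OF q(1,2)] unfolding repeated_in_def by blast
    have "y \<in> tail T W pc q" using xy(1,2) after_trans[OF q(1)] unfolding mem_tail_iff_after[OF q(1)] by blast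
    hence "repeated_in first_unrepeated f x" unfolding repeated_in_def using xy subsetD[OF q(3)] by blast
    hence "\<not> red G (subcopy f first_unrepeated)"
      unfolding red_def repeats_subcopy[OF f(1) first_unrepeated_full]
      using first_unrepeated_not_repeats_first repeats_def by blast
    thus False using U red_subcopies[OF U(1) first_unrepeated_full] by blast
  qed
  thus ?thesis using that by blast
qed

lemma injective_subcopy_ex:
  obtains U where "s.full U" "\<not> repeats T (subcopy f U)"
proof -
  let ?U = "sep T (\<lambda>t. \<forall>s. s \<in> tail T W pc t \<longrightarrow> \<not> repeated_in T f s)"
  have mem: "t \<in> ?U \<longleftrightarrow> t \<in> T \<and> (\<forall>s. s \<in> tail T W pc t \<longrightarrow> \<not> repeated_in T f s)" for t by (rule mem_sep) simp
  have full: "s.full ?U"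
  proof (rule s.full_if_tails)
    show "?U \<subseteq> T" by (rule sep_subset) simp
    fix t assume "t \<in> T"
    then obtain u where u: "u \<in> T" "ap pc u = ap pc t" "\<And>s. s \<in> tail T W pc u \<Longrightarrow> \<not> repeated_in T f s"
      using not_repeating_tail by blast
    have "x \<in> ?U" if "x \<in> tail T W pc u" for x
      unfolding mem using u(3) s.tail_trans[OF u(1) that] that by (metis mem_tail)
    thus "\<exists>u. u \<in> T \<and> ap pc u = ap pc t \<and> tail T W pc u \<subseteq> ?U" using u(1,2) subsetI by blast
  qed
  have "\<not> repeated_in ?U f s" for s
  proof
    assume "repeated_in ?U f s"
    hence "s \<in> tail T W pc s" "repeated_in T f s" "s \<in> ?U" unfolding repeated_in_def mem by auto
    thus False unfolding mem by blast
  qed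
  hence "\<not> repeats ?U f" unfolding repeats_def by blast
  thus ?thesis using that[OF full] repeats_subcopy(1)[OF f(1) full] by blast
qed

end

context
  fixes f Y :: 'a
  assumes f: "embedding f Y" and inj: "\<not> repeats T f"
begin

lemma position_less_memrel: "\<lbrakk>s \<in> T; t \<in> T; lt W s t\<rbrakk> \<Longrightarrow> lt (memrel k) (position f s) (position f t)"
  using position_less[OF f inj] position_mem[OF f] by simp

lemma positions_isomorphic: "isomorphic (positions f) (memrel k) T W"
  unfolding positions_def
  by (rule isomorphic_sym[OF increasing_isomorphic_img[OF well_ord_lin[OF well_ord_W] lin_memrel[OF ord_k] _
      position_mem[OF f] position_less_memrel]]) simp

lemma positions_subcopy_surj:
  assumes Z: "Z \<subseteq> positions f" "isomorphic Z (memrel k) T W"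
  obtains V where "s.full V" "\<not> repeats T (subcopy f V)" "positions (subcopy f V) = Z"
proof -
  define V where "V = sep T (\<lambda>t. position f t \<in> Z)"
  have VT: "V \<subseteq> T" unfolding V_def by simp
  have vimage: "img (position f) V = Z" "isomorphic V W Z (memrel k)" unfolding V_def
    by (rule increasing_isomorphic_vimage[OF well_ord_lin[OF well_ord_W] lin_memrel[OF ord_k] _
      position_mem[OF f] position_less_memrel Z(1)[unfolded positions_def]]; simp)+
  have full: "s.full V" using w.isomorphic_full[OF VT isomorphic_trans[OF vimage(2) Z(2)]] full_eq by blast
  have "repeated_in T f s" if "repeated_in V f s" for s
    using that subsetD[OF VT] unfolding repeated_in_def by blast
  hence "\<not> repeats T (subcopy f V)" unfolding repeats_subcopy(1)[OF f full] using inj unfolding repeats_def by blast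
  moreover have "positions (subcopy f V) = img (position f) V"
  proof (rule mem_ext)
    show "z \<in> positions (subcopy f V) \<longleftrightarrow> z \<in> img (position f) V" for z
      using position_subcopy[OF f full] s.glue_mem[OF full] s.glue_surj[OF full]
      unfolding positions_def by (auto; metis)
  qed
  ultimately show ?thesis using that full vimage(1) by simp
qed

end

theorem arrow_lex_imp_arrow_ordinal:
  assumes arrow: "arrow (binary_seqs k) (lex k) T S T S"
  shows "arrow k (memrel k) T W T W"
proof (rule arrow_transfer[OF arrow])
  fix G assume G: "maps G (subsets_of_type k (memrel k) T W) two"
  have "\<exists>K. K \<in> subsets_of_type k (memrel k) T W \<and> (\<forall>Z. Z \<in> subsets_of_type K (memrel k) T W \<longrightarrow>
      (\<exists>X. X \<in> subsets_of_type H (lex k) T S \<and> ap (induced_coloring G) X = ap G Z))"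
    if H: "H \<in> subsets_of_type (binary_seqs k) (lex k) T S" "homogeneous (induced_coloring G) H (lex k) T S" for H
  proof -
    have "H \<subseteq> binary_seqs k" "isomorphic T S H (lex k)" using H(1) isomorphic_sym by simp_all
    then obtain h where h: "embedding h H" unfolding isomorphic_iff embedding_def by blast
    obtain U where U: "s.full U" "canonical (subcopy h U)" using canonical_subcopy_ex[OF h] .
    define g where "g = subcopy h U"
    note g = subcopy_embedding[OF h U(1), folded g_def] U(2)[folded g_def]
    obtain V where V: "s.full V" "\<not> repeats T (subcopy g V)"
      using injective_subcopy_ex[OF H(2) g img_full_subset[OF h U(1)]] .
    define f where "f = subcopy g V"
    note f = subcopy_embedding[OF g(1) V(1), folded f_def] and inj = V(2)[folded f_def]
    have canonical: "canonical f" unfolding f_def by (rule canonical_full_subcopy[OF g(2) V(1)])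
    have f_sub: "img (ap g) V \<subseteq> H" by (rule subset_trans[OF img_full_subset[OF g(1) V(1)] img_full_subset[OF h U(1)]])
    have "positions f \<subseteq> k" using position_mem[OF f] by (auto simp: subset_def positions_def)
    hence K: "positions f \<in> subsets_of_type k (memrel k) T W" using positions_isomorphic[OF f inj] by simp
    have "\<exists>X. X \<in> subsets_of_type H (lex k) T S \<and> ap (induced_coloring G) X = ap G Z"
      if Z: "Z \<in> subsets_of_type (positions f) (memrel k) T W" for Z
    proof -
      obtain X where X: "s.full X" "\<not> repeats T (subcopy f X)" "positions (subcopy f X) = Z"
        using positions_subcopy_surj[OF f inj] Z by auto
      note e = subcopy_embedding[OF f X(1)]
      have "ap G Z \<in> two" using G Z K subset_trans unfolding maps_iff by auto
      hence "ap (induced_coloring G) (img (ap f) X) = ap G Z"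
        using induced_coloring_eq[OF e canonical_full_subcopy[OF canonical X(1)]] X(2,3) unfolding red_def by auto
      moreover have "img (ap f) X \<in> subsets_of_type H (lex k) T S"
        using embedding_isomorphic[OF e] subset_trans[OF img_full_subset[OF f X(1)] f_sub] by simp
      ultimately show ?thesis by blast
    qed
    thus ?thesis using K by blast
  qed
  thus "\<exists>F. maps F (subsets_of_type (binary_seqs k) (lex k) T S) two \<and>
      (\<forall>H. H \<in> subsets_of_type (binary_seqs k) (lex k) T S \<and> homogeneous F H (lex k) T S \<longrightarrow>
        (\<exists>K. K \<in> subsets_of_type k (memrel k) T W \<and> (\<forall>Z. Z \<in> subsets_of_type K (memrel k) T W \<longrightarrow>
          (\<exists>X. X \<in> subsets_of_type H (lex k) T S \<and> ap F X = ap G Z))))"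
    using induced_coloring_maps by blast
qed

end

subsection \<open>Ordinal sums and powers of \<open>\<omega>\<close>\<close>

context zf_model
begin

text \<open>The sums \<open>sum_set\<close> and \<open>sum_rel\<close> with the definable application \<open>ap\<close> in place of \<open>app\<close>.\<close>

definition ap_sum_set :: "'a \<Rightarrow> 'a \<Rightarrow> 'a" where
  "ap_sum_set I b = setof (\<lambda>p. \<exists>i x. i \<in> I \<and> x \<in> ap b i \<and> p = opair i x)"

definition ap_sum_rel :: "'a \<Rightarrow> 'a \<Rightarrow> 'a \<Rightarrow> 'a" where
  "ap_sum_rel I b d = setof (\<lambda>p. \<exists>i x j y.
     i \<in> I \<and> x \<in> ap b i \<and> j \<in> I \<and> y \<in> ap b j \<and> p = opair (opair i x) (opair j y) \<and>
     (i \<in> j \<or> i = j \<and> (ap d i = zero \<and> x \<in> y \<or> ap d i = one \<and> y \<in> x)))"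

lemma mem_ap_sum_set [simp]: "p \<in> ap_sum_set I b \<longleftrightarrow> (\<exists>i x. i \<in> I \<and> x \<in> ap b i \<and> p = opair i x)"
  unfolding ap_sum_set_def
proof (rule mem_setof)
  have "definable_map (ap b)" by simp
  thus "\<exists>u. \<forall>z. z \<in> u \<longleftrightarrow> (\<exists>i x. i \<in> I \<and> x \<in> ap b i \<and> z = opair i x)"
    by (intro exI[of _ "sep (times I (big_union (img (ap b) I))) (\<lambda>p. \<exists>i x. i \<in> I \<and> x \<in> ap b i \<and> p = opair i x)"]) auto
qed

lemma mem_ap_sum_rel: "opair (opair i x) (opair j y) \<in> ap_sum_rel I b d \<longleftrightarrow>
    i \<in> I \<and> x \<in> ap b i \<and> j \<in> I \<and> y \<in> ap b j \<and>
    (i \<in> j \<or> i = j \<and> (ap d i = zero \<and> x \<in> y \<or> ap d i = one \<and> y \<in> x))"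
proof -
  let ?P = "\<lambda>p. \<exists>i x j y.
     i \<in> I \<and> x \<in> ap b i \<and> j \<in> I \<and> y \<in> ap b j \<and> p = opair (opair i x) (opair j y) \<and>
     (i \<in> j \<or> i = j \<and> (ap d i = zero \<and> x \<in> y \<or> ap d i = one \<and> y \<in> x))"
  have "\<exists>u. \<forall>z. z \<in> u \<longleftrightarrow> ?P z"
    by (rule exI[of _ "sep (times (ap_sum_set I b) (ap_sum_set I b)) ?P"]) auto
  thus ?thesis unfolding ap_sum_rel_def by (subst mem_setof) auto
qed

lemma definable_fn_ap_sum_set [definable, simp]: "definable_fn I \<Longrightarrow> definable_fn b \<Longrightarrow>
    definable_fn (\<lambda>v. ap_sum_set (I v) (b v))"
  by (rule definable_fn_app2[of ap_sum_set]) (unfold ap_sum_set_def, intro definable)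

lemma definable_fn_ap_sum_rel [definable, simp]: "\<lbrakk>definable_fn I; definable_fn b; definable_fn d\<rbrakk> \<Longrightarrow>
    definable_fn (\<lambda>v. ap_sum_rel (I v) (b v) (d v))"
  by (rule definable_fn_app3[of ap_sum_rel]) (unfold ap_sum_rel_def, intro definable)

lemma sum_set_eq: "fun_on b I \<Longrightarrow> sum_set I b = ap_sum_set I b"
  unfolding sum_set_def ap_sum_set_def by (rule arg_cong[where f = setof], rule ext) (metis app_eq_ap)

lemma sum_rel_eq: "fun_on b I \<Longrightarrow> fun_on d I \<Longrightarrow> sum_rel I b d = ap_sum_rel I b d"
  unfolding sum_rel_def ap_sum_rel_def
  by (rule arg_cong[where f = setof], rule ext, intro ex_cong1 conj_cong refl) (simp_all add: app_eq_ap)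

lemma const_eq: "const I c = lam I (\<lambda>i. c)"
  unfolding const_def lam_def ..

lemma fun_on_const [simp]: "fun_on (const I c) I"
  unfolding const_eq by simp

lemma ap_const [simp]: "i \<in> I \<Longrightarrow> ap (const I c) i = c"
  unfolding const_eq by simp

lemma definable_fn_const_fun [definable, simp]: "definable_fn I \<Longrightarrow> definable_fn c \<Longrightarrow>
    definable_fn (\<lambda>v. const (I v) (c v))"
  by (rule definable_fn_app2[of const]) (unfold const_eq, intro definable)

definition osum_rel :: "'a \<Rightarrow> 'a \<Rightarrow> 'a" where
  "osum_rel I b = ap_sum_rel I b (const I zero)"

lemma mem_osum_rel: "lt (osum_rel I b) (opair i x) (opair j y) \<longleftrightarrow>
    i \<in> I \<and> x \<in> ap b i \<and> j \<in> I \<and> y \<in> ap b j \<and> (i \<in> j \<or> i = j \<and> x \<in> y)"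
  unfolding osum_rel_def mem_ap_sum_rel by auto

lemma definable_fn_osum_rel [definable, simp]: "definable_fn I \<Longrightarrow> definable_fn b \<Longrightarrow>
    definable_fn (\<lambda>v. osum_rel (I v) (b v))"
  by (rule definable_fn_app2[of osum_rel]) (unfold osum_rel_def, intro definable)

lemma well_ord_ap_sum_set:
  assumes I: "ordinal I" and b: "\<And>i. i \<in> I \<Longrightarrow> ordinal (ap b i)"
  shows "well_ord (ap_sum_set I b) (osum_rel I b)"
proof -
  let ?c = "big_union (img (ap b) I)"
  have ap_b: "definable_map (ap b)" by simp
  have "ordinal ?c" by (rule ord_big_union) (use b in \<open>auto simp: mem_img[OF ap_b]\<close>)
  hence wo: "well_ord (times I ?c) (lex_prod I ?c)" by (rule well_ord_lex_prod[OF I])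
  have sub: "ap_sum_set I b \<subseteq> times I ?c" unfolding subset_def by (auto simp: mem_img[OF ap_b])
  have "well_ord (ap_sum_set I b) (lex_prod I ?c)" by (rule well_ord_subset[OF wo sub])
  thus ?thesis
  proof (rule well_ord_agree)
    fix x y assume x: "x \<in> ap_sum_set I b" and y: "y \<in> ap_sum_set I b"
    obtain i u where i: "x = opair i u" "i \<in> I" "u \<in> ap b i" using x by auto
    obtain j w where j: "y = opair j w" "j \<in> I" "w \<in> ap b j" using y by auto
    have "u \<in> ?c" "w \<in> ?c" using i j by (auto simp: mem_img[OF ap_b])
    thus "opair x y \<in> lex_prod I ?c \<longleftrightarrow> lt (osum_rel I b) x y"
      unfolding i(1) j(1) mem_lex_prod mem_osum_rel using i j by blast
  qed
qed

lemma osum_eq: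
  assumes "ordinal I" "fun_on b I" "\<And>i. i \<in> I \<Longrightarrow> ordinal (ap b i)"
  shows "osum I b = ordertype (ap_sum_set I b) (osum_rel I b)"
  unfolding osum_def sum_set_eq[OF assms(2)] sum_rel_eq[OF assms(2) fun_on_const] osum_rel_def[symmetric]
  by (rule otype_eq_ordertype[OF well_ord_ap_sum_set[OF assms(1,3)]])

definition omul :: "'a \<Rightarrow> 'a \<Rightarrow> 'a" where
  "omul a c = ordertype (times c a) (lex_prod c a)"

lemma definable_fn_omul [definable, simp]: "definable_fn a \<Longrightarrow> definable_fn c \<Longrightarrow> definable_fn (\<lambda>v. omul (a v) (c v))"
  by (rule definable_fn_app2[of omul]) (unfold omul_def, intro definable)

lemma omul_eq_sum:
  assumes "ordinal a" "ordinal c"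
  shows "omul a c = ordertype (ap_sum_set c (const c a)) (osum_rel c (const c a))"
proof -
  have "ap_sum_set c (const c a) = times c a"
    by (rule mem_ext) (unfold mem_ap_sum_set mem_times, metis ap_const)
  moreover have "omul a c = ordertype (times c a) (osum_rel c (const c a))"
    unfolding omul_def
    by (rule ordertype_agree[OF well_ord_lex_prod[OF assms(2,1)]]) (auto simp: mem_osum_rel mem_lex_prod)
  ultimately show ?thesis by simp
qed

lemma omult_eq: "ordinal a \<Longrightarrow> ordinal c \<Longrightarrow> omult a c = omul a c"
  unfolding omult_def by (simp add: osum_eq omul_eq_sum)

lemma ord_omul: "ordinal a \<Longrightarrow> ordinal c \<Longrightarrow> ordinal (omul a c)"
  unfolding omul_def by (rule ord_ordertype[OF well_ord_lex_prod])

lemma omul_mono: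
  assumes "ordinal a" "ordinal b" "ordinal c" "a \<subseteq> b"
  shows "omul a c \<subseteq> omul b c"
  unfolding omul_def
  by (rule ordertype_le[OF well_ord_lex_prod[OF assms(3,1)] well_ord_lex_prod[OF assms(3,2)], of "\<lambda>x. x"])
    (use assms(4) subsetD in \<open>auto simp: mem_lex_prod\<close>)

lemma omul_less:
  assumes a: "ordinal a" "zero \<in> a" and c: "ordinal c" "c' \<in> c"
  shows "omul a c' \<in> omul a c"
  unfolding omul_def
  by (rule ordertype_less[OF well_ord_lex_prod[OF ord_mem[OF c] a(1)] well_ord_lex_prod[OF c(1) a(1)], of "\<lambda>x. x" "opair c' zero"])
    (use a c ord_trans[OF c(1)] in \<open>auto simp: mem_lex_prod\<close>)

lemma omul_ge:
  assumes a: "ordinal a" and c: "ordinal c" "c \<noteq> zero"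
  shows "a \<subseteq> omul a c"
proof -
  have "zero \<in> c" by (rule ord_zero_mem[OF c])
  hence "ordertype a (memrel a) \<subseteq> omul a c" unfolding omul_def
    by (intro ordertype_le[OF well_ord_memrel[OF a] well_ord_lex_prod[OF c(1) a], of "opair zero"]) (auto simp: mem_lex_prod)
  thus ?thesis unfolding ordertype_ordinal[OF a] .
qed

lemma mem_omul_omega:
  assumes "ordinal a" "zero \<in> a"
  shows "a \<in> omul a omega"
  using ord_le_lt[OF assms(1) _ _ omul_ge[OF assms(1), of one] omul_less[OF assms ord_omega, of one]]
    ord_omul[OF assms(1)] by (simp add: one_def)

lemma omega_shift:
  "i \<in> omega \<Longrightarrow> \<exists>f. (\<forall>n. n \<in> omega \<longrightarrow> ap f n \<in> omega \<and> i \<in> ap f n) \<and> (\<forall>n. n \<in> omega \<longrightarrow> (\<forall>m. m \<in> n \<longrightarrow> ap f m \<in> ap f n))"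
proof (induction rule: omega_induct)
  case zero
  have "zero \<in> succ n" if "n \<in> omega" for n using ord_zero_mem[OF ord_succ[OF ord_omega_mem[OF that]]] by simp
  thus ?case
    using omega_mem_mem succ_mem_succ[OF ord_omega_mem ord_omega_mem] by (intro exI[of _ "lam omega succ"]) auto
next
  case (succ i)
  then obtain f where f: "\<And>n. n \<in> omega \<Longrightarrow> ap f n \<in> omega \<and> i \<in> ap f n" "\<And>m n. n \<in> omega \<Longrightarrow> m \<in> n \<Longrightarrow> ap f m \<in> ap f n"
    by blast
  have "succ i \<in> succ (ap f n)" if "n \<in> omega" for n
    using succ_mem_succ[OF ord_omega_mem ord_omega_mem] f(1)[OF that] succ(1) by blast
  moreover have "succ (ap f m) \<in> succ (ap f n)" if "n \<in> omega" "m \<in> n" for m n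
    using succ_mem_succ[OF ord_omega_mem ord_omega_mem] f that omega_mem_mem by blast
  ultimately show ?case
    using f(1) omega_mem_mem by (intro exI[of _ "lam omega (\<lambda>n. succ (ap f n))"]) (auto simp del: mem_succ)
qed simp

definition ord_tail :: "'a \<Rightarrow> 'a \<Rightarrow> 'a" where
  "ord_tail a x = sep a (\<lambda>y. y = x \<or> x \<in> y)"

lemma mem_ord_tail [simp]: "y \<in> ord_tail a x \<longleftrightarrow> y \<in> a \<and> (y = x \<or> x \<in> y)"
  unfolding ord_tail_def by simp

lemma well_ord_ord_tail: "ordinal a \<Longrightarrow> well_ord (ord_tail a x) (memrel a)"
  by (rule well_ord_subset[OF well_ord_memrel]) (simp_all add: subset_def)

lemma ordertype_ord_tail_mono:
  assumes "ordinal a" "ordinal b" "a \<subseteq> b"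
  shows "ordertype (ord_tail a x) (memrel a) \<subseteq> ordertype (ord_tail b x) (memrel b)"
  by (rule ordertype_le[OF well_ord_ord_tail[OF assms(1)] well_ord_ord_tail[OF assms(2)], of "\<lambda>x. x"])
    (use subsetD[OF assms(3)] in auto)

lemma omul_omega_tail:
  assumes a: "ordinal a" and x: "x \<in> omul a omega"
  shows "omul a omega \<subseteq> ordertype (ord_tail (omul a omega) x) (memrel (omul a omega))"
proof -
  let ?Q = "times omega a" and ?L = "lex_prod omega a"
  have wo: "well_ord ?Q ?L" by (rule well_ord_lex_prod[OF ord_omega a])
  obtain i u where iu: "i \<in> omega" "u \<in> a" "ordermap ?Q ?L (opair i u) = x"
    using ordermap_surj[OF wo, of x] x unfolding omul_def mem_times by blast
  obtain f where f: "\<And>n. n \<in> omega \<Longrightarrow> ap f n \<in> omega" "\<And>n. n \<in> omega \<Longrightarrow> i \<in> ap f n"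
    "\<And>m n. n \<in> omega \<Longrightarrow> m \<in> n \<Longrightarrow> ap f m \<in> ap f n"
    using omega_shift[OF iu(1)] by blast
  let ?shift = "\<lambda>p. opair (ap f (pfst p)) (psnd p)"
  have shift: "?shift p \<in> ?Q" "lt ?L (opair i u) (?shift p)" if "p \<in> ?Q" for p
    using that f(1,2) iu(1,2) by (auto simp: mem_lex_prod)
  have shift_less: "lt ?L (?shift p) (?shift q)" if "p \<in> ?Q" "q \<in> ?Q" "lt ?L p q" for p q
    using that f(1,3) by (auto simp: mem_lex_prod)
  have "opair i u \<in> ?Q" using iu by simp
  hence above: "x \<in> ordermap ?Q ?L (?shift p)" if "p \<in> ?Q" for p
    using ordermap_iff[OF wo] shift[OF that] iu(3) by blast
  note map_mem = ordermap_mem[OF wo, folded omul_def]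
  have "ordertype ?Q ?L \<subseteq> ordertype (ord_tail (omul a omega) x) (memrel (omul a omega))"
  proof (rule ordertype_le[OF wo well_ord_ord_tail[OF ord_omul[OF a ord_omega]], of "\<lambda>p. ordermap ?Q ?L (?shift p)"])
    show "lt (memrel (omul a omega)) (ordermap ?Q ?L (?shift p)) (ordermap ?Q ?L (?shift q))"
      if "p \<in> ?Q" "q \<in> ?Q" "lt ?L p q" for p q
      using ordermap_iff[OF wo shift(1) shift(1)] shift_less map_mem[OF shift(1)] that by (simp del: mem_times)
  qed (use map_mem[OF shift(1)] above in \<open>simp_all del: mem_times\<close>)
  thus ?thesis unfolding omul_def .
qed

text \<open>
  The recursion \<open>\<omega>\<^bsup>e\<^esup> = 1 \<union> (\<Union>y<e. \<omega>\<^bsup>y\<^esup> \<omega>)\<close> treats zero, successors and limits uniformly.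
\<close>

definition omega_exp :: "'a \<Rightarrow> 'a" where
  "omega_exp = ord_rec (\<lambda>f. union one (setof (\<lambda>z. \<exists>y u. opair y u \<in> f \<and> z \<in> omul u omega)))"

lemma definable_fn_omega_exp [definable, simp]: "definable_fn f \<Longrightarrow> definable_fn (\<lambda>v. omega_exp (f v))"
  by (rule definable_fn_app1[of omega_exp]) (unfold omega_exp_def, intro definable)

lemma mem_omega_exp:
  assumes e: "ordinal e"
  shows "z \<in> omega_exp e \<longleftrightarrow> z = zero \<or> (\<exists>y. y \<in> e \<and> z \<in> omul (omega_exp y) omega)"
proof -
  let ?f = "lam e omega_exp"
  have exp: "definable_map omega_exp" and exp_omega: "definable_fn (\<lambda>v. omul (omega_exp (v 0)) omega)" by simp_all
  have "omega_exp e = union one (setof (\<lambda>z. \<exists>y u. opair y u \<in> ?f \<and> z \<in> omul u omega))"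
    unfolding omega_exp_def by (rule ord_rec[OF _ e]) (intro definable)
  moreover have "(\<exists>y u. opair y u \<in> ?f \<and> z \<in> omul u omega) \<longleftrightarrow> (\<exists>y. y \<in> e \<and> z \<in> omul (omega_exp y) omega)" for z
    unfolding mem_lam[OF exp] opair_eq by blast
  ultimately have "omega_exp e = union one (setof (\<lambda>z. \<exists>y. y \<in> e \<and> z \<in> omul (omega_exp y) omega))" by simp
  moreover have "\<exists>u. \<forall>z. z \<in> u \<longleftrightarrow> (\<exists>y. y \<in> e \<and> z \<in> omul (omega_exp y) omega)"
    by (rule exI[of _ "big_union (img (\<lambda>y. omul (omega_exp y) omega) e)"]) (unfold mem_big_union mem_img[OF exp_omega], blast)
  ultimately show ?thesis using mem_setof[of "\<lambda>z. \<exists>y. y \<in> e \<and> z \<in> omul (omega_exp y) omega"] by simp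
qed

lemma omega_exp_zero_mem [simp]: "ordinal e \<Longrightarrow> zero \<in> omega_exp e"
  using mem_omega_exp by blast

lemma ord_omega_exp: "ordinal e \<Longrightarrow> ordinal (omega_exp e)"
proof (induction rule: ord_induct)
  case (step e)
  have m: "ordinal (omul (omega_exp y) omega)" if "y \<in> e" for y using step ord_omul that by simp
  show ?case
  proof (rule ord_memI)
    show "x \<in> omega_exp e" if "y \<in> omega_exp e" "x \<in> y" for x y
      using that m ord_trans[OF m] unfolding mem_omega_exp[OF step(1)] by (metis not_mem_zero)
    show "ordinal x" if "x \<in> omega_exp e" for x
      using that ord_mem[OF m] ord_zero unfolding mem_omega_exp[OF step(1)] by metis
  qed
qed simp

lemma omul_omega_exp_subset: "ordinal e \<Longrightarrow> y \<in> e \<Longrightarrow> omul (omega_exp y) omega \<subseteq> omega_exp e"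
  unfolding subset_def using mem_omega_exp by blast

lemma omega_exp_less: "ordinal e \<Longrightarrow> y \<in> e \<Longrightarrow> omega_exp y \<in> omega_exp e"
  using subsetD[OF omul_omega_exp_subset mem_omul_omega[OF ord_omega_exp omega_exp_zero_mem]] ord_mem by blast

lemma omega_exp_mono: "\<lbrakk>ordinal e; ordinal y; y \<subseteq> e\<rbrakk> \<Longrightarrow> omega_exp y \<subseteq> omega_exp e"
  using ord_subset_iff[of y e] omega_exp_less[of e y] ord_mem_subset[OF ord_omega_exp] by auto

lemma omega_exp_ge: "ordinal e \<Longrightarrow> e \<subseteq> omega_exp e"
  by (rule increasing_ge[of "succ e" e omega_exp]) (auto intro: omega_exp_less ord_omega_exp ord_mem)

lemma omega_exp_term_less:
  assumes "ordinal e" "y \<in> e" "c \<in> omega"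
  shows "omul (omega_exp y) c \<in> omega_exp e"
proof -
  have y: "ordinal y" using assms ord_mem by blast
  show ?thesis using subsetD[OF omul_omega_exp_subset[OF assms(1,2)] omul_less[OF ord_omega_exp[OF y] omega_exp_zero_mem[OF y] ord_omega assms(3)]] .
qed

lemma omega_exp_term_le:
  assumes e: "ordinal e" and y: "ordinal y" and c: "c \<in> omega" "c' \<in> omega" "c' \<noteq> zero"
    and le: "omul (omega_exp y) c' \<subseteq> omul (omega_exp e) c"
  shows "y \<subseteq> e"
proof (rule ccontr)
  assume "\<not> y \<subseteq> e"
  hence "e \<in> y" using ord_not_mem[OF e y] by blast
  hence "omul (omega_exp e) c \<in> omega_exp y" using omega_exp_term_less[OF y] c by blast
  thus False
    using subsetD[OF le subsetD[OF omul_ge[OF ord_omega_exp[OF y] ord_omega_mem[OF c(2)] c(3)]]] mem_irrefl by blast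
qed

lemma zero_mem_omul_omega: "ordinal y \<Longrightarrow> zero \<in> omul (omega_exp y) omega"
  using ord_trans[OF ord_omul _ mem_omul_omega] ord_omega_exp omega_exp_zero_mem ord_omega by blast

lemma omul_omega_exp_mono: "\<lbrakk>ordinal e; y \<subseteq> e; ordinal y\<rbrakk> \<Longrightarrow> omul (omega_exp y) omega \<subseteq> omul (omega_exp e) omega"
  by (rule omul_mono) (simp_all add: ord_omega_exp omega_exp_mono)

lemma omega_exp_common:
  assumes e: "ordinal e" and x: "x \<in> omega_exp e" "x \<noteq> zero" and u: "u \<in> omega_exp e"
  obtains y where "y \<in> e" "x \<in> omul (omega_exp y) omega" "u \<in> omul (omega_exp y) omega"
proof -
  obtain y where y: "y \<in> e" "x \<in> omul (omega_exp y) omega" using x mem_omega_exp[OF e] by blast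
  obtain z where z: "z \<in> e" "u \<in> omul (omega_exp z) omega"
    using u y(1) mem_omega_exp[OF e] zero_mem_omul_omega[OF ord_mem[OF e y(1)]] by metis
  have ord: "ordinal y" "ordinal z" using y(1) z(1) ord_mem[OF e] by blast+
  have "y \<subseteq> z \<or> z \<subseteq> y" using ord_not_mem[OF ord] ord_mem_subset[OF ord(2)] by blast
  thus ?thesis using that y z omul_omega_exp_mono ord subsetD by metis
qed

lemma omega_exp_tail:
  assumes e: "ordinal e" and x: "x \<in> omega_exp e"
  shows "ordertype (ord_tail (omega_exp e) x) (memrel (omega_exp e)) = omega_exp e"
proof (rule subset_antisym)
  note ord = ord_omega_exp[OF e]
  show "ordertype (ord_tail (omega_exp e) x) (memrel (omega_exp e)) \<subseteq> omega_exp e"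
    by (rule ordertype_subset_ordinal[OF ord]) (simp add: subset_def)
  show "omega_exp e \<subseteq> ordertype (ord_tail (omega_exp e) x) (memrel (omega_exp e))"
  proof (cases "x = zero")
    case True
    have "ord_tail (omega_exp e) x = omega_exp e"
      by (rule mem_ext) (use ord_zero_mem[OF ord_mem[OF ord]] in \<open>auto simp: True\<close>)
    thus ?thesis using ordertype_ordinal[OF ord] by simp
  next
    case False
    show ?thesis
    proof (rule subsetI)
      fix u assume "u \<in> omega_exp e"
      then obtain y where y: "y \<in> e" "x \<in> omul (omega_exp y) omega" "u \<in> omul (omega_exp y) omega"
        using omega_exp_common[OF e x False] by blast
      have y_ord: "ordinal (omega_exp y)" using ord_omega_exp ord_mem[OF e y(1)] by blast
      have "u \<in> ordertype (ord_tail (omul (omega_exp y) omega) x) (memrel (omul (omega_exp y) omega))"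
        using subsetD[OF omul_omega_tail[OF y_ord y(2)] y(3)] .
      thus "u \<in> ordertype (ord_tail (omega_exp e) x) (memrel (omega_exp e))"
        using subsetD[OF ordertype_ord_tail_mono[OF ord_omul[OF y_ord ord_omega] ord omul_omega_exp_subset[OF e y(1)]]] by blast
    qed
  qed
qed

lemma omega_exp_zero: "omega_exp zero = one"
  by (rule mem_ext) (simp add: mem_omega_exp)

lemma omega_exp_succ:
  assumes e: "ordinal e" shows "omega_exp (succ e) = omul (omega_exp e) omega"
proof (rule subset_antisym)
  show "omul (omega_exp e) omega \<subseteq> omega_exp (succ e)" using omul_omega_exp_subset e by simp
  have "omul (omega_exp y) omega \<subseteq> omul (omega_exp e) omega" if "y \<in> succ e" for y
    by (rule omul_omega_exp_mono[OF e]) (use that e ord_mem ord_mem_subset in auto)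
  thus "omega_exp (succ e) \<subseteq> omul (omega_exp e) omega"
    unfolding subset_def mem_omega_exp[OF ord_succ[OF e]] using zero_mem_omul_omega[OF e] subsetD by blast
qed

lemma omega_exp_limit:
  assumes e: "ordinal e" "e \<noteq> zero" "\<not> (\<exists>y. e = succ y)"
  shows "z \<in> omega_exp e \<longleftrightarrow> (\<exists>y. y \<in> e \<and> z \<in> omega_exp y)"
proof
  assume "\<exists>y. y \<in> e \<and> z \<in> omega_exp y"
  thus "z \<in> omega_exp e" using omega_exp_less e ord_trans[OF ord_omega_exp] by blast
next
  assume "z \<in> omega_exp e"
  then consider (zero) "z = zero" | (omul) y where "y \<in> e" "z \<in> omul (omega_exp y) omega"
    using mem_omega_exp e by blast
  thus "\<exists>y. y \<in> e \<and> z \<in> omega_exp y"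
  proof cases
    case zero
    thus ?thesis using ord_zero_mem e omega_exp_zero_mem ord_zero by blast
  next
    case (omul y)
    have y: "ordinal y" using ord_mem e omul by blast
    hence "succ y \<in> e" using succ_subset_iff[OF y e(1)] ord_subset_iff[of "succ y" e] omul e by auto
    thus ?thesis using omul omega_exp_succ[OF y] by metis
  qed
qed

lemma omega_exp_limit_setof:
  assumes "ordinal e" "e \<noteq> zero" "\<not> (\<exists>y. e = succ y)" and F: "\<And>y. y \<in> e \<Longrightarrow> F y = omega_exp y"
  shows "setof (\<lambda>z. \<exists>y. y \<in> e \<and> z \<in> F y) = omega_exp e"
proof (rule mem_ext)
  have "(\<exists>y. y \<in> e \<and> u \<in> F y) \<longleftrightarrow> u \<in> omega_exp e" for u unfolding omega_exp_limit[OF assms(1-3)] using F by metis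
  thus "u \<in> setof (\<lambda>z. \<exists>y. y \<in> e \<and> z \<in> F y) \<longleftrightarrow> u \<in> omega_exp e" for u by (subst mem_setof) blast+
qed

definition omega_power_fun :: "'a \<Rightarrow> 'a \<Rightarrow> bool" where
  "omega_power_fun e f \<longleftrightarrow> fun_on f (succ e) \<and> app f zero = one \<and>
     (\<forall>x. x \<in> e \<longrightarrow> app f (succ x) = omult (app f x) omega) \<and>
     (\<forall>x. x \<in> succ e \<and> x \<noteq> zero \<and> \<not> (\<exists>y. x = succ y) \<longrightarrow> app f x = setof (\<lambda>z. \<exists>y. y \<in> x \<and> z \<in> app f y))"

lemma omega_power_fun_exp:
  assumes e: "ordinal e"
  shows "omega_power_fun e (lam (succ e) omega_exp)"
  unfolding omega_power_fun_def
proof (intro conjI allI impI)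
  let ?f = "lam (succ e) omega_exp"
  note ord = ord_succ[OF e]
  show f: "fun_on ?f (succ e)" by simp
  have app: "app ?f x = omega_exp x" if "x \<in> succ e" for x using app_eq_ap[OF f that] that by simp
  show "app ?f zero = one" using app ord_zero_mem[OF ord] omega_exp_zero by simp
  show "app ?f (succ x) = omult (app ?f x) omega" if "x \<in> e" for x
    using app that succ_mem_succ[OF ord_mem[OF e that] e] omult_eq[OF ord_omega_exp ord_omega] omega_exp_succ
      ord_mem[OF e that] by simp
  fix x assume x: "x \<in> succ e \<and> x \<noteq> zero \<and> \<not> (\<exists>y. x = succ y)"
  show "app ?f x = setof (\<lambda>z. \<exists>y. y \<in> x \<and> z \<in> app ?f y)"
    unfolding app[OF conjunct1[OF x]]
    by (rule omega_exp_limit_setof[symmetric]) (use x ord_mem[OF ord] app ord_trans[OF ord] in blast)+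
qed

lemma omega_power_fun_eq:
  assumes e: "ordinal e" and f: "omega_power_fun e f" and "ordinal x"
  shows "x \<in> succ e \<longrightarrow> ap f x = omega_exp x"
  using \<open>ordinal x\<close>
proof (induction rule: ord_induct)
  case (step x)
  note ord = ord_succ[OF e]
  have app: "app f x = ap f x" if "x \<in> succ e" for x using f app_eq_ap that unfolding omega_power_fun_def by blast
  show ?case
  proof
    assume x: "x \<in> succ e"
    consider (zero) "x = zero" | (succ) y where "x = succ y" | (limit) "x \<noteq> zero" "\<not> (\<exists>y. x = succ y)" by blast
    thus "ap f x = omega_exp x"
    proof cases
      case zero
      thus ?thesis using f app[OF x] omega_exp_zero unfolding omega_power_fun_def by simp
    next
      case (succ y)
      have y: "ordinal y" using step(1) ord_mem succ by auto
      have ye: "y \<in> e" using x succ succ_mem_succ[OF y e] by simp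
      hence "ap f y = omega_exp y" using step(2)[of y] succ by simp
      moreover have "app f (succ y) = omult (app f y) omega" using f ye unfolding omega_power_fun_def by blast
      ultimately show ?thesis
        using app[OF x] app[of y] ye omult_eq[OF ord_omega_exp[OF y] ord_omega] omega_exp_succ[OF y] succ by simp
    next
      case limit
      have "ap f x = setof (\<lambda>z. \<exists>y. y \<in> x \<and> z \<in> app f y)"
        using f limit x app[OF x] unfolding omega_power_fun_def by simp
      also have "\<dots> = omega_exp x"
        by (rule omega_exp_limit_setof[OF step(1) limit]) (use step(2) app ord_trans[OF ord _ x] in metis)
      finally show ?thesis .
    qed
  qed
qed simp

lemma omega_power_eq:
  assumes e: "ordinal e" shows "omega_power e = omega_exp e"
proof -
  have "app f e = omega_exp e" if f: "omega_power_fun e f" for f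
    using omega_power_fun_eq[OF e f e] app_eq_ap[of f "succ e" e] f unfolding omega_power_fun_def by simp
  hence "(THE p. \<exists>f. omega_power_fun e f \<and> p = app f e) = omega_exp e"
    by (intro the_equality) (use omega_power_fun_exp[OF e] in metis)+
  moreover have "omega_power e = (THE p. \<exists>f. omega_power_fun e f \<and> p = app f e)"
    unfolding omega_power_def omega_power_fun_def by (rule arg_cong[where f = The], rule ext, rule ex_cong1) blast
  ultimately show ?thesis by simp
qed

subsection \<open>Cantor normal forms\<close>

definition cnf_terms :: "'a \<Rightarrow> 'a \<Rightarrow> 'a \<Rightarrow> 'a" where
  "cnf_terms m e c = lam m (\<lambda>j. omul (omega_exp (ap e j)) (ap c j))"

lemma definable_fn_cnf_terms [definable, simp]: "\<lbrakk>definable_fn m; definable_fn e; definable_fn c\<rbrakk> \<Longrightarrow>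
    definable_fn (\<lambda>v. cnf_terms (m v) (e v) (c v))"
  by (rule definable_fn_app3[of cnf_terms]) (unfold cnf_terms_def, intro definable)

lemma fun_on_cnf_terms [simp]: "fun_on (cnf_terms m e c) m"
  unfolding cnf_terms_def by simp

lemma ap_cnf_terms [simp]: "j \<in> m \<Longrightarrow> ap (cnf_terms m e c) j = omul (omega_exp (ap e j)) (ap c j)"
  unfolding cnf_terms_def by simp

definition cnf_data :: "'a \<Rightarrow> 'a \<Rightarrow> 'a \<Rightarrow> bool" where
  "cnf_data m e c \<longleftrightarrow> m \<in> omega \<and> fun_on e m \<and> fun_on c m \<and>
     (\<forall>j. j \<in> m \<longrightarrow> ordinal (ap e j) \<and> ap c j \<in> omega \<and> ap c j \<noteq> zero) \<and>
     (\<forall>i j. i \<in> j \<and> j \<in> m \<longrightarrow> ap e j \<in> ap e i)"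

definition cnf_val :: "'a \<Rightarrow> 'a \<Rightarrow> 'a \<Rightarrow> 'a" where
  "cnf_val m e c = ordertype (ap_sum_set m (cnf_terms m e c)) (osum_rel m (cnf_terms m e c))"

lemma definable_cnf_data [definable, simp]: "\<lbrakk>definable_fn m; definable_fn e; definable_fn c\<rbrakk> \<Longrightarrow>
    definable (\<lambda>v. cnf_data (m v) (e v) (c v))"
  by (rule definable_app3[of cnf_data]) (unfold cnf_data_def, intro definable)

lemma definable_fn_cnf_val [definable, simp]: "\<lbrakk>definable_fn m; definable_fn e; definable_fn c\<rbrakk> \<Longrightarrow>
    definable_fn (\<lambda>v. cnf_val (m v) (e v) (c v))"
  by (rule definable_fn_app3[of cnf_val]) (unfold cnf_val_def, intro definable)

lemma cnf_dataD:
  assumes "cnf_data m e c"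
  shows cnf_omega: "m \<in> omega"
    and cnf_fun_on: "fun_on e m" "fun_on c m" and cnf_exp_ord: "\<And>j. j \<in> m \<Longrightarrow> ordinal (ap e j)"
    and cnf_coeff: "\<And>j. j \<in> m \<Longrightarrow> ap c j \<in> omega" "\<And>j. j \<in> m \<Longrightarrow> ap c j \<noteq> zero"
    and cnf_exp_less: "\<And>i j. i \<in> j \<Longrightarrow> j \<in> m \<Longrightarrow> ap e j \<in> ap e i"
    and cnf_term_ord: "\<And>j. j \<in> m \<Longrightarrow> ordinal (ap (cnf_terms m e c) j)"
    and well_ord_cnf: "well_ord (ap_sum_set m (cnf_terms m e c)) (osum_rel m (cnf_terms m e c))"
proof -
  show m: "m \<in> omega" and "fun_on e m" "fun_on c m" and e: "\<And>j. j \<in> m \<Longrightarrow> ordinal (ap e j)"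
    and c: "\<And>j. j \<in> m \<Longrightarrow> ap c j \<in> omega" and "\<And>j. j \<in> m \<Longrightarrow> ap c j \<noteq> zero"
    and "\<And>i j. i \<in> j \<Longrightarrow> j \<in> m \<Longrightarrow> ap e j \<in> ap e i"
    using assms unfolding cnf_data_def by blast+
  show ord: "\<And>j. j \<in> m \<Longrightarrow> ordinal (ap (cnf_terms m e c) j)"
    by (simp add: ord_omul ord_omega_exp e c ord_omega_mem)
  show "well_ord (ap_sum_set m (cnf_terms m e c)) (osum_rel m (cnf_terms m e c))"
    by (rule well_ord_ap_sum_set[OF ord_omega_mem[OF m] ord])
qed

lemma is_cnfI:
  assumes data: "cnf_data m e c"
  shows "is_cnf (cnf_val m e c) m (cnf_terms m e c)"
proof -
  have app: "app e j = ap e j" "app c j = ap c j" "app (cnf_terms m e c) j = omul (omega_exp (ap e j)) (ap c j)"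
    if "j \<in> m" for j using that app_eq_ap[OF cnf_fun_on(1)[OF data]] app_eq_ap[OF cnf_fun_on(2)[OF data]] app_eq_ap[OF fun_on_cnf_terms] by simp_all
  have "ordinal (app e j) \<and> app c j \<noteq> zero \<and>
      app (cnf_terms m e c) j = omult (omega_power (app e j)) (app c j)" if "j \<in> m" for j
    using cnf_exp_ord[OF data that] cnf_coeff[OF data that] app[OF that]
    by (simp add: omega_power_eq omult_eq ord_omega_exp ord_omega_mem)
  moreover have "app e j \<in> app e i" if "i \<in> j \<and> j \<in> m" for i j
    using cnf_exp_less[OF data, of i j] that ord_trans[OF ord_omega_mem[OF cnf_omega[OF data]], of i j] app by simp
  moreover have "cnf_val m e c = osum m (cnf_terms m e c)"
    unfolding cnf_val_def
    by (rule osum_eq[OF ord_omega_mem[OF cnf_omega[OF data]] fun_on_cnf_terms cnf_term_ord[OF data], symmetric])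
  ultimately show ?thesis unfolding is_cnf_def maps_iff
    using cnf_omega[OF data] cnf_coeff(1)[OF data] cnf_fun_on[OF data] fun_on_cnf_terms by blast
qed

lemma is_cnfE:
  assumes "is_cnf x m t"
  obtains e c where "cnf_data m e c" "x = cnf_val m e c" "t = cnf_terms m e c"
proof -
  obtain e c where m: "m \<in> omega" and t: "fun_on t m" and e: "fun_on e m" and c: "maps c m omega"
    and terms: "\<And>j. j \<in> m \<Longrightarrow> ordinal (app e j) \<and> app c j \<noteq> zero \<and>
           app t j = omult (omega_power (app e j)) (app c j)"
    and decreasing: "\<And>i j. i \<in> j \<Longrightarrow> j \<in> m \<Longrightarrow> app e j \<in> app e i" and x: "x = osum m t"
    using assms unfolding is_cnf_def by blast
  have fun_c: "fun_on c m" and c_omega: "\<And>j. j \<in> m \<Longrightarrow> ap c j \<in> omega" using c unfolding maps_iff by blast+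
  have app: "app e j = ap e j" "app c j = ap c j" "app t j = ap t j" if "j \<in> m" for j
    using app_eq_ap e fun_c t that by blast+
  have data: "cnf_data m e c" unfolding cnf_data_def
  proof (intro conjI allI impI m e fun_c)
    fix j assume j: "j \<in> m"
    show "ordinal (ap e j)" "ap c j \<in> omega" "ap c j \<noteq> zero" using terms[OF j] app[OF j] c_omega[OF j] by simp_all
  next
    show "ap e j \<in> ap e i" if "i \<in> j \<and> j \<in> m" for i j
      using decreasing[of i j] app that ord_trans[OF ord_omega_mem[OF m], of i j] by simp
  qed
  have "t = cnf_terms m e c"
  proof (rule fun_on_ext[OF t fun_on_cnf_terms])
    show "ap t j = ap (cnf_terms m e c) j" if "j \<in> m" for j
      using terms[OF that] app[OF that] cnf_exp_ord[OF data that] cnf_coeff(1)[OF data that] that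
      by (simp add: omega_power_eq omult_eq ord_omega_exp ord_omega_mem)
  qed
  moreover from this have "x = cnf_val m e c"
    using x osum_eq[OF ord_omega_mem[OF cnf_omega[OF data]] fun_on_cnf_terms cnf_term_ord[OF data]]
    unfolding cnf_val_def by simp
  ultimately show ?thesis using that data by blast
qed

lemma cnf_term_le:
  assumes data: "cnf_data m e c" and j: "j \<in> m"
  shows "omega_exp (ap e j) \<subseteq> cnf_val m e c"
proof -
  let ?a = "omul (omega_exp (ap e j)) (ap c j)"
  have ord: "ordinal ?a" using cnf_term_ord[OF data j] j by simp
  have "omega_exp (ap e j) \<subseteq> ?a"
    by (rule omul_ge) (simp_all add: ord_omega_exp cnf_exp_ord[OF data] cnf_coeff[OF data] j ord_omega_mem)
  also have "?a = ordertype ?a (memrel ?a)" using ordertype_ordinal[OF ord] by simp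
  also have "\<dots> \<subseteq> cnf_val m e c" unfolding cnf_val_def
    by (rule ordertype_le[OF well_ord_memrel[OF ord] well_ord_cnf[OF data], of "opair j"]) (use j in \<open>auto simp: mem_osum_rel\<close>)
  finally show ?thesis .
qed

definition oadd :: "'a \<Rightarrow> 'a \<Rightarrow> 'a" where
  "oadd a b = ordertype (union (img (opair zero) a) (img (opair one) b)) (lex_prod two (union a b))"

lemma definable_map_opair [simp]: "definable_map (opair i)"
  by (intro definable)

lemma ord_union: "ordinal a \<Longrightarrow> ordinal b \<Longrightarrow> ordinal (union a b)"
  by (rule ord_memI) (auto intro: ord_trans ord_mem)

lemma well_ord_oadd:
  assumes "ordinal a" "ordinal b"
  shows "well_ord (union (img (opair zero) a) (img (opair one) b)) (lex_prod two (union a b))"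
  by (rule well_ord_subset[OF well_ord_lex_prod[OF _ ord_union[OF assms]]])
    (auto simp: subset_def two_def one_def)

lemma ordertype_union:
  assumes wo: "well_ord (union A B) R" and less: "\<And>a b. a \<in> A \<Longrightarrow> b \<in> B \<Longrightarrow> lt R a b"
  shows "ordertype (union A B) R = oadd (ordertype A R) (ordertype B R)"
proof -
  let ?a = "ordertype A R" and ?b = "ordertype B R"
  have woA: "well_ord A R" and woB: "well_ord B R"
    by (rule well_ord_subset[OF wo], simp add: subset_def)+
  let ?C = "union (img (opair zero) ?a) (img (opair one) ?b)" and ?L = "lex_prod two (union ?a ?b)"
  note woC = well_ord_oadd[OF ord_ordertype[OF woA] ord_ordertype[OF woB]]
  have disjoint: "\<not> x \<in> B" if "x \<in> A" for x using less[OF that] lin_irrefl[OF well_ord_lin[OF woA] that] by blast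
  define G where "G x = (if x \<in> A then opair zero (ordermap A R x) else opair one (ordermap B R x))" for x
  have G: "definable_map G" unfolding G_def by (intro definable)
  have G_A: "G x = opair zero (ordermap A R x)" "ordermap A R x \<in> ?a" if "x \<in> A" for x
    unfolding G_def using that ordermap_mem[OF woA] by simp_all
  have G_B: "G x = opair one (ordermap B R x)" "ordermap B R x \<in> ?b" if "x \<in> B" for x
    unfolding G_def using that disjoint ordermap_mem[OF woB] by auto
  have G_mem: "G x \<in> ?C" if "x \<in> union A B" for x using that G_A[of x] G_B[of x] by auto
  have G_less: "lt ?L (G x) (G y)" if "x \<in> union A B" "y \<in> union A B" "lt R x y" for x y
  proof -
    have "\<not> (x \<in> B \<and> y \<in> A)" using less[of y x] lin_asym[OF well_ord_lin[OF wo] that] that(3) by blast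
    thus ?thesis
      using that G_A[of x] G_A[of y] G_B[of x] G_B[of y] ordermap_iff[OF woA, of x y] ordermap_iff[OF woB, of x y]
      by (auto simp: mem_lex_prod one_def)
  qed
  have "img G (union A B) = ?C"
  proof (rule mem_ext)
    have "\<exists>x. x \<in> union A B \<and> z = G x" if "z \<in> ?C" for z
      using that ordermap_surj[OF woA] ordermap_surj[OF woB] G_A(1) G_B(1) by (auto; metis)
    thus "z \<in> img G (union A B) \<longleftrightarrow> z \<in> ?C" for z unfolding mem_img[OF G] using G_mem by blast
  qed
  hence "isomorphic (union A B) R ?C ?L"
    using increasing_isomorphic_img[OF well_ord_lin[OF wo] well_ord_lin[OF woC] G G_mem G_less] by simp
  thus ?thesis unfolding oadd_def using ordertype_eq_iff[OF wo woC] by blast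
qed

lemma ordertype_row:
  assumes b: "ordinal b" and R: "\<And>x y. x \<in> b \<Longrightarrow> y \<in> b \<Longrightarrow> lt R (opair i x) (opair i y) \<longleftrightarrow> x \<in> y"
  shows "ordertype (img (opair i) b) R = b"
proof (rule ordertype_eq(1)[OF b isomorphic_sym[OF isomorphicI[of "opair i"]]])
  show "bij_betw (opair i) (elts b) (elts (img (opair i) b))" by (rule bij_betw_img) simp_all
qed (use R in simp_all)

lemma oadd_zero: "ordinal b \<Longrightarrow> oadd zero b = b"
proof -
  assume b: "ordinal b"
  have "union (img (opair zero) zero) (img (opair one) b) = img (opair one) b" by (rule mem_ext) auto
  thus ?thesis unfolding oadd_def using ordertype_row[OF b] by (simp add: mem_lex_prod)
qed

lemma omul_zero: "ordinal a \<Longrightarrow> omul a zero = zero"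
  unfolding omul_def by (rule ordertype_eq(1)[OF ord_zero isomorphicI[of "\<lambda>x. x"]]) (auto simp: bij_elts_iff)

lemma mem_omulE:
  assumes a: "ordinal a" and c': "ordinal c'" and x: "x \<in> omul a c'"
  obtains c r where "c \<in> c'" "r \<in> a" "x = oadd (omul a c) r"
proof -
  let ?Q = "times c' a" and ?L = "lex_prod c' a"
  have wo: "well_ord ?Q ?L" by (rule well_ord_lex_prod[OF c' a])
  obtain c r where c: "c \<in> c'" and r: "r \<in> a" and cr: "ordermap ?Q ?L (opair c r) = x"
    using ordermap_surj[OF wo, of x] x unfolding omul_def mem_times by blast
  have pred: "pred ?Q ?L (opair c r) = union (times c a) (img (opair c) r)"
  proof (rule mem_ext)
    have below_iff: "i \<in> c' \<and> y \<in> a \<and> lt ?L (opair i y) (opair c r) \<longleftrightarrow> i \<in> c \<and> y \<in> a \<or> i = c \<and> y \<in> r" for i y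
      unfolding mem_lex_prod using c r ord_trans[OF c', of i c] ord_trans[OF a, of y r] by blast
    have "p \<in> pred ?Q ?L (opair c r) \<longleftrightarrow> (\<exists>i y. p = opair i y \<and> i \<in> c' \<and> y \<in> a \<and> lt ?L (opair i y) (opair c r))" for p
      by auto
    thus "p \<in> pred ?Q ?L (opair c r) \<longleftrightarrow> p \<in> union (times c a) (img (opair c) r)" for p unfolding below_iff by auto
  qed
  have wo_pred: "well_ord (union (times c a) (img (opair c) r)) ?L"
    using well_ord_subset[OF wo pred_subset] pred by metis
  have "x = ordertype (union (times c a) (img (opair c) r)) ?L" using cr unfolding ordermap_def pred by simp
  also have "\<dots> = oadd (ordertype (times c a) ?L) (ordertype (img (opair c) r) ?L)"
  proof (rule ordertype_union[OF wo_pred])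
    fix p q assume "p \<in> times c a" "q \<in> img (opair c) r"
    then obtain i y z where "p = opair i y" "i \<in> c" "y \<in> a" "q = opair c z" "z \<in> r" by auto
    thus "lt ?L p q" using ord_trans[OF c' _ c] ord_trans[OF a _ r] c by (simp add: mem_lex_prod)
  qed
  also have "ordertype (times c a) ?L = omul a c" unfolding omul_def
    by (rule ordertype_agree[OF well_ord_lex_prod[OF ord_mem[OF c' c] a], symmetric])
      (use ord_trans[OF c' _ c] in \<open>auto simp: mem_lex_prod\<close>)
  also have "ordertype (img (opair c) r) ?L = r"
    by (rule ordertype_row[OF ord_mem[OF a r]]) (use c ord_trans[OF a _ r] in \<open>auto simp: mem_lex_prod\<close>)
  finally show ?thesis using that c r by blast
qed

lemma leading_term:
  assumes x: "ordinal x" "x \<noteq> zero"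
  obtains e c r where "ordinal e" "c \<in> omega" "c \<noteq> zero" "r \<in> omega_exp e" "r \<in> x" "x = oadd (omul (omega_exp e) c) r"
proof -
  have "x \<in> omega_exp (succ x)" using subsetD[OF omega_exp_ge[of "succ x"]] x by simp
  then obtain q where q: "ordinal q" "x \<in> omega_exp q" "\<And>c. c \<in> q \<Longrightarrow> \<not> x \<in> omega_exp c"
    using ord_least[of "succ x" "\<lambda>q. x \<in> omega_exp q"] x(1) by auto
  obtain e where e: "e \<in> q" "x \<in> omul (omega_exp e) omega" using mem_omega_exp[OF q(1)] q(2) x(2) by blast
  have ord_e: "ordinal e" "ordinal (omega_exp e)" using ord_mem[OF q(1) e(1)] ord_omega_exp by blast+
  have exp_le: "omega_exp e \<subseteq> x" using q(3)[OF e(1)] ord_not_mem[OF x(1) ord_e(2)] by blast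
  obtain c r where cr: "c \<in> omega" "r \<in> omega_exp e" "x = oadd (omul (omega_exp e) c) r"
    using mem_omulE[OF ord_e(2) ord_omega e(2)] .
  have "r \<in> x" using subsetD[OF exp_le cr(2)] .
  moreover have "c \<noteq> zero"
    using cr(3) \<open>r \<in> x\<close> oadd_zero[OF ord_mem[OF ord_e(2) cr(2)]] omul_zero[OF ord_e(2)] mem_irrefl by metis
  ultimately show ?thesis using that ord_e(1) cr by blast
qed

lemma big_union_succ: "ordinal a \<Longrightarrow> big_union (succ a) = a"
  by (rule mem_ext) (auto intro: ord_trans)

lemma mem_succ_nat_iff:
  assumes m: "m \<in> omega" shows "j \<in> succ m \<longleftrightarrow> j = zero \<or> (\<exists>i. i \<in> m \<and> j = succ i)"
proof -
  have "j \<in> omega" if "j \<in> succ m" using that omega_mem_mem succ_omega m by blast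
  moreover have "zero \<in> succ m" using ord_zero_mem[OF ord_succ[OF ord_omega_mem[OF m]]] by simp
  ultimately show ?thesis
    using omega_cases[of j] succ_mem_succ[OF ord_omega_mem ord_omega_mem[OF m]] omega_mem_mem[OF m] by metis
qed

definition seq_cons :: "'a \<Rightarrow> 'a \<Rightarrow> 'a \<Rightarrow> 'a" where
  "seq_cons m x f = lam (succ m) (\<lambda>j. if j = zero then x else ap f (big_union j))"

lemma fun_on_seq_cons [simp]: "fun_on (seq_cons m x f) (succ m)"
  unfolding seq_cons_def by simp

lemma ap_seq_cons:
  assumes m: "m \<in> omega"
  shows "ap (seq_cons m x f) zero = x" and "j \<in> m \<Longrightarrow> ap (seq_cons m x f) (succ j) = ap f j"
proof -
  note mem = mem_succ_nat_iff[OF m]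
  show "ap (seq_cons m x f) zero = x" unfolding seq_cons_def using mem[of zero] by simp
  assume "j \<in> m"
  thus "ap (seq_cons m x f) (succ j) = ap f j" unfolding seq_cons_def
    using mem[of "succ j"] big_union_succ[OF ord_mem[OF ord_omega_mem[OF m]]] by (simp del: mem_succ)
qed

context
  fixes m b b' :: 'a
  assumes m: "m \<in> omega" and b_succ: "\<And>j. j \<in> m \<Longrightarrow> ap b (succ j) = ap b' j"
    and b_ord: "ordinal (ap b zero)" "\<And>j. j \<in> m \<Longrightarrow> ordinal (ap b' j)"
begin

definition shift :: "'a \<Rightarrow> 'a" where
  "shift p = opair (succ (pfst p)) (psnd p)"

lemma shift_opair [simp]: "shift (opair i x) = opair (succ i) x"
  unfolding shift_def by simp

lemma definable_map_shift: "definable_map shift"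
  unfolding shift_def by (intro definable)

lemma ap_sum_set_succ: "ap_sum_set (succ m) b = union (img (opair zero) (ap b zero)) (img shift (ap_sum_set m b'))"
proof (rule mem_ext)
  have "p \<in> ap_sum_set (succ m) b \<longleftrightarrow>
      (\<exists>x. x \<in> ap b zero \<and> p = opair zero x) \<or> (\<exists>j x. j \<in> m \<and> x \<in> ap b' j \<and> p = opair (succ j) x)" for p
    unfolding mem_ap_sum_set mem_succ_nat_iff[OF m] using b_succ by metis
  moreover have "p \<in> img shift (ap_sum_set m b') \<longleftrightarrow> (\<exists>j x. j \<in> m \<and> x \<in> ap b' j \<and> p = opair (succ j) x)" for p
    unfolding mem_img[OF definable_map_shift] mem_ap_sum_set using shift_opair by metis
  ultimately show "p \<in> ap_sum_set (succ m) b \<longleftrightarrow> p \<in> union (img (opair zero) (ap b zero)) (img shift (ap_sum_set m b'))" for p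
    by simp
qed

lemma ordertype_sum_succ:
  "ordertype (ap_sum_set (succ m) b) (osum_rel (succ m) b) = oadd (ap b zero) (ordertype (ap_sum_set m b') (osum_rel m b'))"
proof -
  let ?B = "ap_sum_set (succ m) b" and ?R = "osum_rel (succ m) b" and ?B' = "ap_sum_set m b'"
  have "ordinal (ap b j)" if "j \<in> succ m" for j using that b_ord b_succ unfolding mem_succ_nat_iff[OF m] by auto
  hence wo: "well_ord ?B ?R" by (rule well_ord_ap_sum_set[OF ord_succ[OF ord_omega_mem[OF m]]])
  have wo': "well_ord ?B' (osum_rel m b')" by (rule well_ord_ap_sum_set[OF ord_omega_mem[OF m] b_ord(2)])
  have row: "opair zero x \<in> ?B" if "x \<in> ap b zero" for x unfolding ap_sum_set_succ using that by simp
  have rest: "opair (succ i) x \<in> ?B" if "i \<in> m" "x \<in> ap b' i" for i x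
    using that b_succ mem_succ_nat_iff[OF m] by (simp del: mem_succ)
  have shift_mem: "shift p \<in> ?B" if "p \<in> ?B'" for p unfolding ap_sum_set_succ using that definable_map_shift by auto
  have R: "lt ?R (opair i x) (opair j y) \<longleftrightarrow> i \<in> j \<or> i = j \<and> x \<in> y" if "opair i x \<in> ?B" "opair j y \<in> ?B" for i x j y
    using that unfolding mem_osum_rel mem_ap_sum_set opair_eq by blast
  have zero_succ: "zero \<in> succ j" if "j \<in> m" for j
    using ord_zero_mem[OF ord_succ[OF ord_mem[OF ord_omega_mem[OF m] that]]] by simp
  have below: "lt ?R p q" if "p \<in> img (opair zero) (ap b zero)" "q \<in> img shift ?B'" for p q
    using that R[OF row rest] zero_succ definable_map_shift by (auto simp del: mem_succ)
  have shift_less: "lt ?R (shift p) (shift q)" if pq: "p \<in> ?B'" "q \<in> ?B'" "lt (osum_rel m b') p q" for p q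
  proof -
    obtain i x j y where p: "p = opair i x" "i \<in> m" "x \<in> ap b' i" and q: "q = opair j y" "j \<in> m" "y \<in> ap b' j"
      using pq(1,2) by auto
    have "i \<in> j \<or> i = j \<and> x \<in> y" using pq(3) unfolding p(1) q(1) mem_osum_rel by blast
    thus ?thesis
      using R[OF rest[OF p(2,3)] rest[OF q(2,3)]] succ_mem_succ ord_mem[OF ord_omega_mem[OF m]] p(2) q(2)
      unfolding p(1) q(1) shift_opair by auto
  qed
  have "ordertype (img (opair zero) (ap b zero)) ?R = ap b zero"
    by (rule ordertype_row[OF b_ord(1)]) (use R[OF row row] in simp)
  moreover have "well_ord (img shift ?B') ?R" by (rule well_ord_subset[OF wo]) (simp add: ap_sum_set_succ subset_def)
  hence "ordertype (img shift ?B') ?R = ordertype ?B' (osum_rel m b')"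
    using ordertype_eq_iff[OF wo'] increasing_isomorphic_img[OF well_ord_lin[OF wo'] well_ord_lin[OF wo] definable_map_shift shift_mem shift_less]
    by metis
  moreover have "ordertype ?B ?R = oadd (ordertype (img (opair zero) (ap b zero)) ?R) (ordertype (img shift ?B') ?R)"
    using ordertype_union[OF wo[unfolded ap_sum_set_succ] below] unfolding ap_sum_set_succ .
  ultimately show ?thesis by simp
qed

end

context
  fixes m e c e0 c0 :: 'a
  assumes data: "cnf_data m e0 c0" and e: "ordinal e" and c: "c \<in> omega" "c \<noteq> zero"
    and below: "\<And>j. j \<in> m \<Longrightarrow> ap e0 j \<in> e"
begin

lemma cnf_data_cons: "cnf_data (succ m) (seq_cons m e e0) (seq_cons m c c0)"
  unfolding cnf_data_def
proof (intro conjI allI impI)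
  note mem = mem_succ_nat_iff[OF cnf_omega[OF data]] and ap = ap_seq_cons[OF cnf_omega[OF data]]
  show "succ m \<in> omega" using cnf_omega[OF data] by simp
  show "ordinal (ap (seq_cons m e e0) j)" "ap (seq_cons m c c0) j \<in> omega" "ap (seq_cons m c c0) j \<noteq> zero"
      if "j \<in> succ m" for j
    using that e c cnf_exp_ord[OF data] cnf_coeff[OF data] unfolding mem by (auto simp: ap)
  show "ap (seq_cons m e e0) j \<in> ap (seq_cons m e e0) i" if ij: "i \<in> j \<and> j \<in> succ m" for i j
  proof -
    obtain j' where j': "j' \<in> m" "j = succ j'" using ij unfolding mem by auto
    have "i \<in> succ m" using ij ord_trans[OF ord_succ[OF ord_omega_mem[OF cnf_omega[OF data]]]] by blast
    then consider (zero) "i = zero" | (succ) i' where "i' \<in> m" "i = succ i'" unfolding mem by blast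
    thus ?thesis
    proof cases
      case zero
      thus ?thesis using j' below by (simp add: ap)
    next
      case (succ i')
      hence "i' \<in> j'" using ij j' succ_mem_succ ord_mem[OF ord_omega_mem[OF cnf_omega[OF data]]] by metis
      thus ?thesis using j' succ cnf_exp_less[OF data] by (simp add: ap)
    qed
  qed
qed simp_all

lemma cnf_val_cons:
  "cnf_val (succ m) (seq_cons m e e0) (seq_cons m c c0) = oadd (omul (omega_exp e) c) (cnf_val m e0 c0)"
proof -
  let ?terms = "cnf_terms (succ m) (seq_cons m e e0) (seq_cons m c c0)"
  have head: "ap ?terms zero = omul (omega_exp e) c"
    using mem_succ_nat_iff[OF cnf_omega[OF data]] ap_seq_cons[OF cnf_omega[OF data]] by (simp del: mem_succ)
  have rest: "ap ?terms (succ j) = ap (cnf_terms m e0 c0) j" if "j \<in> m" for j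
    using that mem_succ_nat_iff[OF cnf_omega[OF data]] ap_seq_cons[OF cnf_omega[OF data]] by (simp del: mem_succ)
  have "ordinal (omul (omega_exp e) c)" by (rule ord_omul[OF ord_omega_exp[OF e] ord_omega_mem[OF c(1)]])
  thus ?thesis
    unfolding cnf_val_def using ordertype_sum_succ[OF cnf_omega[OF data] rest _ cnf_term_ord[OF data]] head by simp
qed

end

lemma cnf_val_zero: "cnf_val zero zero zero = zero"
  unfolding cnf_val_def by (rule ordertype_eq(1)[OF ord_zero isomorphicI[of "\<lambda>x. x"]]) (auto simp: bij_elts_iff)

lemma cnf_ex: "ordinal x \<Longrightarrow> \<exists>m e c. cnf_data m e c \<and> x = cnf_val m e c"
proof (induction rule: ord_induct)
  case (step x)
  show ?case
  proof (cases "x = zero")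
    case True
    have "cnf_data zero zero zero" unfolding cnf_data_def fun_on_def by simp
    thus ?thesis using True cnf_val_zero by metis
  next
    case False
    obtain e c r where e: "ordinal e" and c: "c \<in> omega" "c \<noteq> zero" and r: "r \<in> omega_exp e" "r \<in> x"
      and x: "x = oadd (omul (omega_exp e) c) r"
      using leading_term[OF step(1) False] .
    obtain m e0 c0 where data: "cnf_data m e0 c0" and r_eq: "r = cnf_val m e0 c0" using step(2)[OF r(2)] by blast
    have below: "ap e0 j \<in> e" if j: "j \<in> m" for j
    proof (rule ccontr)
      assume "\<not> ap e0 j \<in> e"
      hence "e \<subseteq> ap e0 j" using ord_not_mem cnf_exp_ord[OF data j] e by blast
      hence "omega_exp e \<subseteq> r"
        using subset_trans[OF omega_exp_mono cnf_term_le[OF data j]] cnf_exp_ord[OF data j] e r_eq by blast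
      thus False using r(1) subsetD mem_irrefl by blast
    qed
    show ?thesis using cnf_data_cons[OF data e c below] cnf_val_cons[OF data e c below] x r_eq by metis
  qed
qed simp

end

subsection \<open>Coordinates in sums of ordinals\<close>

context zf_model
begin

lemma fin_choice:
  assumes n: "n \<in> omega" and P: "definable (\<lambda>v. P (v 0) (v 1))" and ex: "\<And>i. i \<in> n \<Longrightarrow> \<exists>x. P i x"
  obtains f where "\<And>i. i \<in> n \<Longrightarrow> P i (ap f i)"
proof -
  have "(\<forall>i. i \<in> n \<longrightarrow> (\<exists>x. P i x)) \<longrightarrow> (\<exists>f. \<forall>i. i \<in> n \<longrightarrow> P i (ap f i))" using n
  proof (induction rule: omega_induct)
    case defn
    show ?case by (intro definable definable_app2[OF P])
  next
    case (succ n)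
    show ?case
    proof
      assume ex: "\<forall>i. i \<in> succ n \<longrightarrow> (\<exists>x. P i x)"
      then obtain f where f: "\<And>i. i \<in> n \<Longrightarrow> P i (ap f i)" using succ by auto
      obtain x where x: "P n x" using ex by auto
      let ?F = "\<lambda>i. if i = n then x else ap f i"
      have F: "definable_map ?F" by simp
      have "P i (ap (lam (succ n) ?F) i)" if "i \<in> succ n" for i
        unfolding ap_lam[OF F that] using that x f by auto
      thus "\<exists>f. \<forall>i. i \<in> succ n \<longrightarrow> P i (ap f i)" by blast
    qed
  qed simp
  thus ?thesis using ex that by blast
qed

lemma fin_ap_sum_set:
  assumes "finite_set I" "\<And>i. i \<in> I \<Longrightarrow> finite_set (ap b i)"
  shows "finite_set (ap_sum_set I b)"
proof -
  let ?row = "\<lambda>i. img (opair i) (ap b i)"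
  have row: "definable_map ?row" by simp
  have "finite_set (big_union (img ?row I))"
    by (rule fin_big_union_img[OF assms(1) row fin_img[OF assms(2)]]) simp_all
  moreover have "ap_sum_set I b \<subseteq> big_union (img ?row I)"
    unfolding subset_def mem_big_union mem_img[OF row] mem_ap_sum_set by (metis mem_img[OF definable_map_opair])
  ultimately show ?thesis by (rule fin_subset)
qed

definition sum_coordinates :: "'a \<Rightarrow> 'a \<Rightarrow> 'a \<Rightarrow> 'a \<Rightarrow> 'a \<Rightarrow> ('a \<Rightarrow> 'a) \<Rightarrow> ('a \<Rightarrow> 'a) \<Rightarrow> bool" where
  "sum_coordinates T S n b d i x \<longleftrightarrow> definable_map i \<and> definable_map x \<and>
     (\<forall>t. t \<in> T \<longrightarrow> i t \<in> n \<and> x t \<in> ap b (i t)) \<and>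
     (\<forall>j y. j \<in> n \<and> y \<in> ap b j \<longrightarrow> (\<exists>t. t \<in> T \<and> i t = j \<and> x t = y)) \<and>
     (\<forall>s t. s \<in> T \<and> t \<in> T \<longrightarrow> (lt S s t \<longleftrightarrow> i s \<in> i t \<or> i s = i t \<and>
       (ap d (i t) = zero \<and> x s \<in> x t \<or> ap d (i t) = one \<and> x t \<in> x s)))"

lemma sum_coordinatesD:
  assumes "sum_coordinates T S n b d i x"
  shows definable_coordinates: "definable_map i" "definable_map x"
    and coordinates_mem: "\<And>t. t \<in> T \<Longrightarrow> i t \<in> n" "\<And>t. t \<in> T \<Longrightarrow> x t \<in> ap b (i t)"
    and coordinates_surj: "\<And>j y. j \<in> n \<Longrightarrow> y \<in> ap b j \<Longrightarrow> \<exists>t. t \<in> T \<and> i t = j \<and> x t = y"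
    and coordinates_less_iff: "\<And>s t. s \<in> T \<Longrightarrow> t \<in> T \<Longrightarrow> lt S s t \<longleftrightarrow> i s \<in> i t \<or> i s = i t \<and>
      (ap d (i t) = zero \<and> x s \<in> x t \<or> ap d (i t) = one \<and> x t \<in> x s)"
  using assms unfolding sum_coordinates_def by blast+

lemma isomorphic_ap_sumE:
  assumes "isomorphic T S (ap_sum_set n b) (ap_sum_rel n b d)"
  obtains i x where "sum_coordinates T S n b d i x"
proof -
  obtain f where f: "order_iso f T S (ap_sum_set n b) (ap_sum_rel n b d)"
    using assms unfolding isomorphic_iff by blast
  let ?i = "\<lambda>t. pfst (ap f t)" and ?x = "\<lambda>t. psnd (ap f t)"
  have pair: "ap f t = opair (?i t) (?x t)" "?i t \<in> n" "?x t \<in> ap b (?i t)" if "t \<in> T" for t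
    using order_iso_mem[OF f that] by auto
  have "sum_coordinates T S n b d ?i ?x"
    unfolding sum_coordinates_def
  proof (intro conjI allI impI)
    fix j y assume "j \<in> n \<and> y \<in> ap b j"
    hence "opair j y \<in> ap_sum_set n b" by simp
    then obtain t where "t \<in> T" "ap f t = opair j y" using order_iso_surj[OF f] by blast
    thus "\<exists>t. t \<in> T \<and> ?i t = j \<and> ?x t = y" by auto
  next
    fix s t assume st: "s \<in> T \<and> t \<in> T"
    hence "lt S s t \<longleftrightarrow> opair (opair (?i s) (?x s)) (opair (?i t) (?x t)) \<in> ap_sum_rel n b d"
      using order_iso_less_iff[OF f, of s t] pair(1) by simp
    thus "lt S s t \<longleftrightarrow> ?i s \<in> ?i t \<or> ?i s = ?i t \<and>
        (ap d (?i t) = zero \<and> ?x s \<in> ?x t \<or> ap d (?i t) = one \<and> ?x t \<in> ?x s)"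
      unfolding mem_ap_sum_rel using pair(2,3) st by auto
  qed (use pair in \<open>simp_all add: definable\<close>)
  thus ?thesis by (rule that)
qed

lemma isomorphic_ap_sumI:
  assumes coordinates: "sum_coordinates T S n b d i x"
    and inj: "\<And>s t. \<lbrakk>s \<in> T; t \<in> T; i s = i t; x s = x t\<rbrakk> \<Longrightarrow> s = t"
  shows "isomorphic T S (ap_sum_set n b) (ap_sum_rel n b d)"
proof (rule isomorphicI[of "\<lambda>t. opair (i t) (x t)"])
  show "definable_map (\<lambda>t. opair (i t) (x t))" using definable_coordinates[OF coordinates] by simp
  show "bij_betw (\<lambda>t. opair (i t) (x t)) (elts T) (elts (ap_sum_set n b))"
    by (rule bij_eltsI) (use coordinates_mem[OF coordinates] coordinates_surj[OF coordinates] inj in auto)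
  show "lt S s t \<longleftrightarrow> lt (ap_sum_rel n b d) (opair (i s) (x s)) (opair (i t) (x t))" if "s \<in> T" "t \<in> T" for s t
    unfolding mem_ap_sum_rel coordinates_less_iff[OF coordinates that]
    using coordinates_mem[OF coordinates] that by auto
qed

definition sum_point :: "'a \<Rightarrow> 'a \<Rightarrow> 'a \<Rightarrow> 'a" where
  "sum_point I b z = nth_elt (ap_sum_set I b) (osum_rel I b) z"

lemma definable_fn_sum_point [definable, simp]:
  "\<lbrakk>definable_fn I; definable_fn b; definable_fn z\<rbrakk> \<Longrightarrow> definable_fn (\<lambda>v. sum_point (I v) (b v) (z v))"
  by (rule definable_fn_app3[of sum_point]) (unfold sum_point_def, intro definable)

context
  fixes I b :: 'a
  assumes wo: "well_ord (ap_sum_set I b) (osum_rel I b)"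
begin

lemma sum_point:
  assumes "z \<in> ordertype (ap_sum_set I b) (osum_rel I b)"
  shows sum_point_eq: "sum_point I b z = opair (pfst (sum_point I b z)) (psnd (sum_point I b z))"
    and sum_point_index: "pfst (sum_point I b z) \<in> I"
    and sum_point_offset: "psnd (sum_point I b z) \<in> ap b (pfst (sum_point I b z))"
  using nth_elt_mem[OF wo assms] by (auto simp: sum_point_def)

lemma sum_point_less_iff:
  assumes z: "z \<in> ordertype (ap_sum_set I b) (osum_rel I b)" and z': "z' \<in> ordertype (ap_sum_set I b) (osum_rel I b)"
  shows "z \<in> z' \<longleftrightarrow> pfst (sum_point I b z) \<in> pfst (sum_point I b z') \<or>
    pfst (sum_point I b z) = pfst (sum_point I b z') \<and> psnd (sum_point I b z) \<in> psnd (sum_point I b z')"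
proof -
  have "z \<in> z' \<longleftrightarrow> lt (osum_rel I b) (sum_point I b z) (sum_point I b z')"
    using ordermap_iff[OF wo nth_elt_mem[OF wo z] nth_elt_mem[OF wo z']] ordermap_nth_elt[OF wo] z z'
    unfolding sum_point_def by simp
  also have "\<dots> \<longleftrightarrow> lt (osum_rel I b) (opair (pfst (sum_point I b z)) (psnd (sum_point I b z)))
      (opair (pfst (sum_point I b z')) (psnd (sum_point I b z')))"
    using sum_point_eq z z' by simp
  finally show ?thesis unfolding mem_osum_rel using sum_point z z' by blast
qed

lemma sum_point_ex:
  assumes "i \<in> I" "y \<in> ap b i"
  obtains z where "z \<in> ordertype (ap_sum_set I b) (osum_rel I b)" "sum_point I b z = opair i y"
proof -
  have mem: "opair i y \<in> ap_sum_set I b" using assms by simp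
  show ?thesis using that ordermap_mem[OF wo mem] nth_elt_ordermap[OF wo mem] unfolding sum_point_def by blast
qed

end

lemma cnf_infinite:
  assumes data: "cnf_data m e c" and infinite: "\<not> finite_set (cnf_val m e c)"
  shows cnf_nonempty: "zero \<in> m" and cnf_lead_exp: "ap e zero \<noteq> zero"
proof -
  have "\<not> finite_set (ap_sum_set m (cnf_terms m e c))"
    using infinite fin_cong[OF equipotent_ordertype[OF well_ord_cnf[OF data]]] unfolding cnf_val_def by blast
  then obtain j where j: "j \<in> m" "\<not> finite_set (omul (omega_exp (ap e j)) (ap c j))"
    using fin_ap_sum_set fin_omega_mem[OF cnf_omega[OF data]] ap_cnf_terms by metis
  show zero: "zero \<in> m" using ord_zero_mem[OF ord_omega_mem[OF cnf_omega[OF data]]] j(1) not_mem_zero by metis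
  show "ap e zero \<noteq> zero"
  proof
    assume exp: "ap e zero = zero"
    have "j = zero" using cnf_exp_less[OF data, of zero j] ord_zero_mem[OF ord_mem[OF ord_omega_mem[OF cnf_omega[OF data]] j(1)]] j(1) exp by auto
    hence "\<not> finite_set (omul one (ap c zero))" using j(2) exp omega_exp_zero by simp
    moreover have one: "one \<in> omega" by (simp add: one_def)
    moreover have "finite_set (times (ap c zero) one)"
      by (intro fin_times fin_omega_mem cnf_coeff(1)[OF data zero] one)
    ultimately show False
      unfolding omul_def
      using fin_omega_mem fin_ordertype well_ord_lex_prod[OF ord_omega_mem[OF cnf_coeff(1)[OF data zero]] ord_omega_mem[OF one]]
      by blast
  qed
qed

end

subsection \<open>Numbering convex classes\<close>

context zf_model
begin

definition numbering :: "'a \<Rightarrow> ('a \<Rightarrow> 'a) \<Rightarrow> 'a \<Rightarrow> 'a \<Rightarrow> 'a \<Rightarrow> bool" where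
  "numbering T key R N pc \<longleftrightarrow> N \<in> omega \<and> (\<forall>t. t \<in> T \<longrightarrow> ap pc t \<in> N) \<and>
     (\<forall>s t. s \<in> T \<and> t \<in> T \<longrightarrow> (ap pc s = ap pc t \<longleftrightarrow> key s = key t) \<and>
       (ap pc s \<in> ap pc t \<longleftrightarrow> key s \<noteq> key t \<and> lt R s t))"

lemma numberingD:
  assumes "numbering T key R N pc"
  shows numbering_omega: "N \<in> omega" and numbering_mem: "\<And>t. t \<in> T \<Longrightarrow> ap pc t \<in> N"
    and numbering_eq_iff: "\<And>s t. s \<in> T \<Longrightarrow> t \<in> T \<Longrightarrow> ap pc s = ap pc t \<longleftrightarrow> key s = key t"
    and numbering_less_iff: "\<And>s t. s \<in> T \<Longrightarrow> t \<in> T \<Longrightarrow> ap pc s \<in> ap pc t \<longleftrightarrow> key s \<noteq> key t \<and> lt R s t"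
  using assms unfolding numbering_def by blast+

lemma lin_ord_quotient:
  assumes lin: "lin_ord T R"
    and Q: "\<And>s t. s \<in> T \<Longrightarrow> t \<in> T \<Longrightarrow> lt Q (key s) (key t) \<longleftrightarrow> key s \<noteq> key t \<and> lt R s t"
    and K: "\<And>u. u \<in> K \<longleftrightarrow> (\<exists>t. t \<in> T \<and> u = key t)"
  shows "lin_ord K Q"
  unfolding lin_ord_def
proof (intro conjI allI impI)
  show "\<not> lt Q x x" if "x \<in> K" for x using that Q[of t t for t] unfolding K by metis
  show "lt Q x y \<or> lt Q y x" if xy: "x \<in> K \<and> y \<in> K \<and> x \<noteq> y" for x y
  proof -
    obtain s t where "s \<in> T" "t \<in> T" "x = key s" "y = key t" using xy unfolding K by blast
    thus ?thesis using Q[of s t] Q[of t s] lin_total[OF lin, of s t] xy by metis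
  qed
  show "lt Q x z" if xyz: "x \<in> K \<and> y \<in> K \<and> z \<in> K \<and> lt Q x y \<and> lt Q y z" for x y z
  proof -
    obtain r s t where T: "r \<in> T" "s \<in> T" "t \<in> T" and keys: "x = key r" "y = key s" "z = key t"
      using xyz unfolding K by blast
    have less: "lt R r s" "lt R s t" using xyz Q T keys by blast+
    have "key r \<noteq> key t"
      using xyz Q[of r s] Q[of t s] T keys lin_asym[OF lin T(2,3)] less by metis
    thus ?thesis using Q[OF T(1,3)] lin_trans[OF lin T less] keys by blast
  qed
qed

lemma numbering_ex:
  assumes lin: "lin_ord T R" and key: "definable_map key" and fin: "finite_set (img key T)"
    and descends: "\<And>s t s' t'. \<lbrakk>s \<in> T; t \<in> T; s' \<in> T; t' \<in> T; key s' = key s; key t' = key t; key s \<noteq> key t;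
      lt R s t\<rbrakk> \<Longrightarrow> lt R s' t'"
  obtains N pc where "numbering T key R N pc"
proof -
  let ?K = "img key T"
  have K: "u \<in> ?K \<longleftrightarrow> (\<exists>t. t \<in> T \<and> u = key t)" for u by (rule mem_img[OF key])
  let ?related = "\<lambda>p. \<exists>s t. s \<in> T \<and> t \<in> T \<and> key s \<noteq> key t \<and> lt R s t \<and> p = opair (key s) (key t)"
  define Q where "Q = sep (times ?K ?K) ?related"
  have "definable (\<lambda>v. ?related (v 0))" by (intro definable definable_fn_app1[OF key])
  hence "lt Q x y \<longleftrightarrow> x \<in> ?K \<and> y \<in> ?K \<and> ?related (opair x y)" for x y unfolding Q_def by simp
  hence Q: "lt Q (key s) (key t) \<longleftrightarrow> key s \<noteq> key t \<and> lt R s t" if "s \<in> T" "t \<in> T" for s t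
    using that K descends[of _ _ s t] unfolding opair_eq by metis
  have wo: "well_ord ?K Q" by (rule fin_lin_well_ord[OF fin lin_ord_quotient[OF lin Q K]])
  define pc where "pc = lam T (\<lambda>t. ordermap ?K Q (key t))"
  have pc: "ap pc t = ordermap ?K Q (key t)" if "t \<in> T" for t
    unfolding pc_def by (rule ap_lam[OF definable_fn_ordermap that]) (simp_all add: key)
  have mem: "key t \<in> ?K" if "t \<in> T" for t using K that by blast
  have "numbering T key R (ordertype ?K Q) pc"
    unfolding numbering_def
    using fin_ordertype[OF fin wo] ordermap_mem[OF wo mem] ordermap_inj[OF wo mem mem] ordermap_iff[OF wo mem mem] pc Q
    by (intro conjI allI impI) metis+
  thus ?thesis by (rule that)
qed

lemma ap_factor_ex:
  assumes f: "definable_map f" and factor: "\<And>s t. \<lbrakk>s \<in> T; t \<in> T; ap pc s = ap pc t\<rbrakk> \<Longrightarrow> f s = f t"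
  obtains h where "\<And>t. t \<in> T \<Longrightarrow> ap h (ap pc t) = f t"
proof -
  define h where "h = img (\<lambda>t. opair (ap pc t) (f t)) T"
  have h: "opair q y \<in> h \<longleftrightarrow> (\<exists>t. t \<in> T \<and> q = ap pc t \<and> y = f t)" for q y
    unfolding h_def using f by simp
  have "ap h (ap pc t) = f t" if t: "t \<in> T" for t
    unfolding ap_def[of h]
  proof (rule desc_eq)
    show "opair (ap pc t) (f t) \<in> h" using h t by blast
    show "y = f t" if "opair (ap pc t) y \<in> h" for y using that h factor t by metis
  qed
  thus ?thesis by (rule that)
qed

end

subsection \<open>The well-order of type \<open>\<beta>(\<tau>)\<close>\<close>

text \<open>
  A point is the \<open>place\<close>-th element of the \<open>copy\<close>-th copy of \<open>\<omega>\<^bsup>expo\<^esup>\<close> in the \<open>row\<close>-th term of the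
  normal form of its \<open>summand\<close>; that term is the \<open>rank\<close>-th one in decreasing order.
\<close>

locale beta_expansion = zf_model mem
  for mem :: "'a \<Rightarrow> 'a \<Rightarrow> bool"  (infix "\<in>" 50) +
  fixes T S n b d m \<epsilon> \<gamma> N g u :: 'a and summand position :: "'a \<Rightarrow> 'a"
  assumes lin_S: "lin_ord T S" and n: "n \<in> omega"
    and direction: "i \<in> n \<Longrightarrow> ap d i = zero \<or> ap d i = one"
    and alternating: "succ i \<in> n \<Longrightarrow> ap d (succ i) \<noteq> ap d i"
    and coordinates: "sum_coordinates T S n b d summand position"
    and infinite: "i \<in> n \<Longrightarrow> \<not> finite_set (ap b i)"
    and cnf: "i \<in> n \<Longrightarrow> cnf_data (ap m i) (ap \<epsilon> i) (ap \<gamma> i)"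
    and b_cnf: "i \<in> n \<Longrightarrow> ap b i = cnf_val (ap m i) (ap \<epsilon> i) (ap \<gamma> i)"
    and N: "N \<in> omega" and g: "bij_betw (ap g) (elts N) (elts (ap_sum_set n m))"
    and u_term: "l \<in> N \<Longrightarrow> ap g l = opair i j \<Longrightarrow> ap u l = ap (cnf_terms (ap m i) (ap \<epsilon> i) (ap \<gamma> i)) j"
    and u_decreasing: "l \<in> l' \<Longrightarrow> l' \<in> N \<Longrightarrow> ap u l' \<subseteq> ap u l"
begin

abbreviation terms :: "'a \<Rightarrow> 'a" where
  "terms i \<equiv> cnf_terms (ap m i) (ap \<epsilon> i) (ap \<gamma> i)"

definition row :: "'a \<Rightarrow> 'a" where
  "row t = pfst (sum_point (ap m (summand t)) (terms (summand t)) (position t))"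

definition offset :: "'a \<Rightarrow> 'a" where
  "offset t = psnd (sum_point (ap m (summand t)) (terms (summand t)) (position t))"

definition expo :: "'a \<Rightarrow> 'a" where
  "expo t = ap (ap \<epsilon> (summand t)) (row t)"

definition coeff :: "'a \<Rightarrow> 'a" where
  "coeff t = ap (ap \<gamma> (summand t)) (row t)"

abbreviation copies :: "'a \<Rightarrow> 'a" where
  "copies t \<equiv> const (coeff t) (omega_exp (expo t))"

definition copy :: "'a \<Rightarrow> 'a" where
  "copy t = pfst (sum_point (coeff t) (copies t) (offset t))"

definition place :: "'a \<Rightarrow> 'a" where
  "place t = psnd (sum_point (coeff t) (copies t) (offset t))"

definition rank :: "'a \<Rightarrow> 'a" where
  "rank t = inv_on N (ap g) (opair (summand t) (row t))"

definition W :: 'a where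
  "W = sep (times T T) (\<lambda>p. rank (pfst p) \<in> rank (psnd p) \<or>
    rank (pfst p) = rank (psnd p) \<and> offset (pfst p) \<in> offset (psnd p))"

definition key :: "'a \<Rightarrow> 'a" where
  "key t = opair (opair (summand t) (row t)) (copy t)"

lemmas summand_mem = coordinates_mem(1)[OF coordinates]
  and position_mem = coordinates_mem(2)[OF coordinates]
  and position_surj = coordinates_surj[OF coordinates]
  and S_position_iff = coordinates_less_iff[OF coordinates]

lemma definable_fn_summand [definable, simp]: "definable_fn f \<Longrightarrow> definable_fn (\<lambda>v. summand (f v))"
  and definable_fn_position [definable, simp]: "definable_fn f \<Longrightarrow> definable_fn (\<lambda>v. position (f v))"
  using definable_fn_app1 definable_coordinates[OF coordinates] by blast+

lemma definable_fn_row [definable, simp]: "definable_fn f \<Longrightarrow> definable_fn (\<lambda>v. row (f v))"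
  and definable_fn_offset [definable, simp]: "definable_fn f \<Longrightarrow> definable_fn (\<lambda>v. offset (f v))"
  unfolding row_def offset_def by simp_all

lemma definable_fn_expo [definable, simp]: "definable_fn f \<Longrightarrow> definable_fn (\<lambda>v. expo (f v))"
  and definable_fn_coeff [definable, simp]: "definable_fn f \<Longrightarrow> definable_fn (\<lambda>v. coeff (f v))"
  and definable_fn_rank [definable, simp]: "definable_fn f \<Longrightarrow> definable_fn (\<lambda>v. rank (f v))"
  unfolding expo_def coeff_def rank_def by simp_all

lemma definable_fn_copy [definable, simp]: "definable_fn f \<Longrightarrow> definable_fn (\<lambda>v. copy (f v))"
  and definable_fn_place [definable, simp]: "definable_fn f \<Longrightarrow> definable_fn (\<lambda>v. place (f v))"
  unfolding copy_def place_def by simp_all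

lemma definable_fn_key [definable, simp]: "definable_fn f \<Longrightarrow> definable_fn (\<lambda>v. key (f v))"
  unfolding key_def by simp

lemma key_eq: "key s = key t \<longleftrightarrow> summand s = summand t \<and> row s = row t \<and> copy s = copy t"
  unfolding key_def by auto

lemma summand_ord: "t \<in> T \<Longrightarrow> ordinal (summand t)"
  using summand_mem n ord_mem ord_omega_mem by blast

lemma well_ord_copies:
  assumes i: "i \<in> n" and j: "j \<in> ap m i"
  defines "c \<equiv> ap (ap \<gamma> i) j" and "a \<equiv> omega_exp (ap (ap \<epsilon> i) j)"
  shows "well_ord (ap_sum_set c (const c a)) (osum_rel c (const c a))"
    and "ap (terms i) j = ordertype (ap_sum_set c (const c a)) (osum_rel c (const c a))"
proof -
  have ord: "ordinal c" "ordinal a"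
    unfolding c_def a_def
    using ord_omega_mem[OF cnf_coeff(1)[OF cnf[OF i] j]] ord_omega_exp[OF cnf_exp_ord[OF cnf[OF i] j]] by simp_all
  show "well_ord (ap_sum_set c (const c a)) (osum_rel c (const c a))"
    by (rule well_ord_ap_sum_set[OF ord(1)]) (simp add: ord)
  show "ap (terms i) j = ordertype (ap_sum_set c (const c a)) (osum_rel c (const c a))"
    using omul_eq_sum[OF ord(2,1)] j unfolding c_def a_def by simp
qed

lemma point:
  assumes t: "t \<in> T"
  shows row_mem: "row t \<in> ap m (summand t)" and offset_mem: "offset t \<in> ap (terms (summand t)) (row t)"
    and copy_mem: "copy t \<in> coeff t" and place_mem: "place t \<in> omega_exp (expo t)"
proof -
  note i = summand_mem[OF t]
  have position: "position t \<in> ordertype (ap_sum_set (ap m (summand t)) (terms (summand t))) (osum_rel (ap m (summand t)) (terms (summand t)))"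
    using position_mem[OF t] b_cnf[OF i] unfolding cnf_val_def by simp
  note cnf_point = sum_point[OF well_ord_cnf[OF cnf[OF i]] position, folded row_def offset_def]
  show row: "row t \<in> ap m (summand t)" and offset: "offset t \<in> ap (terms (summand t)) (row t)"
    by (fact cnf_point)+
  note wo = well_ord_copies[OF i row, folded coeff_def expo_def]
  note copy_point = sum_point[OF wo(1) offset[unfolded wo(2)], folded copy_def place_def]
  show copy: "copy t \<in> coeff t" by (fact copy_point)
  show "place t \<in> omega_exp (expo t)" using copy_point(3) copy by simp
qed

lemma expo_ord: "t \<in> T \<Longrightarrow> ordinal (expo t)"
  unfolding expo_def by (rule cnf_exp_ord[OF cnf[OF summand_mem] row_mem])

lemma coeff_omega: "t \<in> T \<Longrightarrow> coeff t \<in> omega"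
  unfolding coeff_def by (rule cnf_coeff(1)[OF cnf[OF summand_mem] row_mem])

lemma row_copy_ord: "t \<in> T \<Longrightarrow> ordinal (row t)" "t \<in> T \<Longrightarrow> ordinal (copy t)"
  using ord_mem ord_omega_mem cnf_omega[OF cnf[OF summand_mem]] row_mem coeff_omega copy_mem by blast+

lemma position_less_iff:
  assumes s: "s \<in> T" and t: "t \<in> T" and same: "summand s = summand t"
  shows "position s \<in> position t \<longleftrightarrow> row s \<in> row t \<or> row s = row t \<and> offset s \<in> offset t"
  using sum_point_less_iff[OF well_ord_cnf[OF cnf[OF summand_mem[OF t]]], of "position s" "position t"] summand_mem[OF s] position_mem[OF s] position_mem[OF t]
    b_cnf[OF summand_mem[OF t]] same unfolding row_def offset_def cnf_val_def by simp

lemma offset_less_iff: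
  assumes s: "s \<in> T" and t: "t \<in> T" and same: "summand s = summand t" "row s = row t"
  shows "offset s \<in> offset t \<longleftrightarrow> copy s \<in> copy t \<or> copy s = copy t \<and> place s \<in> place t"
proof -
  have eq: "coeff s = coeff t" "expo s = expo t" unfolding coeff_def expo_def same by simp_all
  note wo = well_ord_copies[OF summand_mem[OF t] row_mem[OF t], folded coeff_def expo_def]
  show ?thesis
    using sum_point_less_iff[OF wo(1), of "offset s" "offset t"] offset_mem[OF s] offset_mem[OF t] wo(2) same
    unfolding copy_def place_def eq by simp
qed

lemma offset_ex:
  assumes i: "i \<in> n" and j: "j \<in> ap m i" and z: "z \<in> ap (terms i) j"
  obtains t where "t \<in> T" "summand t = i" "row t = j" "offset t = z"
proof -
  obtain x where x: "x \<in> ap b i" "sum_point (ap m i) (terms i) x = opair j z"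
    using sum_point_ex[OF well_ord_cnf[OF cnf[OF i]] j z] b_cnf[OF i] unfolding cnf_val_def by metis
  obtain t where "t \<in> T" "summand t = i" "position t = x" using position_surj[OF i x(1)] by blast
  thus ?thesis using that x(2) unfolding row_def offset_def by simp
qed

lemma place_ex:
  assumes i: "i \<in> n" and j: "j \<in> ap m i" and k: "k \<in> ap (ap \<gamma> i) j" and y: "y \<in> omega_exp (ap (ap \<epsilon> i) j)"
  obtains t where "t \<in> T" "summand t = i" "row t = j" "copy t = k" "place t = y"
proof -
  note wo = well_ord_copies[OF i j]
  obtain z where z: "z \<in> ap (terms i) j"
    "sum_point (ap (ap \<gamma> i) j) (const (ap (ap \<gamma> i) j) (omega_exp (ap (ap \<epsilon> i) j))) z = opair k y"
    using sum_point_ex[OF wo(1) k] y k wo(2) by (metis ap_const)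
  obtain t where "t \<in> T" "summand t = i" "row t = j" "offset t = z" using offset_ex[OF i j z(1)] .
  thus ?thesis using that z(2) unfolding copy_def place_def coeff_def expo_def by simp
qed

lemma S_iff:
  assumes s: "s \<in> T" and t: "t \<in> T"
  shows "lt S s t \<longleftrightarrow> summand s \<in> summand t \<or> summand s = summand t \<and>
    (ap d (summand t) = zero \<and> (row s \<in> row t \<or> row s = row t \<and> (copy s \<in> copy t \<or> copy s = copy t \<and> place s \<in> place t)) \<or>
     ap d (summand t) = one \<and> (row t \<in> row s \<or> row t = row s \<and> (copy t \<in> copy s \<or> copy t = copy s \<and> place t \<in> place s)))"
  unfolding S_position_iff[OF s t]
  using position_less_iff[OF s t] position_less_iff[OF t s] offset_less_iff[OF s t] offset_less_iff[OF t s]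
  by (cases "summand s = summand t"; cases "row s = row t") auto

lemma rank:
  assumes "t \<in> T"
  shows rank_mem: "rank t \<in> N" and g_rank: "ap g (rank t) = opair (summand t) (row t)"
    and u_rank: "ap u (rank t) = ap (terms (summand t)) (row t)"
proof -
  have "opair (summand t) (row t) \<in> ap_sum_set n m" using summand_mem row_mem assms by simp
  thus rank: "rank t \<in> N" "ap g (rank t) = opair (summand t) (row t)"
    unfolding rank_def by (fact inv_on_mem[OF g] ap_inv_on[OF g])+
  show "ap u (rank t) = ap (terms (summand t)) (row t)" by (rule u_term[OF rank])
qed

lemma rank_eq_iff: "s \<in> T \<Longrightarrow> t \<in> T \<Longrightarrow> rank s = rank t \<longleftrightarrow> summand s = summand t \<and> row s = row t"
  using g_rank opair_eq rank_def by metis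

lemma g_pair:
  assumes "l \<in> N"
  obtains i j where "ap g l = opair i j" "i \<in> n" "j \<in> ap m i"
  using bij_elts_mem[OF g assms] by auto

lemma u_ord: "l \<in> N \<Longrightarrow> ordinal (ap u l)"
  using g_pair u_term cnf_term_ord[OF cnf] by metis

lemma W_rank_offset: "s \<in> T \<Longrightarrow> t \<in> T \<Longrightarrow> lt W s t \<longleftrightarrow> rank s \<in> rank t \<or> rank s = rank t \<and> offset s \<in> offset t"
  unfolding W_def by simp

lemma W_iff:
  assumes "s \<in> T" "t \<in> T"
  shows "lt W s t \<longleftrightarrow> rank s \<in> rank t \<or>
    rank s = rank t \<and> (copy s \<in> copy t \<or> copy s = copy t \<and> place s \<in> place t)"
  using W_rank_offset[OF assms] offset_less_iff[OF assms] rank_eq_iff[OF assms] by blast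

lemma W_isomorphic: "isomorphic T W (ap_sum_set N u) (osum_rel N u)"
  unfolding osum_rel_def
proof (rule isomorphic_ap_sumI[of T W N u _ rank offset])
  show "sum_coordinates T W N u (const N zero) rank offset"
    unfolding sum_coordinates_def
  proof (intro conjI allI impI)
    fix l z assume l: "l \<in> N \<and> z \<in> ap u l"
    obtain i j where ij: "ap g l = opair i j" "i \<in> n" "j \<in> ap m i" using g_pair l by blast
    obtain t where t: "t \<in> T" "summand t = i" "row t = j" "offset t = z"
      using offset_ex[OF ij(2,3)] l u_term[OF _ ij(1)] by metis
    thus "\<exists>t. t \<in> T \<and> rank t = l \<and> offset t = z"
      using inv_on_ap[OF g, of l] l ij(1) unfolding rank_def by auto
  qed (use rank offset_mem W_rank_offset in auto)
next
  fix s t assume st: "s \<in> T" "t \<in> T" and same: "rank s = rank t" "offset s = offset t"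
  hence "summand s = summand t" "row s = row t" using rank_eq_iff by blast+
  hence "\<not> lt S s t" "\<not> lt S t s"
    using S_position_iff[OF st] S_position_iff[OF st(2,1)] position_less_iff[OF st] position_less_iff[OF st(2,1)] same
    by simp_all
  thus "s = t" using lin_total[OF lin_S st] by blast
qed

lemma well_ord_osum: "well_ord (ap_sum_set N u) (osum_rel N u)"
  by (rule well_ord_ap_sum_set[OF ord_omega_mem[OF N] u_ord])

lemma well_ord_W: "well_ord T W"
  by (rule isomorphic_well_ord[OF W_isomorphic well_ord_osum])

lemma osum_eq_ordertype: "fun_on u N \<Longrightarrow> osum N u = ordertype T W"
  using osum_eq[OF ord_omega_mem[OF N] _ u_ord] ordertype_eq_iff[OF well_ord_W well_ord_osum] W_isomorphic by simp

lemma fin_key: "finite_set (img key T)"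
proof -
  let ?coeff = "\<lambda>p. ap (ap \<gamma> (pfst p)) (psnd p)"
  let ?keys = "ap_sum_set (ap_sum_set n m) (lam (ap_sum_set n m) ?coeff)"
  have coeff: "definable_map ?coeff" by simp
  have "finite_set (ap_sum_set n m)"
    by (rule fin_ap_sum_set[OF fin_omega_mem[OF n]]) (use cnf_omega[OF cnf] fin_omega_mem in blast)
  hence "finite_set ?keys"
    by (rule fin_ap_sum_set) (use cnf_coeff(1)[OF cnf] fin_omega_mem in \<open>auto simp: ap_lam[OF coeff]\<close>)
  moreover have "img key T \<subseteq> ?keys"
    using summand_mem row_mem copy_mem by (auto simp: subset_def key_def coeff_def ap_lam[OF coeff])
  ultimately show ?thesis by (rule fin_subset)
qed

lemma S_descends:
  assumes "s \<in> T" "t \<in> T" "s' \<in> T" "t' \<in> T" "key s' = key s" "key t' = key t" "key s \<noteq> key t" "lt S s t"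
  shows "lt S s' t'"
  using assms(5-8) unfolding S_iff[OF assms(1,2)] S_iff[OF assms(3,4)] key_eq by auto

lemma W_descends:
  assumes "s \<in> T" "t \<in> T" "s' \<in> T" "t' \<in> T" "key s' = key s" "key t' = key t" "key s \<noteq> key t" "lt W s t"
  shows "lt W s' t'"
proof -
  have "rank s' = rank s" "rank t' = rank t" using assms key_eq rank_eq_iff by blast+
  thus ?thesis
    using assms(5-8) rank_eq_iff[OF assms(1,2)] unfolding W_iff[OF assms(1,2)] W_iff[OF assms(3,4)] key_eq by auto
qed

context
  fixes s t :: 'a
  assumes st: "s \<in> T" "t \<in> T" and same: "key s = key t"
begin

lemma same_expo: "expo s = expo t"
  using same unfolding key_eq expo_def by simp

lemma same_W_iff: "lt W s t \<longleftrightarrow> place s \<in> place t"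
  using W_iff[OF st] same rank_eq_iff[OF st] unfolding key_eq by auto

lemma same_S_iff: "lt S s t \<longleftrightarrow> (if ap d (summand t) = zero then place s \<in> place t else place t \<in> place s)"
  using S_iff[OF st] same direction[OF summand_mem[OF st(2)]] unfolding key_eq by auto

end

lemma place_inj: "\<lbrakk>s \<in> T; t \<in> T; key s = key t; place s = place t\<rbrakk> \<Longrightarrow> s = t"
  using lin_total[OF well_ord_lin[OF well_ord_W]] same_W_iff[of s t] same_W_iff[of t s]
  by (metis mem_irrefl)

lemma place_mem_same: "\<lbrakk>s \<in> T; t \<in> T; key s = key t\<rbrakk> \<Longrightarrow> place s \<in> omega_exp (expo t)"
  using place_mem same_expo by metis

lemma place_surj:
  assumes "t \<in> T" "y \<in> omega_exp (expo t)"
  shows "\<exists>s. s \<in> T \<and> key s = key t \<and> place s = y"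
  using place_ex[OF summand_mem row_mem copy_mem[unfolded coeff_def] assms(2)[unfolded expo_def]] assms(1) key_eq
  by metis

lemma expo_nonzero:
  assumes t: "t \<in> T" "expo t \<noteq> zero"
  obtains s where "s \<in> T" "key s = key t" "s \<noteq> t"
proof -
  have "one \<in> omega_exp (expo t)"
    using omega_exp_less[OF expo_ord ord_zero_mem[OF expo_ord]] t omega_exp_zero by simp
  then obtain s where s: "s \<in> T" "key s = key t" "place s = one" using place_surj[OF t(1)] by blast
  obtain s' where s': "s' \<in> T" "key s' = key t" "place s' = zero"
    using place_surj[OF t(1) omega_exp_zero_mem[OF expo_ord[OF t(1)]]] by blast
  have "s \<noteq> s'" using s s' by auto
  thus ?thesis using that s s' by metis
qed

context
  fixes pc :: 'a
  assumes pc: "\<And>s t. s \<in> T \<Longrightarrow> t \<in> T \<Longrightarrow> ap pc s = ap pc t \<longleftrightarrow> key s = key t"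
begin

lemma place_isomorphic:
  assumes t: "t \<in> T" and A: "A \<subseteq> piece T pc t"
  shows "isomorphic A W (img place A) (memrel (omega_exp (expo t)))"
proof (rule increasing_isomorphic_img)
  have mem: "s \<in> T" "key s = key t" if "s \<in> A" for s using subsetD[OF A that] pc[OF _ t] by auto
  show place: "place s \<in> omega_exp (expo t)" if "s \<in> A" for s
    using place_mem_same[OF mem(1)[OF that] t mem(2)[OF that]] .
  show "lin_ord A W" by (rule lin_subset[OF well_ord_lin[OF well_ord_W] subsetI]) (rule mem(1))
  show "lin_ord (omega_exp (expo t)) (memrel (omega_exp (expo t)))"
    by (rule lin_memrel[OF ord_omega_exp[OF expo_ord[OF t]]])
  show "lt (memrel (omega_exp (expo t))) (place r) (place s)" if "r \<in> A" "s \<in> A" "lt W r s" for r s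
    using same_W_iff[OF mem(1) mem(1)] mem(2) place that by simp
qed simp

lemma piece_type:
  assumes t: "t \<in> T" shows "ordertype (piece T pc t) W = omega_exp (expo t)"
proof -
  have "img place (piece T pc t) = omega_exp (expo t)"
  proof (rule mem_ext)
    show "y \<in> img place (piece T pc t) \<longleftrightarrow> y \<in> omega_exp (expo t)" for y
      using place_mem_same[OF _ t] place_surj[OF t, of y] pc[OF _ t] by auto
  qed
  thus ?thesis using ordertype_eq(1)[OF ord_omega_exp[OF expo_ord[OF t]]] place_isomorphic[OF t subset_refl] by simp
qed

lemma tail_type:
  assumes t: "t \<in> T" shows "ordertype (tail T W pc t) W = omega_exp (expo t)"
proof -
  have tail: "s \<in> tail T W pc t \<longleftrightarrow> s \<in> T \<and> key s = key t \<and> (place s = place t \<or> place t \<in> place s)" for s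
    using pc[OF _ t, of s] same_W_iff[OF t, of s] place_inj[OF _ t, of s] t unfolding mem_tail by metis
  have "img place (tail T W pc t) = ord_tail (omega_exp (expo t)) (place t)"
  proof (rule mem_ext)
    show "y \<in> img place (tail T W pc t) \<longleftrightarrow> y \<in> ord_tail (omega_exp (expo t)) (place t)" for y
      unfolding mem_ord_tail mem_img[OF definable_fn_place[OF definable_fn_var]] tail
      using place_mem_same[OF _ t] place_surj[OF t, of y] by metis
  qed
  hence "isomorphic (tail T W pc t) W (ord_tail (omega_exp (expo t)) (place t)) (memrel (omega_exp (expo t)))"
    using place_isomorphic[OF t tail_subset_piece[of T W pc t]] by simp
  moreover have "well_ord (tail T W pc t) W" by (rule well_ord_subset[OF well_ord_W]) (simp add: subset_def)
  ultimately show ?thesis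
    using ordertype_eq_iff[OF _ well_ord_ord_tail[OF ord_omega_exp[OF expo_ord[OF t]]]]
      omega_exp_tail[OF expo_ord[OF t] place_mem[OF t]] by metis
qed

end

lemma lead_ex:
  assumes i: "i \<in> n"
  obtains r where "r \<in> T" "summand r = i" "row r = zero" "copy r = zero" "expo r \<noteq> zero"
proof -
  have inf: "\<not> finite_set (cnf_val (ap m i) (ap \<epsilon> i) (ap \<gamma> i))" using infinite[OF i] b_cnf[OF i] by simp
  note zero = cnf_nonempty[OF cnf[OF i] inf]
  have "zero \<in> ap (ap \<gamma> i) zero" using ord_zero_mem[OF ord_omega_mem] cnf_coeff[OF cnf[OF i] zero] by blast
  then obtain r where "r \<in> T" "summand r = i" "row r = zero" "copy r = zero"
    using place_ex[OF i zero _ omega_exp_zero_mem[OF cnf_exp_ord[OF cnf[OF i] zero]]] by blast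
  thus ?thesis using that cnf_lead_exp[OF cnf[OF i] inf] unfolding expo_def by simp
qed

lemma neighbour_ex:
  assumes s: "s \<in> T" and t: "t \<in> T"
    and side: "if ap d (summand t) = zero then summand s \<in> summand t else summand t \<in> summand s"
  obtains i where "i \<in> n" "ap d i \<noteq> ap d (summand t)"
    "if ap d (summand t) = zero then i \<in> summand t \<and> (summand s \<in> i \<or> summand s = i)
     else summand t \<in> i \<and> (i \<in> summand s \<or> i = summand s)"
proof (cases "ap d (summand t) = zero")
  case True
  have "summand t \<in> omega" using omega_mem_mem[OF n summand_mem[OF t]] .
  then obtain i where i: "summand t = succ i" using omega_cases side True by force
  hence "i \<in> n" using ord_trans[OF ord_omega_mem[OF n] _ summand_mem[OF t]] by simp
  thus ?thesis using that[of i] alternating[of i] summand_mem[OF t] side True i by auto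
next
  case False
  let ?i = "succ (summand t)"
  have le: "?i \<in> summand s \<or> ?i = summand s"
    using side False ord_subset_iff[of ?i "summand s"] succ_subset_iff summand_ord[OF s] summand_ord[OF t] by simp
  hence "?i \<in> n" using ord_trans[OF ord_omega_mem[OF n] _ summand_mem[OF s]] summand_mem[OF s] by auto
  thus ?thesis using that[of ?i] alternating[of "summand t"] le False by simp
qed

text \<open>The leading piece of a neighbouring summand is infinite and has the opposite direction.\<close>

lemma separating_ex:
  assumes s: "s \<in> T" and t: "t \<in> T"
    and "if ap d (summand t) = zero then summand s \<in> summand t else summand t \<in> summand s"
  obtains r where "r \<in> T" "expo r \<noteq> zero" "ap d (summand r) \<noteq> ap d (summand t)" "key r \<noteq> key t"
    "key r = key s \<or> (if ap d (summand t) = zero then lt S s r \<and> lt S r t else lt S t r \<and> lt S r s)"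
proof -
  obtain i where i: "i \<in> n" "ap d i \<noteq> ap d (summand t)"
    "if ap d (summand t) = zero then i \<in> summand t \<and> (summand s \<in> i \<or> summand s = i)
     else summand t \<in> i \<and> (i \<in> summand s \<or> i = summand s)"
    using neighbour_ex[OF assms] .
  obtain r where r: "r \<in> T" "summand r = i" "row r = zero" "copy r = zero" "expo r \<noteq> zero"
    using lead_ex[OF i(1)] .
  have "row s = zero \<or> zero \<in> row s" "copy s = zero \<or> zero \<in> copy s"
    using ord_zero_mem row_copy_ord[OF s] by metis+
  hence "key r = key s \<or> (if ap d i = zero then lt S r s else lt S s r)" if "summand s = i"
    unfolding key_eq S_iff[OF s r(1)] S_iff[OF r(1) s] using that r(2-4) direction[OF i(1)] by auto
  hence "key r = key s \<or> (if ap d (summand t) = zero then lt S s r else lt S r s)"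
    using i direction[OF i(1)] direction[OF summand_mem[OF t]] S_iff[OF s r(1)] S_iff[OF r(1) s] r(2) by metis
  moreover have "if ap d (summand t) = zero then lt S r t else lt S t r"
    using i(3) S_iff[OF r(1) t] S_iff[OF t r(1)] r(2) by simp
  moreover have "key r \<noteq> key t" using i r(2) unfolding key_eq by (auto split: if_splits)
  ultimately show ?thesis using that[OF r(1,5)] i(2) r(2) by (auto split: if_splits)
qed

lemma convex_pieces_S:
  assumes pc: "numbering T key S N' pc" and d': "\<And>t. t \<in> T \<Longrightarrow> ap d' (ap pc t) = ap d (summand t)"
  shows "convex_pieces mem T S W pc N' d'"
proof
  show "lt W s t \<longleftrightarrow> (if ap d' (ap pc t) = zero then lt S s t else lt S t s)"
    if st: "s \<in> T" "t \<in> T" "ap pc s = ap pc t" for s t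
  proof -
    have key: "key s = key t" "key t = key s" "summand s = summand t"
      using numbering_eq_iff[OF pc st(1,2)] st(3) key_eq by auto
    show ?thesis
      using same_W_iff[OF st(1,2) key(1)] same_S_iff[OF st(1,2) key(1)] same_S_iff[OF st(2,1) key(2)] d'[OF st(2)] key(3) by simp
  qed
  show "well_ord (piece T pc t) W" for t by (rule well_ord_subset[OF well_ord_W]) (simp add: subset_def)
qed (use lin_S numberingD[OF pc] in blast)+

lemma convex_pieces_W:
  assumes pc: "numbering T key W M wp"
  shows "convex_pieces mem T W W wp M (const M zero)"
proof
  show "lt W s t \<longleftrightarrow> (if ap (const M zero) (ap wp t) = zero then lt W s t else lt W t s)" if "t \<in> T" for s t
    using numbering_mem[OF pc that] by simp
  show "well_ord (piece T wp t) W" for t by (rule well_ord_subset[OF well_ord_W]) (simp add: subset_def)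
qed (use well_ord_lin[OF well_ord_W] numberingD[OF pc] in blast)+

lemma expo_antimono:
  assumes s: "s \<in> T" and t: "t \<in> T"
  shows expo_row: "summand s = summand t \<Longrightarrow> row s \<in> row t \<or> row s = row t \<Longrightarrow> omega_exp (expo t) \<subseteq> omega_exp (expo s)"
    and expo_rank: "rank s \<in> rank t \<Longrightarrow> omega_exp (expo t) \<subseteq> omega_exp (expo s)"
proof -
  note mono = omega_exp_mono[OF expo_ord[OF s] expo_ord[OF t]]
  show "omega_exp (expo t) \<subseteq> omega_exp (expo s)"
      if same: "summand s = summand t" and le: "row s \<in> row t \<or> row s = row t"
    using le
  proof
    assume "row s \<in> row t"
    hence "expo t \<in> expo s"
      using cnf_exp_less[OF cnf[OF summand_mem[OF t]] _ row_mem[OF t]] same unfolding expo_def by simp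
    thus ?thesis by (rule mono[OF ord_mem_subset[OF expo_ord[OF s]]])
  qed (simp add: expo_def same)
  show "omega_exp (expo t) \<subseteq> omega_exp (expo s)" if "rank s \<in> rank t"
  proof (rule mono[OF omega_exp_term_le[OF expo_ord[OF s] expo_ord[OF t] coeff_omega[OF s] coeff_omega[OF t]]])
    show "coeff t \<noteq> zero" unfolding coeff_def by (rule cnf_coeff(2)[OF cnf[OF summand_mem[OF t]] row_mem[OF t]])
    have "ap (terms (summand t)) (row t) \<subseteq> ap (terms (summand s)) (row s)"
      using u_decreasing[OF that rank_mem[OF t]] u_rank s t by simp
    thus "omul (omega_exp (expo t)) (coeff t) \<subseteq> omul (omega_exp (expo s)) (coeff s)"
      unfolding expo_def coeff_def using row_mem s t by simp
  qed
qed

lemma indecomposable_S: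
  assumes pc: "numbering T key S N' pc" and d': "\<And>t. t \<in> T \<Longrightarrow> ap d' (ap pc t) = ap d (summand t)"
  shows "indecomposable_pieces mem T S W pc N' d'"
proof -
  interpret convex_pieces mem T S W pc N' d' by (rule convex_pieces_S[OF assms])
  note eq_iff = numbering_eq_iff[OF pc] and less_iff = numbering_less_iff[OF pc]
  have nontrivial: "nontrivial r" if "r \<in> T" "expo r \<noteq> zero" for r
    using expo_nonzero[OF that] eq_iff that(1) unfolding nontrivial_def by metis
  show ?thesis
  proof
    show "ordertype (tail T W pc t) W = piece_type t" if "t \<in> T" for t
      using tail_type[OF eq_iff that] piece_type[OF eq_iff that] by simp
    fix s t assume st: "s \<in> T" "t \<in> T" "earlier s t"
      and block: "\<And>r. \<lbrakk>r \<in> T; nontrivial r; ap pc r = ap pc s \<or> between s r t\<rbrakk> \<Longrightarrow>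
        ap d' (ap pc r) = zero \<longleftrightarrow> ap d' (ap pc t) = zero"
    have less: "if ap d (summand t) = zero then lt S s t else lt S t s"
      using st less_iff d'[OF st(2)] unfolding earlier_def by (auto split: if_splits)
    have "\<not> (if ap d (summand t) = zero then summand s \<in> summand t else summand t \<in> summand s)"
    proof
      assume "if ap d (summand t) = zero then summand s \<in> summand t else summand t \<in> summand s"
      then obtain r where r: "r \<in> T" "expo r \<noteq> zero" "ap d (summand r) \<noteq> ap d (summand t)" "key r \<noteq> key t"
        "key r = key s \<or> (if ap d (summand t) = zero then lt S s r \<and> lt S r t else lt S t r \<and> lt S r s)"
        using separating_ex[OF st(1,2)] by blast
      hence "ap pc r = ap pc s \<or> between s r t"
        unfolding between_def eq_iff[OF r(1) st(1)] less_iff[OF r(1) st(1)] less_iff[OF r(1) st(2)]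
          less_iff[OF st(1) r(1)] less_iff[OF st(2) r(1)] by (auto split: if_splits)
      hence "ap d (summand r) = zero \<longleftrightarrow> ap d (summand t) = zero"
        using block[OF r(1) nontrivial[OF r(1,2)]] d' r(1) st(2) by simp
      thus False using r(3) direction[OF summand_mem] r(1) st(2) by metis
    qed
    hence "summand s = summand t" "row s \<in> row t \<or> row s = row t"
      using less S_iff[OF st(1,2)] S_iff[OF st(2,1)] by (auto split: if_splits)
    thus "piece_type t \<subseteq> piece_type s"
      using expo_row[OF st(1,2)] piece_type[OF eq_iff] st by simp
  qed
qed

lemma indecomposable_W:
  assumes pc: "numbering T key W M wp"
  shows "indecomposable_pieces mem T W W wp M (const M zero)"
proof -
  interpret convex_pieces mem T W W wp M "const M zero" by (rule convex_pieces_W[OF pc])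
  note eq_iff = numbering_eq_iff[OF pc]
  show ?thesis
  proof
    show "ordertype (tail T W wp t) W = piece_type t" if "t \<in> T" for t
      using tail_type[OF eq_iff that] piece_type[OF eq_iff that] by simp
    fix s t assume st: "s \<in> T" "t \<in> T" "earlier s t"
    hence "lt W s t" using numbering_mem[OF pc st(2)] numbering_less_iff[OF pc] unfolding earlier_def by simp
    hence "rank s \<in> rank t \<or> rank s = rank t" using W_iff st by blast
    hence "omega_exp (expo t) \<subseteq> omega_exp (expo s)"
      using expo_rank[OF st(1,2)] expo_row[OF st(1,2)] rank_eq_iff[OF st(1,2)] by blast
    thus "piece_type t \<subseteq> piece_type s" using piece_type[OF eq_iff] st by simp
  qed
qed

theorem beta_structure_ex: "\<exists>pc N d wp M e. beta_structure mem T S W pc N d wp M e"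
proof -
  have key: "definable_map key" by simp
  obtain N' pc where pc: "numbering T key S N' pc"
    by (rule numbering_ex[OF lin_S key fin_key S_descends])
  obtain M wp where wp: "numbering T key W M wp"
    by (rule numbering_ex[OF well_ord_lin[OF well_ord_W] key fin_key W_descends])
  obtain d' where d': "\<And>t. t \<in> T \<Longrightarrow> ap d' (ap pc t) = ap d (summand t)"
    using ap_factor_ex[of "\<lambda>t. ap d (summand t)" T pc] numbering_eq_iff[OF pc] key_eq by auto
  interpret s: indecomposable_pieces mem T S W pc N' d' by (rule indecomposable_S[OF pc d'])
  interpret w: indecomposable_pieces mem T W W wp M "const M zero" by (rule indecomposable_W[OF wp])
  have "beta_structure mem T S W pc N' d' wp M (const M zero)"
    by unfold_locales (use numbering_eq_iff[OF pc] numberingD[OF wp] well_ord_W in simp_all)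
  thus ?thesis by blast
qed

end

context zf_model
begin

lemma alternating_sumE:
  assumes "alternating_sum T S n b"
  obtains d i x where "n \<in> omega" "fun_on b n"
    "\<And>j. j \<in> n \<Longrightarrow> ordinal (ap b j)" "\<And>j. j \<in> n \<Longrightarrow> \<not> finite_set (ap b j)"
    "\<And>j. j \<in> n \<Longrightarrow> ap d j = zero \<or> ap d j = one" "\<And>j. succ j \<in> n \<Longrightarrow> ap d (succ j) \<noteq> ap d j"
    "sum_coordinates T S n b d i x"
proof -
  obtain d where n: "n \<in> omega" and b: "fun_on b n"
    and ord: "\<And>j. j \<in> n \<Longrightarrow> ordinal (app b j) \<and> infinite_set (app b j)" and d: "maps d n two"
    and alt: "\<And>j. succ j \<in> n \<Longrightarrow> app d (succ j) \<noteq> app d j" and iso: "isomorphic T S (sum_set n b) (sum_rel n b d)"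
    using assms unfolding alternating_sum_def by blast
  have fun_d: "fun_on d n" and two: "\<And>j. j \<in> n \<Longrightarrow> ap d j = zero \<or> ap d j = one"
    using d unfolding maps_iff by simp_all
  have alternating: "ap d (succ j) \<noteq> ap d j" if j: "succ j \<in> n" for j
    using alt[OF j] app_eq_ap[OF fun_d] j ord_trans[OF ord_omega_mem[OF n] _ j, of j] by simp
  have ordinals: "ordinal (ap b j)" "\<not> finite_set (ap b j)" if "j \<in> n" for j
    using ord[OF that] app_eq_ap[OF b that] infinite_set_iff by simp_all
  obtain i x where "sum_coordinates T S n b d i x"
    using isomorphic_ap_sumE iso unfolding sum_set_eq[OF b] sum_rel_eq[OF b fun_d] by blast
  thus ?thesis using that n b ordinals two alternating by blast
qed

lemma is_cnf_choice:
  assumes n: "n \<in> omega" and cnf: "\<And>i. i \<in> n \<Longrightarrow> is_cnf (ap b i) (ap m i) (ap t i)"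
  obtains e c where "\<And>i. i \<in> n \<Longrightarrow> cnf_data (ap m i) (ap e i) (ap c i)"
    "\<And>i. i \<in> n \<Longrightarrow> ap b i = cnf_val (ap m i) (ap e i) (ap c i)"
    "\<And>i. i \<in> n \<Longrightarrow> ap t i = cnf_terms (ap m i) (ap e i) (ap c i)"
proof -
  let ?P = "\<lambda>i q. cnf_data (ap m i) (pfst q) (psnd q) \<and> ap b i = cnf_val (ap m i) (pfst q) (psnd q) \<and>
    ap t i = cnf_terms (ap m i) (pfst q) (psnd q)"
  have P: "definable (\<lambda>v. ?P (v 0) (v 1))" by (intro definable)
  have "\<exists>q. ?P i q" if i: "i \<in> n" for i
  proof -
    obtain e c where "cnf_data (ap m i) e c" "ap b i = cnf_val (ap m i) e c" "ap t i = cnf_terms (ap m i) e c"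
      using is_cnfE[OF cnf[OF i]] .
    hence "?P i (opair e c)" by simp
    thus ?thesis by blast
  qed
  then obtain f where "\<And>i. i \<in> n \<Longrightarrow> ?P i (ap f i)" using fin_choice[OF n P] by blast
  thus ?thesis using that[of "lam n (\<lambda>i. pfst (ap f i))" "lam n (\<lambda>i. psnd (ap f i))"] by simp
qed

lemma is_beta_structure:
  assumes lin: "lin_ord T S" and beta: "is_beta T S x"
  obtains W pc N d wp M e where "beta_structure mem T S W pc N d wp M e" "x = ordertype T W"
proof -
  obtain n b m t N g u where alt: "alternating_sum T S n b" and m: "fun_on m n" and t: "fun_on t n"
    and cnf: "\<And>i. i \<in> n \<Longrightarrow> is_cnf (app b i) (app m i) (app t i)"
    and N: "N \<in> omega" and g: "bijection g N (sum_set n m)" and u: "fun_on u N"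
    and u_term: "\<And>l i j. l \<in> N \<Longrightarrow> app g l = opair i j \<Longrightarrow> app u l = app (app t i) j"
    and dec: "\<And>l l'. l \<in> l' \<Longrightarrow> l' \<in> N \<Longrightarrow> app u l' \<in> app u l \<or> app u l' = app u l"
    and x: "x = osum N u"
    using beta unfolding is_beta_def by blast
  obtain d i p where n: "n \<in> omega" and b: "fun_on b n" and sum:
    "\<And>j. j \<in> n \<Longrightarrow> \<not> finite_set (ap b j)" "\<And>j. j \<in> n \<Longrightarrow> ap d j = zero \<or> ap d j = one"
    "\<And>j. succ j \<in> n \<Longrightarrow> ap d (succ j) \<noteq> ap d j" "sum_coordinates T S n b d i p"
    by (rule alternating_sumE[OF alt]) blast
  have "is_cnf (ap b i) (ap m i) (ap t i)" if "i \<in> n" for i using cnf[OF that] app_eq_ap b m t that by metis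
  then obtain \<epsilon> \<gamma> where data: "\<And>i. i \<in> n \<Longrightarrow> cnf_data (ap m i) (ap \<epsilon> i) (ap \<gamma> i)"
    "\<And>i. i \<in> n \<Longrightarrow> ap b i = cnf_val (ap m i) (ap \<epsilon> i) (ap \<gamma> i)"
    "\<And>i. i \<in> n \<Longrightarrow> ap t i = cnf_terms (ap m i) (ap \<epsilon> i) (ap \<gamma> i)"
    using is_cnf_choice[OF n] by metis
  have fun_g: "fun_on g N" and bij_g: "bij_betw (ap g) (elts N) (elts (ap_sum_set n m))"
    using g unfolding bijection_iff sum_set_eq[OF m] by blast+
  have u_ap: "ap u l = ap (cnf_terms (ap m i) (ap \<epsilon> i) (ap \<gamma> i)) j"
      if l: "l \<in> N" and pair: "ap g l = opair i j" for l i j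
  proof -
    have "opair i j \<in> ap_sum_set n m" using bij_elts_mem[OF bij_g l] pair by simp
    hence ij: "i \<in> n" "j \<in> ap m i" by simp_all
    have "app u l = app (app t i) j" using u_term[OF l] app_eq_ap[OF fun_g l] pair by simp
    thus ?thesis
      using app_eq_ap[OF u l] app_eq_ap[OF t ij(1)] data(3)[OF ij(1)] app_eq_ap[OF fun_on_cnf_terms ij(2)] by simp
  qed
  have u_ord: "ordinal (ap u l)" if "l \<in> N" for l
    using bij_elts_mem[OF bij_g that] u_ap[OF that] cnf_term_ord[OF data(1)] by auto
  have u_dec: "ap u l' \<subseteq> ap u l" if l: "l \<in> l'" "l' \<in> N" for l l'
  proof -
    have "l \<in> N" using ord_trans[OF ord_omega_mem[OF N] l] .
    thus ?thesis using dec[OF l] app_eq_ap[OF u] ord_subset_iff u_ord l(2) by simp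
  qed
  interpret beta_expansion mem T S n b d m \<epsilon> \<gamma> N g u i p
    by unfold_locales (fact lin n sum data N bij_g u_ap u_dec)+
  show ?thesis using beta_structure_ex that x osum_eq_ordertype[OF u] by blast
qed

end

subsection \<open>Existence of alternating sums\<close>

context zf_model
begin

definition converse_rel :: "'a \<Rightarrow> 'a \<Rightarrow> 'a" where
  "converse_rel A R = sep (times A A) (\<lambda>p. lt R (psnd p) (pfst p))"

lemma mem_converse_rel: "opair x y \<in> converse_rel A R \<longleftrightarrow> x \<in> A \<and> y \<in> A \<and> lt R y x"
  unfolding converse_rel_def by simp

definition oriented :: "'a \<Rightarrow> 'a \<Rightarrow> 'a \<Rightarrow> 'a" where
  "oriented A R c = (if c = zero then R else converse_rel A R)"

lemma definable_fn_oriented [definable, simp]: "\<lbrakk>definable_fn A; definable_fn R; definable_fn c\<rbrakk> \<Longrightarrow>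
    definable_fn (\<lambda>v. oriented (A v) (R v) (c v))"
  by (rule definable_fn_app3[of oriented]) (unfold oriented_def converse_rel_def, intro definable)

lemma lin_oriented:
  assumes lin: "lin_ord A R" shows "lin_ord A (oriented A R c)"
proof (cases "c = zero")
  case False
  have "lin_ord A (converse_rel A R)" unfolding lin_ord_def mem_converse_rel
    using lin_irrefl[OF lin] lin_trans[OF lin] lin_total[OF lin] by blast
  thus ?thesis using False unfolding oriented_def by simp
qed (use lin in \<open>simp add: oriented_def\<close>)

definition fibre :: "'a \<Rightarrow> 'a \<Rightarrow> 'a \<Rightarrow> 'a" where
  "fibre T pc i = sep T (\<lambda>t. ap pc t = i)"

lemma mem_fibre [simp]: "t \<in> fibre T pc i \<longleftrightarrow> t \<in> T \<and> ap pc t = i"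
  unfolding fibre_def by simp

lemma definable_fn_fibre [definable, simp]: "\<lbrakk>definable_fn A; definable_fn pc; definable_fn c\<rbrakk> \<Longrightarrow>
    definable_fn (\<lambda>v. fibre (A v) (pc v) (c v))"
  by (rule definable_fn_app3[of fibre]) (unfold fibre_def, intro definable)

definition blocks :: "'a \<Rightarrow> 'a \<Rightarrow> 'a \<Rightarrow> 'a \<Rightarrow> 'a \<Rightarrow> bool" where
  "blocks T S N pc d \<longleftrightarrow> (\<forall>t. t \<in> T \<longrightarrow> ap pc t \<in> N) \<and>
     (\<forall>s t. s \<in> T \<and> t \<in> T \<and> ap pc s \<in> ap pc t \<longrightarrow> lt S s t) \<and>
     (\<forall>i. i \<in> N \<longrightarrow> (ap d i = zero \<or> ap d i = one) \<and> well_ord (fibre T pc i) (oriented T S (ap d i)))"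

lemma definable_blocks [definable, simp]:
  "\<lbrakk>definable_fn T; definable_fn S; definable_fn N; definable_fn pc; definable_fn d\<rbrakk> \<Longrightarrow>
    definable (\<lambda>v. blocks (T v) (S v) (N v) (pc v) (d v))"
  by (rule definable_app5[of blocks]) (unfold blocks_def, intro definable)

lemma blocksD:
  assumes "blocks T S N pc d"
  shows blocks_mem: "\<And>t. t \<in> T \<Longrightarrow> ap pc t \<in> N"
    and blocks_less: "\<And>s t. \<lbrakk>s \<in> T; t \<in> T; ap pc s \<in> ap pc t\<rbrakk> \<Longrightarrow> lt S s t"
    and blocks_two: "\<And>i. i \<in> N \<Longrightarrow> ap d i = zero \<or> ap d i = one"
    and blocks_well_ord: "\<And>i. i \<in> N \<Longrightarrow> well_ord (fibre T pc i) (oriented T S (ap d i))"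
  using assms unfolding blocks_def by blast+

lemma blocks_if_finite_sum_below:
  assumes k: "ordinal k" and lin: "lin_ord T S" and "finite_sum_below k T S"
  obtains n pc d where "n \<in> omega" "blocks T S n pc d"
    "\<And>i. i \<in> n \<Longrightarrow> ordertype (fibre T pc i) (oriented T S (ap d i)) \<in> k"
proof -
  obtain n b d where n: "n \<in> omega" and b: "maps b n k" and d: "maps d n two"
    and iso: "isomorphic T S (sum_set n b) (sum_rel n b d)" using assms(3) unfolding finite_sum_below_def by blast
  have funs: "fun_on b n" "fun_on d n" and b_k: "\<And>j. j \<in> n \<Longrightarrow> ap b j \<in> k"
    and d_two: "\<And>j. j \<in> n \<Longrightarrow> ap d j = zero \<or> ap d j = one"
    using b d unfolding maps_iff by auto
  obtain i x where sum: "sum_coordinates T S n b d i x"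
    using isomorphic_ap_sumE iso unfolding sum_set_eq[OF funs(1)] sum_rel_eq[OF funs] by blast
  note mem = coordinates_mem[OF sum] and less_iff = coordinates_less_iff[OF sum]
  define pc where "pc = lam T i"
  have pc: "ap pc t = i t"
      if "t \<in> T" for t unfolding pc_def by (rule ap_lam[OF definable_coordinates(1)[OF sum] that])
  have fibre: "isomorphic (fibre T pc j) (oriented T S (ap d j)) (ap b j) (memrel (ap b j))" if j: "j \<in> n" for j
  proof (rule isomorphicI[OF definable_coordinates(2)[OF sum] bij_eltsI])
    show "x t \<in> ap b j" if "t \<in> fibre T pc j" for t using that mem(2)[of t] pc[of t] by simp
    show "s = t" if "s \<in> fibre T pc j" "t \<in> fibre T pc j" "x s = x t" for s t
      using lin_total[OF lin, of s t] less_iff[of s t] less_iff[of t s] that pc by auto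
    show "\<exists>t. t \<in> fibre T pc j \<and> x t = y" if "y \<in> ap b j" for y
      using coordinates_surj[OF sum j that] pc by auto
    show "lt (oriented T S (ap d j)) s t \<longleftrightarrow> lt (memrel (ap b j)) (x s) (x t)"
      if st: "s \<in> fibre T pc j" "t \<in> fibre T pc j" for s t
    proof -
      have T: "s \<in> T" "t \<in> T" "i s = j" "i t = j" using st pc by auto
      hence "x s \<in> ap b j" "x t \<in> ap b j" using mem(2)[of s] mem(2)[of t] by simp_all
      thus ?thesis
        using d_two[OF j] less_iff[OF T(1,2)] less_iff[OF T(2,1)] T unfolding oriented_def
        by (elim disjE) (simp_all add: mem_converse_rel)
    qed
  qed
  have ord: "ordinal (ap b j)" if "j \<in> n" for j using ord_mem[OF k b_k[OF that]] .
  have "blocks T S n pc d" unfolding blocks_def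
    using mem(1) pc less_iff d_two isomorphic_well_ord[OF fibre well_ord_memrel[OF ord]] by auto
  moreover have "ordertype (fibre T pc j) (oriented T S (ap d j)) \<in> k" if "j \<in> n" for j
    using ordertype_eq(1)[OF ord fibre] b_k that by simp
  ultimately show ?thesis using that n by blast
qed

text \<open>Identifies \<open>i\<close> with \<open>succ i\<close> and closes the gap.\<close>

definition collapse :: "'a \<Rightarrow> 'a \<Rightarrow> 'a" where
  "collapse i p = (if p \<in> succ i then p else big_union p)"

lemma collapse_omega: "i \<in> omega \<Longrightarrow> p \<in> omega \<Longrightarrow> collapse i p \<in> omega"
  using omega_cases[of p] ord_zero_mem[OF ord_succ[OF ord_omega_mem, of i]] unfolding collapse_def
  by (auto simp: big_union_succ ord_omega_mem)

lemma collapse_eq_iff: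
  assumes "i \<in> omega" "p \<in> omega" "j \<in> omega"
  shows "collapse i p = j \<longleftrightarrow> (if j \<in> i then p = j else if j = i then p = i \<or> p = succ i else p = succ j)"
proof (cases "p \<in> succ i")
  case True
  thus ?thesis
    using mem_asym[of i "succ j"] mem_asym[of i "succ i"] ord_linear[of i j] assms ord_omega_mem
    unfolding collapse_def by auto
next
  case False
  hence "p \<noteq> zero" using ord_zero_mem[OF ord_succ[OF ord_omega_mem[OF assms(1)]]] succ_not_zero by metis
  then obtain q where q: "q \<in> omega" "p = succ q" using omega_cases[OF assms(2)] by blast
  hence "collapse i p = q" using False big_union_succ[OF ord_omega_mem] unfolding collapse_def by simp
  moreover have "\<not> q \<in> i" using False succ_mem_succ[OF ord_omega_mem ord_omega_mem] q assms(1) by blast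
  moreover have "\<not> p \<in> i" "p \<noteq> i" using False by auto
  ultimately show ?thesis using q(2) by auto
qed

lemma collapse_mem:
  assumes M: "M \<in> omega" and i: "i \<in> M" and p: "p \<in> succ M"
  shows "collapse i p \<in> M"
proof -
  have omega: "i \<in> omega" "p \<in> omega" using omega_mem_mem[OF M i] omega_mem_mem[OF succ_omega[OF M] p] .
  note collapse = collapse_omega[OF omega]
  consider "collapse i p \<in> i" | "collapse i p = i" | "p = succ (collapse i p)"
    using collapse_eq_iff[OF omega collapse] by (auto split: if_splits)
  thus ?thesis
    using i p succ_mem_succ[OF ord_omega_mem[OF collapse] ord_omega_mem[OF M]] ord_trans[OF ord_omega_mem[OF M] _ i]
    by cases auto
qed

lemma collapse_less:
  assumes i: "i \<in> omega" and p: "p \<in> omega" and p': "p' \<in> omega" and less: "collapse i p \<in> collapse i p'"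
  shows "p \<in> p'"
proof (rule ccontr)
  assume "\<not> p \<in> p'"
  note ord = ord_omega_mem[OF i] ord_omega_mem[OF p] ord_omega_mem[OF p']
  hence le: "p' \<in> p \<or> p' = p" using ord_linear[OF ord(2,3)] \<open>\<not> p \<in> p'\<close> by blast
  show False
  proof (cases "p \<in> succ i")
    case True
    hence "p' \<in> succ i" using le ord_trans[OF ord_succ[OF ord(1)]] by blast
    thus False using True le less mem_asym unfolding collapse_def by auto
  next
    case False
    note omega = collapse_omega[OF i p] collapse_omega[OF i p']
    have p_eq: "p = succ (collapse i p)" using collapse_eq_iff[OF i p omega(1)] False by (auto split: if_splits)
    hence "\<not> collapse i p \<in> i" using False succ_mem_succ[OF ord_omega_mem[OF omega(1)] ord(1)] by metis
    hence "\<not> collapse i p' \<in> i" "collapse i p' \<noteq> i" using less ord_trans[OF ord(1)] by auto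
    hence "p' = succ (collapse i p')" using collapse_eq_iff[OF i p' omega(2)] by auto
    hence "collapse i p' \<in> collapse i p \<or> collapse i p' = collapse i p"
      using le p_eq succ_mem_succ[OF ord_omega_mem[OF omega(2)] ord_omega_mem[OF omega(1)]] succ_eq by metis
    thus False using less mem_asym[OF less] by auto
  qed
qed

lemma well_ord_fibre_union:
  assumes lin: "lin_ord T S" and bl: "blocks T S N pc d"
    and wo: "well_ord (fibre T pc i) (oriented T S c)" "well_ord (fibre T pc (succ i)) (oriented T S c)"
  shows "well_ord (union (fibre T pc i) (fibre T pc (succ i))) (oriented T S c)"
proof -
  have less: "lt S a b" if "a \<in> fibre T pc i" "b \<in> fibre T pc (succ i)" for a b
    using blocks_less[OF bl, of a b] that by simp
  have lin': "lin_ord (union (fibre T pc i) (fibre T pc (succ i))) (oriented T S c)"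
    "lin_ord (union (fibre T pc (succ i)) (fibre T pc i)) (oriented T S c)"
    by (rule lin_subset[OF lin_oriented[OF lin]], force simp: subset_def)+
  have comm: "union (fibre T pc i) (fibre T pc (succ i)) = union (fibre T pc (succ i)) (fibre T pc i)"
    by (rule mem_ext) auto
  show ?thesis
  proof (cases "c = zero")
    case True
    show ?thesis by (rule well_ord_union[OF wo lin'(1)]) (use less True in \<open>simp add: oriented_def\<close>)
  next
    case False
    show ?thesis unfolding comm
      by (rule well_ord_union[OF wo(2,1) lin'(2)]) (use less False in \<open>simp add: oriented_def mem_converse_rel\<close>)
  qed
qed

lemma blocks_merge:
  assumes lin: "lin_ord T S" and M: "M \<in> omega" and bl: "blocks T S (succ M) pc d" and i: "i \<in> M"
    and c: "c = zero \<or> c = one"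
    and wo: "well_ord (fibre T pc i) (oriented T S c)" "well_ord (fibre T pc (succ i)) (oriented T S c)"
  shows "\<exists>pc d. blocks T S M pc d"
proof -
  define pc' where "pc' = lam T (\<lambda>t. collapse i (ap pc t))"
  define d' where "d' = lam M (\<lambda>j. if j = i then c else if j \<in> i then ap d j else ap d (succ j))"
  have "definable_map (\<lambda>t. collapse i (ap pc t))" unfolding collapse_def by (intro definable)
  hence pc': "ap pc' t = collapse i (ap pc t)" if "t \<in> T" for t unfolding pc'_def using that by simp
  have d': "ap d' j = (if j = i then c else if j \<in> i then ap d j else ap d (succ j))" if "j \<in> M" for j
    unfolding d'_def using that by (subst ap_lam) (intro definable, auto)
  have succ_M: "j \<in> succ M" "succ j \<in> succ M" if "j \<in> M" for j
    using that succ_mem_succ[OF ord_mem[OF ord_omega_mem[OF M] that] ord_omega_mem[OF M]] by auto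
  have pc_omega: "ap pc t \<in> omega" if "t \<in> T" for t
    using omega_mem_mem[OF succ_omega[OF M] blocks_mem[OF bl that]] .
  note i_omega = omega_mem_mem[OF M i]
  have fibre: "fibre T pc' j = (if j \<in> i then fibre T pc j
      else if j = i then union (fibre T pc i) (fibre T pc (succ i)) else fibre T pc (succ j))" if "j \<in> M" for j
  proof (rule mem_ext)
    fix t
    have "collapse i (ap pc t) = j \<longleftrightarrow> (if j \<in> i then ap pc t = j else if j = i then ap pc t = i \<or> ap pc t = succ i
        else ap pc t = succ j)" if "t \<in> T"
      by (rule collapse_eq_iff[OF i_omega pc_omega[OF that] omega_mem_mem[OF M \<open>j \<in> M\<close>]])
    thus "t \<in> fibre T pc' j \<longleftrightarrow> t \<in> (if j \<in> i then fibre T pc j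
        else if j = i then union (fibre T pc i) (fibre T pc (succ i)) else fibre T pc (succ j))"
      by (cases "t \<in> T") (simp_all add: pc')
  qed
  have "blocks T S M pc' d'" unfolding blocks_def
  proof (intro conjI allI impI)
    show "ap pc' t \<in> M" if "t \<in> T" for t
      using collapse_mem[OF M i blocks_mem[OF bl that]] pc'[OF that] by simp
    show "lt S s t" if "s \<in> T \<and> t \<in> T \<and> ap pc' s \<in> ap pc' t" for s t
      using blocks_less[OF bl, of s t] collapse_less[OF i_omega pc_omega pc_omega, of s t] that pc'[of s] pc'[of t]
      by auto
    fix j assume j: "j \<in> M"
    show "ap d' j = zero \<or> ap d' j = one" using d'[OF j] c blocks_two[OF bl] succ_M[OF j] by simp
    show "well_ord (fibre T pc' j) (oriented T S (ap d' j))"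
      using fibre[OF j] d'[OF j] blocks_well_ord[OF bl] well_ord_fibre_union[OF lin bl wo] succ_M[OF j] by auto
  qed
  thus ?thesis by blast
qed

lemma minimal_blocks_ex:
  assumes lin: "lin_ord T S" and "N0 \<in> omega" "blocks T S N0 pc0 d0"
  obtains N pc d where "N \<in> omega" "blocks T S N pc d"
    "\<And>i c. \<lbrakk>succ i \<in> N; c = zero \<or> c = one; well_ord (fibre T pc i) (oriented T S c)\<rbrakk> \<Longrightarrow>
      \<not> well_ord (fibre T pc (succ i)) (oriented T S c)"
proof -
  let ?P = "\<lambda>N. N \<in> omega \<and> (\<exists>pc d. blocks T S N pc d)"
  have P: "definable (\<lambda>v. ?P (v 0))" and P0: "?P N0" using assms(2,3) by (intro definable, blast)
  obtain N where "?P N" and min: "\<And>M. M \<in> N \<Longrightarrow> \<not> ?P M"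
    by (rule ord_least[OF ord_omega_mem[OF assms(2)] P0 P]) blast
  then obtain pc d where N: "N \<in> omega" and bl: "blocks T S N pc d" by blast
  have "\<not> well_ord (fibre T pc (succ i)) (oriented T S c)"
    if i: "succ i \<in> N" and c: "c = zero \<or> c = one" "well_ord (fibre T pc i) (oriented T S c)" for i c
  proof
    assume wo: "well_ord (fibre T pc (succ i)) (oriented T S c)"
    obtain M where M: "M \<in> omega" "N = succ M" using omega_cases[OF N] i by auto
    have "i \<in> M" using i M(2) ord_trans[OF ord_omega_mem[OF M(1)], of i "succ i"] by auto
    hence "\<exists>pc d. blocks T S M pc d" using blocks_merge[OF lin M(1) _ _ c wo] bl M(2) by blast
    thus False using min[of M] M by simp
  qed
  thus ?thesis using that N bl by blast
qed

lemma alternating_blocks_ex: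
  assumes lin: "lin_ord T S" and infinite: "\<not> finite_set T" and "N0 \<in> omega" "blocks T S N0 pc0 d0"
  obtains N pc d where "N \<in> omega" "blocks T S N pc d" "\<And>i. i \<in> N \<Longrightarrow> \<not> finite_set (fibre T pc i)"
    "\<And>i. succ i \<in> N \<Longrightarrow> ap d (succ i) \<noteq> ap d i"
proof -
  obtain N pc d where N: "N \<in> omega" and bl: "blocks T S N pc d"
    and unmergeable: "\<And>i c. \<lbrakk>succ i \<in> N; c = zero \<or> c = one; well_ord (fibre T pc i) (oriented T S c)\<rbrakk> \<Longrightarrow>
      \<not> well_ord (fibre T pc (succ i)) (oriented T S c)"
    by (rule minimal_blocks_ex[OF lin assms(3,4)]) blast
  note two = blocks_two[OF bl] and wo = blocks_well_ord[OF bl]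
  have mem: "i \<in> N" if "succ i \<in> N" for i using ord_trans[OF ord_omega_mem[OF N] _ that, of i] by simp
  have finite: "well_ord (fibre T pc i) (oriented T S c)" if "finite_set (fibre T pc i)" for i c
    by (rule fin_lin_well_ord[OF that lin_subset[OF lin_oriented[OF lin]]]) (simp add: subset_def)
  have fibres: "\<not> finite_set (fibre T pc i)" if i: "i \<in> N" for i
  proof
    assume fin: "finite_set (fibre T pc i)"
    have next_i: "\<not> succ i \<in> N" using unmergeable[of i] two wo finite[OF fin] by blast
    show False
    proof (cases "i = zero")
      case True
      have "ap pc t = i" if t: "t \<in> T" for t
      proof (rule ccontr)
        note ord = ord_mem[OF ord_omega_mem[OF N] blocks_mem[OF bl t]]
        assume "ap pc t \<noteq> i"
        hence "succ i \<subseteq> ap pc t" using ord_zero_mem[OF ord] succ_subset_iff[OF _ ord] True by simp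
        thus False
          using ord_le_lt[OF _ ord ord_omega_mem[OF N] _ blocks_mem[OF bl t], of "succ i"] next_i True by simp
      qed
      hence "fibre T pc i = T" by (intro mem_ext) auto
      thus False using fin infinite by simp
    next
      case False
      then obtain j where "i = succ j" using omega_cases[OF omega_mem_mem[OF N i]] by blast
      thus False using unmergeable[of j] two wo finite[OF fin] i mem by metis
    qed
  qed
  have "ap d (succ i) \<noteq> ap d i" if "succ i \<in> N" for i
    using unmergeable[OF that two wo] mem[OF that] wo[OF that] by metis
  thus ?thesis using that[OF N bl fibres] by blast
qed

lemma isomorphic_sum_if_blocks:
  assumes lin: "lin_ord T S" and N: "N \<in> omega" and bl: "blocks T S N pc d"
    and d': "\<And>i. i \<in> N \<Longrightarrow> ap d' i = ap d i"
    and b: "\<And>i. i \<in> N \<Longrightarrow> ap b i = ordertype (fibre T pc i) (oriented T S (ap d i))"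
  shows "isomorphic T S (ap_sum_set N b) (ap_sum_rel N b d')"
proof -
  define x where "x t = ordermap (fibre T pc (ap pc t)) (oriented T S (ap d (ap pc t))) t" for t
  note mem = blocks_mem[OF bl] and wo = blocks_well_ord[OF bl]
  have x_iff: "x s \<in> x t \<longleftrightarrow> lt (oriented T S (ap d (ap pc t))) s t" and x_inj: "x s = x t \<Longrightarrow> s = t"
    if "s \<in> T" "t \<in> T" "ap pc s = ap pc t" for s t
    using ordermap_iff[OF wo[OF mem[OF that(2)]], of s t] ordermap_inj[OF wo[OF mem[OF that(2)]], of s t] that
    unfolding x_def by simp_all
  have less: "lt S s t \<longleftrightarrow> ap pc s \<in> ap pc t \<or> ap pc s = ap pc t \<and>
      (ap d' (ap pc t) = zero \<and> x s \<in> x t \<or> ap d' (ap pc t) = one \<and> x t \<in> x s)" if st: "s \<in> T" "t \<in> T" for s t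
  proof (cases "ap pc s = ap pc t")
    case True
    thus ?thesis
      using x_iff[OF st True] x_iff[OF st(2,1) True[symmetric]] blocks_two[OF bl mem[OF st(2)]] d'[OF mem[OF st(2)]] st
      unfolding oriented_def by (auto simp: mem_converse_rel)
  next
    case False
    hence "ap pc s \<in> ap pc t \<or> ap pc t \<in> ap pc s"
      using ord_linear ord_mem[OF ord_omega_mem[OF N]] mem st by blast
    thus ?thesis using False blocks_less[OF bl] lin_asym[OF lin] mem_asym st by blast
  qed
  have "sum_coordinates T S N b d' (ap pc) x"
    unfolding sum_coordinates_def
  proof (intro conjI allI impI)
    show "definable_map x" unfolding x_def by (intro definable)
    show "x t \<in> ap b (ap pc t)" if "t \<in> T" for t
      using ordermap_mem[OF wo[OF mem[OF that]], of t] b[OF mem[OF that]] that unfolding x_def by simp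
    show "\<exists>t. t \<in> T \<and> ap pc t = i \<and> x t = y" if iy: "i \<in> N \<and> y \<in> ap b i" for i y
      using ordermap_surj[OF wo, of i y] iy b unfolding x_def by auto
  qed (use mem less in \<open>simp_all add: definable\<close>)
  thus ?thesis by (rule isomorphic_ap_sumI) (rule x_inj)
qed

lemma alternating_sum_ex:
  assumes lin: "lin_ord T S" and "\<not> finite_set T" "N0 \<in> omega" "blocks T S N0 pc0 d0"
  shows "\<exists>n b. alternating_sum T S n b"
proof -
  obtain N pc d where N: "N \<in> omega" and bl: "blocks T S N pc d"
    and fibres: "\<And>i. i \<in> N \<Longrightarrow> \<not> finite_set (fibre T pc i)" and alt: "\<And>i. succ i \<in> N \<Longrightarrow> ap d (succ i) \<noteq> ap d i"
    by (rule alternating_blocks_ex[OF assms]) blast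
  define b where "b = lam N (\<lambda>i. ordertype (fibre T pc i) (oriented T S (ap d i)))"
  define d' where "d' = lam N (ap d)"
  have fun_b: "fun_on b N" and fun_d: "fun_on d' N" unfolding b_def d'_def by simp_all
  have b: "app b i = ordertype (fibre T pc i) (oriented T S (ap d i))" "ap b i = app b i"
    and d': "app d' i = ap d i" "ap d' i = ap d i"
    if "i \<in> N" for i
    using app_eq_ap[OF fun_b that] app_eq_ap[OF fun_d that] that unfolding b_def d'_def by simp_all
  note wo = blocks_well_ord[OF bl]
  have "alternating_sum T S N b" unfolding alternating_sum_def
  proof (intro conjI allI impI exI[of _ d'] N fun_b)
    show "maps d' N two" unfolding maps_iff using fun_d d'(2) blocks_two[OF bl] by simp
    show "app d' (succ i) \<noteq> app d' i" if "succ i \<in> N" for i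
      using alt[OF that] d'(1) that ord_trans[OF ord_omega_mem[OF N] _ that, of i] by simp
    show "isomorphic T S (sum_set N b) (sum_rel N b d')"
      unfolding sum_set_eq[OF fun_b] sum_rel_eq[OF fun_b fun_d]
      by (rule isomorphic_sum_if_blocks[OF lin N bl]) (use b d' in simp_all)
    show "ordinal (app b i)" "infinite_set (app b i)" if i: "i \<in> N" for i
      using ord_ordertype[OF wo[OF i]] fin_cong[OF equipotent_ordertype[OF wo[OF i]]] fibres[OF i] b(1)[OF i]
      by (simp_all add: infinite_set_iff)
  qed
  thus ?thesis by blast
qed

end

subsection \<open>The theorem\<close>

context zf_model
begin

lemma cnf_choice:
  assumes n: "n \<in> omega" and ord: "\<And>i. i \<in> n \<Longrightarrow> ordinal (ap b i)"
  obtains m t where "fun_on m n" "fun_on t n" "\<And>i. i \<in> n \<Longrightarrow> is_cnf (ap b i) (ap m i) (ap t i)"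
proof -
  let ?m = "pfst" and ?e = "\<lambda>q. pfst (psnd q)" and ?c = "\<lambda>q. psnd (psnd q)"
  let ?P = "\<lambda>i q. cnf_data (?m q) (?e q) (?c q) \<and> ap b i = cnf_val (?m q) (?e q) (?c q)"
  have P: "definable (\<lambda>v. ?P (v 0) (v 1))" by (intro definable)
  have "\<exists>q. ?P i q" if i: "i \<in> n" for i
  proof -
    obtain m e c where "cnf_data m e c \<and> ap b i = cnf_val m e c" using cnf_ex[OF ord[OF i]] by blast
    hence "?P i (opair m (opair e c))" by simp
    thus ?thesis by blast
  qed
  then obtain f where f: "\<And>i. i \<in> n \<Longrightarrow> ?P i (ap f i)" using fin_choice[OF n P] by blast
  let ?t = "\<lambda>i. cnf_terms (?m (ap f i)) (?e (ap f i)) (?c (ap f i))"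
  have "is_cnf (ap b i) (?m (ap f i)) (?t i)" if "i \<in> n" for i using is_cnfI f[OF that] by metis
  thus ?thesis using that[of "lam n (\<lambda>i. ?m (ap f i))" "lam n ?t"] by simp
qed

lemma decreasing_enumeration_ex:
  assumes fin: "finite_set P" and wo: "well_ord P R" and h: "definable_map h" and ord: "\<And>p. p \<in> P \<Longrightarrow> ordinal (h p)"
  obtains N g where "N \<in> omega" "fun_on g N" "bij_betw (ap g) (elts N) (elts P)"
    "\<forall>l l'. l \<in> l' \<and> l' \<in> N \<longrightarrow> h (ap g l') \<subseteq> h (ap g l)"
proof -
  define Q where "Q = sep (times P P) (\<lambda>p. h (psnd p) \<in> h (pfst p) \<or> h (psnd p) = h (pfst p) \<and> p \<in> R)"
  have "definable (\<lambda>v. h (psnd (v 0)) \<in> h (pfst (v 0)) \<or> h (psnd (v 0)) = h (pfst (v 0)) \<and> v 0 \<in> R)"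
    by (intro definable definable_fn_app1[OF h])
  hence Q: "lt Q p q \<longleftrightarrow> h q \<in> h p \<or> h q = h p \<and> lt R p q" if "p \<in> P" "q \<in> P" for p q
    unfolding Q_def using that by simp
  note lin = lin_ordD[OF well_ord_lin[OF wo]]
  have "lin_ord P Q" unfolding lin_ord_def
  proof (intro conjI allI impI)
    show "\<not> lt Q p p" if "p \<in> P" for p using Q[OF that that] lin(1)[OF that] by simp
    show "lt Q p r" if pqr: "p \<in> P \<and> q \<in> P \<and> r \<in> P \<and> lt Q p q \<and> lt Q q r" for p q r
      using pqr Q[of p q] Q[of q r] Q[of p r] ord_trans[OF ord, of p "h r" "h q"] lin(2)[of p q r] by auto
    show "lt Q p q \<or> lt Q q p" if "p \<in> P \<and> q \<in> P \<and> p \<noteq> q" for p q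
      using that Q ord_linear[OF ord ord] lin(3) by metis
  qed
  hence wo: "well_ord P Q" by (rule fin_lin_well_ord[OF fin])
  let ?N = "ordertype P Q"
  define g where "g = lam ?N (nth_elt P Q)"
  have nth: "definable_map (nth_elt P Q)" by simp
  have bij: "bij_betw (nth_elt P Q) (elts ?N) (elts P)"
    unfolding nth_elt_def[abs_def] by (rule bij_inv_on[OF ordermap_bij[OF wo]])
  have "h (ap g l') \<subseteq> h (ap g l)" if l: "l \<in> l'" "l' \<in> ?N" for l l'
  proof -
    have l': "l \<in> ?N" using ord_trans[OF ord_ordertype[OF wo] l] .
    have mem: "nth_elt P Q l \<in> P" "nth_elt P Q l' \<in> P" using nth_elt_mem[OF wo] l' l(2) by blast+
    have "lt Q (nth_elt P Q l) (nth_elt P Q l')"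
      using ordermap_iff[OF wo mem] ordermap_nth_elt[OF wo] l l' by simp
    thus ?thesis unfolding g_def using Q[OF mem] ord_subset_iff[OF ord ord] mem l l' by auto
  qed
  thus ?thesis
    using that fin_ordertype[OF fin wo] fun_on_lam[OF nth] bij_betw_ap_lam[OF nth bij] unfolding g_def by blast
qed

lemma is_beta_ex:
  assumes alt: "alternating_sum T S n b"
  shows "\<exists>x. is_beta T S x"
proof -
  have n: "n \<in> omega" and b: "fun_on b n" and ord: "\<And>i. i \<in> n \<Longrightarrow> ordinal (ap b i)"
    by (rule alternating_sumE[OF alt], blast)+
  obtain m t where m: "fun_on m n" and t: "fun_on t n" and cnf: "\<And>i. i \<in> n \<Longrightarrow> is_cnf (ap b i) (ap m i) (ap t i)"
    using cnf_choice[OF n ord] by blast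
  have m_omega: "ap m i \<in> omega" if "i \<in> n" for i using cnf[OF that] unfolding is_cnf_def by blast
  have t_fun: "fun_on (ap t i) (ap m i)" if "i \<in> n" for i using cnf[OF that] unfolding is_cnf_def by blast
  have t_ord: "ordinal (ap (ap t i) j)" if "i \<in> n" "j \<in> ap m i" for i j
    using is_cnfE[OF cnf[OF that(1)]] cnf_term_ord that(2) by metis
  let ?P = "ap_sum_set n m"
  define h where "h p = ap (ap t (pfst p)) (psnd p)" for p
  have fin: "finite_set ?P" by (rule fin_ap_sum_set[OF fin_omega_mem[OF n] fin_omega_mem[OF m_omega]])
  have wo: "well_ord ?P (osum_rel n m)"
    by (rule well_ord_ap_sum_set[OF ord_omega_mem[OF n] ord_omega_mem[OF m_omega]])
  have h: "definable_map h" "\<And>p. p \<in> ?P \<Longrightarrow> ordinal (h p)" using t_ord unfolding h_def by auto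
  obtain N g where N: "N \<in> omega" and g: "fun_on g N" "bij_betw (ap g) (elts N) (elts ?P)"
    and dec: "\<forall>l l'. l \<in> l' \<and> l' \<in> N \<longrightarrow> h (ap g l') \<subseteq> h (ap g l)"
    by (rule decreasing_enumeration_ex[OF fin wo h])
  have hg: "definable_map (\<lambda>l. h (ap g l))" using definable_fn_app1[OF h(1)] by simp
  define u where "u = lam N (\<lambda>l. h (ap g l))"
  have u: "fun_on u N" unfolding u_def by (rule fun_on_lam[OF hg])
  have u_app: "app u l = h (ap g l)" "app g l = ap g l" if "l \<in> N" for l
    using app_eq_ap[OF u that] app_eq_ap[OF g(1) that] ap_lam[OF hg that] unfolding u_def by simp_all
  have "is_beta T S (osum N u)" unfolding is_beta_def
  proof (rule exI[of _ n], rule exI[of _ b], rule exI[of _ m], rule exI[of _ t], rule exI[of _ N], rule exI[of _ g],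
      rule exI[of _ u], intro conjI allI impI alt m t N u refl)
    show "is_cnf (app b i) (app m i) (app t i)" if "i \<in> n" for i
      using cnf[OF that] app_eq_ap b m t that by metis
    show "bijection g N (sum_set n m)" unfolding bijection_iff sum_set_eq[OF m] using g by blast
    show "app u l = app (app t i) j" if l: "l \<in> N \<and> app g l = opair i j" for l i j
    proof -
      have pair: "ap g l = opair i j" using u_app(2)[of l] l by simp
      hence "i \<in> n" "j \<in> ap m i" using bij_elts_mem[OF g(2), of l] l by simp_all
      thus ?thesis using u_app(1)[of l] l pair app_eq_ap[OF t] app_eq_ap[OF t_fun] unfolding h_def by simp
    qed
    show "app u l' \<in> app u l \<or> app u l' = app u l" if l: "l \<in> l' \<and> l' \<in> N" for l l'
    proof -
      have "l \<in> N" using l ord_trans[OF ord_omega_mem[OF N]] by blast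
      thus ?thesis using dec u_app(1) l ord_subset_iff[OF h(2) h(2)] bij_elts_mem[OF g(2)] by metis
    qed
  qed
  thus ?thesis by blast
qed

lemma beta_eqI:
  assumes lin: "lin_ord T S" and x: "is_beta T S x"
  shows "beta T S = x"
  unfolding beta_def
proof (rule the_equality[of "is_beta T S" x, OF x])
  show "y = x" if y: "is_beta T S y" for y
    using is_beta_structure[OF lin x] is_beta_structure[OF lin y] beta_structure_unique by metis
qed

lemma convex_pieces_if_blocks:
  assumes lin: "lin_ord T S" and n: "n \<in> omega" and bl: "blocks T S n pc d"
  obtains W where "convex_pieces mem T S W pc n d" "\<And>t. t \<in> T \<Longrightarrow>
    ordertype (piece T pc t) W = ordertype (fibre T pc (ap pc t)) (oriented T S (ap d (ap pc t)))"
proof -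
  define W where "W = sep (times T T) (\<lambda>p. p \<in> oriented T S (ap d (ap pc (psnd p))))"
  have W: "lt W s t \<longleftrightarrow> lt (oriented T S (ap d (ap pc t))) s t" if "s \<in> T" "t \<in> T" for s t
    unfolding W_def using that by simp
  have piece: "piece T pc t = fibre T pc (ap pc t)" for t by (rule mem_ext) simp
  have agree: "lt (oriented T S (ap d i)) s t \<longleftrightarrow> lt W s t" if "s \<in> fibre T pc i" "t \<in> fibre T pc i" for s t i
    using W[of s t] that by simp
  note wo = blocks_well_ord[OF bl blocks_mem[OF bl]]
  have "convex_pieces mem T S W pc n d"
  proof
    show "well_ord (piece T pc t) W" if "t \<in> T" for t unfolding piece by (rule well_ord_agree[OF wo[OF that] agree])
    show "lt W s t \<longleftrightarrow> (if ap d (ap pc t) = zero then lt S s t else lt S t s)" if "s \<in> T" "t \<in> T" for s t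
      unfolding W[OF that] oriented_def using that by (simp add: mem_converse_rel)
  qed (fact lin n blocks_mem[OF bl] blocks_less[OF bl])+
  thus ?thesis using that ordertype_agree[OF wo agree] unfolding piece by metis
qed

lemma omega_subset_if_blocks:
  assumes k: "ordinal k" and n: "n \<in> omega" and infinite: "\<not> finite_set T" and bl: "blocks T S n pc d"
    and small: "\<And>i. i \<in> n \<Longrightarrow> ordertype (fibre T pc i) (oriented T S (ap d i)) \<in> k"
  shows "omega \<subseteq> k"
proof -
  have fibre: "definable_map (fibre T pc)" by simp
  have "T \<subseteq> big_union (img (fibre T pc) n)"
    unfolding subset_def mem_big_union mem_img[OF fibre] using blocks_mem[OF bl] by (metis mem_fibre)
  then obtain i where i: "i \<in> n" "\<not> finite_set (fibre T pc i)"
    using infinite fin_subset fin_big_union_img[OF fin_omega_mem[OF n] fibre] by blast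
  note wo = blocks_well_ord[OF bl i(1)]
  have "omega \<subseteq> ordertype (fibre T pc i) (oriented T S (ap d i))"
    using i(2) fin_cong[OF equipotent_ordertype[OF wo]] omega_subset_iff[OF ord_ordertype[OF wo]] by blast
  thus ?thesis using subset_trans ord_mem_subset[OF k small[OF i(1)]] by blast
qed

end

lemma (in beta_structure) piece_type_less:
  assumes k: "ordinal k" and n: "n \<in> omega" and bl: "blocks T S n pc' d'"
    and small: "\<And>i. i \<in> n \<Longrightarrow> ordertype (fibre T pc' i) (oriented T S (ap d' i)) \<in> k" and t: "t \<in> T"
  shows "s.piece_type t \<in> k"
proof -
  obtain W' where W': "convex_pieces mem T S W' pc' n d'" and block_type: "\<And>t. t \<in> T \<Longrightarrow>
      ordertype (piece T pc' t) W' = ordertype (fibre T pc' (ap pc' t)) (oriented T S (ap d' (ap pc' t)))"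
    by (rule convex_pieces_if_blocks[OF s.lin_R n bl]) blast
  interpret tgt: convex_pieces mem T S W' pc' n d' by (rule W')
  interpret id: piece_embedding mem T S W pc N d T S W' pc' n d' "\<lambda>x. x" by unfold_locales simp_all
  obtain t0 where t0: "id.stable t0" "ap pc t0 = ap pc t" by (rule id.stable_ex[OF t])
  note t0T = id.stable_mem[OF t0(1)]
  have "s.piece_type t \<subseteq> tgt.piece_type t0" using id.stable_type_le[OF t0(1)] piece_cong[OF t0(2)] by simp
  moreover have "tgt.piece_type t0 \<in> k" using small[OF blocks_mem[OF bl t0T]] block_type[OF t0T] by simp
  ultimately show ?thesis by (rule ord_le_lt[OF s.ord_piece_type[OF t] tgt.ord_piece_type[OF t0T] k])
qed

theorem (in zf_model) arrow_lex_iff_arrow_beta: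
  assumes k: "initial_ordinal k" and "linear_order T S" "infinite_set T" and sum: "finite_sum_below k T S"
  shows "arrow (binary_seqs k) (lex k) T S T S \<longleftrightarrow>
    arrow k (memrel k) (beta T S) (memrel (beta T S)) (beta T S) (memrel (beta T S))"
proof -
  note ord = initial_ord[OF k]
  have lin: "lin_ord T S" using assms(2) unfolding linear_order_def lin_ord_def by blast
  have infinite: "\<not> finite_set T" using assms(3) infinite_set_iff by blast
  obtain n pc0 d0 where n: "n \<in> omega" and bl: "blocks T S n pc0 d0"
    and small: "\<And>i. i \<in> n \<Longrightarrow> ordertype (fibre T pc0 i) (oriented T S (ap d0 i)) \<in> k"
    by (rule blocks_if_finite_sum_below[OF ord lin sum]) blast
  obtain x where x: "is_beta T S x" using is_beta_ex alternating_sum_ex[OF lin infinite n bl] by blast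
  obtain W pc N d wp M e where "beta_structure mem T S W pc N d wp M e" and xW: "x = ordertype T W"
    using is_beta_structure[OF lin x] .
  then interpret beta_structure mem T S W pc N d wp M e by simp
  have omega: "omega \<subseteq> k" by (rule omega_subset_if_blocks[OF ord n infinite bl small])
  let ?cofinal = "\<lambda>r c. r \<in> k \<and> (\<forall>x. x \<in> r \<longrightarrow> ap c x \<in> k) \<and> (\<forall>x. x \<in> k \<longrightarrow> (\<exists>y. y \<in> r \<and> x \<subseteq> ap c y))"
  obtain \<rho> c where cofinal: "\<And>r c'. ?cofinal r c' \<Longrightarrow> ?cofinal \<rho> c" by (cases "\<exists>r c. ?cofinal r c") blast+
  interpret lex_reduction mem T S W pc N d wp M e k \<rho> c
  proof
    show "s.piece_type t \<in> k" if "t \<in> T" for t by (rule piece_type_less[OF ord n bl small that])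
    show "?cofinal \<rho> c" if "r \<in> k" "\<And>x. x \<in> r \<Longrightarrow> ap c' x \<in> k" "\<And>x. x \<in> k \<Longrightarrow> \<exists>y. y \<in> r \<and> x \<subseteq> ap c' y" for r c'
      by (rule cofinal[of r c']) (use that in blast)
  qed (fact k omega)+
  have "arrow k (memrel k) T W T W \<longleftrightarrow> arrow k (memrel k) x (memrel x) x (memrel x)"
    unfolding xW by (rule arrow_cong[OF isomorphic_ordertype[OF well_ord_W]])
  thus ?thesis unfolding beta_eqI[OF lin x]
    using arrow_lex_imp_arrow_ordinal arrow_ordinal_imp_arrow_lex[OF infinite ord omega] by blast
qed

theorem theorem4:
  fixes mem :: "'a \<Rightarrow> 'a \<Rightarrow> bool" and \<kappa> T S :: 'a
  assumes "zf_model mem"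
    and "membership.initial_ordinal mem \<kappa>"
    and "membership.linear_order mem T S"
    and "membership.infinite_set mem T"
    and "membership.finite_sum_below mem \<kappa> T S"
  shows "membership.arrow mem (membership.binary_seqs mem \<kappa>) (membership.lex mem \<kappa>) T S T S \<longleftrightarrow>
    (let \<beta> = membership.beta mem T S; less_\<beta> = membership.memrel mem \<beta>
     in membership.arrow mem \<kappa> (membership.memrel mem \<kappa>) \<beta> less_\<beta> \<beta> less_\<beta>)"
  unfolding Let_def by (rule zf_model.arrow_lex_iff_arrow_beta[OF assms])

end
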